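(* Let $\mathcal B$ be a ball in $\mathbb R^4$ and let $h:\mathcal B\times\mathbb R\to\mathbb R^+$ be a Carathéodory function satisfying (H1), (H2) (with associated functions $f$ and $a$) and (H3), as spelled out in the context. Suppose moreover that one of the following holds: (i) there is a constant $a_0>0$ such that $a(x)\ge a_0$ for all $x\in\mathcal B$; (ii) $\lim_{t\to+\infty}\frac{f(t)}{t^\alpha}=+\infty$ for some $\alpha>1$. Then there exists $C>0$ such that $\|u\|_{L^\infty(\mathcal B)}\le C$ for all weak solutions $u$ of the problem $\Delta^2u=h(x,u)$ in $\mathcal B$, $u=\partial_n u=0$ on $\partial\mathcal B$.
   Context: $\mathbb R^+=[0,+\infty)$; $n$ denotes the outer unit normal. Weak solution: $u\in H^2_0(\mathcal B)$ such that $\int_{\mathcal B}\Delta u\,\Delta\varphi\,dx=\int_{\mathcal B}h(x,u)\varphi\,dx$ for every $\varphi\in H^2_0(\mathcal B)$. Assumption (A) on $f\in C^1([0,+\infty))$: (A1) $f>0$ and $f'\ge0$ on $[M,+\infty)$ for some $M>0$; (A2) $\lim_{t\to+\infty}f(t)/t=+\infty$; (A3) the limit $\lim_{t\to+\infty}f'(t)/f(t)$ exists and belongs to $[0,+\infty)$. (H1) $h\in L^\infty(\mathcal B\times[0,\tau])$ for all $\tau\in\mathbb R^+$. (H2) There exist $f\in C^1([0,+\infty))$ satisfying assumption (A) and $a\in L^\infty(\mathcal B)\cap C(\mathcal B)$ with $a>0$ such that $\lim_{t\to+\infty}\frac{h(x,t)}{a(x)f(t)}=1$ uniformly in $x\in\mathcal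 B$. (H3) There exist $\bar r,\bar\delta>0$ such that, with $\omega_{\bar r}:=\{x\in\mathcal B: d(x,\partial\mathcal B)<\bar r\}$: (H3a) for all $x\in\omega_{\bar r}$, $h(x,\cdot)$ is increasing for $t\ge0$; (H3b) $h(\cdot,t)\in C^1(\omega_{\bar r})$ for all $t\ge0$, and $\nabla_xh(x,t)\cdot\theta\le0$ for all $x\in\omega_{\bar r}$, $t\ge0$ and all unit vectors $\theta$ with $|\theta-n(x)|\le\bar\delta$. Here, for $x\in\omega_{\bar r}$, $n(x)$ is the outer unit normal at the boundary point nearest to $x$, i.e. $n(x)=(x-x_c)/|x-x_c|$ with $x_c$ the centre of $\mathcal B$ ($\bar r$ is smaller than the radius). *)

theory Defs
  imports "HOL-Probability.Probability"
begin

section \<open>Classical derivatives\<close>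

definition pderiv_at :: "'n::finite \<Rightarrow> (real^'n \<Rightarrow> real) \<Rightarrow> real^'n \<Rightarrow> real" where
  "pderiv_at i g x = frechet_derivative g (at x) (axis i 1)"

definition gradient :: "(real^'n::finite \<Rightarrow> real) \<Rightarrow> real^'n \<Rightarrow> real^'n" where
  "gradient g x = (\<chi> i. pderiv_at i g x)"

definition C1_on :: "(real^'n::finite) set \<Rightarrow> (real^'n \<Rightarrow> real) \<Rightarrow> bool" where
  "C1_on S g \<longleftrightarrow> (\<forall>x\<in>S. g differentiable (at x)) \<and> continuous_on S (gradient g)"

text \<open>A list \<open>[i\<^sub>1, \<dots>, i\<^sub>k]\<close> of coordinates stands for the operator
  \<open>\<partial>\<^bsub>i\<^sub>1\<^esub> \<dots> \<partial>\<^bsub>i\<^sub>k\<^esub>\<close> of order \<open>k\<close>.\<close>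

primrec iter_pderiv :: "'n::finite list \<Rightarrow> (real^'n \<Rightarrow> real) \<Rightarrow> real^'n \<Rightarrow> real" where
  "iter_pderiv [] g = g"
| "iter_pderiv (i # is) g = pderiv_at i (iter_pderiv is g)"

text \<open>If all iterated partial derivatives are (Frechet) differentiable, then they are
  also continuous, so this is \<open>C\<^sup>\<infinity>\<close>.\<close>

definition smooth :: "(real^'n::finite \<Rightarrow> real) \<Rightarrow> bool" where
  "smooth g \<longleftrightarrow> (\<forall>is x. iter_pderiv is g differentiable (at x))"

definition test_functions :: "(real^'n::finite) set \<Rightarrow> (real^'n \<Rightarrow> real) set" where
  "test_functions \<Omega> =
     {\<phi>. smooth \<phi> \<and> compact (closure {x. \<phi> x \<noteq> 0}) \<and> closure {x. \<phi> x \<noteq> 0} \<subseteq> \<Omega>}"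

section \<open>Lebesgue and Sobolev spaces\<close>

text \<open>Elements of the function spaces below are represented by functions on the whole
  Euclidean space; only their values on \<open>\<Omega>\<close>, up to Lebesgue null sets, matter.\<close>

definition L2 :: "'a::euclidean_space set \<Rightarrow> ('a \<Rightarrow> real) set" where
  "L2 \<Omega> = {u \<in> borel_measurable (lebesgue_on \<Omega>). integrable (lebesgue_on \<Omega>) (\<lambda>x. (u x)\<^sup>2)}"

definition Linf_norm :: "'a::euclidean_space set \<Rightarrow> ('a \<Rightarrow> real) \<Rightarrow> ereal" where
  "Linf_norm \<Omega> u = esssup (lebesgue_on \<Omega>) (\<lambda>x. ereal \<bar>u x\<bar>)"

definition Linf :: "'a::euclidean_space set \<Rightarrow> ('a \<Rightarrow> real) set" where
  "Linf \<Omega> = {u \<in> borel_measurable (lebesgue_on \<Omega>). Linf_norm \<Omega> u < \<infinity>}"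

definition is_weak_deriv ::
  "(real^'n::finite) set \<Rightarrow> 'n list \<Rightarrow> (real^'n \<Rightarrow> real) \<Rightarrow> (real^'n \<Rightarrow> real) \<Rightarrow> bool" where
  "is_weak_deriv \<Omega> is u v \<longleftrightarrow> u \<in> L2 \<Omega> \<and> v \<in> L2 \<Omega> \<and>
     (\<forall>\<phi>\<in>test_functions \<Omega>.
        (LINT x|lebesgue_on \<Omega>. u x * iter_pderiv is \<phi> x)
          = (-1) ^ length is * (LINT x|lebesgue_on \<Omega>. v x * \<phi> x))"

text \<open>A weak derivative is unique up to null sets (for open \<open>\<Omega>\<close>); this picks a representative.\<close>

definition weak_deriv ::
  "(real^'n::finite) set \<Rightarrow> 'n list \<Rightarrow> (real^'n \<Rightarrow> real) \<Rightarrow> real^'n \<Rightarrow> real" where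
  "weak_deriv \<Omega> is u = (SOME v. is_weak_deriv \<Omega> is u v)"

definition weak_laplacian :: "(real^'n::finite) set \<Rightarrow> (real^'n \<Rightarrow> real) \<Rightarrow> real^'n \<Rightarrow> real" where
  "weak_laplacian \<Omega> u x = (\<Sum>i\<in>UNIV. weak_deriv \<Omega> [i, i] u x)"

definition H2 :: "(real^'n::finite) set \<Rightarrow> (real^'n \<Rightarrow> real) set" where
  "H2 \<Omega> = {u \<in> L2 \<Omega>. \<forall>is. length is \<le> 2 \<longrightarrow> (\<exists>v. is_weak_deriv \<Omega> is u v)}"

definition H2_norm :: "(real^'n::finite) set \<Rightarrow> (real^'n \<Rightarrow> real) \<Rightarrow> real" where
  "H2_norm \<Omega> u = sqrt (\<Sum>is\<in>{is. length is \<le> 2}. LINT x|lebesgue_on \<Omega>. (weak_deriv \<Omega> is u x)\<^sup>2)"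

text \<open>\<open>H\<^sup>2\<^sub>0(\<Omega>)\<close> is the closure of \<open>C\<^sup>\<infinity>\<^sub>c(\<Omega>)\<close> in \<open>H\<^sup>2(\<Omega>)\<close>; the boundary conditions
  \<open>u = \<partial>\<^sub>n u = 0\<close> are encoded in this space.\<close>

definition H20 :: "(real^'n::finite) set \<Rightarrow> (real^'n \<Rightarrow> real) set" where
  "H20 \<Omega> = {u \<in> H2 \<Omega>. \<exists>\<phi>. (\<forall>k. \<phi> k \<in> test_functions \<Omega>) \<and>
              (\<lambda>k::nat. H2_norm \<Omega> (\<lambda>x. u x - \<phi> k x)) \<longlonglongrightarrow> 0}"

section \<open>The Dirichlet problem for the biharmonic equation\<close>

text \<open>The integrability requirement says that the right-hand side of the weak formulation
  is meaningful: the Bochner integral of a non-integrable function is 0 in the library.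
  The integrand on the left is a product of two \<open>L\<^sup>2\<close> functions.\<close>

definition weak_solution ::
  "(real^'n::finite) set \<Rightarrow> (real^'n \<Rightarrow> real \<Rightarrow> real) \<Rightarrow> (real^'n \<Rightarrow> real) \<Rightarrow> bool" where
  "weak_solution \<Omega> h u \<longleftrightarrow> u \<in> H20 \<Omega> \<and>
     (\<forall>\<phi>\<in>H20 \<Omega>.
        integrable (lebesgue_on \<Omega>) (\<lambda>x. h x (u x) * \<phi> x) \<and>
        (LINT x|lebesgue_on \<Omega>. weak_laplacian \<Omega> u x * weak_laplacian \<Omega> \<phi> x)
          = (LINT x|lebesgue_on \<Omega>. h x (u x) * \<phi> x))"

definition caratheodory :: "(real^'n::finite) set \<Rightarrow> (real^'n \<Rightarrow> real \<Rightarrow> real) \<Rightarrow> bool" where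
  "caratheodory \<Omega> h \<longleftrightarrow>
     (\<forall>t. (\<lambda>x. h x t) \<in> borel_measurable (lebesgue_on \<Omega>)) \<and>
     (AE x in lebesgue_on \<Omega>. continuous_on UNIV (h x))"

text \<open>\<open>f'\<close> is the derivative of \<open>f\<close> on \<open>[0,\<infinity>)\<close>, one-sided at 0; it is uniquely
  determined there by \<open>f\<close>.\<close>

definition assumption_A :: "(real \<Rightarrow> real) \<Rightarrow> bool" where
  "assumption_A f \<longleftrightarrow> (\<exists>f'.
     (\<forall>t\<ge>0. (f has_real_derivative f' t) (at t within {0..})) \<and> continuous_on {0..} f' \<and>
     (\<exists>M>0. \<forall>t\<ge>M. f t > 0 \<and> f' t \<ge> 0) \<and>
     filterlim (\<lambda>t. f t / t) at_top at_top \<and>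
     (\<exists>l\<ge>0. ((\<lambda>t. f' t / f t) \<longlongrightarrow> l) at_top))"

definition hyp_H1 :: "(real^'n::finite) set \<Rightarrow> (real^'n \<Rightarrow> real \<Rightarrow> real) \<Rightarrow> bool" where
  "hyp_H1 \<Omega> h \<longleftrightarrow> (\<forall>\<tau>\<ge>0. (\<lambda>(x, t). h x t) \<in> Linf (\<Omega> \<times> {0..\<tau>}))"

definition hyp_H2 ::
  "(real^'n::finite) set \<Rightarrow> (real^'n \<Rightarrow> real \<Rightarrow> real) \<Rightarrow> (real \<Rightarrow> real) \<Rightarrow> (real^'n \<Rightarrow> real) \<Rightarrow> bool" where
  "hyp_H2 \<Omega> h f a \<longleftrightarrow>
     assumption_A f \<and> a \<in> Linf \<Omega> \<and> continuous_on \<Omega> a \<and> (\<forall>x\<in>\<Omega>. a x > 0) \<and>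
     uniform_limit \<Omega> (\<lambda>t x. h x t / (a x * f t)) (\<lambda>_. 1) at_top"

definition boundary_strip :: "(real^'n::finite) set \<Rightarrow> real \<Rightarrow> (real^'n) set" where
  "boundary_strip \<Omega> r = {x \<in> \<Omega>. infdist x (frontier \<Omega>) < r}"

text \<open>Here \<open>sgn (x - c) = (x - c) / |x - c|\<close> is the outer unit normal of \<open>ball c R\<close> at the
  boundary point nearest to \<open>x\<close>. Monotonicity
  in \<open>t\<close> is not assumed to be strict.\<close>

definition hyp_H3 :: "real^'n::finite \<Rightarrow> real \<Rightarrow> (real^'n \<Rightarrow> real \<Rightarrow> real) \<Rightarrow> bool" where
  "hyp_H3 c R h \<longleftrightarrow> (\<exists>r \<delta>. 0 < r \<and> r < R \<and> 0 < \<delta> \<and>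
     (\<forall>x\<in>boundary_strip (ball c R) r. mono_on {0..} (h x)) \<and>
     (\<forall>t\<ge>0. C1_on (boundary_strip (ball c R) r) (\<lambda>x. h x t)) \<and>
     (\<forall>x\<in>boundary_strip (ball c R) r. \<forall>t\<ge>0. \<forall>\<theta>.
        norm \<theta> = 1 \<and> norm (\<theta> - sgn (x - c)) \<le> \<delta> \<longrightarrow>
        gradient (\<lambda>y. h y t) x \<bullet> \<theta> \<le> 0))"

end

(* After rescaling to the unit ball, a weak solution is represented by Boggio's explicit positive
   Green function: u(x) is the integral of N y * G(x, y) with N = h(., u) >= 0. Testing with suitable
   functions bounds u in L^1 and N in a weighted L^1 norm, because f is superlinear. Near the sphere,
   hypothesis (H3) makes the method of moving planes work directly on the Green representation, so u
   decreases towards the boundary; together with the L^1 bound this controls u in a boundary layer, and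
   N in L^1. Suppose the maximum t of u is large; it is then attained at an interior point p. On the
   scale r = f(t)^(-1/4) the mass m of N around p satisfies m >= const * (integral of (1 + |y|)^(-q))
   with q close to 2 * kappa * l * m, so boundedness of the total mass forces q > 4. But then
   N(x) >= const / |x - p|^4 from the scale r up to a fixed radius, whose integral diverges
   logarithmically as r tends to 0: contradiction. *)
theory Submission
  imports Defs "HOL-Computational_Algebra.Polynomial"
begin

section \<open>Smooth functions and integration by parts\<close>

text \<open>Two difficulties shape the development. Moreover \<open>a\<close> is bounded below only
  on compact parts of the ball, so every lower bound for the density is interior and the boundary
  layer has to be controlled by reflection. The kernel enters through a regularisation in which |x -
  y|^2 becomes |x - y|^2 + e: it is smooth, vanishes to second order on the sphere, and its
  bi-Laplacian is an explicit multiple of a mollifier plus an error of order e. The constant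
  \<open>\<kappa>\<close> normalises that mollifier, so the pole of the kernel is -2 \<kappa> ln |x
  - y|. Since \<open>l\<close> is the limit of f'/f, a mass m near p makes f(u) behave like |x -
  p|^(-2 \<kappa> l m), and the threshold 4 for q is the dimension, where |x|^(-4) just fails to be
  integrable. Such divergent integrals are replaced by counts of dyadic annuli, which keeps all
  constants uniform over the solutions.\<close>

lemma pderiv_at_eq:
  assumes "(g has_derivative D) (at x)"
  shows "pderiv_at i g x = D (axis i 1)"
  unfolding pderiv_at_def using frechet_derivative_at[OF assms] by simp

text \<open>Every iterated partial derivative of a member stays in a class that is stable under
  partial derivatives, so differentiability of the members alone gives smoothness. The proofs below
  only have to exhibit a stable class.\<close>

lemma smooth_coinduct:
  assumes "\<And>g. g \<in> C \<Longrightarrow> (\<forall>x. g differentiable (at x)) \<and> (\<forall>i. pderiv_at i g \<in> C)" and "g \<in> C"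
  shows "smooth g"
proof -
  have "iter_pderiv is g \<in> C" for "is"
    by (induction "is") (use assms in auto)
  then show ?thesis using assms(1) unfolding smooth_def by blast
qed

lemma smooth_differentiable: "smooth g \<Longrightarrow> g differentiable (at x)"
  unfolding smooth_def by (metis iter_pderiv.simps(1))

lemma smooth_iter_pderiv: "smooth g \<Longrightarrow> smooth (iter_pderiv is g)"
proof (rule smooth_coinduct[where C="{iter_pderiv is g | is. True}"])
  fix k assume s: "smooth g" and "k \<in> {iter_pderiv is g | is. True}"
  then obtain js where k: "k = iter_pderiv js g" by auto
  have "pderiv_at i k = iter_pderiv (i # js) g" for i by (simp add: k)
  then show "(\<forall>x. k differentiable (at x)) \<and> (\<forall>i. pderiv_at i k \<in> {iter_pderiv is g | is. True})"
    using s unfolding smooth_def k by blast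
qed auto

lemma smooth_pderiv: "smooth g \<Longrightarrow> smooth (pderiv_at i g)"
  using smooth_iter_pderiv[of g "[i]"] by simp

lemma smooth_continuous_on: "smooth g \<Longrightarrow> continuous_on S g"
  by (meson continuous_at_imp_continuous_on differentiable_imp_continuous_within smooth_differentiable)

lemma smooth_has_derivative: "smooth g \<Longrightarrow> (g has_derivative frechet_derivative g (at x)) (at x)"
  using smooth_differentiable frechet_derivative_works by blast

lemma pderiv_at_add:
  assumes "f differentiable (at x)" "g differentiable (at x)"
  shows "pderiv_at i (\<lambda>x. f x + g x) x = pderiv_at i f x + pderiv_at i g x"
proof -
  have "((\<lambda>x. f x + g x) has_derivative (\<lambda>v. frechet_derivative f (at x) v + frechet_derivative g (at x) v)) (at x)"
    using assms by (intro has_derivative_add) (auto simp: frechet_derivative_works[symmetric])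
  from pderiv_at_eq[OF this] show ?thesis by (simp add: pderiv_at_def)
qed

lemma pderiv_at_mult:
  assumes "f differentiable (at x)" "g differentiable (at x)"
  shows "pderiv_at i (\<lambda>x. f x * g x) x = f x * pderiv_at i g x + pderiv_at i f x * g x"
proof -
  have "((\<lambda>x. f x * g x) has_derivative (\<lambda>v. f x * frechet_derivative g (at x) v + frechet_derivative f (at x) v * g x)) (at x)"
    using assms by (intro has_derivative_mult) (auto simp: frechet_derivative_works[symmetric])
  from pderiv_at_eq[OF this] show ?thesis by (simp add: pderiv_at_def)
qed

lemma pderiv_at_const [simp]: "pderiv_at i (\<lambda>x. c) = (\<lambda>x. 0)"
  by (simp add: fun_eq_iff pderiv_at_def)

lemma smooth_const [simp]: "smooth (\<lambda>x. c)"
  by (rule smooth_coinduct[where C="{\<lambda>x. c | c. True}"]) auto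

text \<open>Product and chain rules create sums of products, so the stable classes are generated
  from a set \<open>S\<close> of building blocks by these two operations; \<open>alg_smooth\<close>
  then inspects the generators only.\<close>

inductive_set alg :: "((real^'n::finite) \<Rightarrow> real) set \<Rightarrow> ((real^'n) \<Rightarrow> real) set" for S where
  base: "g \<in> S \<Longrightarrow> g \<in> alg S"
| add: "f \<in> alg S \<Longrightarrow> g \<in> alg S \<Longrightarrow> (\<lambda>x. f x + g x) \<in> alg S"
| mult: "f \<in> alg S \<Longrightarrow> g \<in> alg S \<Longrightarrow> (\<lambda>x. f x * g x) \<in> alg S"

lemma alg_smooth:
  assumes S: "\<And>g. g \<in> S \<Longrightarrow> (\<forall>x. g differentiable (at x)) \<and> (\<forall>i. pderiv_at i g \<in> alg S)"
    and "g \<in> alg S"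
  shows "smooth g"
proof (rule smooth_coinduct[where C="alg S"])
  fix k assume "k \<in> alg S"
  then show "(\<forall>x. k differentiable (at x)) \<and> (\<forall>i. pderiv_at i k \<in> alg S)"
  proof induction
    case (base g) then show ?case using S by blast
  next
    case (add f g)
    have "pderiv_at i (\<lambda>x. f x + g x) = (\<lambda>x. pderiv_at i f x + pderiv_at i g x)" for i
      using add by (auto simp: pderiv_at_add)
    then show ?case using add by (auto intro: alg.add)
  next
    case (mult f g)
    have "pderiv_at i (\<lambda>x. f x * g x) = (\<lambda>x. f x * pderiv_at i g x + pderiv_at i f x * g x)" for i
      using mult by (auto simp: pderiv_at_mult)
    then show ?case using mult by (auto intro!: alg.add alg.mult)
  qed
qed fact

lemma smooth_add: "smooth f \<Longrightarrow> smooth g \<Longrightarrow> smooth (\<lambda>x. f x + g x)"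
  by (rule alg_smooth[where S="Collect smooth"])
     (auto simp: smooth_differentiable smooth_pderiv intro!: alg.add intro: alg.base)

lemma smooth_mult: "smooth f \<Longrightarrow> smooth g \<Longrightarrow> smooth (\<lambda>x. f x * g x)"
  by (rule alg_smooth[where S="Collect smooth"])
     (auto simp: smooth_differentiable smooth_pderiv intro!: alg.mult intro: alg.base)

lemma smooth_diff: "smooth f \<Longrightarrow> smooth g \<Longrightarrow> smooth (\<lambda>x. f x - g x)"
  using smooth_add[of f "\<lambda>x. (-1) * g x"] smooth_mult[of "\<lambda>x. -1" g] by simp

lemma smooth_power: "smooth g \<Longrightarrow> smooth (\<lambda>x. g x ^ n)"
  by (induction n) (auto intro: smooth_mult)

lemma smooth_prod: "finite I \<Longrightarrow> (\<And>i. i \<in> I \<Longrightarrow> smooth (g i)) \<Longrightarrow> smooth (\<lambda>x. \<Prod>i\<in>I. g i x)"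
  by (induction I rule: finite_induct) (auto intro: smooth_mult)

lemma smooth_sum: "finite I \<Longrightarrow> (\<And>i. i \<in> I \<Longrightarrow> smooth (g i)) \<Longrightarrow> smooth (\<lambda>x. \<Sum>i\<in>I. g i x)"
  by (induction I rule: finite_induct) (auto intro: smooth_add)

lemma pderiv_at_inner: "pderiv_at i (\<lambda>x. v \<bullet> x) = (\<lambda>x. v $ i)"
proof
  fix x
  have "((\<lambda>x. v \<bullet> x) has_derivative (\<lambda>x. v \<bullet> x)) (at x)"
    by (auto intro!: derivative_eq_intros)
  from pderiv_at_eq[OF this] show "pderiv_at i (\<lambda>x. v \<bullet> x) x = v $ i"
    by (simp add: inner_axis)
qed

lemma smooth_inner: "smooth (\<lambda>x. v \<bullet> x)"
  by (rule smooth_coinduct[where C="insert (\<lambda>x. v \<bullet> x) (range (\<lambda>c x. c))"])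
     (auto simp: pderiv_at_inner intro!: derivative_intros)

lemma smooth_nth: "smooth (\<lambda>x. x $ i)"
  using smooth_inner[of "axis i 1"] by (simp add: inner_axis' )

lemma pderiv_at_compose:
  assumes "(F has_real_derivative F') (at (g x))" "g differentiable (at x)"
  shows "pderiv_at i (\<lambda>x. F (g x)) x = F' * pderiv_at i g x"
    and "(\<lambda>x. F (g x)) differentiable (at x)"
proof -
  have *: "((\<lambda>x. F (g x)) has_derivative (\<lambda>v. F' * frechet_derivative g (at x) v)) (at x)"
    using has_derivative_compose[OF assms(2)[unfolded frechet_derivative_works] assms(1)[unfolded has_field_derivative_def]] .
  from pderiv_at_eq[OF this] show "pderiv_at i (\<lambda>x. F (g x)) x = F' * pderiv_at i g x"
    by (simp add: pderiv_at_def)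
  show "(\<lambda>x. F (g x)) differentiable (at x)" using * by (rule differentiableI)
qed

text \<open>\<open>F\<close> lists an outer function together with its successive derivatives,
  required only at values taken by \<open>g\<close>. This covers ln and the reciprocal of a positive
  \<open>g\<close>, whose outer functions are not smooth on the whole line.\<close>

lemma smooth_compose:
  assumes F: "\<And>n x. (F n has_real_derivative F (Suc n) (g x)) (at (g x))" and g: "smooth g"
  shows "smooth (\<lambda>x. F n (g x))"
proof (rule alg_smooth[where S="Collect smooth \<union> range (\<lambda>n x. F n (g x))"])
  fix k assume "k \<in> Collect smooth \<union> range (\<lambda>n x. F n (g x))"
  then consider "smooth k" | n where "k = (\<lambda>x. F n (g x))" by auto
  then show "(\<forall>x. k differentiable (at x)) \<and> (\<forall>i. pderiv_at i k \<in> alg (Collect smooth \<union> range (\<lambda>n x. F n (g x))))"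
  proof cases
    case 1 then show ?thesis by (auto simp: smooth_differentiable smooth_pderiv intro: alg.base)
  next
    case 2
    have "pderiv_at i k = (\<lambda>x. F (Suc n) (g x) * pderiv_at i g x)" for i
      unfolding 2 using pderiv_at_compose(1)[OF F smooth_differentiable[OF g]] by auto
    then show ?thesis
      using pderiv_at_compose(2)[OF F smooth_differentiable[OF g]] g smooth_pderiv[OF g]
      by (auto simp: 2 intro!: alg.mult intro: alg.base)
  qed
qed (auto intro: alg.base)

text \<open>ln followed by its derivatives; index 1 is the reciprocal, so one sequence serves both
  \<open>smooth_ln\<close> and \<open>smooth_inverse\<close>.\<close>

definition ln_seq :: "nat \<Rightarrow> real \<Rightarrow> real" where
  "ln_seq n t = (if n = 0 then ln t else (-1) ^ (n-1) * fact (n-1) * inverse t ^ n)"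

lemma ln_seq_deriv: "t > 0 \<Longrightarrow> (ln_seq n has_real_derivative ln_seq (Suc n) t) (at t)"
proof (cases n)
  case 0
  assume "t > 0"
  then have "(ln has_real_derivative inverse t) (at t)" by (rule DERIV_ln)
  then show ?thesis using 0 by (simp add: ln_seq_def[abs_def])
next
  case (Suc m)
  assume t: "t > 0"
  have "((\<lambda>t. (-1) ^ m * fact m * inverse t ^ Suc m) has_real_derivative
        (-1) ^ Suc m * fact (Suc m) * inverse t ^ Suc (Suc m)) (at t)"
    using t by (auto intro!: derivative_eq_intros simp: field_simps power2_eq_square)
      (cases m; simp)
  then show ?thesis by (simp add: ln_seq_def[abs_def] Suc)
qed

lemma smooth_ln:
  assumes "smooth g" "\<And>x. g x > 0" shows "smooth (\<lambda>x. ln (g x))"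
  using smooth_compose[of ln_seq g 0] assms ln_seq_deriv by (simp add: ln_seq_def)

lemma smooth_inverse:
  assumes "smooth g" "\<And>x. g x > 0" shows "smooth (\<lambda>x. inverse (g x))"
  using smooth_compose[of ln_seq g 1] assms ln_seq_deriv by (simp add: ln_seq_def)

lemma pderiv_at_affine:
  fixes c :: "real^'n::finite"
  assumes "g differentiable (at (s *\<^sub>R (x - c)))"
  shows "pderiv_at i (\<lambda>x. k * g (s *\<^sub>R (x - c))) x = k * s * pderiv_at i g (s *\<^sub>R (x - c))"
    and "(\<lambda>x. k * g (s *\<^sub>R (x - c))) differentiable (at x)"
proof -
  let ?D = "frechet_derivative g (at (s *\<^sub>R (x - c)))"
  have g: "(g has_derivative ?D) (at (s *\<^sub>R (x - c)))"
    using assms by (simp add: frechet_derivative_works)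
  have 1: "((\<lambda>x. s *\<^sub>R (x - c)) has_derivative (\<lambda>v. s *\<^sub>R v)) (at x)"
    by (auto intro!: derivative_eq_intros)
  have 2: "((\<lambda>x. k * g (s *\<^sub>R (x - c))) has_derivative (\<lambda>v. k * ?D (s *\<^sub>R v))) (at x)"
    using has_derivative_compose[OF 1 g] by (rule has_derivative_mult_right)
  have "?D (s *\<^sub>R v) = s * ?D v" for v
    using linear_scale[OF has_derivative_linear[OF g]] by simp
  then show "pderiv_at i (\<lambda>x. k * g (s *\<^sub>R (x - c))) x = k * s * pderiv_at i g (s *\<^sub>R (x - c))"
    using pderiv_at_eq[OF 2] by (simp add: pderiv_at_def)
  show "(\<lambda>x. k * g (s *\<^sub>R (x - c))) differentiable (at x)" using 2 by (rule differentiableI)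
qed

text \<open>The free factor \<open>k\<close> is what makes the class stable: each partial derivative
  pulls out one more factor \<open>s\<close>.\<close>

lemma smooth_affine:
  fixes c :: "real^'n::finite"
  assumes "smooth g" shows "smooth (\<lambda>x. k * g (s *\<^sub>R (x - c)))"
proof (rule smooth_coinduct[where C="{\<lambda>x. k * g (s *\<^sub>R (x - c)) | k g. smooth g}"])
  fix f assume "f \<in> {\<lambda>x. k * g (s *\<^sub>R (x - c)) | k g. smooth g}"
  then obtain k g where f: "f = (\<lambda>x. k * g (s *\<^sub>R (x - c)))" and g: "smooth g" by auto
  have "pderiv_at i f = (\<lambda>x. k * s * pderiv_at i g (s *\<^sub>R (x - c)))" for i
    unfolding f using pderiv_at_affine(1)[OF smooth_differentiable[OF g]] by auto
  then show "(\<forall>x. f differentiable (at x)) \<and> (\<forall>i. pderiv_at i f \<in> {\<lambda>x. k * g (s *\<^sub>R (x - c)) | k g. smooth g})"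
    using pderiv_at_affine(2)[OF smooth_differentiable[OF g]] smooth_pderiv[OF g] by (fastforce simp: f)
qed (use assms in auto)

section \<open>Calculus of the Laplacian for smooth functions\<close>

definition lap :: "(real^'n::finite \<Rightarrow> real) \<Rightarrow> real^'n \<Rightarrow> real" where
  "lap g x = (\<Sum>i\<in>UNIV. iter_pderiv [i, i] g x)"

text \<open>The inner product of two gradients, as it appears in the Leibniz and chain rules for
  \<open>lap\<close>.\<close>

definition grad2 :: "(real^'n::finite \<Rightarrow> real) \<Rightarrow> (real^'n \<Rightarrow> real) \<Rightarrow> real^'n \<Rightarrow> real" where
  "grad2 f g x = (\<Sum>i\<in>UNIV. pderiv_at i f x * pderiv_at i g x)"

lemma smooth_lap: "smooth g \<Longrightarrow> smooth (lap g)"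
  unfolding lap_def[abs_def] by (intro smooth_sum smooth_iter_pderiv) auto

lemma pderiv_at_add': "smooth f \<Longrightarrow> smooth g \<Longrightarrow> pderiv_at i (\<lambda>x. f x + g x) = (\<lambda>x. pderiv_at i f x + pderiv_at i g x)"
  using pderiv_at_add smooth_differentiable by blast

lemma pderiv_at_mult': "smooth f \<Longrightarrow> smooth g \<Longrightarrow> pderiv_at i (\<lambda>x. f x * g x) = (\<lambda>x. f x * pderiv_at i g x + pderiv_at i f x * g x)"
  using pderiv_at_mult smooth_differentiable by blast

lemma lap_add: "smooth f \<Longrightarrow> smooth g \<Longrightarrow> lap (\<lambda>x. f x + g x) = (\<lambda>x. lap f x + lap g x)"
  by (auto simp: lap_def[abs_def] pderiv_at_add' smooth_pderiv sum.distrib)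

lemma iter_mult:
  assumes "smooth f" "smooth g"
  shows "iter_pderiv [i,j] (\<lambda>x. f x * g x) = (\<lambda>x. f x * iter_pderiv [i,j] g x + pderiv_at i f x * pderiv_at j g x
    + (pderiv_at j f x * pderiv_at i g x + iter_pderiv [i,j] f x * g x))"
  using assms by (simp add: pderiv_at_mult' pderiv_at_add' smooth_pderiv smooth_mult)

lemma lap_mult:
  assumes "smooth f" "smooth g"
  shows "lap (\<lambda>x. f x * g x) = (\<lambda>x. f x * lap g x + 2 * grad2 f g x + lap f x * g x)"
  unfolding lap_def[abs_def] iter_mult[OF assms] grad2_def
  by (auto simp: sum.distrib sum_distrib_left sum_distrib_right algebra_simps)

lemma lap_cmult: "smooth g \<Longrightarrow> lap (\<lambda>x. c * g x) = (\<lambda>x. c * lap g x)"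
  by (subst lap_mult) (auto simp: lap_def grad2_def)

lemma lap_const [simp]: "lap (\<lambda>x. c) = (\<lambda>x. 0)"
  by (auto simp: lap_def)

lemma lap_compose:
  assumes F: "\<And>x. (F has_real_derivative F1 (g x)) (at (g x))" 
   and F1: "\<And>x. (F1 has_real_derivative F2 (g x)) (at (g x))" and g: "smooth g"
  shows "lap (\<lambda>x. F (g x)) x = F2 (g x) * grad2 g g x + F1 (g x) * lap g x"
proof -
  have 1: "pderiv_at i (\<lambda>x. F (g x)) = (\<lambda>x. F1 (g x) * pderiv_at i g x)" for i
    using pderiv_at_compose(1)[OF F smooth_differentiable[OF g]] by auto
  have 2: "pderiv_at i (\<lambda>x. F1 (g x) * pderiv_at i g x) x = F1 (g x) * pderiv_at i (pderiv_at i g) x + (F2 (g x) * pderiv_at i g x) * pderiv_at i g x" for i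
    using pderiv_at_compose[OF F1 smooth_differentiable[OF g]] smooth_pderiv[OF g]
    by (subst pderiv_at_mult) (auto simp: smooth_differentiable)
  show ?thesis
    by (simp add: lap_def grad2_def 1 2 sum.distrib sum_distrib_left algebra_simps)
qed

lemma lap_affine:
  fixes c :: "real^'n::finite"
  assumes "smooth g"
  shows "lap (\<lambda>x. k * g (s *\<^sub>R (x - c))) x = k * s\<^sup>2 * lap g (s *\<^sub>R (x - c))"
proof -
  have 1: "pderiv_at i (\<lambda>x. k * g (s *\<^sub>R (x - c))) = (\<lambda>x. k * s * pderiv_at i g (s *\<^sub>R (x - c)))"
    if "smooth g" for i k and g :: "real^'n \<Rightarrow> real"
    using pderiv_at_affine(1)[OF smooth_differentiable[OF that]] by auto
  show ?thesis
    using assms by (simp add: lap_def 1 smooth_pderiv sum_distrib_left power2_eq_square)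
      (simp add: mult_ac)
qed

section \<open>A flat transition function and bounds for its derivatives\<close>

primrec bump_poly :: "nat \<Rightarrow> real poly" where
  "bump_poly 0 = 1"
| "bump_poly (Suc n) = monom 1 2 * (bump_poly n - pderiv (bump_poly n))"

text \<open>\<open>bump n\<close> is the n-th derivative of the function that equals exp(-1/t) for t
  > 0 and 0 otherwise. Differentiating p(z) exp(-z) with z = 1/t multiplies by z^2 and turns p into
  p - p', which is the recursion of \<open>bump_poly\<close>.\<close>

definition bump :: "nat \<Rightarrow> real \<Rightarrow> real" where
  "bump n t = (if t > 0 then poly (bump_poly n) (1/t) * exp (- (1/t)) else 0)"

lemma poly_mult_exp_tendsto_0: "((\<lambda>z::real. poly p z * exp (- z)) \<longlongrightarrow> 0) at_top"
proof -
  have "((\<lambda>z::real. \<Sum>i\<le>degree p. coeff p i * (z ^ i / exp z)) \<longlongrightarrow> (\<Sum>i\<le>degree p. coeff p i * 0)) at_top"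
    by (intro tendsto_intros tendsto_power_div_exp_0)
  then show ?thesis by (simp add: poly_altdef sum_distrib_right exp_minus divide_inverse mult.assoc)
qed

lemma bump_deriv: "(bump n has_real_derivative bump (Suc n) t) (at t)"
proof -
  consider "t > 0" | "t = 0" | "t < 0" by linarith
  then show ?thesis
  proof cases
    case 1
    have "((\<lambda>t. poly (bump_poly n) (1/t) * exp (- (1/t))) has_real_derivative bump (Suc n) t) (at t)"
      using 1 by (auto intro!: derivative_eq_intros DERIV_chain2[OF poly_DERIV]
         simp: bump_def poly_monom power2_eq_square field_simps)
    then show ?thesis
      by (rule has_field_derivative_transform_within_open[where S="{0<..}"]) (use 1 in \<open>auto simp: bump_def\<close>)
  next
    case 3
    have "((\<lambda>t::real. 0) has_real_derivative bump (Suc n) t) (at t)"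
      using 3 by (simp add: bump_def)
    then show ?thesis
      by (rule has_field_derivative_transform_within_open[where S="{..<0}"]) (use 3 in \<open>auto simp: bump_def\<close>)
  next
    case 2
    \<comment> \<open>From the right the difference quotient at 0 is z p(z) exp(-z) with z = 1/h;
      \<open>pCons 0\<close> supplies the extra factor z.\<close>
    have "((\<lambda>h. poly (pCons 0 (bump_poly n)) (inverse h) * exp (- inverse h)) \<longlongrightarrow> 0) (at_right 0)"
      by (rule filterlim_compose[OF poly_mult_exp_tendsto_0 filterlim_inverse_at_top_right])
    then have r: "((\<lambda>h. (bump n (0 + h) - bump n 0) / h) \<longlongrightarrow> 0) (at_right 0)"
      by (rule Lim_transform_eventually) (auto simp: eventually_at_filter bump_def field_simps)
    have l: "((\<lambda>h. (bump n (0 + h) - bump n 0) / h) \<longlongrightarrow> 0) (at_left 0)"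
      by (rule Lim_transform_eventually[OF tendsto_const]) (auto simp: eventually_at_filter bump_def)
    show ?thesis
      using filterlim_split_at[OF l r] 2 by (simp add: has_field_derivative_def DERIV_def bump_def[of "Suc n"] flip: has_field_derivative_def)
  qed
qed

lemma smooth_bump: "smooth g \<Longrightarrow> smooth (\<lambda>x. bump n (g x))"
  by (rule smooth_compose[of bump]) (rule bump_deriv)

lemma bump_0: "bump 0 t = (if t > 0 then exp (- (1/t)) else 0)"
  by (simp add: bump_def)

lemma bump_1: "bump 1 t = (if t > 0 then (1/t)^2 * exp (- (1/t)) else 0)"
  by (simp add: bump_def poly_monom)

lemma bump_2: "bump 2 t = (if t > 0 then ((1/t)^4 - 2 * (1/t)^3) * exp (- (1/t)) else 0)"
  unfolding numeral_2_eq_2 bump_def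
  by (simp add: poly_monom pderiv_monom pderiv_mult algebra_simps numeral_eq_Suc)

lemma bump_bounds: "0 \<le> bump 0 t" "bump 0 t \<le> 1" "t > 0 \<Longrightarrow> 0 < bump 0 t" "t \<le> 0 \<Longrightarrow> bump 0 t = 0"
  by (auto simp: bump_0)

lemma bump_mono: "s \<le> t \<Longrightarrow> bump 0 s \<le> bump 0 t"
  by (auto simp: bump_0 frac_le)

lemma bump_tendsto_1: "filterlim f at_top F \<Longrightarrow> ((\<lambda>k. bump 0 (f k)) \<longlongrightarrow> 1) F"
proof (rule filterlim_compose[where g="bump 0"])
  have "((\<lambda>t::real. exp (- inverse t)) \<longlongrightarrow> exp (- 0)) at_top"
    by (intro tendsto_intros tendsto_inverse_0_at_top filterlim_ident)
  then have "((\<lambda>t::real. exp (- inverse t)) \<longlongrightarrow> 1) at_top" by simp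
  then show "(bump 0 \<longlongrightarrow> 1) at_top"
    by (rule Lim_transform_eventually)
       (auto intro!: eventually_mono[OF eventually_gt_at_top[of 0]] simp: bump_0 inverse_eq_divide)
qed

lemma power_exp_le: "z \<ge> 0 \<Longrightarrow> z ^ n * exp (- z) \<le> (fact n :: real)"
proof -
  assume "z \<ge> 0"
  then have "z ^ n / fact n \<le> exp z"
    using sum_le_suminf[OF summable_exp_generic[of z], of "{n}"] 
    by (simp add: exp_def divide_inverse mult.commute)
  then show ?thesis by (simp add: exp_minus field_simps)
qed

text \<open>In the cutoff below the argument is \<tau> - 1, where \<tau> is k times the boundary
  defect. Each derivative costs a factor k, compensated by a defect factor of the test function, so
  only \<tau> times the first and \<tau>^2 times the second derivative occur. A uniform bound serves
  for domination, decay for large \<tau> for the pointwise limit.\<close>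

lemma bump_1_bound:
  "\<tau> \<ge> 0 \<Longrightarrow> \<tau> * \<bar>bump 1 (\<tau> - 1)\<bar> \<le> 3" 
  "\<tau> \<ge> 2 \<Longrightarrow> \<tau> * \<bar>bump 1 (\<tau> - 1)\<bar> \<le> 2 / (\<tau> - 1)"
proof -
  \<comment> \<open>With z = 1 / (\<tau> - 1) everything becomes a polynomial in z times exp(-z),
    and z is at most 1 as soon as \<tau> is at least 2.\<close>
  have *: "\<tau> * \<bar>bump 1 (\<tau> - 1)\<bar> = (z + z^2) * exp (- z)" if "\<tau> > 1" "z = 1 / (\<tau> - 1)" for z
  proof -
    have z: "\<tau> = 1 + 1/z" "z > 0" using that by simp_all
    then have "bump 1 (\<tau> - 1) = z^2 * exp (- z)" unfolding bump_1 by simp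
    then have "\<tau> * \<bar>bump 1 (\<tau> - 1)\<bar> = (1 + 1/z) * (z^2 * exp (- z))" using z by simp
    also have "\<dots> = (z + z^2) * exp (- z)" using z(2) by (simp add: field_simps power2_eq_square)
    finally show ?thesis .
  qed
  show "\<tau> * \<bar>bump 1 (\<tau> - 1)\<bar> \<le> 3" if "\<tau> \<ge> 0"
  proof (cases "\<tau> > 1")
    case True
    define z where "z = 1 / (\<tau> - 1)"
    have "z \<ge> 0" using True by (simp add: z_def)
    then show ?thesis unfolding *[OF True z_def] 
      using power_exp_le[of z 1] power_exp_le[of z 2] by (simp add: algebra_simps)
  qed (simp add: bump_def)
  show "\<tau> * \<bar>bump 1 (\<tau> - 1)\<bar> \<le> 2 / (\<tau> - 1)" if "\<tau> \<ge> 2"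
  proof -
    define z where "z = 1 / (\<tau> - 1)"
    have z: "z \<ge> 0" "z \<le> 1" using that by (auto simp: z_def)
    have "(z + z^2) * exp (- z) \<le> (z + z * 1) * 1"
      unfolding power2_eq_square using z by (intro mult_mono add_left_mono mult_left_mono) auto
    then show ?thesis using *[OF _ z_def] that z by (simp add: z_def)
  qed
qed

lemma bump_2_bound:
  "\<tau> \<ge> 0 \<Longrightarrow> \<tau>^2 * \<bar>bump 2 (\<tau> - 1)\<bar> \<le> 60" 
  "\<tau> \<ge> 2 \<Longrightarrow> \<tau>^2 * \<bar>bump 2 (\<tau> - 1)\<bar> \<le> 12 / (\<tau> - 1)"
proof -
  have *: "\<tau>^2 * \<bar>bump 2 (\<tau> - 1)\<bar> \<le> (z^4 + 4 * z^3 + 5 * z^2 + 2 * z) * exp (- z)" if "\<tau> > 1" "z = 1 / (\<tau> - 1)" for z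
  proof -
    have z: "\<tau> = 1 + 1/z" "z > 0" using that by simp_all
    have "\<tau>^2 * \<bar>bump 2 (\<tau> - 1)\<bar> = (1 + 1/z)^2 * z^3 * \<bar>z - 2\<bar> * exp (- z)"
    proof -
      have "bump 2 (\<tau> - 1) = z^3 * (z - 2) * exp (- z)" 
        using z unfolding bump_2 by (simp add: algebra_simps power3_eq_cube power4_eq_xxxx)
      then show ?thesis using z by (simp add: abs_mult)
    qed
    also have "\<dots> \<le> (1 + 1/z)^2 * z^3 * (z + 2) * exp (- z)"
      using z by (intro mult_right_mono mult_left_mono) auto
    also have "(1 + 1/z)^2 * z^3 * (z + 2) = z^4 + 4 * z^3 + 5 * z^2 + 2 * z"
      using z by (simp add: field_simps power2_eq_square power3_eq_cube power4_eq_xxxx)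
    finally show ?thesis .
  qed
  show "\<tau>^2 * \<bar>bump 2 (\<tau> - 1)\<bar> \<le> 60" if "\<tau> \<ge> 0"
  proof (cases "\<tau> > 1")
    case True
    define z where "z = 1 / (\<tau> - 1)"
    have "z \<ge> 0" using True by (simp add: z_def)
    then show ?thesis using *[OF True z_def] 
      using power_exp_le[of z 1] power_exp_le[of z 2] power_exp_le[of z 3] power_exp_le[of z 4]
      by (simp add: algebra_simps fact_numeral)
  qed (simp add: bump_def)
  show "\<tau>^2 * \<bar>bump 2 (\<tau> - 1)\<bar> \<le> 12 / (\<tau> - 1)" if "\<tau> \<ge> 2"
  proof -
    define z where "z = 1 / (\<tau> - 1)"
    have z: "z \<ge> 0" "z \<le> 1" using that by (auto simp: z_def)
    have "z^4 \<le> z" "z^3 \<le> z" "z^2 \<le> z" using z power_decreasing[of 1 _ z] by (auto simp del: power_decreasing_iff)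
    then have "(z^4 + 4 * z^3 + 5 * z^2 + 2 * z) * exp (- z) \<le> (12 * z) * 1"
      using z by (intro mult_mono) auto
    then show ?thesis using *[OF _ z_def] that z by (simp add: z_def)
  qed
qed

section \<open>Measure-theoretic preliminaries: functions determined by their integrals over
  boxes\<close>

lemma integrable_continuous_bounded_set:
  fixes f :: "'a::euclidean_space \<Rightarrow> real"
  assumes "bounded \<Omega>" "\<Omega> \<in> sets borel" "continuous_on UNIV f"
  shows "integrable lborel (\<lambda>x. indicator \<Omega> x * f x)"
proof -
  have "compact (closure \<Omega>)" using assms by (simp add: compact_closure)
  then have *: "integrable lborel (\<lambda>x. indicator (closure \<Omega>) x *\<^sub>R f x)"
    by (rule borel_integrable_compact) (use assms continuous_on_subset in blast)
  have [measurable]: "f \<in> borel_measurable borel" using assms(3) by (rule borel_measurable_continuous_onI)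
  show ?thesis
    by (rule Bochner_Integration.integrable_bound[OF *])
       (use assms closure_subset in \<open>auto simp: indicator_def\<close>)
qed

lemma lebesgue_on_integral:
  fixes f :: "'a::euclidean_space \<Rightarrow> real"
  assumes [measurable]: "f \<in> borel_measurable borel" "\<Omega> \<in> sets borel"
  shows "(LINT x|lebesgue_on \<Omega>. f x) = (LINT x|lborel. indicator \<Omega> x * f x)"
    and "integrable (lebesgue_on \<Omega>) f \<longleftrightarrow> integrable lborel (\<lambda>x. indicator \<Omega> x * f x)"
proof -
  show "(LINT x|lebesgue_on \<Omega>. f x) = (LINT x|lborel. indicator \<Omega> x * f x)"
    by (subst integral_restrict_space) (auto intro!: integral_completion)
  show "integrable (lebesgue_on \<Omega>) f \<longleftrightarrow> integrable lborel (\<lambda>x. indicator \<Omega> x * f x)"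
    by (subst integrable_restrict_space) (auto intro!: integrable_completion)
qed

lemma AE_lebesgue_on_iff:
  "\<Omega> \<in> sets borel \<Longrightarrow> (AE x in lebesgue_on \<Omega>. P x) \<longleftrightarrow> (AE x in lborel. x \<in> \<Omega> \<longrightarrow> P x)"
  by (subst AE_restrict_space_iff) (auto simp: AE_completion_iff)

text \<open>Open boxes are stable under intersection and generate the Borel sets, so vanishing
  integrals spread from boxes to all Borel sets by a Dynkin-class argument; the density is then zero
  almost everywhere.\<close>

lemma AE_zero_if_box_integrals_zero:
  fixes g :: "'a::euclidean_space \<Rightarrow> real"
  assumes g: "integrable lborel g" and z: "\<And>a b. (LINT x|lborel. indicator (box a b) x * g x) = 0"
  shows "AE x in lborel. g x = 0"
proof -
  have [measurable]: "g \<in> borel_measurable borel" using g by auto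
  have int: "integrable lborel (\<lambda>x. indicator A x * g x)" if "A \<in> sets borel" for A
    using integrable_mult_indicator[of A lborel g] that g by simp
  \<comment> \<open>Complements in the induction require the integral over the whole space, obtained
    by exhausting it with centred boxes.\<close>
  have "(LINT x|lborel. g x) = 0"
  proof -
    have "(\<lambda>n::nat. LINT x|lborel. indicator (box (-(real n *\<^sub>R One)) (real n *\<^sub>R One)) x * g x) \<longlonglongrightarrow> (LINT x|lborel. g x)"
    proof (rule integral_dominated_convergence[where w="\<lambda>x. norm (g x)"])
      show "AE x in lborel. (\<lambda>n. indicator (box (-(real n *\<^sub>R One)) (real n *\<^sub>R One)) x * g x) \<longlonglongrightarrow> g x"
      proof (rule AE_I2)
        fix x :: 'a
        have "x \<in> (\<Union>n::nat. box (-(real n *\<^sub>R One)) (real n *\<^sub>R One))"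
          using UN_box_eq_UNIV by auto
        then obtain m where m: "x \<in> box (-(real m *\<^sub>R One)) (real m *\<^sub>R One)" by auto
        have "x \<in> box (-(real n *\<^sub>R One)) (real n *\<^sub>R One)" if "n \<ge> m" for n
        proof -
          have "real m \<le> real n" using that by simp
          then show ?thesis using m by (fastforce simp: mem_box)
        qed
        then have "\<forall>\<^sub>F n in sequentially. indicator (box (-(real n *\<^sub>R One)) (real n *\<^sub>R One)) x * g x = g x"
          by (intro eventually_mono[OF eventually_ge_at_top[of m]]) simp
        then show "(\<lambda>n. indicator (box (-(real n *\<^sub>R One)) (real n *\<^sub>R One)) x * g x) \<longlonglongrightarrow> g x"
          by (rule tendsto_eventually)
      qed
    qed (use g in \<open>auto simp: indicator_def\<close>)
    then show ?thesis using z by (simp add: LIMSEQ_const_iff)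
  qed
  note all = this
  have "(LINT x|lborel. indicator A x * g x) = 0" if "A \<in> sets borel" for A
  proof -
    let ?G = "range (\<lambda> (a, b). box a b :: 'a set)"
    have "A \<in> sigma_sets UNIV ?G" using that by (simp add: borel_eq_box)
    have "Int_stable ?G" by (auto simp: Int_stable_def box_Int_box)
    moreover have "?G \<subseteq> Pow UNIV" by simp
    moreover note \<open>A \<in> sigma_sets UNIV ?G\<close>
    ultimately show ?thesis
    proof (induction rule: sigma_sets_induct_disjoint)
      case (basic A) then show ?case using z by auto
    next
      case (compl A)
      then have "A \<in> sets borel" by (simp add: borel_eq_box)
      have "(LINT x|lborel. indicator (UNIV - A) x * g x) = (LINT x|lborel. g x - indicator A x * g x)"
        by (intro Bochner_Integration.integral_cong) (auto simp: indicator_def)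
      also have "\<dots> = 0" using g int[OF \<open>A \<in> sets borel\<close>] compl all by simp
      finally show ?case .
    next
      case (union A)
      then have A[measurable]: "\<And>i. A i \<in> sets borel" by (auto simp: borel_eq_box)
      then have "set_integrable lborel (\<Union>i. A i) g" by (simp add: set_integrable_def int)
      from lebesgue_integral_countable_add[OF _ _ this] union
      have "(LINT x:(\<Union>i. A i)|lborel. g x) = (\<Sum>i. (LINT x:(A i)|lborel. g x))" by (auto simp: disjoint_family_on_def)
      also have "\<dots> = 0" using union by (simp add: set_lebesgue_integral_def)
      finally show ?case by (simp add: set_lebesgue_integral_def)
    qed auto
  qed
  then show ?thesis
    by (intro density_unique_real[where f'="\<lambda>x. 0"]) (auto simp: g set_lebesgue_integral_def)
qed

text \<open>An open set is a countable union of closed boxes. On each of them the global version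
  applies to \<open>g\<close> restricted to the open box, because the intersection of two boxes is
  again a box; the faces are null.\<close>

lemma AE_zero_if_local_box_integrals_zero:
  fixes g :: "'a::euclidean_space \<Rightarrow> real"
  assumes "open \<Omega>"
    and int: "\<And>a b. cbox a b \<subseteq> \<Omega> \<Longrightarrow> integrable lborel (\<lambda>x. indicator (box a b) x * g x)"
    and z: "\<And>a b. cbox a b \<subseteq> \<Omega> \<Longrightarrow> (LINT x|lborel. indicator (box a b) x * g x) = 0"
  shows "AE x in lborel. x \<in> \<Omega> \<longrightarrow> g x = 0"
proof -
  obtain D where D: "countable D" "\<And>X. X \<in> D \<Longrightarrow> X \<subseteq> \<Omega>" "\<And>X. X \<in> D \<Longrightarrow> \<exists>a b. X = cbox a b" "\<Union>D = \<Omega>"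
    by (rule open_countable_Union_open_cbox[OF assms(1)]) (intro that, auto)
  have "AE x in lborel. x \<in> X \<longrightarrow> g x = 0" if "X \<in> D" for X
  proof -
    obtain a b where X: "X = cbox a b" using D(3)[OF \<open>X \<in> D\<close>] by auto
    then have sub: "cbox a b \<subseteq> \<Omega>" using D(2)[OF \<open>X \<in> D\<close>] by simp
    have "AE x in lborel. indicator (box a b) x * g x = 0"
    proof (rule AE_zero_if_box_integrals_zero[OF int[OF sub]])
      fix c d :: 'a
      obtain e f where ef: "box a b \<inter> box c d = box e f" "cbox a b \<inter> cbox c d = cbox e f"
        using that[OF box_Int_box Int_interval] by blast
      have "(LINT x|lborel. indicator (box c d) x * (indicator (box a b) x * g x)) = (LINT x|lborel. indicator (box e f) x * g x)"
        by (intro Bochner_Integration.integral_cong) (auto simp: indicator_def ef(1)[symmetric])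
      also have "\<dots> = 0" using z[of e f] ef(2) sub by blast
      finally show "(LINT x|lborel. indicator (box c d) x * (indicator (box a b) x * g x)) = 0" .
    qed
    moreover have "AE x in lborel. x \<notin> cbox a b - box a b"
    proof (rule AE_not_in)
      have "cbox a b - box a b \<in> sets lborel" by simp
      moreover have "emeasure lborel (cbox a b - box a b) = emeasure lborel (cbox a b) - emeasure lborel (box a b)"
        by (rule emeasure_Diff) (auto simp: box_subset_cbox emeasure_lborel_box_eq)
      moreover have "\<dots> = 0" by (simp add: emeasure_lborel_box_eq emeasure_lborel_cbox_eq)
      ultimately show "cbox a b - box a b \<in> null_sets lborel" by (auto intro: null_setsI)
    qed
    ultimately show ?thesis by eventually_elim (auto simp: X indicator_def split: if_splits)
  qed
  then have "AE x in lborel. \<forall>X\<in>D. x \<in> X \<longrightarrow> g x = 0"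
    by (subst AE_ball_countable[OF D(1)]) blast
  then show ?thesis using D(4) by (auto elim!: eventually_mono)
qed

section \<open>Test functions and integration by parts\<close>

lemma pderiv_at_support: "x \<notin> closure {x. \<psi> x \<noteq> 0} \<Longrightarrow> pderiv_at i \<psi> x = 0"
proof -
  assume x: "x \<notin> closure {x. \<psi> x \<noteq> 0}"
  have "((\<lambda>x. 0) has_derivative (\<lambda>v. 0)) (at x)" by simp
  then have "(\<psi> has_derivative (\<lambda>v. 0)) (at x)"
    by (rule has_derivative_transform_within_open[where s="- closure {x. \<psi> x \<noteq> 0}"])
       (use x closure_subset[of "{x. \<psi> x \<noteq> 0}"] in auto)
  from pderiv_at_eq[OF this] show ?thesis .
qed

lemma test_functionsI:
  assumes "smooth \<phi>" "compact K" "K \<subseteq> \<Omega>" "\<And>x. x \<notin> K \<Longrightarrow> \<phi> x = 0"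
  shows "\<phi> \<in> test_functions \<Omega>"
proof -
  have "{x. \<phi> x \<noteq> 0} \<subseteq> K" using assms(4) by blast
  then have c: "closure {x. \<phi> x \<noteq> 0} \<subseteq> K" using assms(2) by (simp add: closure_minimal compact_imp_closed)
  then have "compact (closure {x. \<phi> x \<noteq> 0})"
    using compact_Int_closed[OF assms(2) closed_closure[of "{x. \<phi> x \<noteq> 0}"]] by (simp add: inf.absorb2)
  then show ?thesis using assms c by (simp add: test_functions_def)
qed

lemma test_functions_pderiv:
  assumes "\<psi> \<in> test_functions \<Omega>" shows "pderiv_at i \<psi> \<in> test_functions \<Omega>"
  using assms
  by (intro test_functionsI[where K="closure {x. \<psi> x \<noteq> 0}"])
     (simp_all add: test_functions_def smooth_pderiv pderiv_at_support)

lemma test_functions_iter_pderiv: "\<psi> \<in> test_functions \<Omega> \<Longrightarrow> iter_pderiv is \<psi> \<in> test_functions \<Omega>"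
  by (induction "is") (auto intro: test_functions_pderiv)

lemma test_functions_smooth: "\<psi> \<in> test_functions \<Omega> \<Longrightarrow> smooth \<psi>"
  by (simp add: test_functions_def)

lemma test_functions_outside: "\<psi> \<in> test_functions \<Omega> \<Longrightarrow> x \<notin> \<Omega> \<Longrightarrow> \<psi> x = 0"
  using closure_subset[of "{x. \<psi> x \<noteq> 0}"] by (auto simp: test_functions_def)

lemma test_functions_integrable:
  assumes "\<psi> \<in> test_functions \<Omega>" shows "integrable lborel \<psi>"
proof -
  let ?K = "closure {x. \<psi> x \<noteq> 0}"
  have "integrable lborel (\<lambda>x. indicator ?K x * \<psi> x)"
    by (rule integrable_continuous_bounded_set)
       (use assms in \<open>auto simp: test_functions_def compact_imp_bounded smooth_continuous_on\<close>)
  also have "(\<lambda>x. indicator ?K x * \<psi> x) = \<psi>"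
    using closure_subset[of "{x. \<psi> x \<noteq> 0}"] by (auto simp: indicator_def fun_eq_iff)
  finally show ?thesis .
qed

lemma lborel_integral_translate:
  fixes f :: "'a::euclidean_space \<Rightarrow> real"
  assumes [measurable]: "f \<in> borel_measurable borel"
  shows "(LINT x|lborel. f (c + x)) = (LINT x|lborel. f x)"
    "integrable lborel (\<lambda>x. f (c + x)) \<longleftrightarrow> integrable lborel f"
proof -
  show "(LINT x|lborel. f (c + x)) = (LINT x|lborel. f x)"
    using integral_distr[of "(+) c" lborel borel f] by (simp only: lborel_distr_plus) simp
  show "integrable lborel (\<lambda>x. f (c + x)) \<longleftrightarrow> integrable lborel f"
    using integrable_distr_eq[of "(+) c" lborel borel f] by (simp only: lborel_distr_plus) simp
qed

text \<open>By translation invariance every difference quotient has integral zero; the mean value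
  theorem bounds the quotients by the maximum of the derivative, and dominated convergence passes to
  the derivative.\<close>

lemma test_functions_integral_pderiv:
  assumes "\<psi> \<in> test_functions \<Omega>" shows "(LINT x|lborel. pderiv_at i \<psi> x) = 0"
proof -
  define v :: "real^'a" where "v = axis i 1"
  define K where "K = closure {x. \<psi> x \<noteq> 0}"
  have s: "smooth \<psi>" and K: "compact K" using assms by (auto simp: test_functions_def K_def)
  have [measurable]: "\<psi> \<in> borel_measurable borel" "pderiv_at i \<psi> \<in> borel_measurable borel"
    using s by (auto intro!: borel_measurable_continuous_onI smooth_continuous_on smooth_pderiv)
  obtain r where r: "r > 0" "K \<subseteq> cball 0 r" using compact_imp_bounded[OF K] by (metis bounded_pos mem_cball_0 subsetI)
  obtain M where M: "\<And>x. \<bar>pderiv_at i \<psi> x\<bar> \<le> M"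
  proof -
    have "bounded (pderiv_at i \<psi> ` K)"
      using K smooth_continuous_on[OF smooth_pderiv[OF s]] by (intro compact_imp_bounded compact_continuous_image) auto
    then obtain M where "\<And>x. x \<in> K \<Longrightarrow> \<bar>pderiv_at i \<psi> x\<bar> \<le> M" by (auto simp: bounded_iff)
    then have "\<bar>pderiv_at i \<psi> x\<bar> \<le> max M 0" for x
      using pderiv_at_support[of x \<psi> i] by (cases "x \<in> K") (force simp: K_def)+
    then show ?thesis using that by blast
  qed
  have D: "((\<lambda>t. \<psi> (x + t *\<^sub>R v)) has_real_derivative pderiv_at i \<psi> (x + t *\<^sub>R v)) (at t)" for x t
  proof -
    have 1: "((\<lambda>t. x + t *\<^sub>R v) has_derivative (\<lambda>t. t *\<^sub>R v)) (at t)"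
      by (auto intro!: derivative_eq_intros)
    have "((\<lambda>t. \<psi> (x + t *\<^sub>R v)) has_derivative (\<lambda>t'. frechet_derivative \<psi> (at (x + t *\<^sub>R v)) (t' *\<^sub>R v))) (at t)"
      by (rule has_derivative_compose[OF 1 smooth_has_derivative[OF s]])
    moreover have "frechet_derivative \<psi> (at (x + t *\<^sub>R v)) (t' *\<^sub>R v) = pderiv_at i \<psi> (x + t *\<^sub>R v) * t'" for t'
      using linear_scale[OF has_derivative_linear[OF smooth_has_derivative[OF s]]] by (simp add: pderiv_at_def v_def)
    ultimately show ?thesis by (simp add: has_field_derivative_def)
  qed
  define q where "q n x = (\<psi> (x + (1 / Suc n) *\<^sub>R v) - \<psi> x) * Suc n" for n :: nat and x
  have "(\<lambda>n. LINT x|lborel. q n x) \<longlonglongrightarrow> (LINT x|lborel. pderiv_at i \<psi> x)"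
  \<comment> \<open>The steps 1/(n+1) have length at most 1, so all quotients vanish outside radius
    r + 1.\<close>
  proof (rule integral_dominated_convergence[where w="\<lambda>x. indicator (cball 0 (r + 1)) x * M"])
    show "integrable lborel (\<lambda>x. indicator (cball 0 (r + 1)) x * M)"
      by (rule integrable_continuous_bounded_set) auto
    show "q n \<in> borel_measurable lborel" for n unfolding q_def by measurable
    show "AE x in lborel. (\<lambda>n. q n x) \<longlonglongrightarrow> pderiv_at i \<psi> x"
    proof (rule AE_I2)
      fix x
      have "(\<lambda>h. (\<psi> (x + h *\<^sub>R v) - \<psi> x) / h) \<midarrow>0\<rightarrow> pderiv_at i \<psi> x"
        using D[of x 0] by (simp add: DERIV_def)
      moreover have "filterlim (\<lambda>n. 1 / real (Suc n)) (at 0) sequentially"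
        using LIMSEQ_inverse_real_of_nat by (auto simp: filterlim_at inverse_eq_divide)
      ultimately have "(\<lambda>n. (\<psi> (x + (1 / real (Suc n)) *\<^sub>R v) - \<psi> x) / (1 / real (Suc n))) \<longlonglongrightarrow> pderiv_at i \<psi> x"
        by (rule filterlim_compose)
      then show "(\<lambda>n. q n x) \<longlonglongrightarrow> pderiv_at i \<psi> x" by (simp add: q_def)
    qed
    show "AE x in lborel. norm (q n x) \<le> indicator (cball 0 (r + 1)) x * M" for n
    proof (rule AE_I2)
      fix x
      obtain z where z: "\<psi> (x + (1 / Suc n) *\<^sub>R v) - \<psi> (x + 0 *\<^sub>R v) = (1 / Suc n - 0) * pderiv_at i \<psi> (x + z *\<^sub>R v)"
        using MVT2[of 0 "1 / Suc n" "\<lambda>t. \<psi> (x + t *\<^sub>R v)" "\<lambda>t. pderiv_at i \<psi> (x + t *\<^sub>R v)"] D by auto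
      then have *: "norm (q n x) \<le> M" using M[of "x + z *\<^sub>R v"] by (simp add: q_def)
      show "norm (q n x) \<le> indicator (cball 0 (r + 1)) x * M"
      proof (cases "x \<in> cball 0 (r + 1)")
        case False
        then have 1: "norm x > r + 1" by simp
        have nv: "norm ((1 / Suc n) *\<^sub>R v) \<le> 1" by (simp add: v_def)
        then have "norm (x + (1 / Suc n) *\<^sub>R v) > r"
          using 1 nv norm_triangle_ineq4[of "x + (1 / Suc n) *\<^sub>R v" "(1 / Suc n) *\<^sub>R v"]
          unfolding add_diff_cancel_right' by linarith
        then have "x + (1 / Suc n) *\<^sub>R v \<notin> K" "x \<notin> K" using r 1 by auto
        moreover have "\<psi> y = 0" if "y \<notin> K" for y
          using that closure_subset[of "{x. \<psi> x \<noteq> 0}"] by (auto simp: K_def)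
        ultimately have "\<psi> (x + (1 / Suc n) *\<^sub>R v) = 0" "\<psi> x = 0" by blast+
        then show ?thesis using 1 by (simp add: q_def indicator_def)
      qed (use * in auto)
    qed
  qed auto
  moreover have "(LINT x|lborel. q n x) = 0" for n
  proof -
    have i: "integrable lborel \<psi>" by (rule test_functions_integrable[OF assms])
    have "(LINT x|lborel. \<psi> (x + (1 / Suc n) *\<^sub>R v)) = (LINT x|lborel. \<psi> x)" "integrable lborel (\<lambda>x. \<psi> (x + (1 / Suc n) *\<^sub>R v))"
      using lborel_integral_translate[of \<psi> "(1 / Suc n) *\<^sub>R v"] i by (simp_all add: add.commute)
    then show ?thesis unfolding q_def using i by simp
  qed
  ultimately show ?thesis by (simp add: LIMSEQ_const_iff)
qed

lemma test_functions_mult: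
  assumes "\<psi> \<in> test_functions \<Omega>" "smooth \<phi>" shows "(\<lambda>x. \<phi> x * \<psi> x) \<in> test_functions \<Omega>"
proof (rule test_functionsI[where K="closure {x. \<psi> x \<noteq> 0}"])
  show "\<phi> x * \<psi> x = 0" if "x \<notin> closure {x. \<psi> x \<noteq> 0}" for x
    using that closure_subset[of "{x. \<psi> x \<noteq> 0}"] by auto
qed (use assms in \<open>simp_all add: test_functions_def smooth_mult\<close>)

lemma integration_by_parts:
  assumes "smooth \<phi>" "\<psi> \<in> test_functions \<Omega>"
  shows "(LINT x|lborel. \<phi> x * pderiv_at i \<psi> x) = - (LINT x|lborel. pderiv_at i \<phi> x * \<psi> x)"
proof -
  have "(LINT x|lborel. \<phi> x * pderiv_at i \<psi> x + pderiv_at i \<phi> x * \<psi> x) = 0"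
    using test_functions_integral_pderiv[OF test_functions_mult[OF assms(2,1)], of i]
    by (subst (asm) pderiv_at_mult') (use assms test_functions_smooth in auto)
  moreover have "integrable lborel (\<lambda>x. \<phi> x * pderiv_at i \<psi> x)" "integrable lborel (\<lambda>x. pderiv_at i \<phi> x * \<psi> x)"
    using assms by (auto intro!: test_functions_integrable test_functions_mult test_functions_pderiv smooth_pderiv)
  ultimately show ?thesis by simp
qed

text \<open>The derivatives are moved over one at a time, the outermost first, so they reach
  \<open>\<phi>\<close> in reversed order; for the lists \<open>[i, i]\<close> of the Laplacian the
  reversal is invisible.\<close>

lemma integration_by_parts_iter:
  assumes "smooth \<phi>" "\<psi> \<in> test_functions \<Omega>"
  shows "(LINT x|lborel. \<phi> x * iter_pderiv is \<psi> x) = (-1) ^ length is * (LINT x|lborel. iter_pderiv (rev is) \<phi> x * \<psi> x)"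
  using assms(1)
proof (induction "is" arbitrary: \<phi>)
  case (Cons i "is")
  have app: "iter_pderiv (is @ [i]) \<phi> = iter_pderiv is (pderiv_at i \<phi>)" for "is" by (induction "is") auto
  have "(LINT x|lborel. \<phi> x * iter_pderiv (i # is) \<psi> x) = - (LINT x|lborel. pderiv_at i \<phi> x * iter_pderiv is \<psi> x)"
    using integration_by_parts[OF Cons.prems test_functions_iter_pderiv[OF assms(2)]] by simp
  also have "\<dots> = - ((-1) ^ length is * (LINT x|lborel. iter_pderiv (rev is) (pderiv_at i \<phi>) x * \<psi> x))"
    by (simp only: Cons.IH[OF smooth_pderiv[OF Cons.prems]])
  finally show ?case by (simp add: app)
qed simp

text \<open>Sobolev functions are only Lebesgue measurable on \<Omega>, while Fubini and the changes
  of variables below are carried out for Borel functions on \<open>lborel\<close>; this supplies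
  Borel versions extended by zero.\<close>

lemma lebesgue_on_borel_rep:
  fixes g :: "'a::euclidean_space \<Rightarrow> real"
  assumes \<Omega>: "\<Omega> \<in> sets borel" and g: "g \<in> borel_measurable (lebesgue_on \<Omega>)"
  shows "\<exists>g'\<in>borel_measurable borel. (\<forall>x. x \<notin> \<Omega> \<longrightarrow> g' x = 0) \<and> (AE x in lebesgue_on \<Omega>. g x = g' x)"
proof -
  have "(\<lambda>x. if x \<in> \<Omega> then g x else 0) \<in> borel_measurable lebesgue"
    using borel_measurable_if_I[OF g] \<Omega> by simp
  from completion_ex_borel_measurable_real[OF this] obtain g' where
    g': "g' \<in> borel_measurable lborel" "AE x in lborel. (if x \<in> \<Omega> then g x else 0) = g' x" by blast
  have "(\<lambda>x. indicator \<Omega> x * g' x) \<in> borel_measurable borel" using g'(1) \<Omega> by measurable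
  moreover have "AE x in lebesgue_on \<Omega>. g x = indicator \<Omega> x * g' x"
    unfolding AE_lebesgue_on_iff[OF \<Omega>] using g'(2) by eventually_elim auto
  ultimately show ?thesis by (intro bexI[of _ "\<lambda>x. indicator \<Omega> x * g' x"]) auto
qed

lemma lebesgue_on_integral':
  fixes g :: "'a::euclidean_space \<Rightarrow> real"
  assumes "g \<in> borel_measurable borel" "\<Omega> \<in> sets borel" "\<And>x. x \<notin> \<Omega> \<Longrightarrow> g x = 0"
  shows "(LINT x|lebesgue_on \<Omega>. g x) = (LINT x|lborel. g x)"
    and "integrable (lebesgue_on \<Omega>) g \<longleftrightarrow> integrable lborel g"
proof -
  have "(\<lambda>x. indicator \<Omega> x * g x) = g" using assms(3) by (auto simp: indicator_def fun_eq_iff)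
  then show "(LINT x|lebesgue_on \<Omega>. g x) = (LINT x|lborel. g x)" "integrable (lebesgue_on \<Omega>) g \<longleftrightarrow> integrable lborel g"
    using lebesgue_on_integral[OF assms(1,2)] by simp_all
qed

lemma borel_measurable_lebesgue_on: "f \<in> borel_measurable borel \<Longrightarrow> f \<in> borel_measurable (lebesgue_on \<Omega>)"
  by (intro measurable_restrict_space1 measurable_completion) simp

lemma smooth_borel: "smooth f \<Longrightarrow> f \<in> borel_measurable borel"
  by (intro borel_measurable_continuous_onI smooth_continuous_on)

text \<open>Products of one-dimensional bumps are test functions between 0 and 1 that converge
  pointwise to the indicator of an open box, which reduces this fundamental lemma of the calculus of
  variations to integrals over boxes.\<close>

lemma AE_zero_if_test_integrals_zero:
  fixes g :: "real^'n::finite \<Rightarrow> real"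
  assumes \<Omega>: "open \<Omega>" and g: "integrable (lebesgue_on \<Omega>) g"
    and z: "\<And>\<psi>. \<psi> \<in> test_functions \<Omega> \<Longrightarrow> (LINT x|lebesgue_on \<Omega>. g x * \<psi> x) = 0"
  shows "AE x in lebesgue_on \<Omega>. g x = 0"
proof -
  have \<Omega>b[measurable]: "\<Omega> \<in> sets borel" using \<Omega> by simp
  obtain g' where g'm[measurable]: "g' \<in> borel_measurable borel" and g'0: "\<And>x. x \<notin> \<Omega> \<Longrightarrow> g' x = 0"
    and g'AE: "AE x in lebesgue_on \<Omega>. g x = g' x"
    using lebesgue_on_borel_rep[OF \<Omega>b borel_measurable_integrable[OF g]] by blast
  have "integrable (lebesgue_on \<Omega>) g'"
    using g g'AE borel_measurable_lebesgue_on[OF g'm]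
    by (subst integrable_cong_AE[of _ _ g]) (auto elim: eventually_mono)
  then have g'i: "integrable lborel g'" using lebesgue_on_integral'(2)[OF g'm \<Omega>b g'0] by simp
  have z': "(LINT x|lborel. g' x * \<psi> x) = 0" if \<psi>: "\<psi> \<in> test_functions \<Omega>" for \<psi>
  proof -
    have m[measurable]: "\<psi> \<in> borel_measurable borel" using \<psi> test_functions_smooth smooth_borel by blast
    have "(LINT x|lborel. g' x * \<psi> x) = (LINT x|lebesgue_on \<Omega>. g' x * \<psi> x)"
      using g'0 by (subst lebesgue_on_integral'(1)) auto
    also have "\<dots> = (LINT x|lebesgue_on \<Omega>. g x * \<psi> x)"
    proof (rule integral_cong_AE)
      show "AE x in lebesgue_on \<Omega>. g' x * \<psi> x = g x * \<psi> x" using g'AE by eventually_elim simp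
      show "(\<lambda>x. g x * \<psi> x) \<in> borel_measurable (lebesgue_on \<Omega>)"
        by (intro borel_measurable_times borel_measurable_integrable[OF g] borel_measurable_lebesgue_on m)
    qed (intro borel_measurable_times borel_measurable_lebesgue_on g'm m)
    finally show ?thesis using z[OF \<psi>] by simp
  qed
  have "AE x in lborel. x \<in> \<Omega> \<longrightarrow> g' x = 0"
  proof (rule AE_zero_if_local_box_integrals_zero[OF \<Omega>])
    fix a b :: "real^'n" assume ab: "cbox a b \<subseteq> \<Omega>"
    show "integrable lborel (\<lambda>x. indicator (box a b) x * g' x)"
      using integrable_mult_indicator[of "box a b" lborel g'] g'i by simp
    define \<psi> where "\<psi> n x = (\<Prod>i\<in>UNIV. bump 0 (real (Suc n) * (x $ i - a $ i)) * bump 0 (real (Suc n) * (b $ i - x $ i)))" for n x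
    have sm: "smooth (\<psi> n)" for n
      unfolding \<psi>_def by (intro smooth_prod smooth_mult smooth_bump smooth_const smooth_diff smooth_nth) auto
    have bd: "0 \<le> \<psi> n x" "\<psi> n x \<le> 1" for n x
      unfolding \<psi>_def by (auto intro!: prod_nonneg prod_le_1 mult_nonneg_nonneg mult_le_one bump_bounds)
    have out: "\<psi> n x = 0" if "x \<notin> box a b" for n x
    proof -
      obtain i where "x $ i \<le> a $ i \<or> b $ i \<le> x $ i" using \<open>x \<notin> box a b\<close> by (auto simp: mem_box_cart not_less)
      then have "bump 0 (real (Suc n) * (x $ i - a $ i)) * bump 0 (real (Suc n) * (b $ i - x $ i)) = 0"
        by (auto simp: mult_le_0_iff intro!: bump_bounds(4))
      then show ?thesis unfolding \<psi>_def by (intro prod_zero bexI[of _ i]) auto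
    qed
    have lim: "(\<lambda>n. \<psi> n x) \<longlonglongrightarrow> indicator (box a b) x" for x
    proof (cases "x \<in> box a b")
      case True
      have l: "filterlim (\<lambda>n. real (Suc n) * e) at_top sequentially" if "e > 0" for e
        by (subst mult.commute, rule filterlim_tendsto_pos_mult_at_top[OF tendsto_const that])
           (rule filterlim_compose[OF filterlim_real_sequentially filterlim_Suc])
      have "(\<lambda>n. \<psi> n x) \<longlonglongrightarrow> (\<Prod>i\<in>(UNIV::'n set). 1 * 1)"
        unfolding \<psi>_def using True by (intro tendsto_prod tendsto_mult bump_tendsto_1 l) (auto simp: mem_box_cart)
      then show ?thesis using True by simp
    qed (simp add: out)
    have t: "\<psi> n \<in> test_functions \<Omega>" for n
      by (rule test_functionsI[OF sm, of "cbox a b"]) (use ab out box_subset_cbox[of a b] in auto)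
    have "(\<lambda>n. LINT x|lborel. g' x * \<psi> n x) \<longlonglongrightarrow> (LINT x|lborel. g' x * indicator (box a b) x)"
    proof (rule integral_dominated_convergence[where w="\<lambda>x. norm (g' x)"])
      show "AE x in lborel. norm (g' x * \<psi> n x) \<le> norm (g' x)" for n
        using bd by (intro AE_I2) (auto simp: abs_mult intro!: mult_left_le)
      show "(\<lambda>x. g' x * \<psi> n x) \<in> borel_measurable lborel" for n using smooth_borel[OF sm] by measurable
    qed (use g'i lim in \<open>auto intro!: tendsto_intros\<close>)
    then show "(LINT x|lborel. indicator (box a b) x * g' x) = 0"
      using z'[OF t] by (simp add: LIMSEQ_const_iff mult.commute)
  qed
  then have "AE x in lebesgue_on \<Omega>. g' x = 0" by (simp add: AE_lebesgue_on_iff)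
  with g'AE show ?thesis by eventually_elim auto
qed

section \<open>Sobolev functions on a bounded open set\<close>

context
  fixes \<Omega> :: "(real^'n::finite) set"
  assumes op: "open \<Omega>" and bdd: "bounded \<Omega>"
begin

lemma finite_measure_lebesgue_on': "finite_measure (lebesgue_on \<Omega>)"
proof -
  have "emeasure lborel \<Omega> < \<infinity>" by (rule emeasure_bounded_finite[OF bdd])
  then show ?thesis using op by (intro finite_measureI) (simp add: emeasure_restrict_space)
qed

lemma L2_integrable: "u \<in> L2 \<Omega> \<Longrightarrow> integrable (lebesgue_on \<Omega>) u"
proof -
  interpret finite_measure "lebesgue_on \<Omega>" by (rule finite_measure_lebesgue_on')
  assume u: "u \<in> L2 \<Omega>"
  then have "integrable (lebesgue_on \<Omega>) (\<lambda>x. 1 + (u x)\<^sup>2)" by (auto simp: L2_def)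
  then show ?thesis
  proof (rule Bochner_Integration.integrable_bound)
    have "\<bar>t\<bar> \<le> 1 + t\<^sup>2" for t :: real using zero_le_power2[of "\<bar>t\<bar> - 1"] by (simp add: power2_eq_square algebra_simps)
    then show "AE x in lebesgue_on \<Omega>. norm (u x) \<le> norm (1 + (u x)\<^sup>2)" by (simp add: abs_of_nonneg add_nonneg_nonneg)
  qed (use u in \<open>simp add: L2_def\<close>)
qed

lemma L2_diff: "u \<in> L2 \<Omega> \<Longrightarrow> v \<in> L2 \<Omega> \<Longrightarrow> (\<lambda>x. u x - v x) \<in> L2 \<Omega>"
proof -
  assume u: "u \<in> L2 \<Omega>" and v: "v \<in> L2 \<Omega>"
  have "integrable (lebesgue_on \<Omega>) (\<lambda>x. 2 * (u x)\<^sup>2 + 2 * (v x)\<^sup>2)" using u v by (auto simp: L2_def)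
  then have "integrable (lebesgue_on \<Omega>) (\<lambda>x. (u x - v x)\<^sup>2)"
  proof (rule Bochner_Integration.integrable_bound)
    have "(s - t)\<^sup>2 \<le> 2 * s\<^sup>2 + 2 * t\<^sup>2" for s t :: real using zero_le_power2[of "s + t"] by (simp add: power2_eq_square algebra_simps)
    then show "AE x in lebesgue_on \<Omega>. norm ((u x - v x)\<^sup>2) \<le> norm (2 * (u x)\<^sup>2 + 2 * (v x)\<^sup>2)" by simp
    show "(\<lambda>x. (u x - v x)\<^sup>2) \<in> borel_measurable (lebesgue_on \<Omega>)"
      by (intro borel_measurable_power borel_measurable_diff) (use u v in \<open>auto simp: L2_def\<close>)
  qed
  then show ?thesis using u v by (auto simp: L2_def)
qed

lemma smooth_bounded_on: "smooth \<phi> \<Longrightarrow> \<exists>C\<ge>0. \<forall>x\<in>\<Omega>. \<bar>\<phi> x\<bar> \<le> C"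
proof -
  assume "smooth \<phi>"
  then have "bounded (\<phi> ` closure \<Omega>)"
    using bdd by (intro compact_imp_bounded compact_continuous_image smooth_continuous_on) (auto simp: compact_closure)
  then obtain C where "\<And>x. x \<in> closure \<Omega> \<Longrightarrow> \<bar>\<phi> x\<bar> \<le> C" by (auto simp: bounded_iff)
  then have "\<forall>x\<in>\<Omega>. \<bar>\<phi> x\<bar> \<le> max C 0" using closure_subset[of \<Omega>] by (auto intro: max.coboundedI1)
  then show ?thesis by (intro exI[of _ "max C 0"]) auto
qed

lemma smooth_L2: "smooth \<phi> \<Longrightarrow> \<phi> \<in> L2 \<Omega>"
proof -
  assume s: "smooth \<phi>"
  then have "continuous_on UNIV (\<lambda>x. (\<phi> x)\<^sup>2)" by (intro smooth_continuous_on smooth_power)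
  then have "integrable lborel (\<lambda>x. indicator \<Omega> x * (\<phi> x)\<^sup>2)"
    using integrable_continuous_bounded_set[OF bdd _ ] op by simp
  then show ?thesis using smooth_borel[OF s] op
    by (auto simp: L2_def lebesgue_on_integral(2) borel_measurable_lebesgue_on)
qed

lemma integrable_L2_mult_bounded:
  assumes "u \<in> L2 \<Omega>" "\<psi> \<in> borel_measurable borel" "\<And>x. x \<in> \<Omega> \<Longrightarrow> \<bar>\<psi> x\<bar> \<le> C"
  shows "integrable (lebesgue_on \<Omega>) (\<lambda>x. u x * \<psi> x)"
proof (rule Bochner_Integration.integrable_bound[where f="\<lambda>x. C * u x"])
  show "integrable (lebesgue_on \<Omega>) (\<lambda>x. C * u x)" using L2_integrable[OF assms(1)] by simp
  show "(\<lambda>x. u x * \<psi> x) \<in> borel_measurable (lebesgue_on \<Omega>)"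
    using assms borel_measurable_lebesgue_on[OF assms(2)] by (auto simp: L2_def)
  show "AE x in lebesgue_on \<Omega>. norm (u x * \<psi> x) \<le> norm (C * u x)"
  proof (rule AE_I2)
    fix x assume "x \<in> space (lebesgue_on \<Omega>)"
    then have "\<bar>\<psi> x\<bar> \<le> \<bar>C\<bar>" using assms(3)[of x] by (simp add: abs_le_iff)
    then show "norm (u x * \<psi> x) \<le> norm (C * u x)" by (simp add: abs_mult mult.commute mult_right_mono)
  qed
qed

lemma integrable_L2_mult_smooth: "u \<in> L2 \<Omega> \<Longrightarrow> smooth \<psi> \<Longrightarrow> integrable (lebesgue_on \<Omega>) (\<lambda>x. u x * \<psi> x)"
proof -
  assume u: "u \<in> L2 \<Omega>" and \<psi>: "smooth \<psi>"
  obtain C where "\<forall>x\<in>\<Omega>. \<bar>\<psi> x\<bar> \<le> C" using smooth_bounded_on[OF \<psi>] by blast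
  then show ?thesis by (intro integrable_L2_mult_bounded[OF u smooth_borel[OF \<psi>]]) auto
qed

text \<open>Cauchy-Schwarz against the constant 1, from the nonnegativity of the integral of (|w| -
  t)^2 as a quadratic polynomial in t.\<close>

lemma integral_abs_L2_bound:
  assumes w: "w \<in> L2 \<Omega>"
  shows "(LINT x|lebesgue_on \<Omega>. \<bar>w x\<bar>) \<le> sqrt (measure lborel \<Omega>) * sqrt (LINT x|lebesgue_on \<Omega>. (w x)\<^sup>2)"
proof -
  have c: "integrable (lebesgue_on \<Omega>) (\<lambda>x. k)" for k :: real
    by (rule finite_measure.integrable_const[OF finite_measure_lebesgue_on'])
  define m where "m = measure (lebesgue_on \<Omega>) \<Omega>"
  define I where "I = (LINT x|lebesgue_on \<Omega>. \<bar>w x\<bar>)"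
  define J where "J = (LINT x|lebesgue_on \<Omega>. (w x)\<^sup>2)"
  have i: "integrable (lebesgue_on \<Omega>) (\<lambda>x. \<bar>w x\<bar>)" "integrable (lebesgue_on \<Omega>) (\<lambda>x. (w x)\<^sup>2)"
    using integrable_abs[OF L2_integrable[OF w]] w by (auto simp: L2_def)
  have m: "m = measure lborel \<Omega>" using op by (simp add: m_def measure_restrict_space)
  have q: "0 \<le> J - 2 * t * I + t\<^sup>2 * m" for t
  proof -
    have "0 \<le> (LINT x|lebesgue_on \<Omega>. (\<bar>w x\<bar> - t)\<^sup>2)" by simp
    also have "(\<lambda>x. (\<bar>w x\<bar> - t)\<^sup>2) = (\<lambda>x. (w x)\<^sup>2 - (2 * t) * \<bar>w x\<bar> + t\<^sup>2)"
      by (auto simp: power2_eq_square algebra_simps)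
    also have "(LINT x|lebesgue_on \<Omega>. (w x)\<^sup>2 - (2 * t) * \<bar>w x\<bar> + t\<^sup>2) = J - 2 * t * I + t\<^sup>2 * m"
      using i c by (simp add: I_def J_def m_def mult.commute)
    finally show ?thesis .
  qed
  have I0: "I \<ge> 0" and m0: "m \<ge> 0" and J0: "J \<ge> 0" by (auto simp: I_def m_def J_def)
  have "I\<^sup>2 \<le> m * J"
  proof (cases "m = 0")
    case True
    \<comment> \<open>On a null set the polynomial is affine in t and can stay nonnegative only if
      its slope vanishes.\<close>
    have "I = 0"
    proof (rule ccontr)
      assume "I \<noteq> 0"
      then have "2 * ((J + 1) / (2 * I)) * I = J + 1" by simp
      then show False using q[of "(J + 1) / (2 * I)"] True by simp
    qed
    then show ?thesis using True by simp
  next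
    case False
    then show ?thesis using q[of "I / m"] m0 by (simp add: field_simps power2_eq_square)
  qed
  then have "I \<le> sqrt (m * J)" by (rule real_le_rsqrt)
  then show ?thesis by (simp add: real_sqrt_mult m I_def J_def)
qed

lemma weak_deriv_unique:
  assumes "is_weak_deriv \<Omega> is u v" "is_weak_deriv \<Omega> is u v'"
  shows "AE x in lebesgue_on \<Omega>. v x = v' x"
proof -
  have v: "v \<in> L2 \<Omega>" "v' \<in> L2 \<Omega>" using assms by (auto simp: is_weak_deriv_def)
  have "AE x in lebesgue_on \<Omega>. v x - v' x = 0"
  proof (rule AE_zero_if_test_integrals_zero[OF op])
    show "integrable (lebesgue_on \<Omega>) (\<lambda>x. v x - v' x)" by (intro L2_integrable L2_diff v)
    fix \<psi> assume \<psi>: "\<psi> \<in> test_functions \<Omega>"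
    have "(LINT x|lebesgue_on \<Omega>. v x * \<psi> x) = (LINT x|lebesgue_on \<Omega>. v' x * \<psi> x)"
      using assms \<psi> unfolding is_weak_deriv_def by auto
    then show "(LINT x|lebesgue_on \<Omega>. (v x - v' x) * \<psi> x) = 0"
      using integrable_L2_mult_smooth[OF v(1) test_functions_smooth[OF \<psi>]] integrable_L2_mult_smooth[OF v(2) test_functions_smooth[OF \<psi>]]
      by (simp add: left_diff_distrib)
  qed
  then show ?thesis by simp
qed

lemma weak_deriv_AE:
  assumes "is_weak_deriv \<Omega> is u v"
  shows "is_weak_deriv \<Omega> is u (weak_deriv \<Omega> is u)" "AE x in lebesgue_on \<Omega>. weak_deriv \<Omega> is u x = v x"
proof -
  show *: "is_weak_deriv \<Omega> is u (weak_deriv \<Omega> is u)" unfolding weak_deriv_def by (rule someI[of "is_weak_deriv \<Omega> is u", OF assms])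
  show "AE x in lebesgue_on \<Omega>. weak_deriv \<Omega> is u x = v x" by (rule weak_deriv_unique[OF * assms])
qed

lemma smooth_times_test_integral:
  assumes "smooth \<phi>" "\<psi> \<in> test_functions \<Omega>"
  shows "(LINT x|lebesgue_on \<Omega>. \<phi> x * \<psi> x) = (LINT x|lborel. \<phi> x * \<psi> x)"
  by (rule lebesgue_on_integral'(1))
     (use op test_functions_outside[OF assms(2)] smooth_borel[OF smooth_mult[OF assms(1) test_functions_smooth[OF assms(2)]]] in auto)

lemma is_weak_deriv_smooth:
  assumes "smooth \<phi>" shows "is_weak_deriv \<Omega> is \<phi> (iter_pderiv (rev is) \<phi>)"
  unfolding is_weak_deriv_def
proof (intro conjI ballI smooth_L2 smooth_iter_pderiv assms)
  fix \<psi> assume \<psi>: "\<psi> \<in> test_functions \<Omega>"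
  show "(LINT x|lebesgue_on \<Omega>. \<phi> x * iter_pderiv is \<psi> x) = (- 1) ^ length is * (LINT x|lebesgue_on \<Omega>. iter_pderiv (rev is) \<phi> x * \<psi> x)"
    by (simp only: smooth_times_test_integral[OF assms test_functions_iter_pderiv[OF \<psi>]]
        smooth_times_test_integral[OF smooth_iter_pderiv[OF assms] \<psi>] integration_by_parts_iter[OF assms \<psi>])
qed

lemma is_weak_deriv_diff:
  assumes "is_weak_deriv \<Omega> is u v" "is_weak_deriv \<Omega> is u' v'"
  shows "is_weak_deriv \<Omega> is (\<lambda>x. u x - u' x) (\<lambda>x. v x - v' x)"
proof -
  have L: "u \<in> L2 \<Omega>" "v \<in> L2 \<Omega>" "u' \<in> L2 \<Omega>" "v' \<in> L2 \<Omega>" using assms by (auto simp: is_weak_deriv_def)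
  have "(LINT x|lebesgue_on \<Omega>. (u x - u' x) * iter_pderiv is \<phi> x)
     = (- 1) ^ length is * (LINT x|lebesgue_on \<Omega>. (v x - v' x) * \<phi> x)" if \<phi>: "\<phi> \<in> test_functions \<Omega>" for \<phi>
  proof -
    note i = integrable_L2_mult_smooth[OF _ smooth_iter_pderiv[OF test_functions_smooth[OF \<phi>]]]
      integrable_L2_mult_smooth[OF _ test_functions_smooth[OF \<phi>]]
    show ?thesis using assms \<phi> i(1)[OF L(1)] i(1)[OF L(3)] i(2)[OF L(2)] i(2)[OF L(4)]
      unfolding is_weak_deriv_def by (simp add: left_diff_distrib right_diff_distrib)
  qed
  then show ?thesis using L by (auto simp: is_weak_deriv_def L2_diff)
qed

lemma test_functions_H20: "\<phi> \<in> test_functions \<Omega> \<Longrightarrow> \<phi> \<in> H20 \<Omega>"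
proof -
  assume \<phi>: "\<phi> \<in> test_functions \<Omega>"
  note s = test_functions_smooth[OF \<phi>]
  have "\<phi> \<in> H2 \<Omega>" using smooth_L2[OF s] is_weak_deriv_smooth[OF s] by (auto simp: H2_def)
  moreover have "H2_norm \<Omega> (\<lambda>x. \<phi> x - \<phi> x) = 0"
  proof -
    have "(LINT x|lebesgue_on \<Omega>. (weak_deriv \<Omega> is (\<lambda>x. 0) x)\<^sup>2) = 0" for "is"
    proof -
      have "iter_pderiv js (\<lambda>x::real^'n. 0) = (\<lambda>x. 0)" for js by (induction js) auto
      then have "is_weak_deriv \<Omega> is (\<lambda>x. 0) (\<lambda>x. 0)" using is_weak_deriv_smooth[of "\<lambda>x. 0" "is"] by simp
      from weak_deriv_AE(2)[OF this] show ?thesis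
        by (intro integral_eq_zero_AE) (auto elim: eventually_mono)
    qed
    then show ?thesis by (simp add: H2_norm_def)
  qed
  ultimately show ?thesis unfolding H20_def using \<phi> by (auto intro!: exI[of _ "\<lambda>k. \<phi>"])
qed

lemma finite_lists_le2: "finite {is::'n list. length is \<le> 2}"
  using finite_lists_length_le[of "UNIV :: 'n set" 2] by simp

lemma H2_norm_component:
  assumes "length is \<le> 2"
  shows "sqrt (LINT x|lebesgue_on \<Omega>. (weak_deriv \<Omega> is u x)\<^sup>2) \<le> H2_norm \<Omega> u"
  unfolding H2_norm_def
proof (rule real_sqrt_le_mono, rule member_le_sum[where f="\<lambda>is. LINT x|lebesgue_on \<Omega>. (weak_deriv \<Omega> is u x)\<^sup>2"])
  show "is \<in> {is. length is \<le> 2}" using assms by simp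
qed (simp_all add: finite_lists_le2)

text \<open>Convergence of compactly supported approximants in H^2 gives convergence of their
  derivatives against any smooth \<open>\<psi>\<close>, whatever its boundary values; this is how
  the boundary conditions hidden in \<open>H20\<close> become usable.\<close>

lemma H2_limit_integral:
  assumes u: "u \<in> H2 \<Omega>" and \<phi>: "\<And>k. \<phi> k \<in> test_functions \<Omega>"
    and lim: "(\<lambda>k::nat. H2_norm \<Omega> (\<lambda>x. u x - \<phi> k x)) \<longlonglongrightarrow> 0"
    and len: "length is \<le> 2" and \<psi>: "smooth \<psi>"
  shows "(\<lambda>k. LINT x|lebesgue_on \<Omega>. iter_pderiv (rev is) (\<phi> k) x * \<psi> x) \<longlonglongrightarrow> (LINT x|lebesgue_on \<Omega>. weak_deriv \<Omega> is u x * \<psi> x)"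
proof -
  obtain v where "is_weak_deriv \<Omega> is u v" using u len by (auto simp: H2_def)
  from weak_deriv_AE(1)[OF this] have W: "is_weak_deriv \<Omega> is u (weak_deriv \<Omega> is u)" .
  define w where "w k = weak_deriv \<Omega> is (\<lambda>x. u x - \<phi> k x)" for k
  have sm: "smooth (\<phi> k)" for k by (rule test_functions_smooth[OF \<phi>])
  have wd: "is_weak_deriv \<Omega> is (\<lambda>x. u x - \<phi> k x) (\<lambda>x. weak_deriv \<Omega> is u x - iter_pderiv (rev is) (\<phi> k) x)" for k
    by (rule is_weak_deriv_diff[OF W is_weak_deriv_smooth[OF sm]])
  have wAE: "AE x in lebesgue_on \<Omega>. w k x = weak_deriv \<Omega> is u x - iter_pderiv (rev is) (\<phi> k) x" for k
    unfolding w_def by (rule weak_deriv_AE(2)[OF wd])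
  have wL: "w k \<in> L2 \<Omega>" for k using weak_deriv_AE(1)[OF wd] by (simp add: w_def is_weak_deriv_def)
  obtain C where C: "C \<ge> 0" "\<And>x. x \<in> \<Omega> \<Longrightarrow> \<bar>\<psi> x\<bar> \<le> C" using smooth_bounded_on[OF \<psi>] by blast
  have iw: "integrable (lebesgue_on \<Omega>) (\<lambda>x. w k x * \<psi> x)" for k by (rule integrable_L2_mult_smooth[OF wL \<psi>])
  have WL: "weak_deriv \<Omega> is u \<in> L2 \<Omega>" using W by (simp add: is_weak_deriv_def)
  have eq: "(LINT x|lebesgue_on \<Omega>. w k x * \<psi> x) = (LINT x|lebesgue_on \<Omega>. weak_deriv \<Omega> is u x * \<psi> x)
     - (LINT x|lebesgue_on \<Omega>. iter_pderiv (rev is) (\<phi> k) x * \<psi> x)" for k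
  proof -
    have i: "integrable (lebesgue_on \<Omega>) (\<lambda>x. weak_deriv \<Omega> is u x * \<psi> x)" "integrable (lebesgue_on \<Omega>) (\<lambda>x. iter_pderiv (rev is) (\<phi> k) x * \<psi> x)"
      by (auto intro!: integrable_L2_mult_smooth WL \<psi> smooth_L2 smooth_iter_pderiv sm)
    have "(LINT x|lebesgue_on \<Omega>. w k x * \<psi> x) = (LINT x|lebesgue_on \<Omega>. weak_deriv \<Omega> is u x * \<psi> x - iter_pderiv (rev is) (\<phi> k) x * \<psi> x)"
      by (rule integral_cong_AE) (use wAE[of k] iw i in \<open>auto simp: left_diff_distrib elim!: eventually_mono\<close>)
    then show ?thesis using i by simp
  qed
  have "(\<lambda>k. LINT x|lebesgue_on \<Omega>. w k x * \<psi> x) \<longlonglongrightarrow> 0"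
  proof (rule Lim_null_comparison)
    show "\<forall>\<^sub>F k in sequentially. norm (LINT x|lebesgue_on \<Omega>. w k x * \<psi> x) \<le> C * (sqrt (measure lborel \<Omega>) * H2_norm \<Omega> (\<lambda>x. u x - \<phi> k x))"
    proof (rule always_eventually, rule allI)
      fix k
      have "norm (LINT x|lebesgue_on \<Omega>. w k x * \<psi> x) \<le> (LINT x|lebesgue_on \<Omega>. norm (w k x * \<psi> x))"
        by (rule integral_norm_bound)
      also have "\<dots> \<le> (LINT x|lebesgue_on \<Omega>. C * \<bar>w k x\<bar>)"
        by (intro integral_mono integrable_norm iw)
           (use L2_integrable[OF wL] C in \<open>auto simp: abs_mult mult.commute intro!: mult_right_mono\<close>)
      also have "\<dots> = C * (LINT x|lebesgue_on \<Omega>. \<bar>w k x\<bar>)" by simp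
      also have "\<dots> \<le> C * (sqrt (measure lborel \<Omega>) * sqrt (LINT x|lebesgue_on \<Omega>. (w k x)\<^sup>2))"
        by (intro mult_left_mono integral_abs_L2_bound wL C)
      also have "\<dots> \<le> C * (sqrt (measure lborel \<Omega>) * H2_norm \<Omega> (\<lambda>x. u x - \<phi> k x))"
        unfolding w_def by (intro mult_left_mono H2_norm_component len C) auto
      finally show "norm (LINT x|lebesgue_on \<Omega>. w k x * \<psi> x) \<le> C * (sqrt (measure lborel \<Omega>) * H2_norm \<Omega> (\<lambda>x. u x - \<phi> k x))" .
    qed
    show "(\<lambda>k. C * (sqrt (measure lborel \<Omega>) * H2_norm \<Omega> (\<lambda>x. u x - \<phi> k x))) \<longlonglongrightarrow> 0"
      using tendsto_mult_right_zero[OF tendsto_mult_right_zero[OF lim]] by blast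
  qed
  then have "(\<lambda>k. (LINT x|lebesgue_on \<Omega>. weak_deriv \<Omega> is u x * \<psi> x) - (LINT x|lebesgue_on \<Omega>. w k x * \<psi> x)) \<longlonglongrightarrow> (LINT x|lebesgue_on \<Omega>. weak_deriv \<Omega> is u x * \<psi> x) - 0"
    by (intro tendsto_intros)
  then show ?thesis by (simp add: eq)
qed

lemma weak_deriv_Nil_AE: "u \<in> L2 \<Omega> \<Longrightarrow> AE x in lebesgue_on \<Omega>. weak_deriv \<Omega> [] u x = u x"
  by (rule weak_deriv_AE(2)) (simp add: is_weak_deriv_def)

lemma weak_laplacian_L2: "u \<in> H2 \<Omega> \<Longrightarrow> weak_deriv \<Omega> [i,i] u \<in> L2 \<Omega>"
proof -
  assume "u \<in> H2 \<Omega>"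
  then have "\<forall>is. length is \<le> 2 \<longrightarrow> (\<exists>v. is_weak_deriv \<Omega> is u v)" by (simp add: H2_def)
  from this[rule_format, of "[i,i]"] obtain v where "is_weak_deriv \<Omega> [i,i] u v" by auto
  from weak_deriv_AE(1)[OF this] show ?thesis by (simp add: is_weak_deriv_def)
qed

text \<open>For the approximants both sides agree by integrating by parts twice, and both sides pass
  to the limit by \<open>H2_limit_integral\<close>. The boundary terms disappear because of the
  compact support of the approximants, not because of \<open>\<psi>\<close>.\<close>

lemma weak_laplacian_smooth:
  assumes u: "u \<in> H20 \<Omega>" and \<psi>: "smooth \<psi>"
  shows "(LINT x|lebesgue_on \<Omega>. weak_laplacian \<Omega> u x * \<psi> x) = (LINT x|lebesgue_on \<Omega>. u x * lap \<psi> x)"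
proof -
  obtain \<phi> where \<phi>: "\<And>k. \<phi> k \<in> test_functions \<Omega>" and lim: "(\<lambda>k::nat. H2_norm \<Omega> (\<lambda>x. u x - \<phi> k x)) \<longlonglongrightarrow> 0"
    using u by (auto simp: H20_def)
  have H: "u \<in> H2 \<Omega>" using u by (simp add: H20_def)
  then have L: "u \<in> L2 \<Omega>" by (simp add: H2_def)
  have "(LINT x|lebesgue_on \<Omega>. weak_deriv \<Omega> [i,i] u x * \<psi> x) = (LINT x|lebesgue_on \<Omega>. u x * iter_pderiv [i,i] \<psi> x)" for i
  proof -
    have "(\<lambda>k. LINT x|lebesgue_on \<Omega>. iter_pderiv [i,i] (\<phi> k) x * \<psi> x) \<longlonglongrightarrow> (LINT x|lebesgue_on \<Omega>. weak_deriv \<Omega> [i,i] u x * \<psi> x)"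
      using H2_limit_integral[OF H \<phi> lim, of "[i,i]" \<psi>] \<psi> by simp
    moreover have "(LINT x|lebesgue_on \<Omega>. iter_pderiv [i,i] (\<phi> k) x * \<psi> x) = (LINT x|lebesgue_on \<Omega>. \<phi> k x * iter_pderiv [i,i] \<psi> x)" for k
    proof -
      have "(LINT x|lebesgue_on \<Omega>. \<psi> x * iter_pderiv [i,i] (\<phi> k) x) = (LINT x|lborel. \<psi> x * iter_pderiv [i,i] (\<phi> k) x)"
        by (rule smooth_times_test_integral[OF \<psi> test_functions_iter_pderiv[OF \<phi>]])
      also have "\<dots> = (LINT x|lborel. iter_pderiv [i,i] \<psi> x * \<phi> k x)"
        using integration_by_parts_iter[OF \<psi> \<phi>, of "[i,i]" k] by simp
      also have "\<dots> = (LINT x|lebesgue_on \<Omega>. iter_pderiv [i,i] \<psi> x * \<phi> k x)"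
        by (rule smooth_times_test_integral[symmetric, OF smooth_iter_pderiv[OF \<psi>] \<phi>])
      finally show ?thesis by (simp add: mult.commute)
    qed
    ultimately have 1: "(\<lambda>k. LINT x|lebesgue_on \<Omega>. \<phi> k x * iter_pderiv [i,i] \<psi> x) \<longlonglongrightarrow> (LINT x|lebesgue_on \<Omega>. weak_deriv \<Omega> [i,i] u x * \<psi> x)" by simp
    have "(\<lambda>k. LINT x|lebesgue_on \<Omega>. \<phi> k x * iter_pderiv [i,i] \<psi> x) \<longlonglongrightarrow> (LINT x|lebesgue_on \<Omega>. weak_deriv \<Omega> [] u x * iter_pderiv [i,i] \<psi> x)"
      using H2_limit_integral[OF H \<phi> lim _ smooth_iter_pderiv[OF \<psi>], of "[]" "[i,i]"] by simp
    from LIMSEQ_unique[OF 1 this] have "(LINT x|lebesgue_on \<Omega>. weak_deriv \<Omega> [i,i] u x * \<psi> x) = (LINT x|lebesgue_on \<Omega>. weak_deriv \<Omega> [] u x * iter_pderiv [i,i] \<psi> x)" .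
    \<comment> \<open>The representative chosen for the derivative of order zero agrees with
      \<open>u\<close> only almost everywhere.\<close>
    also have "\<dots> = (LINT x|lebesgue_on \<Omega>. u x * iter_pderiv [i,i] \<psi> x)"
    proof (rule integral_cong_AE)
      have "weak_deriv \<Omega> [] u \<in> L2 \<Omega>" using weak_deriv_AE(1)[of "[]" u u] L by (simp add: is_weak_deriv_def)
      then show "(\<lambda>x. weak_deriv \<Omega> [] u x * iter_pderiv [i,i] \<psi> x) \<in> borel_measurable (lebesgue_on \<Omega>)"
        using integrable_L2_mult_smooth[OF _ smooth_iter_pderiv[OF \<psi>]] by blast
      show "(\<lambda>x. u x * iter_pderiv [i,i] \<psi> x) \<in> borel_measurable (lebesgue_on \<Omega>)"
        using integrable_L2_mult_smooth[OF L smooth_iter_pderiv[OF \<psi>]] by blast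
      show "AE x in lebesgue_on \<Omega>. weak_deriv \<Omega> [] u x * iter_pderiv [i,i] \<psi> x = u x * iter_pderiv [i,i] \<psi> x"
        using weak_deriv_Nil_AE[OF L] by eventually_elim simp
    qed
    finally show ?thesis .
  qed
  moreover have "integrable (lebesgue_on \<Omega>) (\<lambda>x. weak_deriv \<Omega> [i,i] u x * \<psi> x)" for i
    by (rule integrable_L2_mult_smooth[OF weak_laplacian_L2[OF H] \<psi>])
  moreover have "integrable (lebesgue_on \<Omega>) (\<lambda>x. u x * iter_pderiv [i,i] \<psi> x)" for i
    by (rule integrable_L2_mult_smooth[OF L smooth_iter_pderiv[OF \<psi>]])
  ultimately show ?thesis
    unfolding weak_laplacian_def lap_def sum_distrib_left sum_distrib_right
    by (subst (1 2) Bochner_Integration.integral_sum) auto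
qed

lemma weak_laplacian_test:
  assumes "\<phi> \<in> test_functions \<Omega>"
  shows "AE x in lebesgue_on \<Omega>. weak_laplacian \<Omega> \<phi> x = lap \<phi> x"
proof -
  have "AE x in lebesgue_on \<Omega>. \<forall>i\<in>UNIV. weak_deriv \<Omega> [i,i] \<phi> x = iter_pderiv [i,i] \<phi> x"
    using weak_deriv_AE(2)[OF is_weak_deriv_smooth[OF test_functions_smooth[OF assms]], of "[i,i]" for i]
    by (subst AE_ball_countable) auto
  then show ?thesis unfolding weak_laplacian_def lap_def by eventually_elim simp
qed

lemma weak_solution_test:
  assumes ws: "weak_solution \<Omega> h u" and \<phi>: "\<phi> \<in> test_functions \<Omega>"
  shows "integrable (lebesgue_on \<Omega>) (\<lambda>x. h x (u x) * \<phi> x)"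
    "(LINT x|lebesgue_on \<Omega>. weak_laplacian \<Omega> u x * lap \<phi> x) = (LINT x|lebesgue_on \<Omega>. h x (u x) * \<phi> x)"
proof -
  have u: "u \<in> H20 \<Omega>" and *: "integrable (lebesgue_on \<Omega>) (\<lambda>x. h x (u x) * \<phi> x)"
    "(LINT x|lebesgue_on \<Omega>. weak_laplacian \<Omega> u x * weak_laplacian \<Omega> \<phi> x) = (LINT x|lebesgue_on \<Omega>. h x (u x) * \<phi> x)"
    using ws test_functions_H20[OF \<phi>] by (auto simp: weak_solution_def)
  show "integrable (lebesgue_on \<Omega>) (\<lambda>x. h x (u x) * \<phi> x)" by fact
  have m: "weak_laplacian \<Omega> v \<in> borel_measurable (lebesgue_on \<Omega>)" if "v \<in> H20 \<Omega>" for v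
    using weak_laplacian_L2[of v] that unfolding weak_laplacian_def[abs_def]
    by (intro borel_measurable_sum) (auto simp: L2_def H20_def)
  have "(LINT x|lebesgue_on \<Omega>. weak_laplacian \<Omega> u x * lap \<phi> x) = (LINT x|lebesgue_on \<Omega>. weak_laplacian \<Omega> u x * weak_laplacian \<Omega> \<phi> x)"
  proof (rule integral_cong_AE)
    show "AE x in lebesgue_on \<Omega>. weak_laplacian \<Omega> u x * lap \<phi> x = weak_laplacian \<Omega> u x * weak_laplacian \<Omega> \<phi> x"
      using weak_laplacian_test[OF \<phi>] by eventually_elim simp
  qed (intro borel_measurable_times m u test_functions_H20[OF \<phi>] borel_measurable_lebesgue_on smooth_borel smooth_lap test_functions_smooth[OF \<phi>])+
  then show "(LINT x|lebesgue_on \<Omega>. weak_laplacian \<Omega> u x * lap \<phi> x) = (LINT x|lebesgue_on \<Omega>. h x (u x) * \<phi> x)" using * by simp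
qed

end

section \<open>Radial cutoffs and test functions with a double zero on the sphere\<close>

lemma has_derivative_dist_sq:
  "((\<lambda>x::real^'n::finite. (x - p) \<bullet> (x - p)) has_derivative (\<lambda>v. 2 * ((x - p) \<bullet> v))) (at x)"
  by (auto intro!: derivative_eq_intros simp: inner_commute)

lemma pderiv_at_dist_sq: "pderiv_at i (\<lambda>x. (x - p) \<bullet> (x - p)) = (\<lambda>x. 2 * (x - p) $ i)"
  using pderiv_at_eq[OF has_derivative_dist_sq] by (auto simp: inner_axis)

lemma smooth_dist_sq: "smooth (\<lambda>x::real^'n::finite. (x - p) \<bullet> (x - p))"
proof -
  have "(x - p) \<bullet> (x - p) = (\<Sum>i\<in>UNIV. (x $ i - p $ i) * (x $ i - p $ i))" for x :: "real^'n"
    by (simp add: inner_vec_def)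
  moreover have "smooth (\<lambda>x::real^'n. \<Sum>i\<in>UNIV. (x $ i - p $ i) * (x $ i - p $ i))"
    by (intro smooth_sum smooth_mult smooth_diff smooth_nth smooth_const) simp
  ultimately show ?thesis by simp
qed

lemma pderiv_at_affine_fun:
  assumes "smooth g" shows "pderiv_at i (\<lambda>x. a * g x + b) = (\<lambda>x. a * pderiv_at i g x)"
  using assms by (simp add: pderiv_at_add' smooth_mult pderiv_at_mult')

lemma pderiv_at_nth_diff: "pderiv_at i (\<lambda>x. 2 * ((x::real^'n::finite) - p) $ i) = (\<lambda>x. 2)"
proof
  fix x
  have "((\<lambda>x::real^'n. 2 * (x - p) $ i) has_derivative (\<lambda>v. 2 * v $ i)) (at x)"
    by (auto intro!: derivative_eq_intros bounded_linear.has_derivative[OF bounded_linear_vec_nth])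
  from pderiv_at_eq[OF this] show "pderiv_at i (\<lambda>x. 2 * ((x::real^'n::finite) - p) $ i) x = 2" by simp
qed

lemma lap_dist_sq: "lap (\<lambda>x. (x - p) \<bullet> (x - p)) (x::real^'n::finite) = 2 * CARD('n)"
  unfolding lap_def iter_pderiv.simps pderiv_at_dist_sq pderiv_at_nth_diff by simp

lemma lap_affine_fun: "smooth g \<Longrightarrow> lap (\<lambda>x. a * g x + b) x = a * lap g x"
  using lap_add[of "\<lambda>x. a * g x" "\<lambda>x. b"] lap_cmult[of g a] by (simp add: smooth_mult)

lemma grad2_dist_sq: "grad2 (\<lambda>x. (x - p) \<bullet> (x - p)) (\<lambda>x. (x - p) \<bullet> (x - p)) x = 4 * ((x - p) \<bullet> (x - p))"
  unfolding grad2_def pderiv_at_dist_sq by (simp add: inner_vec_def sum_distrib_left algebra_simps)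

text \<open>A function of R^2 - |x - c|^2 alone, so that its derivatives are explicit. For k > 0 it
  vanishes where that defect is at most 1/k, and inside the ball it increases to 1 as k grows, which
  permits monotone convergence.\<close>

definition cutoff :: "real^'n::finite \<Rightarrow> real \<Rightarrow> real \<Rightarrow> real^'n \<Rightarrow> real" where
  "cutoff c R k x = bump 0 (k * (R\<^sup>2 - (x - c) \<bullet> (x - c)) - 1)"

context
  fixes c :: "real^'n::finite" and R :: real
  assumes R: "R > 0"
begin

abbreviation (input) "\<rho> x \<equiv> R\<^sup>2 - (x - c) \<bullet> (x - c)"

lemma rho_bounds: "x \<in> ball c R \<Longrightarrow> \<rho> x > 0" "\<rho> x \<le> R\<^sup>2"
proof -
  show "\<rho> x > 0" if "x \<in> ball c R"
  proof -
    have "norm (x - c) < R" using that by (simp add: dist_norm norm_minus_commute)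
    then have "(norm (x - c))\<^sup>2 < R\<^sup>2" by (simp add: power_strict_mono)
    then show ?thesis by (simp add: power2_norm_eq_inner)
  qed
qed auto

lemma smooth_cutoff_arg: "smooth (\<lambda>x. k * \<rho> x - 1)"
  by (intro smooth_diff smooth_mult smooth_const smooth_dist_sq)

lemma smooth_cutoff: "smooth (cutoff c R k)"
  unfolding cutoff_def[abs_def] by (intro smooth_bump smooth_cutoff_arg)

lemma cutoff_arg_eq: "(\<lambda>x. k * \<rho> x - 1) = (\<lambda>x. (- k) * ((x - c) \<bullet> (x - c)) + (k * R\<^sup>2 - 1))"
  by (auto simp: algebra_simps)

lemma pderiv_cutoff_arg: "pderiv_at i (\<lambda>x. k * \<rho> x - 1) = (\<lambda>x. - k * (2 * (x - c) $ i))"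
  unfolding cutoff_arg_eq pderiv_at_affine_fun[OF smooth_dist_sq] pderiv_at_dist_sq by simp

lemma lap_cutoff_arg: "lap (\<lambda>x. k * \<rho> x - 1) x = - k * (2 * CARD('n))"
  unfolding cutoff_arg_eq lap_affine_fun[OF smooth_dist_sq] lap_dist_sq by simp

lemma grad2_cutoff_arg: "grad2 (\<lambda>x. k * \<rho> x - 1) (\<lambda>x. k * \<rho> x - 1) x = 4 * k\<^sup>2 * ((x - c) \<bullet> (x - c))"
  unfolding grad2_def pderiv_cutoff_arg by (simp add: inner_vec_def sum_distrib_left power2_eq_square algebra_simps)

lemma lap_cutoff: "lap (cutoff c R k) x = bump 2 (k * \<rho> x - 1) * (4 * k\<^sup>2 * ((x - c) \<bullet> (x - c))) - bump 1 (k * \<rho> x - 1) * (k * (2 * CARD('n)))"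
proof -
  have d0: "(bump 0 has_real_derivative bump 1 t) (at t)" for t using bump_deriv[of 0] by simp
  have d1: "(bump 1 has_real_derivative bump 2 t) (at t)" for t using bump_deriv[of 1] by (simp add: numeral_2_eq_2)
  show ?thesis
    unfolding cutoff_def[abs_def] lap_compose[OF d0 d1 smooth_cutoff_arg] grad2_cutoff_arg lap_cutoff_arg by simp
qed

lemma pderiv_cutoff: "pderiv_at i (cutoff c R k) x = bump 1 (k * \<rho> x - 1) * (- k * (2 * (x - c) $ i))"
  unfolding cutoff_def[abs_def]
  using pderiv_at_compose(1)[of "bump 0" "bump 1 (k * \<rho> x - 1)" "\<lambda>x. k * \<rho> x - 1" x i] bump_deriv[of 0]
  by (simp add: smooth_cutoff_arg smooth_differentiable pderiv_cutoff_arg)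

lemma cutoff_test:
  assumes "smooth \<phi>" "k > 0" shows "(\<lambda>x. \<phi> x * cutoff c R k x) \<in> test_functions (ball c R)"
proof (rule test_functionsI[where K="cball c R \<inter> {x. k * \<rho> x \<ge> 1}"])
  show "smooth (\<lambda>x. \<phi> x * cutoff c R k x)" by (intro smooth_mult assms smooth_cutoff)
  have "closed {x. k * \<rho> x \<ge> 1}" by (intro closed_Collect_le continuous_intros)
  then show "compact (cball c R \<inter> {x. k * \<rho> x \<ge> 1})" by (intro compact_Int_closed compact_cball)
  have "x \<in> ball c R" if "k * \<rho> x \<ge> 1" for x
  proof -
    have "\<rho> x > 0" using that assms(2) zero_less_mult_pos[of k "\<rho> x"] by simp
    then have "(norm (x - c))\<^sup>2 < R\<^sup>2" by (simp add: power2_norm_eq_inner)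
    then have "norm (x - c) < R" using R by (simp add: power2_less_imp_less)
    then show ?thesis by (simp add: dist_norm norm_minus_commute)
  qed
  then show "cball c R \<inter> {x. k * \<rho> x \<ge> 1} \<subseteq> ball c R" by blast
  show "\<phi> x * cutoff c R k x = 0" if "x \<notin> cball c R \<inter> {x. k * \<rho> x \<ge> 1}" for x
  proof -
    have "k * \<rho> x < 1"
    proof (cases "x \<in> cball c R")
      case False
      then have "norm (x - c) > R" by (simp add: dist_norm norm_minus_commute)
      then have "(norm (x - c))\<^sup>2 > R\<^sup>2" using R by (simp add: power_strict_mono)
      then have "\<rho> x < 0" by (simp add: power2_norm_eq_inner)
      then have "k * \<rho> x < 0" using assms(2) by (rule mult_pos_neg[rotated])
      then show ?thesis by simp
    qed (use that in auto)
    then show ?thesis by (simp add: cutoff_def bump_bounds(4))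
  qed
qed

text \<open>These are the terms in the Laplacian of \<open>\<phi>\<close> times the cutoff in which
  the cutoff is differentiated. The double zero of \<open>\<phi>\<close> and the simple zero of its
  gradient absorb the factors k^2 and k, leaving the scale-free quantities \<open>T1\<close> and
  \<open>T2\<close>.\<close>

lemma cutoff_error:
  fixes C :: real
  assumes k: "k > 0" and x: "x \<in> ball c R" and C: "C \<ge> 0"
    and \<phi>: "\<bar>\<phi> x\<bar> \<le> C * (\<rho> x)\<^sup>2" "\<And>i. \<bar>pderiv_at i \<phi> x\<bar> \<le> C * \<rho> x"
  defines "\<tau> \<equiv> k * \<rho> x"
  defines "T1 \<equiv> \<tau> * \<bar>bump 1 (\<tau> - 1)\<bar>" and "T2 \<equiv> \<tau>\<^sup>2 * \<bar>bump 2 (\<tau> - 1)\<bar>"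
  shows "\<bar>\<phi> x * lap (cutoff c R k) x + 2 * grad2 \<phi> (cutoff c R k) x\<bar>
     \<le> 4 * C * R\<^sup>2 * T2 + (2 * CARD('n) * C * R\<^sup>2 + 4 * CARD('n) * C * R) * T1"
proof -
  define r where "r = \<rho> x"
  have r: "r > 0" "r \<le> R\<^sup>2" using rho_bounds x by (auto simp: r_def)
  have n: "(x - c) \<bullet> (x - c) \<le> R\<^sup>2" "(x - c) \<bullet> (x - c) \<ge> 0" using r(1) by (auto simp: r_def)
  have \<tau>: "\<tau> = k * r" by (simp add: \<tau>_def r_def)
  note \<phi> = \<phi>[folded r_def]
  have xi: "\<bar>(x - c) $ i\<bar> \<le> R" for i
    using component_le_norm_cart[of "x - c" i] x by (simp add: dist_norm norm_minus_commute)
  have "\<bar>\<phi> x * lap (cutoff c R k) x\<bar> \<le> (C * r\<^sup>2) * (\<bar>bump 2 (\<tau> - 1)\<bar> * (4 * k\<^sup>2 * R\<^sup>2) + \<bar>bump 1 (\<tau> - 1)\<bar> * (k * (2 * CARD('n))))"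
  proof -
    have "\<bar>lap (cutoff c R k) x\<bar> \<le> \<bar>bump 2 (\<tau> - 1) * (4 * k\<^sup>2 * ((x - c) \<bullet> (x - c)))\<bar> + \<bar>bump 1 (\<tau> - 1) * (k * (2 * CARD('n)))\<bar>"
      unfolding lap_cutoff \<tau>_def[symmetric] by (rule abs_triangle_ineq4)
    also have "\<dots> \<le> \<bar>bump 2 (\<tau> - 1)\<bar> * (4 * k\<^sup>2 * R\<^sup>2) + \<bar>bump 1 (\<tau> - 1)\<bar> * (k * (2 * CARD('n)))"
      using k n by (simp add: abs_mult mult_left_mono)
    finally show ?thesis unfolding abs_mult using \<phi>(1) by (intro mult_mono) auto
  qed
  also have "\<dots> = 4 * C * R\<^sup>2 * T2 + 2 * CARD('n) * C * r * T1"
    unfolding T1_def T2_def by (simp add: \<tau> power2_eq_square algebra_simps)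
  also have "\<dots> \<le> 4 * C * R\<^sup>2 * T2 + 2 * CARD('n) * C * R\<^sup>2 * T1"
    using r C k by (intro add_left_mono mult_right_mono mult_left_mono) (auto simp: T1_def \<tau>)
  finally have 1: "\<bar>\<phi> x * lap (cutoff c R k) x\<bar> \<le> 4 * C * R\<^sup>2 * T2 + 2 * CARD('n) * C * R\<^sup>2 * T1" .
  have "\<bar>grad2 \<phi> (cutoff c R k) x\<bar> \<le> (\<Sum>i\<in>(UNIV::'n set). \<bar>pderiv_at i \<phi> x * pderiv_at i (cutoff c R k) x\<bar>)"
    unfolding grad2_def by (rule sum_abs)
  also have "\<dots> \<le> (\<Sum>i\<in>(UNIV::'n set). (C * r) * (\<bar>bump 1 (\<tau> - 1)\<bar> * (k * (2 * R))))"
  proof (rule sum_mono)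
    fix i
    have "\<bar>pderiv_at i (cutoff c R k) x\<bar> \<le> \<bar>bump 1 (\<tau> - 1)\<bar> * (k * (2 * R))"
      unfolding pderiv_cutoff \<tau>_def[symmetric] abs_mult using xi[of i] k by (simp add: mult_left_mono)
    then show "\<bar>pderiv_at i \<phi> x * pderiv_at i (cutoff c R k) x\<bar> \<le> (C * r) * (\<bar>bump 1 (\<tau> - 1)\<bar> * (k * (2 * R)))"
      unfolding abs_mult using \<phi>(2)[of i] r C by (intro mult_mono) auto
  qed
  also have "\<dots> = 2 * CARD('n) * C * R * T1" by (simp add: T1_def \<tau> algebra_simps)
  finally have 2: "\<bar>grad2 \<phi> (cutoff c R k) x\<bar> \<le> 2 * CARD('n) * C * R * T1" .
  have "\<bar>\<phi> x * lap (cutoff c R k) x + 2 * grad2 \<phi> (cutoff c R k) x\<bar> \<le> \<bar>\<phi> x * lap (cutoff c R k) x\<bar> + 2 * \<bar>grad2 \<phi> (cutoff c R k) x\<bar>" by linarith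
  moreover have "4 * C * R\<^sup>2 * T2 + (2 * CARD('n) * C * R\<^sup>2 + 4 * CARD('n) * C * R) * T1
     = (4 * C * R\<^sup>2 * T2 + 2 * CARD('n) * C * R\<^sup>2 * T1) + 2 * (2 * CARD('n) * C * R * T1)"
    unfolding distrib_right by simp
  ultimately show ?thesis using 1 2 by linarith
qed

text \<open>Extends the weak formulation to smooth \<open>\<phi>\<close> with a double zero on the
  sphere and moves both Laplacians onto \<open>\<phi>\<close>. Along the cutoffs the left side
  converges by domination. On the right only the signs of h and \<open>\<phi>\<close> are available,
  and monotone convergence yields integrability together with the identity.\<close>

lemma weak_solution_smooth:
  fixes C :: real
  assumes ws: "weak_solution (ball c R) h u" and h0: "\<And>x t. x \<in> ball c R \<Longrightarrow> h x t \<ge> 0"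
    and s: "smooth \<phi>" and C: "C \<ge> 0"
    and \<phi>: "\<And>x. x \<in> ball c R \<Longrightarrow> 0 \<le> \<phi> x" "\<And>x. x \<in> ball c R \<Longrightarrow> \<phi> x \<le> C * (\<rho> x)\<^sup>2"
     "\<And>x i. x \<in> ball c R \<Longrightarrow> \<bar>pderiv_at i \<phi> x\<bar> \<le> C * \<rho> x"
  shows "integrable (lebesgue_on (ball c R)) (\<lambda>x. h x (u x) * \<phi> x)"
    "(LINT x|lebesgue_on (ball c R). u x * lap (lap \<phi>) x) = (LINT x|lebesgue_on (ball c R). h x (u x) * \<phi> x)"
proof -
  let ?M = "lebesgue_on (ball c R)"
  let ?W = "weak_laplacian (ball c R) u"
  have op: "open (ball c R)" "bounded (ball c R)" by auto
  define \<phi>k where "\<phi>k n x = \<phi> x * cutoff c R (real (Suc n)) x" for n x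
  have t: "\<phi>k n \<in> test_functions (ball c R)" for n
    unfolding \<phi>k_def[abs_def] by (intro cutoff_test s) simp
  have uH: "u \<in> H20 (ball c R)" using ws by (simp add: weak_solution_def)
  then have uH2: "u \<in> H2 (ball c R)" by (simp add: H20_def)
  have WL: "?W \<in> borel_measurable ?M" "integrable ?M ?W"
  proof -
    show i: "integrable ?M ?W"
      unfolding weak_laplacian_def[abs_def]
      by (intro Bochner_Integration.integrable_sum L2_integrable[OF op] weak_laplacian_L2[OF op] uH2)
    then show "?W \<in> borel_measurable ?M" by auto
  qed
  have lk: "lap (\<phi>k n) x = lap \<phi> x * cutoff c R (real (Suc n)) x + (\<phi> x * lap (cutoff c R (real (Suc n))) x + 2 * grad2 \<phi> (cutoff c R (real (Suc n))) x)" for n x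
    unfolding \<phi>k_def[abs_def] by (simp add: lap_mult[OF s smooth_cutoff])
  define T1 where "T1 n x = (real (Suc n) * \<rho> x) * \<bar>bump 1 (real (Suc n) * \<rho> x - 1)\<bar>" for n x
  define T2 where "T2 n x = (real (Suc n) * \<rho> x)\<^sup>2 * \<bar>bump 2 (real (Suc n) * \<rho> x - 1)\<bar>" for n x
  define K1 where "K1 = 4 * C * R\<^sup>2"
  define K2 where "K2 = 2 * CARD('n) * C * R\<^sup>2 + 4 * CARD('n) * C * R"
  have K: "K1 \<ge> 0" "K2 \<ge> 0" using C R by (auto simp: K1_def K2_def)
  have err: "\<bar>\<phi> x * lap (cutoff c R (real (Suc n))) x + 2 * grad2 \<phi> (cutoff c R (real (Suc n))) x\<bar> \<le> K1 * T2 n x + K2 * T1 n x" 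
    if "x \<in> ball c R" for n x
    unfolding K1_def K2_def T1_def T2_def using \<phi>[OF that] by (intro cutoff_error that C) auto
  have arg: "filterlim (\<lambda>n. real (Suc n) * \<rho> x - 1) at_top sequentially" if "x \<in> ball c R" for x
  proof -
    have "filterlim (\<lambda>n. \<rho> x * real (Suc n)) at_top sequentially"
      by (rule filterlim_tendsto_pos_mult_at_top[OF tendsto_const rho_bounds(1)[OF that]])
         (rule filterlim_compose[OF filterlim_real_sequentially filterlim_Suc])
    then have "filterlim (\<lambda>n. -1 + \<rho> x * real (Suc n)) at_top sequentially"
      by (rule filterlim_tendsto_add_at_top[OF tendsto_const])
    then show ?thesis by (simp add: algebra_simps)
  qed
  have cut1: "(\<lambda>n. cutoff c R (real (Suc n)) x) \<longlonglongrightarrow> 1" if "x \<in> ball c R" for x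
    unfolding cutoff_def by (rule bump_tendsto_1[OF arg[OF that]])
  have Tb: "T1 n x \<le> 3" "T2 n x \<le> 60" "0 \<le> T1 n x" "0 \<le> T2 n x" if "x \<in> ball c R" for n x
  proof -
    have "real (Suc n) * \<rho> x \<ge> 0" using rho_bounds(1)[OF that] by (intro mult_nonneg_nonneg) auto
    note nn = this
    show "T1 n x \<le> 3" unfolding T1_def by (rule bump_1_bound(1)[OF nn])
    show "T2 n x \<le> 60" unfolding T2_def by (rule bump_2_bound(1)[OF nn])
    show "0 \<le> T1 n x" unfolding T1_def by (intro mult_nonneg_nonneg nn) simp
    show "0 \<le> T2 n x" unfolding T2_def by simp
  qed
  have T0: "(\<lambda>n. K1 * T2 n x + K2 * T1 n x) \<longlonglongrightarrow> 0" if x: "x \<in> ball c R" for x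
  proof -
    have inv: "(\<lambda>n. A / (real (Suc n) * \<rho> x - 1)) \<longlonglongrightarrow> 0" for A :: real
      using tendsto_mult[OF tendsto_const[of A] tendsto_inverse_0_at_top[OF arg[OF x]]] by (simp add: divide_inverse)
    have ev: "\<forall>\<^sub>F n in sequentially. real (Suc n) * \<rho> x \<ge> 2"
      using arg[OF x] unfolding filterlim_at_top by (rule allE[of _ 1]) (auto elim: eventually_mono)
    have "(\<lambda>n. T1 n x) \<longlonglongrightarrow> 0"
      by (rule tendsto_sandwich[OF _ _ tendsto_const inv[of 2]])
         (use Tb[OF x] ev bump_1_bound(2) in \<open>auto simp: T1_def elim!: eventually_mono\<close>)
    moreover have "(\<lambda>n. T2 n x) \<longlonglongrightarrow> 0"
      by (rule tendsto_sandwich[OF _ _ tendsto_const inv[of 12]])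
         (use Tb[OF x] ev bump_2_bound(2) in \<open>auto simp: T2_def elim!: eventually_mono\<close>)
    ultimately show ?thesis by (auto intro!: tendsto_eq_intros)
  qed
  obtain D where D: "D \<ge> 0" "\<And>x. x \<in> ball c R \<Longrightarrow> \<bar>lap \<phi> x\<bar> \<le> D"
    using smooth_bounded_on[OF op smooth_lap[OF s]] by blast
  have cb: "0 \<le> cutoff c R k x" "cutoff c R k x \<le> 1" for k x by (auto simp: cutoff_def bump_bounds)
  have L: "(\<lambda>n. LINT x|?M. ?W x * lap (\<phi>k n) x) \<longlonglongrightarrow> (LINT x|?M. ?W x * lap \<phi> x)"
  proof (rule integral_dominated_convergence[where w="\<lambda>x. \<bar>?W x\<bar> * (D + (K1 * 60 + K2 * 3))"])
    show "AE x in ?M. (\<lambda>n. ?W x * lap (\<phi>k n) x) \<longlonglongrightarrow> ?W x * lap \<phi> x"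
    proof (rule AE_I2)
      fix x assume "x \<in> space ?M"
      then have x: "x \<in> ball c R" by simp
      have "(\<lambda>n. \<phi> x * lap (cutoff c R (real (Suc n))) x + 2 * grad2 \<phi> (cutoff c R (real (Suc n))) x) \<longlonglongrightarrow> 0"
        by (rule Lim_null_comparison[OF _ T0[OF x]]) (use err[OF x] in auto)
      then have "(\<lambda>n. lap (\<phi>k n) x) \<longlonglongrightarrow> lap \<phi> x * 1 + 0"
        unfolding lk by (intro tendsto_intros cut1 x)
      then show "(\<lambda>n. ?W x * lap (\<phi>k n) x) \<longlonglongrightarrow> ?W x * lap \<phi> x" by (intro tendsto_intros) simp
    qed
    show "AE x in ?M. norm (?W x * lap (\<phi>k n) x) \<le> \<bar>?W x\<bar> * (D + (K1 * 60 + K2 * 3))" for n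
    proof (rule AE_I2)
      fix x assume "x \<in> space ?M"
      then have x: "x \<in> ball c R" by simp
      have "\<bar>lap \<phi> x * cutoff c R (real (Suc n)) x\<bar> \<le> D * 1"
        unfolding abs_mult using D(2)[OF x] cb D(1) by (intro mult_mono) (auto simp: abs_of_nonneg)
      moreover have "K1 * T2 n x + K2 * T1 n x \<le> K1 * 60 + K2 * 3"
        using Tb[OF x] K by (intro add_mono mult_left_mono) auto
      ultimately have "\<bar>lap (\<phi>k n) x\<bar> \<le> D + (K1 * 60 + K2 * 3)"
        unfolding lk using err[OF x, of n] by linarith
      then show "norm (?W x * lap (\<phi>k n) x) \<le> \<bar>?W x\<bar> * (D + (K1 * 60 + K2 * 3))"
        by (simp add: abs_mult mult_left_mono)
    qed
    show "integrable ?M (\<lambda>x. \<bar>?W x\<bar> * (D + (K1 * 60 + K2 * 3)))" using WL(2) by simp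
    show "(\<lambda>x. ?W x * lap \<phi> x) \<in> borel_measurable ?M"
      by (intro borel_measurable_times WL borel_measurable_lebesgue_on smooth_borel smooth_lap s)
    show "(\<lambda>x. ?W x * lap (\<phi>k n) x) \<in> borel_measurable ?M" for n
      by (intro borel_measurable_times WL borel_measurable_lebesgue_on smooth_borel smooth_lap test_functions_smooth[OF t])
  qed
  have ik: "integrable ?M (\<lambda>x. h x (u x) * \<phi>k n x)" for n by (rule weak_solution_test(1)[OF op ws t])
  have lim: "AE x in ?M. (\<lambda>n. h x (u x) * \<phi>k n x) \<longlonglongrightarrow> h x (u x) * \<phi> x"
  proof (rule AE_I2)
    fix x assume "x \<in> space ?M"
    then have x: "x \<in> ball c R" by simp
    have "(\<lambda>n. \<phi>k n x) \<longlonglongrightarrow> \<phi> x * 1" unfolding \<phi>k_def by (intro tendsto_intros cut1 x)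
    then show "(\<lambda>n. h x (u x) * \<phi>k n x) \<longlonglongrightarrow> h x (u x) * \<phi> x" by (intro tendsto_intros) simp
  qed
  have mono: "AE x in ?M. mono (\<lambda>n. h x (u x) * \<phi>k n x)"
  proof (rule AE_I2)
    fix x assume "x \<in> space ?M"
    then have x: "x \<in> ball c R" by simp
    show "mono (\<lambda>n. h x (u x) * \<phi>k n x)"
    proof (rule monoI)
      fix m n :: nat assume "m \<le> n"
      then have "real (Suc m) * \<rho> x \<le> real (Suc n) * \<rho> x"
        using rho_bounds(1)[OF x] by (intro mult_right_mono) auto
      then have "cutoff c R (real (Suc m)) x \<le> cutoff c R (real (Suc n)) x"
        unfolding cutoff_def by (intro bump_mono) linarith
      then show "h x (u x) * \<phi>k m x \<le> h x (u x) * \<phi>k n x"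
        unfolding \<phi>k_def by (intro mult_left_mono h0[OF x] \<phi>(1)[OF x])
    qed
  qed
  have meas: "(\<lambda>x. h x (u x) * \<phi> x) \<in> borel_measurable ?M"
  proof (rule borel_measurable_LIMSEQ_real)
    show "(\<lambda>n. h x (u x) * \<phi>k n x) \<longlonglongrightarrow> h x (u x) * \<phi> x" if "x \<in> space ?M" for x
    proof -
      have x: "x \<in> ball c R" using that by simp
      have "(\<lambda>n. \<phi>k n x) \<longlonglongrightarrow> \<phi> x * 1" unfolding \<phi>k_def by (intro tendsto_intros cut1 x)
      then show "(\<lambda>n. h x (u x) * \<phi>k n x) \<longlonglongrightarrow> h x (u x) * \<phi> x" by (intro tendsto_intros) simp
    qed
    show "(\<lambda>x. h x (u x) * \<phi>k n x) \<in> borel_measurable ?M" for n using ik by blast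
  qed
  have L': "(\<lambda>n. LINT x|?M. h x (u x) * \<phi>k n x) \<longlonglongrightarrow> (LINT x|?M. ?W x * lap \<phi> x)"
    using L weak_solution_test(2)[OF op ws t] by simp
  show "integrable ?M (\<lambda>x. h x (u x) * \<phi> x)"
    by (rule integrable_monotone_convergence[OF ik mono lim L' meas])
  have "(LINT x|?M. h x (u x) * \<phi> x) = (LINT x|?M. ?W x * lap \<phi> x)"
    by (rule integral_monotone_convergence[OF ik mono lim L' meas])
  then show "(LINT x|?M. u x * lap (lap \<phi>) x) = (LINT x|?M. h x (u x) * \<phi> x)"
    using weak_laplacian_smooth[OF op uH smooth_lap[OF s]] by simp
qed

end

section \<open>Green function of the unit ball\<close>

lemma lborel_scale:
  fixes c :: "'a::euclidean_space" and R :: real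
  assumes R: "R > 0"
  shows lborel_scale_nn_integral: "\<And>g. g \<in> borel_measurable borel \<Longrightarrow> (\<integral>\<^sup>+x. g x \<partial>lborel) = ennreal (R ^ DIM('a)) * (\<integral>\<^sup>+x. g (c + R *\<^sub>R x) \<partial>lborel)"
    and lborel_scale_integrable: "\<And>f::'a \<Rightarrow> real. f \<in> borel_measurable borel \<Longrightarrow> integrable lborel (\<lambda>x. f (c + R *\<^sub>R x)) \<longleftrightarrow> integrable lborel f"
    and lborel_scale_integral: "\<And>f::'a \<Rightarrow> real. f \<in> borel_measurable borel \<Longrightarrow> (LINT x|lborel. f x) = R ^ DIM('a) * (LINT x|lborel. f (c + R *\<^sub>R x))"
    and lborel_scale_AE: "\<And>P. (AE x in lborel. P x) \<Longrightarrow> (AE x in lborel. P (c + R *\<^sub>R x))"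
proof -
  let ?T = "\<lambda>x. c + R *\<^sub>R x"
  have eq: "(lborel :: 'a measure) = density (distr lborel borel ?T) (\<lambda>_. ennreal (R ^ DIM('a)))"
    using lborel_affine[of R c] R by simp
  have [measurable]: "?T \<in> borel_measurable borel" by (intro borel_measurable_continuous_onI continuous_intros)
  show "(\<integral>\<^sup>+x. g x \<partial>lborel) = ennreal (R ^ DIM('a)) * (\<integral>\<^sup>+x. g (c + R *\<^sub>R x) \<partial>lborel)"
    if [measurable]: "g \<in> borel_measurable borel" for g
    by (subst eq) (simp add: nn_integral_density nn_integral_distr nn_integral_cmult)
  show "integrable lborel (\<lambda>x. f (c + R *\<^sub>R x)) \<longleftrightarrow> integrable lborel f" if [measurable]: "f \<in> borel_measurable borel" for f :: "'a \<Rightarrow> real"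
    using R by (subst (2) eq) (simp add: integrable_density integrable_distr_eq)
  show "(LINT x|lborel. f x) = R ^ DIM('a) * (LINT x|lborel. f (c + R *\<^sub>R x))" if [measurable]: "f \<in> borel_measurable borel" for f :: "'a \<Rightarrow> real"
    using R by (subst eq) (simp add: integral_density integral_distr)
  show "AE x in lborel. P (c + R *\<^sub>R x)" if P: "AE x in lborel. P x" for P
  proof -
    obtain S where S: "S \<in> null_sets lborel" "{x \<in> space lborel. \<not> P x} \<subseteq> S"
      using P by (auto simp: eventually_ae_filter)
    then have [measurable]: "S \<in> sets borel" by auto
    have "0 = emeasure (density (distr lborel borel ?T) (\<lambda>_. ennreal (R ^ DIM('a)))) S"
      using S(1) by (subst (asm) eq) (auto simp: null_sets_def)
    also have "\<dots> = ennreal (R ^ DIM('a)) * emeasure lborel (?T -` S)"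
      by (simp add: emeasure_density nn_integral_cmult emeasure_distr)
    finally have "emeasure lborel (?T -` S) = 0" using R by simp
    moreover have "?T -` S \<in> sets borel"
      using measurable_sets[OF \<open>?T \<in> borel_measurable borel\<close> \<open>S \<in> sets borel\<close>] by simp
    ultimately have "?T -` S \<in> null_sets lborel" by (auto simp: null_sets_def)
    then have "AE x in lborel. x \<notin> ?T -` S" by (rule AE_not_in)
    then show ?thesis by (rule AE_mp) (use S in \<open>auto intro!: AE_I2\<close>)
  qed
qed

text \<open>What is retained from a weak solution on the unit ball, in Borel form and extended by
  zero; \<open>N\<close> stands for the right-hand side. Integrability of \<open>N x * U x\<close>
  comes from testing the solution with itself. The last clause is the very weak formulation, in
  which no weak derivative of \<open>U\<close> occurs.\<close>

definition weak_pair :: "(real^4 \<Rightarrow> real) \<Rightarrow> (real^4 \<Rightarrow> real) \<Rightarrow> bool" where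
  "weak_pair U N \<longleftrightarrow> U \<in> borel_measurable borel \<and> N \<in> borel_measurable borel \<and>
     (\<forall>x. x \<notin> ball 0 1 \<longrightarrow> U x = 0 \<and> N x = 0) \<and> (\<forall>x. N x \<ge> 0) \<and>
     integrable lborel U \<and> integrable lborel (\<lambda>x. N x * U x) \<and>
     (\<forall>\<phi> C. smooth \<phi> \<and> C \<ge> 0 \<and> (\<forall>x\<in>ball 0 1. 0 \<le> \<phi> x \<and> \<phi> x \<le> C * (1 - x \<bullet> x)\<^sup>2 \<and> (\<forall>i. \<bar>pderiv_at i \<phi> x\<bar> \<le> C * (1 - x \<bullet> x)))
        \<longrightarrow> integrable lborel (\<lambda>x. N x * \<phi> x) \<and> (LINT x|lborel. U x * lap (lap \<phi>) x) = (LINT x|lborel. N x * \<phi> x))"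

text \<open>Under x -> c + R x the bi-Laplacian gains a factor R^4, which is attached to the
  nonlinearity.\<close>

lemma weak_solution_rescale:
  fixes c :: "real^4"
  assumes R: "R > 0" and ws: "weak_solution (ball c R) h u" and h0: "\<And>x t. x \<in> ball c R \<Longrightarrow> h x t \<ge> 0"
  shows "\<exists>U N. weak_pair U N \<and> (AE x in lborel. x \<in> ball 0 1 \<longrightarrow> U x = u (c + R *\<^sub>R x) \<and> N x = R ^ 4 * h (c + R *\<^sub>R x) (u (c + R *\<^sub>R x)))"
proof -
  let ?B = "ball c R" let ?M = "lebesgue_on (ball c R)" let ?T = "\<lambda>x. c + R *\<^sub>R x"
  have B: "?B \<in> sets borel" "open ?B" "bounded ?B" by auto
  have TB: "?T x \<in> ?B \<longleftrightarrow> x \<in> ball 0 1" for x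
    using R by (simp add: dist_norm)
  have Tm[measurable]: "?T \<in> borel_measurable borel" by (intro borel_measurable_continuous_onI continuous_intros)
  have uH: "u \<in> H20 ?B" using ws by (simp add: weak_solution_def)
  then have uL: "u \<in> L2 ?B" by (simp add: H20_def H2_def)
  have ui: "integrable ?M u" by (rule L2_integrable[OF B(2,3) uL])
  let ?r = "\<lambda>x. R\<^sup>2 - (x - c) \<bullet> (x - c)"
  have r: "?r x > 0" if "x \<in> ?B" for x using rho_bounds(1)[OF R that] .
  have sr: "smooth ?r" by (intro smooth_diff smooth_const smooth_dist_sq)
  have pr: "pderiv_at i (\<lambda>x. (?r x)\<^sup>2) x = 2 * ?r x * (- (2 * (x - c) $ i))" for i x
  proof -
    have "?r = (\<lambda>x. (-1) * ((x - c) \<bullet> (x - c)) + R\<^sup>2)" by auto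
    then have "pderiv_at i ?r = (\<lambda>x. - (2 * (x - c) $ i))" for i
      using pderiv_at_affine_fun[OF smooth_dist_sq, of i "-1" c "R\<^sup>2"] by (simp add: pderiv_at_dist_sq)
    then show ?thesis unfolding power2_eq_square[of "?r _"] by (subst pderiv_at_mult'[OF sr sr]) simp
  qed
  \<comment> \<open>Testing with the squared boundary defect makes h(x, u(x)) measurable: the weight
    is positive inside the ball and can be divided out.\<close>
  have "integrable ?M (\<lambda>x. h x (u x) * (?r x)\<^sup>2)"
  proof (rule weak_solution_smooth(1)[OF R ws h0, where C="1 + 4 * R"])
    show "smooth (\<lambda>x. (?r x)\<^sup>2)" by (rule smooth_power[OF sr])
    fix x assume x: "x \<in> ?B"
    show "0 \<le> (?r x)\<^sup>2" by simp
    show "(?r x)\<^sup>2 \<le> (1 + 4 * R) * (?r x)\<^sup>2" using mult_right_mono[of 1 "1 + 4 * R" "(?r x)\<^sup>2"] R by simp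
    fix i
    have "\<bar>(x - c) $ i\<bar> \<le> R" using component_le_norm_cart[of "x - c" i] x by (simp add: dist_norm norm_minus_commute)
    then have "?r x * (4 * \<bar>(x - c) $ i\<bar>) \<le> ?r x * (1 + 4 * R)"
      using r[OF x] by (intro mult_left_mono) auto
    then show "\<bar>pderiv_at i (\<lambda>x. (?r x)\<^sup>2) x\<bar> \<le> (1 + 4 * R) * ?r x"
    proof -
      have *: "\<bar>2 * a * (- (2 * z))\<bar> = a * (4 * \<bar>z\<bar>)" if "a > 0" for a z :: real
        using that by (simp add: abs_mult)
      assume "?r x * (4 * \<bar>(x - c) $ i\<bar>) \<le> ?r x * (1 + 4 * R)"
      then show ?thesis unfolding pr *[OF r[OF x]] by (simp only: mult.commute)
    qed
  qed (use R in auto)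
  then have "(\<lambda>x. h x (u x) * (?r x)\<^sup>2 / (?r x)\<^sup>2) \<in> borel_measurable ?M"
    using borel_measurable_lebesgue_on[OF smooth_borel[OF smooth_power[OF sr, of 2]], of ?B] by (intro borel_measurable_divide) auto
  moreover have "h x (u x) * (?r x)\<^sup>2 / (?r x)\<^sup>2 = h x (u x)" if "x \<in> space ?M" for x
    using r[of x] that by (simp add: less_imp_neq[symmetric])
  ultimately have hm: "(\<lambda>x. h x (u x)) \<in> borel_measurable ?M"
    using measurable_cong[of ?M "\<lambda>x. h x (u x) * (?r x)\<^sup>2 / (?r x)\<^sup>2" "\<lambda>x. h x (u x)" borel] by blast
  obtain u' where u': "u' \<in> borel_measurable borel" "\<And>x. x \<notin> ?B \<Longrightarrow> u' x = 0" and u'E: "AE x in ?M. u x = u' x"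
    using lebesgue_on_borel_rep[OF B(1) borel_measurable_integrable[OF ui]] by blast
  obtain n0 where n0: "n0 \<in> borel_measurable borel" "\<And>x. x \<notin> ?B \<Longrightarrow> n0 x = 0" and n0E: "AE x in ?M. h x (u x) = n0 x"
    using lebesgue_on_borel_rep[OF B(1) hm] by blast
  \<comment> \<open>The Borel version is cut at 0 so that nonnegativity holds everywhere, not merely
    almost everywhere.\<close>
  define n where "n x = max 0 (n0 x)" for x
  have n: "n \<in> borel_measurable borel" "\<And>x. x \<notin> ?B \<Longrightarrow> n x = 0" "\<And>x. n x \<ge> 0"
    using n0 by (auto simp: n_def[abs_def])
  have nE: "AE x in ?M. h x (u x) = n x"
    using n0E AE_space
  proof eventually_elim
    case (elim x)
    then show ?case using h0[of x "u x"] by (simp add: n_def)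
  qed
  have tr: "integrable ?M (\<lambda>x. h x (u x) * v x) \<longleftrightarrow> integrable lborel (\<lambda>x. n x * v' x)"
    "(LINT x|?M. h x (u x) * v x) = (LINT x|lborel. n x * v' x)"
    if v: "v' \<in> borel_measurable borel" "v \<in> borel_measurable ?M" "AE x in ?M. v x = v' x" for v v'
  proof -
    have m: "(\<lambda>x. n x * v' x) \<in> borel_measurable borel" by (rule borel_measurable_times[OF n(1) v(1)])
    have e: "AE x in ?M. h x (u x) * v x = n x * v' x" using v(3) nE by eventually_elim simp
    have mm: "(\<lambda>x. h x (u x) * v x) \<in> borel_measurable ?M" by (intro borel_measurable_times hm v)
    show "integrable ?M (\<lambda>x. h x (u x) * v x) \<longleftrightarrow> integrable lborel (\<lambda>x. n x * v' x)"
      using integrable_cong_AE[OF mm borel_measurable_lebesgue_on[OF m] e] lebesgue_on_integral'(2)[OF m B(1)] n(2) by simp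
    show "(LINT x|?M. h x (u x) * v x) = (LINT x|lborel. n x * v' x)"
      using integral_cong_AE[OF mm borel_measurable_lebesgue_on[OF m] e] lebesgue_on_integral'(1)[OF m B(1)] n(2) by simp
  qed
  have tru: "(LINT x|?M. u x * v x) = (LINT x|lborel. u' x * v x)" if v: "v \<in> borel_measurable borel" for v
  proof -
    have m: "(\<lambda>x. u' x * v x) \<in> borel_measurable borel" by (rule borel_measurable_times[OF u'(1) v])
    have e: "AE x in ?M. u x * v x = u' x * v x" using u'E by eventually_elim simp
    have mm: "(\<lambda>x. u x * v x) \<in> borel_measurable ?M"
      by (intro borel_measurable_times borel_measurable_integrable[OF ui] borel_measurable_lebesgue_on v)
    show ?thesis
      using integral_cong_AE[OF mm borel_measurable_lebesgue_on[OF m] e] lebesgue_on_integral'(1)[OF m B(1)] u'(2) by simp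
  qed
  have u'i: "integrable lborel u'"
    using integrable_cong_AE[OF borel_measurable_integrable[OF ui] borel_measurable_lebesgue_on[OF u'(1)] u'E] ui
      lebesgue_on_integral'(2)[OF u'(1) B(1) u'(2)] by simp
  \<comment> \<open>The solution is itself an admissible test function; integrability of
    \<open>N\<close> will later be deduced from this product.\<close>
  have energy: "integrable lborel (\<lambda>x. n x * u' x)"
    using ws uH tr(1)[OF u'(1) borel_measurable_integrable[OF ui] u'E] by (auto simp: weak_solution_def)
  define U where "U x = u' (?T x)" for x
  define N where "N x = R ^ 4 * n (?T x)" for x
  note u'(1)[measurable] n(1)[measurable]
  have dim: "DIM(real^4) = 4" by simp
  have Um[measurable]: "U \<in> borel_measurable borel" "N \<in> borel_measurable borel" unfolding U_def N_def by measurable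
  have "weak_pair U N" unfolding weak_pair_def
  proof (intro conjI allI impI Um)
    show "U x = 0" if "x \<notin> ball 0 1" for x using TB that u'(2) unfolding U_def by metis
    show "N x = 0" if "x \<notin> ball 0 1" for x using TB that n(2) unfolding N_def by (metis mult_zero_right)
    show "N x \<ge> 0" for x using n(3) R by (simp add: N_def)
    show "integrable lborel U" unfolding U_def[abs_def] using u'i lborel_scale_integrable[OF R u'(1)] by blast
    have m: "(\<lambda>x. n x * u' x) \<in> borel_measurable borel" by measurable
    have "integrable lborel (\<lambda>x. n (?T x) * u' (?T x))"
      using energy lborel_scale_integrable[OF R m] by blast
    then show "integrable lborel (\<lambda>x. N x * U x)" unfolding N_def U_def by (simp add: mult.assoc)
    fix \<phi> :: "real^4 \<Rightarrow> real" and C :: real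
    assume A: "smooth \<phi> \<and> C \<ge> 0 \<and> (\<forall>x\<in>ball 0 1. 0 \<le> \<phi> x \<and> \<phi> x \<le> C * (1 - x \<bullet> x)\<^sup>2 \<and> (\<forall>i. \<bar>pderiv_at i \<phi> x\<bar> \<le> C * (1 - x \<bullet> x)))"
    then have s: "smooth \<phi>" and C: "C \<ge> 0" by auto
    define s' where "s' = inverse R"
    have s'0: "s' > 0" "s' * R = 1" using R by (auto simp: s'_def)
    define \<psi> where "\<psi> x = \<phi> (s' *\<^sub>R (x - c))" for x
    have \<psi>1: "\<psi> = (\<lambda>x. 1 * \<phi> (s' *\<^sub>R (x - c)))" by (simp add: \<psi>_def[abs_def])
    have s\<psi>: "smooth \<psi>" unfolding \<psi>1 by (rule smooth_affine[OF s])
    have p\<psi>: "pderiv_at i \<psi> x = s' * pderiv_at i \<phi> (s' *\<^sub>R (x - c))" for i x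
      unfolding \<psi>1 by (subst pderiv_at_affine(1)[OF smooth_differentiable[OF s]]) simp
    have "lap \<psi> = (\<lambda>x. s'\<^sup>2 * lap \<phi> (s' *\<^sub>R (x - c)))"
      unfolding \<psi>1 using lap_affine[OF s, of 1] by auto
    then have ll: "lap (lap \<psi>) x = s' ^ 4 * lap (lap \<phi>) (s' *\<^sub>R (x - c))" for x
      using lap_affine[OF smooth_lap[OF s], of "s'\<^sup>2"] by (simp add: power2_eq_square power4_eq_xxxx)
    have inv: "s' *\<^sub>R (?T x - c) = x" for x using s'0 by simp
    have rr: "1 - y \<bullet> y = s'\<^sup>2 * ?r x" "y \<in> ball 0 1" if "y = s' *\<^sub>R (x - c)" "x \<in> ?B" for x y
    proof -
      have "s'\<^sup>2 * R\<^sup>2 = 1" using s'0 by (metis power_mult_distrib power_one)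
      then show "1 - y \<bullet> y = s'\<^sup>2 * ?r x" by (simp add: that(1) power2_eq_square algebra_simps)
      have "x = ?T y" using s'0 by (simp add: that(1) mult.commute)
      then show "y \<in> ball 0 1" using that(2) TB by metis
    qed
    have ws1: "integrable ?M (\<lambda>x. h x (u x) * \<psi> x)"
      "(LINT x|?M. u x * lap (lap \<psi>) x) = (LINT x|?M. h x (u x) * \<psi> x)"
    proof -
      have cond: "0 \<le> \<psi> x" "\<psi> x \<le> (C * s' ^ 4 + C * s' ^ 3) * (?r x)\<^sup>2" "\<bar>pderiv_at i \<psi> x\<bar> \<le> (C * s' ^ 4 + C * s' ^ 3) * ?r x"
        if x: "x \<in> ?B" for x i
      proof -
        define y where "y = s' *\<^sub>R (x - c)"
        have y: "y \<in> ball 0 1" "1 - y \<bullet> y = s'\<^sup>2 * ?r x" using rr[OF y_def x] by auto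
        have Ay: "0 \<le> \<phi> y" "\<phi> y \<le> C * (1 - y \<bullet> y)\<^sup>2" "\<bar>pderiv_at i \<phi> y\<bar> \<le> C * (1 - y \<bullet> y)"
          using A y(1) by blast+
        have \<psi>y: "\<psi> x = \<phi> y" by (simp add: \<psi>_def y_def)
        show "0 \<le> \<psi> x" using Ay \<psi>y by simp
        have "\<psi> x \<le> C * (1 - y \<bullet> y)\<^sup>2" using Ay \<psi>y by simp
        also have "\<dots> = (C * s' ^ 4) * (?r x)\<^sup>2" unfolding y(2) by (simp add: power_mult_distrib flip: power_mult)
        also have "\<dots> \<le> (C * s' ^ 4 + C * s' ^ 3) * (?r x)\<^sup>2" using C s'0 by (intro mult_right_mono) auto
        finally show "\<psi> x \<le> (C * s' ^ 4 + C * s' ^ 3) * (?r x)\<^sup>2" .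
        have "\<bar>pderiv_at i \<psi> x\<bar> \<le> s' * (C * (1 - y \<bullet> y))"
          unfolding p\<psi> y_def[symmetric] using Ay(3) s'0 by (simp add: abs_mult mult_left_mono)
        also have "\<dots> = (C * s' ^ 3) * ?r x" unfolding y(2) by (simp only: power2_eq_square power3_eq_cube mult_ac)
        also have "\<dots> \<le> (C * s' ^ 4 + C * s' ^ 3) * ?r x" using C s'0 r[OF x] by (intro mult_right_mono) auto
        finally show "\<bar>pderiv_at i \<psi> x\<bar> \<le> (C * s' ^ 4 + C * s' ^ 3) * ?r x" .
      qed
      have K: "0 \<le> C * s' ^ 4 + C * s' ^ 3" using C s'0 by simp
      show "integrable ?M (\<lambda>x. h x (u x) * \<psi> x)" "(LINT x|?M. u x * lap (lap \<psi>) x) = (LINT x|?M. h x (u x) * \<psi> x)"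
        using weak_solution_smooth[OF R ws h0 s\<psi> K cond] by auto
    qed
    have \<psi>m[measurable]: "\<psi> \<in> borel_measurable borel" "lap (lap \<psi>) \<in> borel_measurable borel" 
      by (auto intro!: smooth_borel smooth_lap s\<psi>)
    have t: "integrable ?M (\<lambda>x. h x (u x) * \<psi> x) \<longleftrightarrow> integrable lborel (\<lambda>x. n x * \<psi> x)"
       "(LINT x|?M. h x (u x) * \<psi> x) = (LINT x|lborel. n x * \<psi> x)"
      by (rule tr[OF \<psi>m(1) borel_measurable_lebesgue_on[OF \<psi>m(1)] AE_I2[OF refl]])+
    have m1: "(\<lambda>x. n x * \<psi> x) \<in> borel_measurable borel" "(\<lambda>x. u' x * lap (lap \<psi>) x) \<in> borel_measurable borel" by measurable
    have i1: "integrable lborel (\<lambda>x. n (?T x) * \<psi> (?T x))"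
      using ws1(1) t(1) lborel_scale_integrable[OF R m1(1)] by blast
    have e\<psi>: "\<psi> (?T x) = \<phi> x" "lap (lap \<psi>) (?T x) = s' ^ 4 * lap (lap \<phi>) x" for x
      unfolding ll \<psi>_def inv by auto
    show "integrable lborel (\<lambda>x. N x * \<phi> x)"
      using i1 unfolding N_def e\<psi> by (simp add: mult.assoc)
    have "R ^ 4 * (LINT x|lborel. u' (?T x) * (s' ^ 4 * lap (lap \<phi>) x)) = R ^ 4 * (LINT x|lborel. n (?T x) * \<phi> x)"
      using ws1(2) unfolding t(2) tru[OF \<psi>m(2)]
        lborel_scale_integral[OF R m1(1), of c] lborel_scale_integral[OF R m1(2), of c] e\<psi> dim by simp
    moreover have "R ^ 4 * (LINT x|lborel. u' (?T x) * (s' ^ 4 * lap (lap \<phi>) x)) = (LINT x|lborel. U x * lap (lap \<phi>) x)"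
    proof -
      have "R ^ 4 * s' ^ 4 = 1" using s'0 by (metis mult.commute power_mult_distrib power_one)
      have "(\<lambda>x. u' (?T x) * (s' ^ 4 * lap (lap \<phi>) x)) = (\<lambda>x. s' ^ 4 * (U x * lap (lap \<phi>) x))" by (auto simp: U_def)
      then have "R ^ 4 * (LINT x|lborel. u' (?T x) * (s' ^ 4 * lap (lap \<phi>) x)) = R ^ 4 * (s' ^ 4 * (LINT x|lborel. U x * lap (lap \<phi>) x))" by simp
      then show ?thesis using \<open>R ^ 4 * s' ^ 4 = 1\<close> by (simp flip: mult.assoc)
    qed
    moreover have "R ^ 4 * (LINT x|lborel. n (?T x) * \<phi> x) = (LINT x|lborel. N x * \<phi> x)"
      unfolding N_def by (simp add: mult.assoc)
    ultimately show "(LINT x|lborel. U x * lap (lap \<phi>) x) = (LINT x|lborel. N x * \<phi> x)" by simp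
  qed
  moreover have "AE x in lborel. x \<in> ball 0 1 \<longrightarrow> U x = u (?T x) \<and> N x = R ^ 4 * h (?T x) (u (?T x))"
  proof -
    have "AE x in lborel. x \<in> ?B \<longrightarrow> u' x = u x \<and> n x = h x (u x)"
      using u'E nE unfolding AE_lebesgue_on_iff[OF B(1)] by eventually_elim auto
    from lborel_scale_AE[OF R this, of c] show ?thesis
      by eventually_elim (use TB in \<open>auto simp: U_def N_def\<close>)
  qed
  ultimately show ?thesis by blast
qed

text \<open>Boggio's formula: twice the integral of (v^2 - 1) v^(-3) over 1 <= v <= sqrt(1 + b), the
  case of order four in dimension four. It behaves like b^2/2 at 0, which gives the double zero of
  the Green function on the sphere, and like ln b at infinity, which gives its logarithmic
  pole.\<close>

definition gf :: "real \<Rightarrow> real" where "gf b = ln (1 + b) - b / (1 + b)"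

lemma gf_nonneg: "b \<ge> 0 \<Longrightarrow> gf b \<ge> 0"
proof -
  assume b: "b \<ge> 0"
  have "ln (inverse (1 + b)) \<le> inverse (1 + b) - 1" using b by (intro ln_le_minus_one) auto
  then have "- ln (1 + b) \<le> inverse (1 + b) - 1" using b by (simp add: ln_inverse)
  moreover have "b / (1 + b) = 1 - inverse (1 + b)" using b by (simp add: field_simps)
  ultimately show ?thesis by (simp add: gf_def)
qed

lemma gf_le_sq: "b \<ge> 0 \<Longrightarrow> gf b \<le> b\<^sup>2"
proof -
  assume b: "b \<ge> 0"
  have "gf b \<le> b - b / (1 + b)" unfolding gf_def using ln_add_one_self_le_self[OF b] by simp
  also have "\<dots> = b\<^sup>2 / (1 + b)" using b by (simp add: field_simps power2_eq_square)
  also have "\<dots> \<le> b\<^sup>2 / 1" using b by (intro divide_left_mono) auto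
  finally show ?thesis by simp
qed

lemma gf_deriv: "b > -1 \<Longrightarrow> (gf has_real_derivative b / (1 + b)\<^sup>2) (at b)"
proof -
  assume b: "b > -1"
  have "(gf has_real_derivative 1 / (1 + b) - (1 * (1 + b) - b * 1) / ((1 + b) * (1 + b))) (at b)"
    unfolding gf_def[abs_def] using b by (auto intro!: derivative_eq_intros)
  moreover have "1 / (1 + b) - (1 * (1 + b) - b * 1) / ((1 + b) * (1 + b)) = b / (1 + b)\<^sup>2"
    using b by (simp add: divide_simps power2_eq_square)
  ultimately show ?thesis by simp
qed

lemma gf_mono: "0 \<le> a \<Longrightarrow> a \<le> b \<Longrightarrow> gf a \<le> gf b"
proof (rule DERIV_nonneg_imp_nondecreasing[of a b])
  fix x assume "0 \<le> a" "a \<le> x"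
  then show "\<exists>y. (gf has_real_derivative y) (at x) \<and> 0 \<le> y"
    by (intro exI[of _ "x / (1 + x)\<^sup>2"] conjI gf_deriv) auto
qed

lemma gf_0 [simp]: "gf 0 = 0" by (simp add: gf_def)

text \<open>The gap in the identity |x|^2 |y|^2 - 2 x.y + 1 = |x - y|^2 +
  \<open>\<theta> x y\<close>, whose left side is |y|^2 times the squared distance from x to the
  inverse point of y in the unit sphere.\<close>

definition \<theta> :: "'a::real_inner \<Rightarrow> 'a \<Rightarrow> real" where
  "\<theta> x y = (1 - x \<bullet> x) * (1 - y \<bullet> y)"

section \<open>The regularised Boggio kernel and its bi-Laplacian\<close>

definition quad :: "real^4 \<Rightarrow> real \<Rightarrow> real \<Rightarrow> real^4 \<Rightarrow> real" where
  "quad y a d x = a * (x \<bullet> x) + (- 2) * (y \<bullet> x) + d"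

lemma smooth_quad: "smooth (quad y a d)"
proof -
  have "smooth (\<lambda>x::real^4. x \<bullet> x)" using smooth_dist_sq[of 0] by simp
  then show ?thesis unfolding quad_def[abs_def] by (intro smooth_add smooth_mult smooth_const smooth_inner)
qed

lemma pderiv_quad: "pderiv_at i (quad y a d) = (\<lambda>x. 2 * (a * x $ i - y $ i))"
proof -
  have s: "smooth (\<lambda>x::real^4. x \<bullet> x)" "pderiv_at i (\<lambda>x::real^4. x \<bullet> x) = (\<lambda>x. 2 * x $ i)"
    using smooth_dist_sq[of 0] pderiv_at_dist_sq[of i 0] by simp_all
  show ?thesis unfolding quad_def[abs_def]
    by (subst pderiv_at_add' pderiv_at_mult' | intro smooth_add smooth_mult smooth_const smooth_inner s | simp only: s pderiv_at_inner pderiv_at_const)+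
       (simp add: algebra_simps)
qed

lemma lap_quad: "lap (quad y a d) = (\<lambda>x. 8 * a)"
proof -
  have "pderiv_at i (\<lambda>x. 2 * (a * x $ i - y $ i)) = (\<lambda>x::real^4. 2 * a)" for i
  proof
    fix x :: "real^4"
    have "((\<lambda>x::real^4. 2 * (a * x $ i - y $ i)) has_derivative (\<lambda>v. 2 * (a * v $ i))) (at x)"
      by (auto intro!: derivative_eq_intros bounded_linear.has_derivative[OF bounded_linear_vec_nth])
    from pderiv_at_eq[OF this] show "pderiv_at i (\<lambda>x. 2 * (a * x $ i - y $ i)) x = 2 * a" by simp
  qed
  then show ?thesis by (simp add: lap_def[abs_def] pderiv_quad)
qed

lemma grad2_quad: "grad2 (quad y a d) (quad y b d') x = 4 * (a * b * (x \<bullet> x) - (a + b) * (y \<bullet> x) + y \<bullet> y)"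
  by (simp add: grad2_def pderiv_quad inner_vec_def sum_distrib_left sum_subtractf sum.distrib[symmetric] algebra_simps)

context
  fixes y :: "real^4" and e :: real
  assumes y: "norm y \<le> 1" and e: "e > 0"
begin

abbreviation (input) "A \<equiv> y \<bullet> y"
text \<open>\<open>gp\<close> is |x - y|^2 + e and \<open>gq\<close> its counterpart for the inverse
  pole, |x|^2 |y|^2 - 2 x.y + 1 + e. \<open>gt\<close> is the constant t in the relation grad p .
  grad q = 2 (q + A p - t), which keeps all later Laplacians inside one family of explicit
  terms.\<close>

definition "gp = quad y 1 (y \<bullet> y + e)"
definition "gq = quad y (y \<bullet> y) (1 + e)"
definition "gt = (1 - y \<bullet> y)\<^sup>2 + e * (1 + y \<bullet> y)"

lemma gp_eq: "gp x = (x - y) \<bullet> (x - y) + e"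
  by (simp add: gp_def quad_def inner_diff_left inner_diff_right inner_commute)

lemma gq_eq: "gq x = gp x + \<theta> x y"
  by (simp add: gp_def gq_def quad_def \<theta>_def algebra_simps)

lemma gp_pos: "gp x \<ge> e" "gp x > 0" using e by (auto simp: gp_eq add_nonneg_pos)

text \<open>By Cauchy-Schwarz \<open>gq\<close> stays away from zero, uniformly in e, as soon as the
  pole y stays away from the sphere; all error estimates rest on this.\<close>

lemma gq_lower: "gq x \<ge> (1 - norm x * norm y)\<^sup>2 + e"
proof -
  have "y \<bullet> x \<le> norm y * norm x" by (rule norm_cauchy_schwarz)
  moreover have "gq x = (norm x * norm y)\<^sup>2 - 2 * (y \<bullet> x) + 1 + e"
    by (simp add: gq_def quad_def power_mult_distrib power2_norm_eq_inner mult.commute)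
  ultimately show ?thesis by (simp add: power2_eq_square algebra_simps)
qed

lemma gq_pos: "gq x \<ge> e" "gq x > 0"
  using gq_lower[of x] zero_le_power2[of "1 - norm x * norm y"] e by linarith+

lemma smooth_gp: "smooth gp" and smooth_gq: "smooth gq"
  unfolding gp_def gq_def by (rule smooth_quad)+

definition "ip m x = inverse (gp x) ^ m"
definition "iq m x = inverse (gq x) ^ m"

lemma smooth_ip: "smooth (ip m)" and smooth_iq: "smooth (iq m)"
  unfolding ip_def[abs_def] iq_def[abs_def]
  by (intro smooth_power smooth_inverse smooth_gp smooth_gq gp_pos gq_pos)+

lemma ip_mult: "gp x * ip (Suc m) x = ip m x" and iq_mult: "gq x * iq (Suc m) x = iq m x"
  using gp_pos[of x] gq_pos[of x] by (auto simp: ip_def iq_def)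

lemma grad_pp: "grad2 gp gp x = 4 * (gp x - e)"
  unfolding gp_def grad2_quad by (simp add: quad_def)

lemma grad_qq: "grad2 gq gq x = 4 * A * (gq x - e)"
  unfolding gq_def grad2_quad by (simp add: quad_def algebra_simps)

lemma grad_pq: "grad2 gp gq x = 2 * (gq x + A * gp x - gt)"
  unfolding gp_def gq_def gt_def grad2_quad by (simp add: quad_def power2_eq_square algebra_simps)

lemma inv_pow_deriv:
  "t > 0 \<Longrightarrow> ((\<lambda>t::real. inverse t ^ m) has_real_derivative - real m * inverse t ^ Suc m) (at t)"
  by (auto intro!: derivative_eq_intros simp: field_simps) (cases m; simp add: field_simps)

lemma lap_inv_pow:
  assumes "smooth g" "\<And>x. g x > 0"
  shows "lap (\<lambda>x. inverse (g x) ^ m) x = real m * (real m + 1) * inverse (g x) ^ (m + 2) * grad2 g g x - real m * inverse (g x) ^ (m + 1) * lap g x"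
proof -
  have d1: "((\<lambda>t::real. - real m * inverse t ^ Suc m) has_real_derivative real m * (real m + 1) * inverse t ^ (m + 2)) (at t)" if "t > 0" for t
    using DERIV_cmult[OF inv_pow_deriv[OF that, of "Suc m"], of "- real m"] by (simp add: algebra_simps)
  show ?thesis
    using lap_compose[OF inv_pow_deriv[OF assms(2)] d1[OF assms(2)] assms(1)] by simp
qed

text \<open>The coefficient m (m - 1) vanishes for m = 1 because |x|^(-2) is harmonic in dimension
  four; what is left then carries the factor e.\<close>

lemma lap_ip: "lap (ip m) x = 4 * (real m * (real m - 1) * ip (m + 1) x - e * real m * (real m + 1) * ip (m + 2) x)"
proof -
  have "lap (ip m) x = real m * (real m + 1) * ip (m + 2) x * (4 * (gp x - e)) - real m * ip (m + 1) x * 8"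
    unfolding ip_def[abs_def] using lap_inv_pow[OF smooth_gp gp_pos(2)] grad_pp by (simp add: gp_def lap_quad)
  moreover have "gp x * ip (m + 2) x = ip (m + 1) x" using ip_mult[of x "m + 1"] by simp
  ultimately show ?thesis by algebra
qed

lemma lap_iq: "lap (iq m) x = 4 * A * (real m * (real m - 1) * iq (m + 1) x - e * real m * (real m + 1) * iq (m + 2) x)"
proof -
  have "lap (iq m) x = real m * (real m + 1) * iq (m + 2) x * (4 * A * (gq x - e)) - real m * iq (m + 1) x * (8 * A)"
    unfolding iq_def[abs_def] using lap_inv_pow[OF smooth_gq gq_pos(2)] grad_qq by (simp add: gq_def lap_quad)
  moreover have "gq x * iq (m + 2) x = iq (m + 1) x" using iq_mult[of x "m + 1"] by simp
  ultimately show ?thesis by algebra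
qed

lemma pderiv_iq: "pderiv_at i (iq m) x = - real m * iq (m + 1) x * pderiv_at i gq x"
  unfolding iq_def[abs_def]
  using pderiv_at_compose(1)[OF inv_pow_deriv[OF gq_pos(2)] smooth_differentiable[OF smooth_gq]] by simp

text \<open>Products of \<open>gp\<close> with a power of 1/\<open>gq\<close> arise from the
  quotient in Boggio's function. The mixed gradient is again expressed by \<open>gp\<close>,
  \<open>gq\<close> and \<open>gt\<close>, so the Laplacian stays in the span of such terms.\<close>

lemma lap_p_iq: "lap (\<lambda>x. gp x * iq m x) x = (8 - 4 * real m) * iq m x + 4 * real m * gt * iq (m + 1) x
   + 4 * A * real m * (real m - 2) * (gp x * iq (m + 1) x) - 4 * e * A * real m * (real m + 1) * (gp x * iq (m + 2) x)"
proof -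
  have "grad2 gp (iq m) x = - real m * iq (m + 1) x * grad2 gp gq x"
    unfolding grad2_def pderiv_iq sum_distrib_left by (intro sum.cong) (auto simp: algebra_simps)
  then have g: "grad2 gp (iq m) x = - real m * iq (m + 1) x * (2 * (gq x + A * gp x - gt))" by (simp add: grad_pq)
  have "lap gp x = 8" by (simp add: gp_def lap_quad)
  then have "lap (\<lambda>x. gp x * iq m x) x = gp x * lap (iq m) x + 2 * grad2 gp (iq m) x + 8 * iq m x"
    using lap_mult[OF smooth_gp smooth_iq, of m] by simp
  moreover have "gq x * iq (m + 1) x = iq m x" using iq_mult[of x m] by simp
  moreover have "gq x * iq (m + 2) x = iq (m + 1) x" using iq_mult[of x "m + 1"] by simp
  ultimately show ?thesis unfolding g lap_iq by algebra
qed

text \<open>This is \<open>gf\<close> at \<open>\<theta> x y / gp x\<close> with the quotient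
  expanded, see \<open>gE_eq\<close>. It is written as a linear combination with explicit
  coefficients so that \<open>lap_comb\<close> can act on it term by term.\<close>

definition "gE x = ln (gq x) + (-1) * ln (gp x) + 1 * (gp x * iq 1 x) + (-1) * 1"

lemma lap_ln:
  assumes "smooth g" "\<And>x. g x > 0"
  shows "lap (\<lambda>x. ln (g x)) x = - (inverse (g x))\<^sup>2 * grad2 g g x + inverse (g x) * lap g x"
proof -
  have d1: "(inverse has_real_derivative - (inverse t)\<^sup>2) (at t)" if "t > 0" for t :: real
    using DERIV_inverse[of t] that by (simp add: power2_eq_square numeral_2_eq_2)
  show ?thesis
    using lap_compose[OF DERIV_ln[OF assms(2)] d1[OF assms(2)] assms(1)] by simp
qed

lemma lap_ln_q: "lap (\<lambda>x. ln (gq x)) x = 4 * A * iq 1 x + 4 * A * e * iq 2 x"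
proof -
  have "lap gq x = 8 * A" by (simp add: gq_def lap_quad)
  then have "lap (\<lambda>x. ln (gq x)) x = - iq 2 x * (4 * A * (gq x - e)) + iq 1 x * (8 * A)"
    using lap_ln[OF smooth_gq gq_pos(2), of x] by (simp add: grad_qq iq_def)
  moreover have "gq x * iq 2 x = iq 1 x" using iq_mult[of x 1] by (simp add: numeral_2_eq_2)
  ultimately show ?thesis by algebra
qed

lemma lap_ln_p: "lap (\<lambda>x. ln (gp x)) x = 4 * ip 1 x + 4 * e * ip 2 x"
proof -
  have "lap gp x = 8" by (simp add: gp_def lap_quad)
  then have "lap (\<lambda>x. ln (gp x)) x = - ip 2 x * (4 * (gp x - e)) + ip 1 x * 8"
    using lap_ln[OF smooth_gp gp_pos(2), of x] by (simp add: grad_pp ip_def)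
  moreover have "gp x * ip 2 x = ip 1 x" using ip_mult[of x 1] by (simp add: numeral_2_eq_2)
  ultimately show ?thesis by algebra
qed

lemma lap_comb: "smooth f \<Longrightarrow> smooth g \<Longrightarrow> lap (\<lambda>x. f x + c * g x) = (\<lambda>x. lap f x + c * lap g x)"
  by (subst lap_add) (auto intro: smooth_mult smooth_const simp: lap_cmult)

lemma smooth_comb: "smooth f \<Longrightarrow> smooth g \<Longrightarrow> smooth (\<lambda>x. f x + c * g x)"
  by (intro smooth_add smooth_mult smooth_const)

lemma smooth_p_iq: "smooth (\<lambda>x. gp x * iq m x)"
  by (intro smooth_mult smooth_gp smooth_iq)

lemmas smooth_gE_parts = smooth_comb smooth_const smooth_ln[OF smooth_gq gq_pos(2)] smooth_ln[OF smooth_gp gp_pos(2)] smooth_p_iq smooth_ip smooth_iq smooth_gp smooth_gq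

lemma smooth_gE: "smooth gE"
  unfolding gE_def[abs_def] by (intro smooth_gE_parts)

lemma lap_gE: "lap gE = (\<lambda>x. 0 + (4 * A + 4) * iq 1 x + (4 * A * e + 4 * gt) * iq 2 x + (-4) * ip 1 x + (-4 * e) * ip 2 x
    + (-4 * A) * (gp x * iq 2 x) + (-8 * e * A) * (gp x * iq 3 x))"
proof
  fix x
  have "lap gE x = lap (\<lambda>x. ln (gq x)) x + (-1) * lap (\<lambda>x. ln (gp x)) x + 1 * lap (\<lambda>x. gp x * iq 1 x) x + (-1) * lap (\<lambda>x. 1) x"
    unfolding gE_def[abs_def] by (simp only: lap_comb smooth_gE_parts)
  also have "\<dots> = 0 + (4 * A + 4) * iq 1 x + (4 * A * e + 4 * gt) * iq 2 x + (-4) * ip 1 x + (-4 * e) * ip 2 x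
    + (-4 * A) * (gp x * iq 2 x) + (-8 * e * A) * (gp x * iq 3 x)"
    unfolding lap_ln_q lap_ln_p lap_p_iq by (simp add: algebra_simps eval_nat_numeral)
  finally show "lap gE x = \<dots>" .
qed

text \<open>The first term is a multiple of an approximate delta at \<open>y\<close>. All others
  contain a factor e and no negative power of \<open>gp\<close>; since \<open>gq\<close> is bounded
  away from zero for interior poles, they form an error of order e.\<close>

lemma lap_lap_gE: "lap (lap gE) x = 96 * e\<^sup>2 * ip 4 x - 96 * e\<^sup>2 * A\<^sup>2 * iq 4 x - 192 * e * A * gt * iq 4 x + 384 * e\<^sup>2 * A\<^sup>2 * (gp x * iq 5 x)"
proof -
  have "lap (lap gE) x = lap (\<lambda>x. 0) x + (4 * A + 4) * lap (iq 1) x + (4 * A * e + 4 * gt) * lap (iq 2) x + (-4) * lap (ip 1) x + (-4 * e) * lap (ip 2) x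
    + (-4 * A) * lap (\<lambda>x. gp x * iq 2 x) x + (-8 * e * A) * lap (\<lambda>x. gp x * iq 3 x) x"
    unfolding lap_gE by (simp only: lap_comb smooth_gE_parts)
  also have "\<dots> = 96 * e\<^sup>2 * ip 4 x - 96 * e\<^sup>2 * A\<^sup>2 * iq 4 x - 192 * e * A * gt * iq 4 x + 384 * e\<^sup>2 * A\<^sup>2 * (gp x * iq 5 x)"
  proof -
    have l: "lap (iq 1) x = - 8 * A * e * iq 3 x" "lap (iq 2) x = 4 * A * (2 * iq 3 x - 6 * e * iq 4 x)"
      "lap (ip 1) x = - 8 * e * ip 3 x" "lap (ip 2) x = 4 * (2 * ip 3 x - 6 * e * ip 4 x)"
      "lap (\<lambda>x. gp x * iq 2 x) x = 8 * gt * iq 3 x - 24 * e * A * (gp x * iq 4 x)"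
      "lap (\<lambda>x. gp x * iq 3 x) x = - 4 * iq 3 x + 12 * gt * iq 4 x + 12 * A * (gp x * iq 4 x) - 48 * e * A * (gp x * iq 5 x)"
      unfolding lap_iq lap_ip lap_p_iq by (simp_all add: eval_nat_numeral)
    show ?thesis unfolding l lap_const by algebra
  qed
  finally show ?thesis .
qed

lemma gE_eq: "gE x = gf (\<theta> x y / gp x)"
proof -
  have p: "gp x > 0" "gq x > 0" by (rule gp_pos gq_pos)+
  have 1: "1 + \<theta> x y / gp x = gq x / gp x" using p by (simp add: gq_eq field_simps)
  have "\<theta> x y / gp x / (1 + \<theta> x y / gp x) = 1 - gp x / gq x"
    unfolding 1 using p gq_eq[of x] by (simp add: field_simps)
  moreover have "ln (gq x / gp x) = ln (gq x) - ln (gp x)" using p by (simp add: ln_div)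
  ultimately show ?thesis unfolding gf_def gE_def 1 iq_def by (simp add: divide_inverse)
qed

text \<open>The factor \<open>\<theta> x y\<close> shows that the gradient vanishes on the sphere to
  first order, as the very weak formulation demands.\<close>

lemma pderiv_gE: "pderiv_at i gE x = \<theta> x y * (pderiv_at i gq x * iq 2 x - pderiv_at i gp x * (ip 1 x * iq 1 x))"
proof -
  have p: "gp x > 0" "gq x > 0" by (rule gp_pos gq_pos)+
  have D: "pderiv_at i (\<lambda>x. f x + c * g x) x = pderiv_at i f x + c * pderiv_at i g x" if "smooth f" "smooth g" for f g :: "real^4 \<Rightarrow> real" and c
    using that by (simp add: pderiv_at_add' pderiv_at_mult' smooth_mult)
  have l: "pderiv_at i (\<lambda>x. ln (g x)) x = inverse (g x) * pderiv_at i g x" if "smooth g" "\<And>x. g x > 0" for g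
    by (rule pderiv_at_compose(1)[OF DERIV_ln[OF that(2)] smooth_differentiable[OF that(1)]])
  have pq: "pderiv_at i (\<lambda>x. gp x * iq 1 x) x = gp x * (- iq 2 x * pderiv_at i gq x) + pderiv_at i gp x * iq 1 x"
    using pderiv_iq[of i 1 x] by (simp add: pderiv_at_mult' smooth_gp smooth_iq numeral_2_eq_2)
  have "pderiv_at i gE x = inverse (gq x) * pderiv_at i gq x + (-1) * (inverse (gp x) * pderiv_at i gp x)
      + 1 * (gp x * (- iq 2 x * pderiv_at i gq x) + pderiv_at i gp x * iq 1 x) + (-1) * pderiv_at i (\<lambda>x. 1) x"
    unfolding gE_def[abs_def] by (simp only: D smooth_gE_parts l[OF smooth_gq gq_pos(2)] l[OF smooth_gp gp_pos(2)] pq)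
  also have "\<dots> = iq 1 x * pderiv_at i gq x - ip 1 x * pderiv_at i gp x - gp x * iq 2 x * pderiv_at i gq x + pderiv_at i gp x * iq 1 x"
    by (simp add: iq_def ip_def)
  also have "\<dots> = \<theta> x y * (pderiv_at i gq x * iq 2 x - pderiv_at i gp x * (ip 1 x * iq 1 x))"
  proof -
    have "gq x * iq 2 x = iq 1 x" using iq_mult[of x 1] by (simp add: numeral_2_eq_2)
    moreover have "gq x * iq 1 x = 1" "gp x * ip 1 x = 1" using p by (auto simp: iq_def ip_def)
    moreover have "\<theta> x y * (pderiv_at i gq x * iq 2 x - pderiv_at i gp x * (ip 1 x * iq 1 x))
       = pderiv_at i gq x * (gq x * iq 2 x) - gp x * iq 2 x * pderiv_at i gq x - pderiv_at i gp x * ip 1 x * (gq x * iq 1 x)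
         + pderiv_at i gp x * iq 1 x * (gp x * ip 1 x)"
      unfolding gq_eq[of x] by (simp only: ring_distribs right_diff_distrib left_diff_distrib mult_ac)
    ultimately show ?thesis by simp
  qed
  finally show ?thesis .
qed

lemma gE_bounds:
  assumes x: "norm x < 1"
  shows "0 \<le> gE x" "gE x \<le> (1 / e\<^sup>2) * (1 - x \<bullet> x)\<^sup>2" "\<bar>pderiv_at i gE x\<bar> \<le> (8 / e\<^sup>2) * (1 - x \<bullet> x)"
proof -
  have xx: "0 \<le> x \<bullet> x" "x \<bullet> x \<le> 1" and yy: "0 \<le> y \<bullet> y" "y \<bullet> y \<le> 1"
    using x y by (auto simp flip: power2_norm_eq_inner simp: power_le_one)
  have t: "0 \<le> \<theta> x y" "\<theta> x y \<le> 1 - x \<bullet> x"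
    using xx yy by (auto simp: \<theta>_def intro!: mult_left_le)
  have p: "gp x \<ge> e" "gq x \<ge> e" by (rule gp_pos gq_pos)+
  have b: "0 \<le> \<theta> x y / gp x" using t p e by simp
  have b2: "\<theta> x y / gp x \<le> (1 - x \<bullet> x) / e" using t p e xx by (intro frac_le) auto
  show "0 \<le> gE x" unfolding gE_eq by (rule gf_nonneg[OF b])
  have "gE x \<le> (\<theta> x y / gp x)\<^sup>2" unfolding gE_eq by (rule gf_le_sq[OF b])
  also have "\<dots> \<le> ((1 - x \<bullet> x) / e)\<^sup>2" by (intro power_mono b b2)
  finally show "gE x \<le> (1 / e\<^sup>2) * (1 - x \<bullet> x)\<^sup>2" by (simp add: power_divide)
  have i: "0 \<le> inverse (gp x)" "inverse (gp x) \<le> 1 / e" "0 \<le> inverse (gq x)" "inverse (gq x) \<le> 1 / e"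
    using p e by (auto simp: divide_inverse intro!: le_imp_inverse_le)
  have xi: "\<bar>x $ i\<bar> \<le> 1" "\<bar>y $ i\<bar> \<le> 1" using component_le_norm_cart[of x i] component_le_norm_cart[of y i] x y by auto
  have "\<bar>y \<bullet> y * x $ i\<bar> \<le> 1 * 1" unfolding abs_mult using xi yy by (intro mult_mono) auto
  then have d: "\<bar>pderiv_at i gp x\<bar> \<le> 4" "\<bar>pderiv_at i gq x\<bar> \<le> 4"
    unfolding gp_def gq_def pderiv_quad using xi by auto
  have "\<bar>pderiv_at i gq x * iq 2 x\<bar> \<le> 4 * (1/e * (1/e))"
    unfolding abs_mult iq_def power2_eq_square using i d e by (intro mult_mono) auto
  moreover have "\<bar>pderiv_at i gp x * (ip 1 x * iq 1 x)\<bar> \<le> 4 * (1/e * (1/e))"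
    unfolding abs_mult iq_def ip_def power_one_right using i d e by (intro mult_mono) auto
  ultimately have "\<bar>pderiv_at i gq x * iq 2 x - pderiv_at i gp x * (ip 1 x * iq 1 x)\<bar> \<le> 8 / e\<^sup>2"
    by (simp add: power2_eq_square)
  then have "\<bar>pderiv_at i gE x\<bar> \<le> (1 - x \<bullet> x) * (8 / e\<^sup>2)"
    unfolding pderiv_gE abs_mult using t xx by (intro mult_mono) auto
  then show "\<bar>pderiv_at i gE x\<bar> \<le> (8 / e\<^sup>2) * (1 - x \<bullet> x)" by (simp only: mult.commute)
qed

end

section \<open>Radial integrals and the normalising constant\<close>

lemma sets_ball_borel[measurable]: "ball c r \<in> sets borel" "cball c r \<in> sets borel" "box a b \<in> sets borel"
  by auto

lemma emeasure_cball4: "r \<ge> 0 \<Longrightarrow> emeasure lborel (cball c r :: (real^4) set) = ennreal (unit_ball_vol 4 * r ^ 4)"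
  using emeasure_cball[of r c] by simp

text \<open>At every point one of the steps of height \<open>a j\<close> on the ball of radius
  \<open>r j\<close> dominates, so the sum of all steps does, and its integral is a multiple of the
  assumed series. The form serves a pole at the origin as well as decay at infinity.\<close>

lemma nn_integral_dyadic_finite:
  fixes f :: "real^4 \<Rightarrow> ennreal"
  assumes f[measurable]: "f \<in> borel_measurable borel" 
    and le: "\<And>x. f x = 0 \<or> (\<exists>j. norm x \<le> r j \<and> f x \<le> ennreal (a j))"
    and a: "\<And>j. a j \<ge> 0" and r: "\<And>j::nat. r j \<ge> 0" and s: "summable (\<lambda>j. a j * r j ^ 4)"
  shows "(\<integral>\<^sup>+x. f x \<partial>lborel) < \<infinity>"
proof -
  let ?g = "\<lambda>j (x::real^4). ennreal (a j) * indicator (cball 0 (r j)) x"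
  have le': "f x \<le> (\<Sum>j. ?g j x)" for x
  proof -
    consider "f x = 0" | j where "norm x \<le> r j" "f x \<le> ennreal (a j)" using le by blast
    then show ?thesis
    proof cases
      case 2
      have "f x \<le> (\<Sum>j\<in>{j}. ?g j x)" using 2 by simp
      also have "\<dots> \<le> (\<Sum>j. ?g j x)" by (rule sum_le_suminf) (auto simp: summableI)
      finally show ?thesis .
    qed simp
  qed
  have "(\<integral>\<^sup>+x. f x \<partial>lborel) \<le> (\<integral>\<^sup>+x. (\<Sum>j. ?g j x) \<partial>lborel)" by (rule nn_integral_mono) (rule le')
  also have "\<dots> = (\<Sum>j. \<integral>\<^sup>+x. ?g j x \<partial>lborel)" by (rule nn_integral_suminf) simp
  also have "\<dots> = (\<Sum>j. ennreal (unit_ball_vol 4 * (a j * r j ^ 4)))"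
    using a r by (intro suminf_cong) (simp add: nn_integral_cmult emeasure_cball4 ennreal_mult'[symmetric] mult_ac)
  also have "\<dots> = ennreal (\<Sum>j. unit_ball_vol 4 * (a j * r j ^ 4))"
    using a r s by (intro suminf_ennreal2) (auto intro!: summable_mult mult_nonneg_nonneg)
  also have "\<dots> < \<infinity>" by simp
  finally show ?thesis .
qed

definition rad2 :: "real^4 \<Rightarrow> real" where "rad2 z = indicator (ball 0 1) z * inverse (z \<bullet> z)"

lemma borel_rad2[measurable]: "rad2 \<in> borel_measurable borel"
  unfolding rad2_def[abs_def] by measurable

lemma nn_integral_rad2: "(\<integral>\<^sup>+z. ennreal (rad2 z) \<partial>lborel) < \<infinity>"
\<comment> \<open>For (1/2)^(j+1) < |x| <= (1/2)^j the value |x|^(-2) is at most 4 * 4^j; times the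
  fourth power of the radius this is the geometric series 4 (1/4)^j.\<close>
proof (rule nn_integral_dyadic_finite[where r="\<lambda>j. (1/2) ^ j" and a="\<lambda>j. 4 * 4 ^ j"])
  have "summable (\<lambda>j::nat. 4 * (1/4) ^ j :: real)" by (intro summable_mult summable_geometric) simp
  moreover have "4 * 4 ^ j * ((1/2) ^ j) ^ 4 = 4 * (1/4::real) ^ j" for j :: nat
  proof -
    have "((1/2::real) ^ j) ^ 4 = ((1/2) ^ 4) ^ j" by (simp only: mult.commute flip: power_mult)
    moreover have "(4::real) ^ j * ((1/2) ^ 4) ^ j = (4 * (1/2) ^ 4) ^ j" by (rule power_mult_distrib[symmetric])
    moreover have "4 * (1/2::real) ^ 4 = 1/4" by (simp add: power4_eq_xxxx)
    ultimately show ?thesis by (simp only: mult.assoc)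
  qed
  ultimately show "summable (\<lambda>j::nat. 4 * 4 ^ j * ((1/2) ^ j) ^ 4 :: real)" by (simp only:)
  fix x :: "real^4"
  show "ennreal (rad2 x) = 0 \<or> (\<exists>j. norm x \<le> (1/2) ^ j \<and> ennreal (rad2 x) \<le> ennreal (4 * 4 ^ j))"
  proof (cases "norm x < 1 \<and> x \<noteq> 0")
    case True
    define n where "n = (LEAST n. (1/2::real) ^ n < norm x)"
    have ex: "\<exists>n. (1/2::real) ^ n < norm x" using real_arch_pow_inv[of "norm x" "1/2"] True by auto
    have n: "(1/2::real) ^ n < norm x" unfolding n_def by (rule LeastI_ex[OF ex])
    then have "n \<noteq> 0" using True by (auto intro: ccontr)
    then obtain j where j: "n = Suc j" by (cases n) auto
    have "\<not> (1/2::real) ^ j < norm x" using not_less_Least[of j "\<lambda>n. (1/2::real) ^ n < norm x"] by (simp add: j n_def[symmetric])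
    then have 1: "norm x \<le> (1/2) ^ j" by simp
    have "((1/2::real) ^ n)\<^sup>2 \<le> (norm x)\<^sup>2" using n by (intro power_mono) auto
    moreover have "((1/2::real) ^ n)\<^sup>2 = (1/4) ^ n" by (simp add: power2_eq_square flip: power_mult_distrib)
    ultimately have "(1/4::real) ^ n \<le> x \<bullet> x" by (simp add: power2_norm_eq_inner)
    then have "inverse (x \<bullet> x) \<le> inverse ((1/4) ^ n)" by (intro le_imp_inverse_le) auto
    also have "\<dots> = 4 * 4 ^ j" by (simp add: j power_divide)
    finally have "rad2 x \<le> 4 * 4 ^ j" using True by (simp add: rad2_def)
    then show ?thesis using 1 by (intro disjI2 exI[of _ j]) (auto intro: ennreal_leI)
  qed (auto simp: rad2_def)
qed (auto simp: rad2_def)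

definition "rad2_int = enn2real (\<integral>\<^sup>+z. ennreal (rad2 z) \<partial>lborel)"

lemma nn_integral_inverse_dist_sq:
  fixes c :: "real^4"
  assumes r: "r > 0"
  shows "(\<integral>\<^sup>+y. ennreal (indicator (ball c r) y * inverse ((y - c) \<bullet> (y - c))) \<partial>lborel) = ennreal (r\<^sup>2 * rad2_int)"
proof -
  have "(\<integral>\<^sup>+y. ennreal (indicator (ball c r) y * inverse ((y - c) \<bullet> (y - c))) \<partial>lborel)
     = ennreal (r ^ DIM(real^4)) * (\<integral>\<^sup>+z. ennreal (indicator (ball c r) (c + r *\<^sub>R z) * inverse ((c + r *\<^sub>R z - c) \<bullet> (c + r *\<^sub>R z - c))) \<partial>lborel)"
    by (rule lborel_scale_nn_integral[OF r]) measurable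
  also have "(\<lambda>z. ennreal (indicator (ball c r) (c + r *\<^sub>R z) * inverse ((c + r *\<^sub>R z - c) \<bullet> (c + r *\<^sub>R z - c)))) = (\<lambda>z. ennreal (inverse (r\<^sup>2)) * ennreal (rad2 z))"
  proof
    fix z :: "real^4"
    have "c + r *\<^sub>R z \<in> ball c r \<longleftrightarrow> z \<in> ball 0 1" using r by (simp add: dist_norm)
    then have "indicator (ball c r) (c + r *\<^sub>R z) * inverse ((c + r *\<^sub>R z - c) \<bullet> (c + r *\<^sub>R z - c)) = inverse (r\<^sup>2) * rad2 z"
      by (simp add: rad2_def indicator_def power2_eq_square)
    then show "ennreal (indicator (ball c r) (c + r *\<^sub>R z) * inverse ((c + r *\<^sub>R z - c) \<bullet> (c + r *\<^sub>R z - c))) = ennreal (inverse (r\<^sup>2)) * ennreal (rad2 z)"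
      by (simp add: ennreal_mult')
  qed
  also have "ennreal (r ^ DIM(real^4)) * (\<integral>\<^sup>+z. ennreal (inverse (r\<^sup>2)) * ennreal (rad2 z) \<partial>lborel) = ennreal (r ^ 4 * inverse (r\<^sup>2)) * (\<integral>\<^sup>+z. ennreal (rad2 z) \<partial>lborel)"
    using r by (subst nn_integral_cmult) (auto simp: ennreal_mult' mult.assoc)
  also have "r ^ 4 * inverse (r\<^sup>2) = r\<^sup>2" using r by (simp add: power4_eq_xxxx power2_eq_square field_simps)
  also have "ennreal (r\<^sup>2) * (\<integral>\<^sup>+z. ennreal (rad2 z) \<partial>lborel) = ennreal (r\<^sup>2 * rad2_int)"
    using nn_integral_rad2 by (simp add: rad2_int_def ennreal_mult')
  finally show ?thesis .
qed

text \<open>The bi-Laplacian of -ln(1 + |z|^2), that is, the leading term of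
  \<open>lap_lap_gE\<close> for e = 1 with the pole moved to the origin.\<close>

definition bubble :: "real^4 \<Rightarrow> real" where "bubble z = 96 * inverse (z \<bullet> z + 1) ^ 4"

lemma borel_bubble[measurable]: "bubble \<in> borel_measurable borel"
  unfolding bubble_def[abs_def] by measurable

lemma bubble_pos: "bubble z > 0"
proof -
  have "z \<bullet> z + 1 > 0" by (intro add_nonneg_pos) auto
  then show ?thesis by (simp add: bubble_def)
qed

lemma integrable_bubble: "integrable lborel bubble"
proof -
  have "(\<integral>\<^sup>+z. ennreal (bubble z) \<partial>lborel) < \<infinity>"
  \<comment> \<open>Outside radius 2^(j-1) the factor (1 + |z|^2)^(-4) is at most 256 (1/256)^j,
    while the volume of the ball of radius 2^j grows like 16^j.\<close>
  proof (rule nn_integral_dyadic_finite[where r="\<lambda>j. 2 ^ j" and a="\<lambda>j. 96 * 256 * (1/256) ^ j"])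
    have "summable (\<lambda>j::nat. (96 * 256) * (1/16) ^ j :: real)" by (intro summable_mult summable_geometric) simp
    moreover have "96 * 256 * (1/256) ^ j * (2 ^ j) ^ 4 = (96 * 256) * (1/16::real) ^ j" for j :: nat
    proof -
      have "((2::real) ^ j) ^ 4 = (2 ^ 4) ^ j" by (simp only: mult.commute flip: power_mult)
      moreover have "(1/256::real) ^ j * (2 ^ 4) ^ j = (1/256 * 2 ^ 4) ^ j" by (rule power_mult_distrib[symmetric])
      moreover have "(1/256::real) * 2 ^ 4 = 1/16" by simp
      ultimately show ?thesis by (simp only: mult.assoc)
    qed
    ultimately show "summable (\<lambda>j::nat. 96 * 256 * (1/256) ^ j * (2 ^ j) ^ 4 :: real)" by (simp only:)
    fix x :: "real^4"
    define n where "n = (LEAST n. norm x < (2::real) ^ n)"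
    have ex: "\<exists>n. norm x < (2::real) ^ n" using real_arch_pow[of 2 "norm x"] by simp
    have n: "norm x < (2::real) ^ n" unfolding n_def by (rule LeastI_ex[OF ex])
    have "inverse (x \<bullet> x + 1) ^ 4 \<le> 256 * (1/256) ^ n"
    proof (cases n)
      case 0
      have "inverse (x \<bullet> x + 1) ^ 4 \<le> 1" by (intro power_le_one) (auto simp: inverse_le_1_iff)
      then show ?thesis using 0 by simp
    next
      case (Suc j)
      have "\<not> norm x < (2::real) ^ j" using not_less_Least[of j "\<lambda>n. norm x < (2::real) ^ n"] by (simp add: Suc n_def[symmetric])
      then have "((2::real) ^ j)\<^sup>2 \<le> (norm x)\<^sup>2" by (intro power_mono) auto
      moreover have "((2::real) ^ j)\<^sup>2 = 4 ^ j" by (simp add: power2_eq_square flip: power_mult_distrib)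
      ultimately have "4 ^ j \<le> x \<bullet> x + 1" by (simp add: power2_norm_eq_inner)
      then have "inverse (x \<bullet> x + 1) \<le> inverse (4 ^ j)" by (intro le_imp_inverse_le) auto
      then have "inverse (x \<bullet> x + 1) ^ 4 \<le> inverse (4 ^ j) ^ 4" by (intro power_mono) auto
      also have "inverse ((4::real) ^ j) ^ 4 = (inverse 4 ^ 4) ^ j" by (simp only: mult.commute power_inverse[symmetric] flip: power_mult)
      also have "inverse (4::real) ^ 4 = 1/256" by (simp add: power4_eq_xxxx)
      finally show ?thesis by (simp add: Suc)
    qed
    then show "ennreal (bubble x) = 0 \<or> (\<exists>j. norm x \<le> 2 ^ j \<and> ennreal (bubble x) \<le> ennreal (96 * 256 * (1/256) ^ j))"
      using n by (intro disjI2 exI[of _ n]) (auto simp: bubble_def intro!: ennreal_leI)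
  qed auto
  then show ?thesis by (intro integrableI_nonneg) (auto simp: less_imp_le[OF bubble_pos])
qed

text \<open>Chosen so that the mollifiers below have total mass 1, which makes it the constant in
  front of Boggio's function.\<close>

definition \<kappa> :: real where "\<kappa> = inverse (LINT z|lborel. bubble z)"

lemma kappa_pos: "\<kappa> > 0"
proof -
  have "(LINT z|lborel. bubble z) \<noteq> 0"
  proof
    assume "(LINT z|lborel. bubble z) = 0"
    then have "AE z in lborel. bubble z = 0"
      using integral_nonneg_eq_0_iff_AE[OF integrable_bubble] less_imp_le[OF bubble_pos] by simp
    then have "AE z in (lborel :: (real^4) measure). False" using bubble_pos by (auto elim!: eventually_mono simp: less_le)
    then have "(UNIV :: (real^4) set) \<in> null_sets lborel" by (subst AE_iff_null_sets) auto
    then show False by (auto simp: null_sets_def)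
  qed
  moreover have "(LINT z|lborel. bubble z) \<ge> 0" using less_imp_le[OF bubble_pos] by simp
  ultimately show ?thesis by (simp add: \<kappa>_def)
qed

lemma kappa_bubble: "\<kappa> * (LINT z|lborel. bubble z) = 1"
  using kappa_pos by (simp add: \<kappa>_def)

section \<open>Green representation of weak solutions\<close>

definition green_reg :: "real \<Rightarrow> real^4 \<Rightarrow> real^4 \<Rightarrow> real" where
  "green_reg e x y = \<kappa> * gf (\<theta> x y / ((x - y) \<bullet> (x - y) + e))"

text \<open>On the diagonal the denominator is 0, and division by zero makes
  \<open>green x x\<close> equal to 0. The diagonal is negligible in every integral, and statements
  about the pole exclude it.\<close>

definition green :: "real^4 \<Rightarrow> real^4 \<Rightarrow> real" where "green = green_reg 0"

lemma borel_gf[measurable]: "gf \<in> borel_measurable borel"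
  unfolding gf_def[abs_def] by measurable

lemma borel_green_reg[measurable]: "(\<lambda>p. green_reg e (fst p) (snd p)) \<in> borel_measurable (borel \<Otimes>\<^sub>M borel)"
  unfolding green_reg_def \<theta>_def by measurable

lemma borel_green_reg'[measurable]:
  "f \<in> borel_measurable M \<Longrightarrow> g \<in> borel_measurable M \<Longrightarrow> (\<lambda>z. green_reg e (f z) (g z)) \<in> borel_measurable M"
  using measurable_compose[OF measurable_Pair borel_green_reg, of f M g e] by simp

lemma borel_green[measurable]:
  "f \<in> borel_measurable M \<Longrightarrow> g \<in> borel_measurable M \<Longrightarrow> (\<lambda>z. green (f z) (g z)) \<in> borel_measurable M"
  unfolding green_def by measurable

lemma inner_self_less_1: "norm x < 1 \<Longrightarrow> x \<bullet> x < 1"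
  using power_strict_mono[of "norm x" 1 2] by (simp add: power2_norm_eq_inner)

lemma inner_self_le_1: "norm x \<le> 1 \<Longrightarrow> x \<bullet> x \<le> 1"
  using power_mono[of "norm x" 1 2] by (simp add: power2_norm_eq_inner)

lemma theta_nonneg: "norm x \<le> 1 \<Longrightarrow> norm y \<le> 1 \<Longrightarrow> \<theta> x y \<ge> 0"
  by (simp add: \<theta>_def inner_self_le_1)

lemma green_reg_nonneg: "norm x \<le> 1 \<Longrightarrow> norm y \<le> 1 \<Longrightarrow> e \<ge> 0 \<Longrightarrow> green_reg e x y \<ge> 0"
  unfolding green_reg_def using kappa_pos theta_nonneg[of x y] by (intro mult_nonneg_nonneg gf_nonneg divide_nonneg_nonneg add_nonneg_nonneg) auto

lemma green_nonneg: "norm x \<le> 1 \<Longrightarrow> norm y \<le> 1 \<Longrightarrow> green x y \<ge> 0"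
  unfolding green_def by (rule green_reg_nonneg) auto

text \<open>Monotonicity in the regularisation is what allows monotone convergence to the singular
  kernel.\<close>

lemma green_reg_antimono:
  assumes "norm x \<le> 1" "norm y \<le> 1" "0 \<le> e" "e \<le> e'" "x \<noteq> y"
  shows "green_reg e' x y \<le> green_reg e x y"
proof -
  have s: "(x - y) \<bullet> (x - y) > 0" using assms by simp
  show ?thesis unfolding green_reg_def
    using kappa_pos theta_nonneg[OF assms(1,2)] assms s
    by (intro mult_left_mono gf_mono divide_nonneg_nonneg divide_left_mono mult_pos_pos add_pos_nonneg add_nonneg_nonneg) auto
qed

text \<open>\<open>\<kappa>\<close> times the leading term of \<open>lap_lap_gE\<close>; for e = s^2
  it is the mass-preserving rescaling of \<open>\<kappa> * bubble z\<close> to length s.\<close>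

definition mollifier :: "real \<Rightarrow> real^4 \<Rightarrow> real" where
  "mollifier e z = \<kappa> * (96 * e\<^sup>2 * inverse (z \<bullet> z + e) ^ 4)"

lemma borel_mollifier[measurable]: "mollifier e \<in> borel_measurable borel"
  unfolding mollifier_def[abs_def] by measurable

lemma mollifier_nonneg: "e > 0 \<Longrightarrow> mollifier e z \<ge> 0"
  unfolding mollifier_def using kappa_pos by (intro mult_nonneg_nonneg zero_le_power) (auto intro: add_nonneg_nonneg)

lemma mollifier_le: "e > 0 \<Longrightarrow> mollifier e z \<le> \<kappa> * 96 / e\<^sup>2"
proof -
  assume e: "e > 0"
  have "inverse (z \<bullet> z + e) \<le> inverse e" using e by (intro le_imp_inverse_le) auto
  then have "inverse (z \<bullet> z + e) ^ 4 \<le> inverse e ^ 4" using e by (intro power_mono) (auto intro: add_nonneg_nonneg)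
  then have "mollifier e z \<le> \<kappa> * (96 * e\<^sup>2 * inverse e ^ 4)" unfolding mollifier_def using kappa_pos by (intro mult_left_mono) auto
  also have "\<dots> = \<kappa> * 96 / e\<^sup>2" using e by (simp add: power4_eq_xxxx power2_eq_square field_simps)
  finally show ?thesis .
qed

lemma mollifier_scaled: "s > 0 \<Longrightarrow> s ^ 4 * mollifier (s\<^sup>2) (s *\<^sub>R z) = \<kappa> * bubble z"
proof -
  assume s: "s > 0"
  have "(s *\<^sub>R z) \<bullet> (s *\<^sub>R z) + s\<^sup>2 = s\<^sup>2 * (z \<bullet> z + 1)" by (simp add: power2_eq_square algebra_simps)
  then have "mollifier (s\<^sup>2) (s *\<^sub>R z) = \<kappa> * (96 * (s\<^sup>2)\<^sup>2 * (inverse (s\<^sup>2) ^ 4 * inverse (z \<bullet> z + 1) ^ 4))"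
    unfolding mollifier_def by (simp add: power_mult_distrib)
  also have "s ^ 4 * \<dots> = (s ^ 4 * (s\<^sup>2)\<^sup>2 * inverse (s\<^sup>2) ^ 4) * (\<kappa> * bubble z)" by (simp add: bubble_def)
  also have "s ^ 4 * (s\<^sup>2)\<^sup>2 * inverse (s\<^sup>2) ^ 4 = 1" using s by (simp add: power4_eq_xxxx power2_eq_square field_simps)
  finally show ?thesis by simp
qed

lemma mollified_indicator:
  fixes S :: "(real^4) set"
  assumes [measurable]: "S \<in> sets borel" and s: "s > 0"
  shows "(LINT y|lborel. indicator S y * mollifier (s\<^sup>2) (x - y)) = (LINT z|lborel. indicator S (x + s *\<^sub>R z) * (\<kappa> * bubble z))"
proof -
  have "(LINT y|lborel. indicator S y * mollifier (s\<^sup>2) (x - y)) = s ^ DIM(real^4) * (LINT z|lborel. indicator S (x + s *\<^sub>R z) * mollifier (s\<^sup>2) (x - (x + s *\<^sub>R z)))"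
    by (rule lborel_scale_integral[OF s]) measurable
  also have "\<dots> = (LINT z|lborel. s ^ 4 * (indicator S (x + s *\<^sub>R z) * mollifier (s\<^sup>2) (- (s *\<^sub>R z))))" by simp
  also have "\<dots> = (LINT z|lborel. indicator S (x + s *\<^sub>R z) * (\<kappa> * bubble z))"
  proof (rule Bochner_Integration.integral_cong[OF refl])
    fix z
    have "mollifier (s\<^sup>2) (- (s *\<^sub>R z)) = mollifier (s\<^sup>2) (s *\<^sub>R z)" by (simp add: mollifier_def)
    then show "s ^ 4 * (indicator S (x + s *\<^sub>R z) * mollifier (s\<^sup>2) (- (s *\<^sub>R z))) = indicator S (x + s *\<^sub>R z) * (\<kappa> * bubble z)"
      using mollifier_scaled[OF s, of z] by (simp add: mult.left_commute)
  qed
  finally show ?thesis .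
qed

lemma mollified_indicator_bounds:
  fixes S :: "(real^4) set"
  assumes [measurable]: "S \<in> sets borel" and s: "s > 0"
  shows "0 \<le> (LINT y|lborel. indicator S y * mollifier (s\<^sup>2) (x - y))" "(LINT y|lborel. indicator S y * mollifier (s\<^sup>2) (x - y)) \<le> 1"
proof -
  have T[measurable]: "(\<lambda>z. x + s *\<^sub>R z) \<in> borel_measurable borel" by (intro borel_measurable_continuous_onI continuous_intros)
  have b: "\<kappa> * bubble z \<ge> 0" for z using kappa_pos less_imp_le[OF bubble_pos] by simp
  show "0 \<le> (LINT y|lborel. indicator S y * mollifier (s\<^sup>2) (x - y))"
    unfolding mollified_indicator[OF assms] by (intro integral_nonneg_AE AE_I2 mult_nonneg_nonneg b) auto
  have i: "integrable lborel (\<lambda>z. \<kappa> * bubble z)" using integrable_bubble by simp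
  have "(LINT z|lborel. indicator S (x + s *\<^sub>R z) * (\<kappa> * bubble z)) \<le> (LINT z|lborel. \<kappa> * bubble z)"
  proof (rule integral_mono[OF _ i])
    show "integrable lborel (\<lambda>z. indicator S (x + s *\<^sub>R z) * (\<kappa> * bubble z))"
      by (rule Bochner_Integration.integrable_bound[OF i]) (auto simp: indicator_def)
    show "indicator S (x + s *\<^sub>R z) * (\<kappa> * bubble z) \<le> \<kappa> * bubble z" for z using b[of z] by (auto simp: indicator_def)
  qed
  then show "(LINT y|lborel. indicator S y * mollifier (s\<^sup>2) (x - y)) \<le> 1"
    unfolding mollified_indicator[OF assms] using kappa_bubble by simp
qed

text \<open>After the substitution y = x + s z the indicator is eventually constant for each z, and
  the integrable bubble dominates. Faces are excluded because there the limit is in general a proper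
  fraction of the mass.\<close>

lemma mollified_box_limit:
  fixes x :: "real^4"
  assumes sl: "s \<longlonglongrightarrow> 0" and sp: "\<And>n. s n > 0" and x: "x \<in> box a b \<or> x \<notin> cbox a b"
  shows "(\<lambda>n. LINT y|lborel. indicator (box a b) y * mollifier ((s n)\<^sup>2) (x - y)) \<longlonglongrightarrow> indicator (box a b) x"
proof -
  have i: "integrable lborel (\<lambda>z. \<kappa> * bubble z)" using integrable_bubble by simp
  have T[measurable]: "(\<lambda>z. x + s n *\<^sub>R z) \<in> borel_measurable borel" for n by (intro borel_measurable_continuous_onI continuous_intros)
  have "(\<lambda>n. LINT z|lborel. indicator (box a b) (x + s n *\<^sub>R z) * (\<kappa> * bubble z)) \<longlonglongrightarrow> (LINT z|lborel. indicator (box a b) x * (\<kappa> * bubble z))"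
  proof (rule integral_dominated_convergence[where w="\<lambda>z. \<kappa> * bubble z"])
    show "AE z in lborel. (\<lambda>n. indicator (box a b) (x + s n *\<^sub>R z) * (\<kappa> * bubble z)) \<longlonglongrightarrow> indicator (box a b) x * (\<kappa> * bubble z)"
    proof (rule AE_I2)
      fix z :: "real^4"
      have l: "(\<lambda>n. x + s n *\<^sub>R z) \<longlonglongrightarrow> x + 0 *\<^sub>R z" by (intro tendsto_intros sl)
      have "\<forall>\<^sub>F n in sequentially. indicator (box a b) (x + s n *\<^sub>R z) = (indicator (box a b) x :: real)"
      proof (cases "x \<in> box a b")
        case True
        have "\<forall>\<^sub>F n in sequentially. x + s n *\<^sub>R z \<in> box a b"
          using topological_tendstoD[OF l open_box, of a b] True by simp
        then show ?thesis using True by (auto elim!: eventually_mono)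
      next
        case False
        then have "x \<in> - cbox a b" using x by auto
        then have "\<forall>\<^sub>F n in sequentially. x + s n *\<^sub>R z \<in> - cbox a b"
          using topological_tendstoD[OF l, of "- cbox a b"] closed_cbox by (auto simp: open_Compl)
        then show ?thesis using False box_subset_cbox[of a b] by (auto elim!: eventually_mono simp: indicator_def)
      qed
      then show "(\<lambda>n. indicator (box a b) (x + s n *\<^sub>R z) * (\<kappa> * bubble z)) \<longlonglongrightarrow> indicator (box a b) x * (\<kappa> * bubble z)"
        by (intro tendsto_mult tendsto_const tendsto_eventually)
    qed
    show "AE z in lborel. norm (indicator (box a b) (x + s n *\<^sub>R z) * (\<kappa> * bubble z)) \<le> \<kappa> * bubble z" for n
      using kappa_pos less_imp_le[OF bubble_pos] by (intro AE_I2) (auto simp: indicator_def abs_mult)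
  qed (use i in auto)
  also have "(LINT z|lborel. indicator (box a b) x * (\<kappa> * bubble z)) = indicator (box a b) x * (\<kappa> * (LINT z|lborel. bubble z))"
    by simp
  also have "\<dots> = indicator (box a b) x" by (simp only: kappa_bubble mult_1_right)
  finally show ?thesis by (simp only: mollified_indicator[OF sets_ball_borel(3) sp])
qed

lemma green_reg_gE: "e > 0 \<Longrightarrow> norm y \<le> 1 \<Longrightarrow> green_reg e x y = \<kappa> * gE y e x"
  by (simp add: green_reg_def gE_eq gp_eq)

lemma weak_pair_green_reg:
  assumes wp: "weak_pair U N" and y: "norm y < 1" and e: "0 < e"
  shows "integrable lborel (\<lambda>x. N x * green_reg e x y)"
    and "(LINT x|lborel. N x * green_reg e x y) = (LINT x|lborel. U x * (\<kappa> * lap (lap (gE y e)) x))"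
proof -
  have y': "norm y \<le> 1" using y by simp
  let ?C = "8 / e\<^sup>2"
  have "smooth (gE y e)" by (rule smooth_gE[OF y' e])
  moreover have "?C \<ge> 0" by simp
  moreover have "\<forall>x\<in>ball 0 1. 0 \<le> gE y e x \<and> gE y e x \<le> ?C * (1 - x \<bullet> x)\<^sup>2 \<and> (\<forall>i. \<bar>pderiv_at i (gE y e) x\<bar> \<le> ?C * (1 - x \<bullet> x))"
  proof (intro ballI conjI allI)
    fix x :: "real^4" assume "x \<in> ball 0 1"
    then have x: "norm x < 1" by simp
    show "0 \<le> gE y e x" by (rule gE_bounds(1)[OF y' e x])
    have "gE y e x \<le> 1 / e\<^sup>2 * (1 - x \<bullet> x)\<^sup>2" by (rule gE_bounds(2)[OF y' e x])
    also have "\<dots> \<le> ?C * (1 - x \<bullet> x)\<^sup>2" by (intro mult_right_mono divide_right_mono) auto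
    finally show "gE y e x \<le> ?C * (1 - x \<bullet> x)\<^sup>2" .
    show "\<bar>pderiv_at i (gE y e) x\<bar> \<le> ?C * (1 - x \<bullet> x)" for i by (rule gE_bounds(3)[OF y' e x])
  qed
  ultimately have *: "integrable lborel (\<lambda>x. N x * gE y e x)" "(LINT x|lborel. U x * lap (lap (gE y e)) x) = (LINT x|lborel. N x * gE y e x)"
    using wp unfolding weak_pair_def by blast+
  have eq: "(\<lambda>x. N x * green_reg e x y) = (\<lambda>x. \<kappa> * (N x * gE y e x))" "(\<lambda>x. U x * (\<kappa> * lap (lap (gE y e)) x)) = (\<lambda>x. \<kappa> * (U x * lap (lap (gE y e)) x))"
    by (auto simp: green_reg_gE[OF e y'])
  show "integrable lborel (\<lambda>x. N x * green_reg e x y)" unfolding eq using *(1) by simp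
  show "(LINT x|lborel. N x * green_reg e x y) = (LINT x|lborel. U x * (\<kappa> * lap (lap (gE y e)) x))"
    unfolding eq using *(2) by simp
qed

text \<open>For |y| <= r the denominator \<open>gq\<close> is at least (1 - r)^2, and it occurs to
  powers at most 5, hence the exponent 10. The three error terms contribute at most 96 + 3 * 192 + 5
  * 384, which is below 3000.\<close>

lemma lap_lap_gE_error:
  assumes y: "norm y \<le> r" and r: "r < 1" and e: "0 < e" "e \<le> 1" and x: "norm x < 1"
  shows "\<bar>\<kappa> * lap (lap (gE y e)) x - mollifier e (x - y)\<bar> \<le> e * (\<kappa> * (3000 / (1 - r) ^ 10))"
proof -
  have y': "norm y \<le> 1" using y r by simp
  define m where "m = (1 - r)\<^sup>2"
  have r0: "r \<ge> 0" using y norm_ge_zero[of y] by linarith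
  have m: "0 < m" "m \<le> 1" using r r0 by (auto simp: m_def power_le_one)
  define A where "A = y \<bullet> y"
  have A: "0 \<le> A" "A \<le> 1" using inner_self_le_1[OF y'] by (auto simp: A_def)
  define t where "t = gt y e"
  have t: "0 \<le> t" "t \<le> 3"
  proof -
    have "(1 - A)\<^sup>2 \<le> 1" using A by (intro power_le_one) auto
    moreover have "e * (1 + A) \<le> 1 * 2" using A e by (intro mult_mono) auto
    ultimately have "(1 - A)\<^sup>2 \<le> 1" "e * (1 + A) \<le> 2" by auto
    then show "t \<le> 3" by (simp add: t_def gt_def[OF y' e(1)] A_def)
    show "0 \<le> t" using A e by (simp add: t_def gt_def[OF y' e(1)] A_def)
  qed
  define P where "P = gp y e x"
  have P: "0 \<le> P" "P \<le> 5"
  proof -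
    have "norm (x - y) \<le> 2" using norm_triangle_ineq4[of x y] x y' by linarith
    then have "(norm (x - y))\<^sup>2 \<le> 2\<^sup>2" by (intro power_mono) auto
    then show "P \<le> 5" using e by (simp add: P_def gp_eq[OF y' e(1)] power2_norm_eq_inner)
    show "0 \<le> P" using gp_pos(2)[OF y' e(1), of x] by (simp add: P_def)
  qed
  define i where "i = inverse (gq y e x)"
  have i: "0 \<le> i" "i \<le> inverse m"
  proof -
    have "norm x * norm y \<le> 1 * r" using x y by (intro mult_mono) auto
    then have "m \<le> (1 - norm x * norm y)\<^sup>2" unfolding m_def using r by (intro power_mono) auto
    then have "m \<le> gq y e x" using gq_lower[OF y' e(1), of x] e by linarith
    then show "i \<le> inverse m" unfolding i_def using m by (intro le_imp_inverse_le) auto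
    show "0 \<le> i" using gq_pos(2)[OF y' e(1), of x] by (simp add: i_def)
  qed
  have im: "1 \<le> inverse m" using m by (simp add: one_le_inverse_iff)
  have i4: "i ^ 4 \<le> inverse m ^ 5" "i ^ 5 \<le> inverse m ^ 5" "0 \<le> i ^ 4" "0 \<le> i ^ 5"
  proof -
    have "i ^ 4 \<le> inverse m ^ 4" using i by (intro power_mono) auto
    also have "\<dots> \<le> inverse m ^ 5" using im by (intro power_increasing) auto
    finally show "i ^ 4 \<le> inverse m ^ 5" .
    show "i ^ 5 \<le> inverse m ^ 5" using i by (intro power_mono) auto
  qed (use i in auto)
  define J where "J = inverse m ^ 5"
  have ip4: "ip y e 4 x = inverse ((x - y) \<bullet> (x - y) + e) ^ 4" "iq y e 4 x = i ^ 4" "iq y e 5 x = i ^ 5"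
    by (simp_all add: ip_def[OF y' e(1)] iq_def[OF y' e(1)] gp_eq[OF y' e(1)] i_def)
  have "\<kappa> * lap (lap (gE y e)) x - mollifier e (x - y) = \<kappa> * (- (96 * e\<^sup>2 * A\<^sup>2 * i ^ 4) - 192 * e * A * t * i ^ 4 + 384 * e\<^sup>2 * A\<^sup>2 * (P * i ^ 5))"
    unfolding lap_lap_gE[OF y' e(1)] mollifier_def ip4 by (simp add: A_def t_def P_def algebra_simps)
  moreover have "\<bar>- (96 * e\<^sup>2 * A\<^sup>2 * i ^ 4) - 192 * e * A * t * i ^ 4 + 384 * e\<^sup>2 * A\<^sup>2 * (P * i ^ 5)\<bar> \<le> e * (3000 * J)"
  proof -
    have e2: "e\<^sup>2 \<le> e" "0 \<le> e\<^sup>2" using e by (auto simp: power2_eq_square mult_left_le)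
    have A2: "A\<^sup>2 \<le> 1" "0 \<le> A\<^sup>2" using A by (auto intro: power_le_one)
    have "e\<^sup>2 * A\<^sup>2 \<le> e * 1" using e2 A2 e by (intro mult_mono) auto
    then have eA: "e\<^sup>2 * A\<^sup>2 \<le> e" "0 \<le> e\<^sup>2 * A\<^sup>2" by auto
    have 1: "0 \<le> e\<^sup>2 * A\<^sup>2 * i ^ 4" "e\<^sup>2 * A\<^sup>2 * i ^ 4 \<le> e * J" unfolding J_def using eA i4 e by (auto intro!: mult_mono)
    have "A * t \<le> 1 * 3" using A t by (intro mult_mono) auto
    then have "A * t * i ^ 4 \<le> 3 * J" unfolding J_def using i4 A t by (intro mult_mono) auto
    then have 2: "0 \<le> e * (A * t * i ^ 4)" "e * (A * t * i ^ 4) \<le> e * (3 * J)" using e A t i4 by (auto intro!: mult_left_mono)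
    have "P * i ^ 5 \<le> 5 * J" unfolding J_def using P i4 by (intro mult_mono) auto
    then have 3: "0 \<le> e\<^sup>2 * A\<^sup>2 * (P * i ^ 5)" "e\<^sup>2 * A\<^sup>2 * (P * i ^ 5) \<le> e * (5 * J)" using eA P i4 e by (auto intro!: mult_mono)
    have J0: "0 \<le> e * J" using 1 by linarith
    have "- (96 * e\<^sup>2 * A\<^sup>2 * i ^ 4) - 192 * e * A * t * i ^ 4 + 384 * e\<^sup>2 * A\<^sup>2 * (P * i ^ 5)
      = - 96 * (e\<^sup>2 * A\<^sup>2 * i ^ 4) - 192 * (e * (A * t * i ^ 4)) + 384 * (e\<^sup>2 * A\<^sup>2 * (P * i ^ 5))" by simp
    then show ?thesis using 1 2 3 J0 unfolding abs_le_iff by (simp only: mult.left_commute[of e]) linarith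
  qed
  moreover have "J = 1 / (1 - r) ^ 10" using r by (simp add: J_def m_def inverse_eq_divide power_one_over flip: power_mult)
  moreover have "\<bar>\<kappa> * X\<bar> \<le> \<kappa> * (e * (3000 * J))" if "\<bar>X\<bar> \<le> e * (3000 * J)" for X
    using that kappa_pos by (simp add: abs_mult)
  ultimately have "\<bar>\<kappa> * lap (lap (gE y e)) x - mollifier e (x - y)\<bar> \<le> \<kappa> * (e * (3000 * J))" by (simp only:)
  also have "\<dots> = e * (\<kappa> * (3000 / (1 - r) ^ 10))" by (simp add: \<open>J = 1 / (1 - r) ^ 10\<close>)
  finally show ?thesis .
qed

text \<open>\<open>U\<close> is only an integrable function, so the identity is averaged over poles
  y in a box. For e > 0 the regularised potential of \<open>N\<close> differs from the mollified
  \<open>U\<close> by at most e times a constant on the box. The mollified averages converge to the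
  integral of \<open>U\<close>, and the potentials increase to the singular one, so the limits agree
  before the singular potential is known to be finite.\<close>

lemma weak_pair_box_integral:
  assumes wp: "weak_pair U N" and ab: "cbox a b \<subseteq> ball (0::real^4) 1"
  shows "(\<integral>\<^sup>+y. indicator (box a b) y * (\<integral>\<^sup>+x. ennreal (N x * green x y) \<partial>lborel) \<partial>lborel)
     = ennreal (LINT y|lborel. indicator (box a b) y * U y)"
    and "0 \<le> (LINT y|lborel. indicator (box a b) y * U y)"
proof -
  have U[measurable]: "U \<in> borel_measurable borel" and N[measurable]: "N \<in> borel_measurable borel"
    and out: "\<And>x. x \<notin> ball 0 1 \<Longrightarrow> U x = 0" "\<And>x. x \<notin> ball 0 1 \<Longrightarrow> N x = 0" and N0: "\<And>x. N x \<ge> 0" and Ui: "integrable lborel U"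
    using wp by (auto simp: weak_pair_def)
  \<comment> \<open>The regularisation is e = 1/(n+1), decreasing to 0, and s = sqrt e is the length
    scale of the mollifier.\<close>
  define s where "s n = inverse (sqrt (real (Suc n)))" for n
  define e where "e n = (s n)\<^sup>2" for n
  have s: "s n > 0" for n by (simp add: s_def)
  have e_eq: "e n = inverse (real (Suc n))" for n by (simp add: e_def s_def power_inverse)
  have e: "0 < e n" "e n \<le> 1" for n by (auto simp: e_eq inverse_le_1_iff)
  have e_lim: "e \<longlonglongrightarrow> 0" unfolding e_eq[abs_def] by (rule LIMSEQ_inverse_real_of_nat)
  have s_lim: "s \<longlonglongrightarrow> 0"
  proof -
    have "(\<lambda>n. sqrt (e n)) \<longlonglongrightarrow> sqrt 0" by (intro tendsto_intros e_lim)
    then show ?thesis using s by (simp add: e_def less_imp_le)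
  qed
  have e_dec: "e (Suc n) \<le> e n" for n by (simp add: e_eq le_imp_inverse_le)
  \<comment> \<open>By compactness the closed box keeps a positive distance 1 - r from the sphere,
    as the error estimate requires.\<close>
  obtain r where r: "r < 1" "\<And>y. y \<in> cbox a b \<Longrightarrow> norm y \<le> r"
  proof (cases "cbox a b = {}")
    case True then show ?thesis using that[of 0] by auto
  next
    case False
    have "continuous_on (cbox a b) norm" by (intro continuous_intros)
    from continuous_attains_sup[OF compact_cbox False this]
    obtain x where x: "x \<in> cbox a b" "\<And>y. y \<in> cbox a b \<Longrightarrow> norm y \<le> norm x" by blast
    then have "norm x < 1" using ab by auto
    then show ?thesis using that x(2) by blast
  qed
  let ?b = "\<lambda>y. indicator (box a b) y :: real"
  have y1: "norm y < 1" "norm y \<le> r" if "y \<in> box a b" for y using that box_subset_cbox[of a b] ab r by auto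
  define W where "W n y = (LINT x|lborel. N x * green_reg (e n) x y)" for n y
  define V where "V n y = (LINT x|lborel. U x * mollifier (e n) (x - y))" for n y
  define K where "K = \<kappa> * (3000 / (1 - r) ^ 10) * (LINT x|lborel. \<bar>U x\<bar>)"
  have sub[measurable]: "(\<lambda>x. x - y) \<in> borel_measurable borel" for y :: "real^4" by (intro borel_measurable_continuous_onI continuous_intros)
  have Vi: "integrable lborel (\<lambda>x. U x * mollifier (e n) (x - y))" for n y
  proof (rule Bochner_Integration.integrable_bound[where f="\<lambda>x. (\<kappa> * 96 / (e n)\<^sup>2) * U x"])
    show "integrable lborel (\<lambda>x. (\<kappa> * 96 / (e n)\<^sup>2) * U x)" using Ui by simp
    show "AE x in lborel. norm (U x * mollifier (e n) (x - y)) \<le> norm ((\<kappa> * 96 / (e n)\<^sup>2) * U x)"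
    proof (rule AE_I2)
      fix x
      have "\<bar>mollifier (e n) (x - y)\<bar> \<le> \<bar>\<kappa> * 96 / (e n)\<^sup>2\<bar>"
        using mollifier_le[OF e(1)[of n], of "x - y"] mollifier_nonneg[OF e(1)[of n], of "x - y"] by linarith
      then show "norm (U x * mollifier (e n) (x - y)) \<le> norm ((\<kappa> * 96 / (e n)\<^sup>2) * U x)"
        unfolding real_norm_def abs_mult by (subst mult.commute) (intro mult_right_mono, auto)
    qed
  qed measurable
  have WV: "\<bar>W n y - V n y\<bar> \<le> e n * K" if y: "y \<in> box a b" for n y
  proof -
    let ?L = "\<lambda>x. \<kappa> * lap (lap (gE y (e n))) x"
    have y': "norm y \<le> 1" "norm y < 1" using y1[OF y] by auto
    have Lm[measurable]: "?L \<in> borel_measurable borel"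
      by (intro borel_measurable_times borel_measurable_const smooth_borel smooth_lap smooth_gE y' e)
    have d: "\<bar>U x * ?L x - U x * mollifier (e n) (x - y)\<bar> \<le> \<bar>U x\<bar> * (e n * (\<kappa> * (3000 / (1 - r) ^ 10)))" for x
    proof (cases "norm x < 1")
      case True
      show ?thesis unfolding right_diff_distrib[symmetric] abs_mult
        by (intro mult_left_mono lap_lap_gE_error y1[OF y] r e True) auto
    qed (use out in simp)
    have di: "integrable lborel (\<lambda>x. U x * ?L x - U x * mollifier (e n) (x - y))"
    proof (rule Bochner_Integration.integrable_bound[where f="\<lambda>x. \<bar>U x\<bar> * (e n * (\<kappa> * (3000 / (1 - r) ^ 10)))"])
      show "AE x in lborel. norm (U x * ?L x - U x * mollifier (e n) (x - y)) \<le> norm (\<bar>U x\<bar> * (e n * (\<kappa> * (3000 / (1 - r) ^ 10))))"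
        by (intro AE_I2) (unfold real_norm_def, rule order_trans[OF d abs_ge_self])
    qed (use Ui in auto)
    have Li: "integrable lborel (\<lambda>x. U x * ?L x)"
      using Bochner_Integration.integrable_add[OF di Vi[of n y]] by (simp only: diff_add_cancel)
    have "W n y - V n y = (LINT x|lborel. U x * ?L x - U x * mollifier (e n) (x - y))"
      unfolding W_def V_def weak_pair_green_reg(2)[OF wp y'(2) e(1)]
      by (rule Bochner_Integration.integral_diff[OF Li Vi[of n y], symmetric])
    also have "\<bar>\<dots>\<bar> \<le> (LINT x|lborel. \<bar>U x\<bar> * (e n * (\<kappa> * (3000 / (1 - r) ^ 10))))"
      by (rule order_trans[OF integral_abs_bound]) (intro integral_mono, use di Ui d in auto)
    also have "\<dots> = e n * K" by (simp add: K_def mult_ac)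
    finally show ?thesis .
  qed
  have emb: "emeasure lborel (box a b) < \<infinity>" using emeasure_lborel_box_finite[of a b] by simp
  have Ji: "integrable (lborel \<Otimes>\<^sub>M lborel) (\<lambda>(x, y). U x * (?b y * mollifier (e n) (x - y)))" for n
  proof (rule Bochner_Integration.integrable_bound[where f="\<lambda>(x, y). (\<kappa> * 96 / (e n)\<^sup>2) * (U x * ?b y)"])
    have "integrable lborel ?b" using emb by (simp add: integrable_real_indicator)
    then have "integrable (lborel \<Otimes>\<^sub>M lborel) (\<lambda>(x, y). U x * ?b y)"
    proof (intro lborel_pair.Fubini_integrable)
      assume bI: "integrable lborel ?b"
      show "(\<lambda>(x, y). U x * ?b y) \<in> borel_measurable (lborel \<Otimes>\<^sub>M lborel)" by measurable
      have "(\<lambda>x. LINT y|lborel. norm (case (x, y) of (x, y) \<Rightarrow> U x * ?b y)) = (\<lambda>x. \<bar>U x\<bar> * (LINT y|lborel. ?b y))"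
        by (simp add: abs_mult)
      then show "integrable lborel (\<lambda>x. LINT y|lborel. norm (case (x, y) of (x, y) \<Rightarrow> U x * ?b y))" using Ui by simp
      show "AE x in lborel. integrable lborel (\<lambda>y. case (x, y) of (x, y) \<Rightarrow> U x * ?b y)" using bI by simp
    qed
    then have "integrable (lborel \<Otimes>\<^sub>M lborel) (\<lambda>p. (\<kappa> * 96 / (e n)\<^sup>2) * (case p of (x, y) \<Rightarrow> U x * ?b y))"
      by (intro integrable_mult_right) simp
    then show "integrable (lborel \<Otimes>\<^sub>M lborel) (\<lambda>(x, y). (\<kappa> * 96 / (e n)\<^sup>2) * (U x * ?b y))"
      by (simp only: split_beta')
    show "(\<lambda>(x, y). U x * (?b y * mollifier (e n) (x - y))) \<in> borel_measurable (lborel \<Otimes>\<^sub>M lborel)"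
      by measurable
    show "AE p in lborel \<Otimes>\<^sub>M lborel. norm (case p of (x, y) \<Rightarrow> U x * (?b y * mollifier (e n) (x - y))) \<le> norm (case p of (x, y) \<Rightarrow> (\<kappa> * 96 / (e n)\<^sup>2) * (U x * ?b y))"
    proof (rule AE_I2)
      fix p :: "(real^4) \<times> (real^4)"
      obtain x y where p: "p = (x, y)" by (cases p)
      have "\<bar>mollifier (e n) (x - y)\<bar> \<le> \<bar>\<kappa> * 96 / (e n)\<^sup>2\<bar>"
        using mollifier_le[OF e(1)[of n], of "x - y"] mollifier_nonneg[OF e(1)[of n], of "x - y"] by linarith
      then have "\<bar>U x * ?b y\<bar> * \<bar>mollifier (e n) (x - y)\<bar> \<le> \<bar>U x * ?b y\<bar> * \<bar>\<kappa> * 96 / (e n)\<^sup>2\<bar>"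
        by (intro mult_left_mono) auto
      then show "norm (case p of (x, y) \<Rightarrow> U x * (?b y * mollifier (e n) (x - y))) \<le> norm (case p of (x, y) \<Rightarrow> (\<kappa> * 96 / (e n)\<^sup>2) * (U x * ?b y))"
        unfolding p by (simp add: abs_mult mult_ac)
    qed
  qed
  have Vbox: "(LINT y|lborel. ?b y * V n y) = (LINT x|lborel. U x * (LINT y|lborel. ?b y * mollifier (e n) (x - y)))"
    and Vboxi: "integrable lborel (\<lambda>y. ?b y * V n y)" for n
  proof -
    have "(LINT y|lborel. (LINT x|lborel. U x * (?b y * mollifier (e n) (x - y)))) = (LINT x|lborel. (LINT y|lborel. U x * (?b y * mollifier (e n) (x - y))))"
      by (rule lborel_pair.Fubini_integral[OF Ji])
    moreover have eq: "(LINT x|lborel. U x * (?b y * mollifier (e n) (x - y))) = ?b y * V n y" for y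
      unfolding V_def by (subst mult.left_commute) simp
    ultimately show "(LINT y|lborel. ?b y * V n y) = (LINT x|lborel. U x * (LINT y|lborel. ?b y * mollifier (e n) (x - y)))" by simp
    show "integrable lborel (\<lambda>y. ?b y * V n y)"
      using lborel_pair.integrable_snd[OF Ji[of n]] unfolding eq .
  qed
  have bdry: "AE x in lborel. x \<in> box a b \<or> x \<notin> cbox a b"
  proof -
    have "cbox a b - box a b \<in> null_sets lborel"
    proof (rule null_setsI)
      have "emeasure lborel (cbox a b - box a b) = emeasure lborel (cbox a b) - emeasure lborel (box a b)"
        by (rule emeasure_Diff) (auto simp: box_subset_cbox emeasure_lborel_box_eq)
      then show "emeasure lborel (cbox a b - box a b) = 0" by (simp add: emeasure_lborel_box_eq emeasure_lborel_cbox_eq)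
    qed auto
    then have "AE x in lborel. x \<notin> cbox a b - box a b" by (rule AE_not_in)
    then show ?thesis by eventually_elim auto
  qed
  have V_lim: "(\<lambda>n. LINT y|lborel. ?b y * V n y) \<longlonglongrightarrow> (LINT x|lborel. U x * ?b x)"
    unfolding Vbox
  proof (rule integral_dominated_convergence[where w="\<lambda>x. \<bar>U x\<bar>"])
    show "AE x in lborel. (\<lambda>n. U x * (LINT y|lborel. ?b y * mollifier (e n) (x - y))) \<longlonglongrightarrow> U x * ?b x"
      using bdry by eventually_elim (unfold e_def, intro tendsto_intros mollified_box_limit[OF s_lim s], auto)
    show "AE x in lborel. norm (U x * (LINT y|lborel. ?b y * mollifier (e n) (x - y))) \<le> \<bar>U x\<bar>" for n
      using mollified_indicator_bounds[OF sets_ball_borel(3) s] unfolding e_def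
      by (intro AE_I2) (auto simp: abs_mult intro!: mult_left_le)
    show "(\<lambda>x. U x * (LINT y|lborel. ?b y * mollifier (e n) (x - y))) \<in> borel_measurable lborel" for n
      by measurable
  qed (use Ui in auto)
  have Wm[measurable]: "W n \<in> borel_measurable borel" for n unfolding W_def by measurable
  have W0: "0 \<le> ?b y * W n y" for n y
  proof (cases "y \<in> box a b")
    case True
    have "0 \<le> W n y" unfolding W_def
    proof (intro integral_nonneg_AE AE_I2)
      fix x show "0 \<le> N x * green_reg (e n) x y"
        using N0[of x] out(2)[of x] green_reg_nonneg[of x y "e n"] y1(1)[OF True] e(1)[of n] by (cases "norm x < 1") auto
    qed
    then show ?thesis by simp
  qed simp
  have bi: "integrable lborel (\<lambda>y. ?b y * c)" for c :: real using emb by (simp add: integrable_real_indicator)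
  have K0: "K \<ge> 0" unfolding K_def using kappa_pos r(1) by (intro mult_nonneg_nonneg) auto
  have WVd: "\<bar>?b y * W n y - ?b y * V n y\<bar> \<le> ?b y * (e n * K)" for n y
    using WV[of y n] by (cases "y \<in> box a b") auto
  have Wdi: "integrable lborel (\<lambda>y. ?b y * W n y - ?b y * V n y)" for n
  proof (rule Bochner_Integration.integrable_bound[OF bi[of "e n * K"]])
    show "(\<lambda>y. ?b y * W n y - ?b y * V n y) \<in> borel_measurable lborel"
      using borel_measurable_integrable[OF Vboxi[of n]] by measurable
    show "AE y in lborel. norm (?b y * W n y - ?b y * V n y) \<le> norm (?b y * (e n * K))"
      using WVd[of _ n] K0 e(1)[of n] by (intro AE_I2) (simp add: abs_mult)
  qed
  have Wi: "integrable lborel (\<lambda>y. ?b y * W n y)" for n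
    using Bochner_Integration.integrable_add[OF Wdi[of n] Vboxi[of n]] by (simp only: diff_add_cancel)
  have W_lim: "(\<lambda>n. LINT y|lborel. ?b y * W n y) \<longlonglongrightarrow> (LINT x|lborel. U x * ?b x)"
  proof -
    have "(\<lambda>n. (LINT y|lborel. ?b y * W n y - ?b y * V n y)) \<longlonglongrightarrow> 0"
    proof (rule Lim_null_comparison)
      have "norm (LINT y|lborel. ?b y * W n y - ?b y * V n y) \<le> (LINT y|lborel. ?b y * (e n * K))" for n
        by (rule order_trans[OF integral_norm_bound]) (intro integral_mono, use Wdi bi WVd in auto)
      then show "\<forall>\<^sub>F n in sequentially. norm (LINT y|lborel. ?b y * W n y - ?b y * V n y) \<le> (LINT y|lborel. ?b y) * (e n * K)" by simp
      show "(\<lambda>n. (LINT y|lborel. ?b y) * (e n * K)) \<longlonglongrightarrow> 0"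
        by (rule tendsto_eq_rhs[OF tendsto_mult[OF tendsto_const tendsto_mult[OF e_lim tendsto_const]]]) simp
    qed
    from tendsto_add[OF this V_lim] show ?thesis using Wi Vboxi by simp
  qed
  let ?F = "\<lambda>n y. \<integral>\<^sup>+x. ennreal (N x * green_reg (e n) x y) \<partial>lborel"
  have nn: "0 \<le> N x * green_reg (e n) x y" if "norm y < 1" for n x y
    using N0[of x] out(2)[of x] green_reg_nonneg[of x y "e n"] that e(1)[of n] by (cases "norm x < 1") auto
  have FW: "indicator (box a b) y * ?F n y = ennreal (?b y * W n y)" for n y
  proof (cases "y \<in> box a b")
    case True
    have "?F n y = ennreal (W n y)" unfolding W_def
      by (rule nn_integral_eq_integral[OF weak_pair_green_reg(1)[OF wp y1(1)[OF True] e(1)]]) (use nn y1(1)[OF True] in auto)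
    then show ?thesis using True by simp
  qed simp
  have step: "N x * green_reg (e n) x y \<le> N x * green_reg (e (Suc n)) x y" if "norm y < 1" "x \<noteq> y" for n x y
    using N0[of x] out(2)[of x] that e_dec[of n] e(1)[of "Suc n"]
    by (cases "norm x < 1") (auto intro!: mult_left_mono green_reg_antimono)
  have F_inc: "?F n y \<le> ?F (Suc n) y" if "norm y < 1" for n y
  proof (rule nn_integral_mono_AE)
    show "AE x in lborel. ennreal (N x * green_reg (e n) x y) \<le> ennreal (N x * green_reg (e (Suc n)) x y)"
      using AE_lborel_singleton[of y] by eventually_elim (intro ennreal_leI step that)
  qed
  have F_sup: "(\<integral>\<^sup>+x. ennreal (N x * green x y) \<partial>lborel) = (SUP n. ?F n y)" if y: "norm y < 1" for y
  proof -
    have "(\<integral>\<^sup>+x. (SUP n. ennreal (N x * green_reg (e n) x y)) \<partial>lborel) = (SUP n. ?F n y)"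
    proof (rule nn_integral_monotone_convergence_SUP_AE)
      show "AE x in lborel. ennreal (N x * green_reg (e n) x y) \<le> ennreal (N x * green_reg (e (Suc n)) x y)" for n
        using AE_lborel_singleton[of y] by eventually_elim (intro ennreal_leI step y)
    qed measurable
    moreover have "(\<integral>\<^sup>+x. ennreal (N x * green x y) \<partial>lborel) = (\<integral>\<^sup>+x. (SUP n. ennreal (N x * green_reg (e n) x y)) \<partial>lborel)"
    proof (rule nn_integral_cong_AE)
      show "AE x in lborel. ennreal (N x * green x y) = (SUP n. ennreal (N x * green_reg (e n) x y))"
        using AE_lborel_singleton[of y]
      proof eventually_elim
        case (elim x)
        show ?case
        proof (cases "norm x < 1")
          case True
          have s0: "(x - y) \<bullet> (x - y) \<noteq> 0" using elim by simp
          have t: "\<theta> x y / ((x - y) \<bullet> (x - y) + 0) \<ge> 0"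
            using theta_nonneg[of x y] True y by (intro divide_nonneg_nonneg add_nonneg_nonneg) auto
          have "isCont gf (\<theta> x y / ((x - y) \<bullet> (x - y) + 0))" using t by (intro DERIV_isCont[OF gf_deriv]) linarith
          then have "(\<lambda>n. green_reg (e n) x y) \<longlonglongrightarrow> green_reg 0 x y"
            unfolding green_reg_def using s0 by (intro tendsto_intros isCont_tendsto_compose[of _ gf] e_lim) auto
          then have "(\<lambda>n. ennreal (N x * green_reg (e n) x y)) \<longlonglongrightarrow> ennreal (N x * green x y)"
            unfolding green_def by (intro tendsto_intros)
          moreover have "incseq (\<lambda>n. ennreal (N x * green_reg (e n) x y))"
            by (intro incseq_SucI ennreal_leI step y elim)
          ultimately show ?thesis using LIMSEQ_SUP LIMSEQ_unique by blast
        qed (use out in simp)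
      qed
    qed
    ultimately show ?thesis by simp
  qed
  have "(\<integral>\<^sup>+y. indicator (box a b) y * (\<integral>\<^sup>+x. ennreal (N x * green x y) \<partial>lborel) \<partial>lborel)
     = (\<integral>\<^sup>+y. (SUP n. indicator (box a b) y * ?F n y) \<partial>lborel)"
  proof (rule nn_integral_cong)
    fix y
    show "indicator (box a b) y * (\<integral>\<^sup>+x. ennreal (N x * green x y) \<partial>lborel) = (SUP n. indicator (box a b) y * ?F n y)"
      using F_sup[of y] y1(1)[of y] by (cases "y \<in> box a b") auto
  qed
  also have "\<dots> = (SUP n. \<integral>\<^sup>+y. indicator (box a b) y * ?F n y \<partial>lborel)"
  proof (rule nn_integral_monotone_convergence_SUP)
    show "incseq (\<lambda>n y. indicator (box a b) y * ?F n y)"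
      using F_inc y1(1) by (intro incseq_SucI le_funI) (auto simp: indicator_def)
    show "(\<lambda>y. indicator (box a b) y * ?F n y) \<in> borel_measurable lborel" for n unfolding FW by measurable
  qed
  also have "\<dots> = ennreal (LINT x|lborel. U x * ?b x)"
  proof -
    have eq: "(\<integral>\<^sup>+y. indicator (box a b) y * ?F n y \<partial>lborel) = ennreal (LINT y|lborel. ?b y * W n y)" for n
      unfolding FW by (rule nn_integral_eq_integral[OF Wi]) (use W0 in auto)
    have "incseq (\<lambda>n. \<integral>\<^sup>+y. indicator (box a b) y * ?F n y \<partial>lborel)"
      using F_inc y1(1) by (intro incseq_SucI nn_integral_mono) (auto simp: indicator_def)
    from LIMSEQ_SUP[OF this] have "(\<lambda>n. ennreal (LINT y|lborel. ?b y * W n y)) \<longlonglongrightarrow> (SUP n. \<integral>\<^sup>+y. indicator (box a b) y * ?F n y \<partial>lborel)"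
      unfolding eq .
    moreover have "(\<lambda>n. ennreal (LINT y|lborel. ?b y * W n y)) \<longlonglongrightarrow> ennreal (LINT x|lborel. U x * ?b x)"
      by (intro tendsto_ennrealI W_lim)
    ultimately show ?thesis using LIMSEQ_unique by blast
  qed
  finally show "(\<integral>\<^sup>+y. indicator (box a b) y * (\<integral>\<^sup>+x. ennreal (N x * green x y) \<partial>lborel) \<partial>lborel)
     = ennreal (LINT y|lborel. indicator (box a b) y * U y)" by (simp add: mult.commute)
  have "0 \<le> (LINT y|lborel. ?b y * W n y)" for n by (intro integral_nonneg_AE AE_I2 W0)
  then have "0 \<le> (LINT x|lborel. U x * ?b x)" by (intro LIMSEQ_le_const[OF W_lim]) auto
  then show "0 \<le> (LINT y|lborel. indicator (box a b) y * U y)" by (simp add: mult.commute)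
qed

text \<open>The box identity is used twice: finite box integrals force the potential to be finite
  almost everywhere, and equal box integrals then identify it with \<open>U\<close>. Nonnegativity
  of \<open>U\<close> is a consequence, since kernel and density are nonnegative.\<close>

theorem green_representation:
  assumes wp: "weak_pair U N"
  shows "AE y in lborel. y \<in> ball 0 1 \<longrightarrow> integrable lborel (\<lambda>x. N x * green x y) \<and> U y = (LINT x|lborel. N x * green x y) \<and> U y \<ge> 0"
proof -
  have U[measurable]: "U \<in> borel_measurable borel" and N[measurable]: "N \<in> borel_measurable borel"
    and out: "\<And>x. x \<notin> ball 0 1 \<Longrightarrow> N x = 0" and N0: "\<And>x. N x \<ge> 0" and Ui: "integrable lborel U"
    using wp by (auto simp: weak_pair_def)
  define F where "F y = (\<integral>\<^sup>+x. ennreal (N x * green x y) \<partial>lborel)" for y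
  have Fm[measurable]: "F \<in> borel_measurable borel" unfolding F_def[abs_def] by measurable
  have Fb: "(\<integral>\<^sup>+y. indicator (box a b) y * F y \<partial>lborel) = ennreal (LINT y|lborel. indicator (box a b) y * U y)" 
    and U0: "0 \<le> (LINT y|lborel. indicator (box a b) y * U y)"
    if "cbox a b \<subseteq> ball 0 1" for a b
    using weak_pair_box_integral[OF wp that] by (simp_all add: F_def)
  have fin: "AE y in lborel. indicator (box a b) y * F y \<noteq> \<infinity>" if "cbox a b \<subseteq> ball 0 1" for a b
    by (rule nn_integral_noteq_infinite) (auto simp: Fb[OF that])
  have "AE y in lborel. y \<in> ball 0 1 \<longrightarrow> (indicator {y. F y = \<infinity>} y :: real) = 0"
  proof (rule AE_zero_if_local_box_integrals_zero[OF open_ball])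
    fix a b :: "real^4" assume ab: "cbox a b \<subseteq> ball 0 1"
    have *: "AE y in lborel. indicator (box a b) y * (indicator {y. F y = \<infinity>} y :: real) = 0"
      using fin[OF ab] by eventually_elim (auto simp: indicator_def split: if_splits)
    show "integrable lborel (\<lambda>y. indicator (box a b) y * (indicator {y. F y = \<infinity>} y :: real))"
      using * by (subst integrable_cong_AE[of _ _ "\<lambda>y. 0"]) auto
    show "(LINT y|lborel. indicator (box a b) y * (indicator {y. F y = \<infinity>} y :: real)) = 0"
      using * by (intro integral_eq_zero_AE)
  qed
  then have finAE: "AE y in lborel. y \<in> ball 0 1 \<longrightarrow> F y \<noteq> \<infinity>" by eventually_elim (auto simp: indicator_def)
  have "AE y in lborel. y \<in> ball 0 1 \<longrightarrow> U y - enn2real (F y) = 0"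
  proof (rule AE_zero_if_local_box_integrals_zero[OF open_ball])
    fix a b :: "real^4" assume ab: "cbox a b \<subseteq> ball 0 1"
    let ?g = "\<lambda>y. indicator (box a b) y * enn2real (F y)"
    have nn: "(\<integral>\<^sup>+y. ennreal (?g y) \<partial>lborel) = ennreal (LINT y|lborel. indicator (box a b) y * U y)"
      unfolding Fb[OF ab, symmetric]
    proof (rule nn_integral_cong_AE)
      show "AE y in lborel. ennreal (?g y) = indicator (box a b) y * F y"
        using fin[OF ab] by eventually_elim (auto simp: indicator_def ennreal_enn2real_if)
    qed
    have gi: "integrable lborel ?g"
      by (rule integrableI_nonneg) (use nn in auto)
    have "(LINT y|lborel. ?g y) = enn2real (\<integral>\<^sup>+y. ennreal (?g y) \<partial>lborel)"
      by (rule integral_eq_nn_integral) auto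
    also have "\<dots> = (LINT y|lborel. indicator (box a b) y * U y)" using U0[OF ab] unfolding nn by simp
    finally have ge: "(LINT y|lborel. ?g y) = (LINT y|lborel. indicator (box a b) y * U y)" .
    have ui: "integrable lborel (\<lambda>y. indicator (box a b) y * U y)"
      using integrable_mult_indicator[of "box a b" lborel U] Ui by simp
    show "integrable lborel (\<lambda>y. indicator (box a b) y * (U y - enn2real (F y)))"
      using Bochner_Integration.integrable_diff[OF ui gi] by (simp add: right_diff_distrib)
    show "(LINT y|lborel. indicator (box a b) y * (U y - enn2real (F y))) = 0"
      using ui gi ge by (simp add: right_diff_distrib)
  qed
  then show ?thesis using finAE
  proof eventually_elim
    case (elim y)
    show ?case
    proof
      assume y: "y \<in> ball 0 1"
      have nn: "0 \<le> N x * green x y" for x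
        using N0[of x] out[of x] green_nonneg[of x y] y by (cases "norm x < 1") auto
      have "integrable lborel (\<lambda>x. N x * green x y)"
        by (rule integrableI_nonneg) (use nn elim y in \<open>auto simp: F_def less_top\<close>)
      moreover have "(LINT x|lborel. N x * green x y) = enn2real (F y)"
        unfolding F_def by (rule integral_eq_nn_integral) (use nn in auto)
      ultimately show "integrable lborel (\<lambda>x. N x * green x y) \<and> U y = (LINT x|lborel. N x * green x y) \<and> U y \<ge> 0"
        using elim y by auto
    qed
  qed
qed

section \<open>Kernel bounds and exponential integrability of potentials\<close>

lemma theta_le_1: "norm x \<le> 1 \<Longrightarrow> norm y \<le> 1 \<Longrightarrow> \<theta> x y \<le> 1"
proof -
  assume "norm x \<le> 1" "norm y \<le> 1"
  then have "\<theta> x y \<le> 1 * 1" unfolding \<theta>_def using inner_self_le_1 by (intro mult_mono) auto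
  then show ?thesis by simp
qed

lemma gf_le_ln: "b \<ge> 0 \<Longrightarrow> gf b \<le> ln (1 + b)"
  by (simp add: gf_def)

lemma green_le_inverse:
  assumes "norm x \<le> 1" "norm y \<le> 1"
  shows "green x y \<le> \<kappa> * inverse ((x - y) \<bullet> (x - y))"
proof -
  let ?s = "(x - y) \<bullet> (x - y)"
  have t: "0 \<le> \<theta> x y / ?s" using theta_nonneg[OF assms] by simp
  have "gf (\<theta> x y / ?s) \<le> \<theta> x y / ?s"
    using gf_le_ln[OF t] ln_add_one_self_le_self[OF t] by linarith
  also have "\<dots> \<le> 1 / ?s" using theta_le_1[OF assms] by (intro divide_right_mono) auto
  finally have "\<kappa> * gf (\<theta> x y / ?s) \<le> \<kappa> * (1 / ?s)" using kappa_pos by (intro mult_left_mono) auto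
  then show ?thesis by (simp add: green_def green_reg_def inverse_eq_divide)
qed

text \<open>The sum equals |x|^2 |y|^2 - 2 x.y + 1, which is at most (1 + |x| |y|)^2.\<close>

lemma s_plus_theta_le_4:
  assumes "norm x \<le> 1" "norm y \<le> 1"
  shows "(x - y) \<bullet> (x - y) + \<theta> x y \<le> 4"
proof -
  have "\<bar>x \<bullet> y\<bar> \<le> norm x * norm y" by (rule Cauchy_Schwarz_ineq2)
  also have "\<dots> \<le> 1 * 1" using assms by (intro mult_mono) auto
  finally have xy: "\<bar>x \<bullet> y\<bar> \<le> 1" by simp
  have "(x \<bullet> x) * (y \<bullet> y) \<le> 1 * 1" using assms inner_self_le_1 by (intro mult_mono) auto
  moreover have "(x - y) \<bullet> (x - y) + \<theta> x y = (x \<bullet> x) * (y \<bullet> y) - 2 * (x \<bullet> y) + 1"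
    by (simp add: \<theta>_def inner_diff_left inner_diff_right inner_commute algebra_simps)
  ultimately show ?thesis using xy by linarith
qed

lemma green_le_ln:
  assumes "norm x \<le> 1" "norm y \<le> 1" "x \<noteq> y"
  shows "1 \<le> 1 + \<theta> x y / ((x - y) \<bullet> (x - y))" "1 + \<theta> x y / ((x - y) \<bullet> (x - y)) \<le> 4 * inverse ((x - y) \<bullet> (x - y))"
    "green x y \<le> \<kappa> * ln (1 + \<theta> x y / ((x - y) \<bullet> (x - y)))"
proof -
  let ?s = "(x - y) \<bullet> (x - y)"
  have s: "?s > 0" using assms by simp
  have t: "0 \<le> \<theta> x y / ?s" using theta_nonneg[OF assms(1,2)] by simp
  then show "1 \<le> 1 + \<theta> x y / ?s" by simp
  have "1 + \<theta> x y / ?s = (?s + \<theta> x y) / ?s" using s by (simp add: add_divide_distrib)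
  also have "\<dots> \<le> 4 / ?s" using s s_plus_theta_le_4[OF assms(1,2)] by (intro divide_right_mono) auto
  finally show "1 + \<theta> x y / ?s \<le> 4 * inverse ?s" by (simp add: divide_inverse)
  show "green x y \<le> \<kappa> * ln (1 + \<theta> x y / ?s)"
    using gf_le_ln[OF t] kappa_pos by (simp add: green_def green_reg_def)
qed

text \<open>As gf(b) <= ln(1 + b), the exponential is at most 1 + b to the power
  \<open>p * \<kappa>\<close>. An exponent of at most 1 leaves a singularity |x - y|^(-2), which is
  integrable in dimension four.\<close>

lemma exp_green_le:
  assumes "norm x \<le> 1" "norm y \<le> 1" "x \<noteq> y" and p: "0 \<le> p" "p * \<kappa> \<le> 1"
  shows "exp (p * green x y) \<le> 4 * inverse ((x - y) \<bullet> (x - y))"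
proof -
  let ?z = "1 + \<theta> x y / ((x - y) \<bullet> (x - y))"
  have z: "?z \<ge> 1" "?z \<le> 4 * inverse ((x - y) \<bullet> (x - y))" by (rule green_le_ln[OF assms(1-3)])+
  have "p * green x y \<le> p * (\<kappa> * ln ?z)" by (intro mult_left_mono green_le_ln assms)
  also have "\<dots> \<le> 1 * ln ?z" unfolding mult.assoc[symmetric] using p z by (intro mult_right_mono) auto
  finally have "exp (p * green x y) \<le> exp (ln ?z)" by simp
  also have "\<dots> = ?z" using z by simp
  finally show ?thesis using z by simp
qed

text \<open>From ln z <= 2 sqrt z: the kernel is square integrable, with a bound that is uniform in
  the position of the pole.\<close>

lemma green_sq_le:
  assumes "norm x \<le> 1" "norm y \<le> 1"
  shows "(green x y)\<^sup>2 \<le> 16 * \<kappa>\<^sup>2 * inverse ((x - y) \<bullet> (x - y))"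
proof (cases "x = y")
  case True
  then show ?thesis by (simp add: green_def green_reg_def)
next
  case False
  let ?z = "1 + \<theta> x y / ((x - y) \<bullet> (x - y))"
  have z: "?z \<ge> 1" "?z \<le> 4 * inverse ((x - y) \<bullet> (x - y))" by (rule green_le_ln[OF assms False])+
  have "ln (sqrt ?z) \<le> sqrt ?z - 1" using z by (intro ln_le_minus_one) auto
  then have "ln ?z \<le> 2 * sqrt ?z" using z by (simp add: ln_sqrt)
  then have "green x y \<le> \<kappa> * (2 * sqrt ?z)"
    using green_le_ln(3)[OF assms False] kappa_pos by (meson mult_left_mono order_trans less_imp_le)
  then have "(green x y)\<^sup>2 \<le> (\<kappa> * (2 * sqrt ?z))\<^sup>2" using green_nonneg[OF assms] by (intro power_mono)
  also have "\<dots> = 4 * \<kappa>\<^sup>2 * ?z" using z by (simp add: power_mult_distrib)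
  also have "\<dots> \<le> 4 * \<kappa>\<^sup>2 * (4 * inverse ((x - y) \<bullet> (x - y)))" using z by (intro mult_left_mono) auto
  finally show ?thesis by simp
qed

lemma borel_inverse_dist_sq[measurable]: "(\<lambda>y::real^4. inverse ((y - x) \<bullet> (y - x))) \<in> borel_measurable borel"
proof -
  have "(\<lambda>y::real^4. (y - x) \<bullet> (y - x)) \<in> borel_measurable borel"
    by (intro borel_measurable_continuous_onI continuous_intros)
  then show ?thesis by (rule borel_measurable_inverse)
qed

lemma rad2_int_nonneg: "rad2_int \<ge> 0" by (simp add: rad2_int_def)

text \<open>The unit ball lies in the ball of radius 2 about x; the factor 4 is 2^2 from the scaling
  of the integral of |z|^(-2).\<close>

lemma nn_integral_kernel_ball:
  assumes "norm (x::real^4) \<le> 1"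
  shows "(\<integral>\<^sup>+y. ennreal (indicator (ball 0 1) y * inverse ((y - x) \<bullet> (y - x))) \<partial>lborel) \<le> ennreal (4 * rad2_int)"
proof -
  have "(\<integral>\<^sup>+y. ennreal (indicator (ball 0 1) y * inverse ((y - x) \<bullet> (y - x))) \<partial>lborel)
     \<le> (\<integral>\<^sup>+y. ennreal (indicator (ball x 2) y * inverse ((y - x) \<bullet> (y - x))) \<partial>lborel)"
  proof (intro nn_integral_mono ennreal_leI mult_right_mono)
    fix y :: "real^4"
    have "dist x y < 2" if "norm y < 1" using that assms norm_triangle_ineq4[of x y] by (simp add: dist_norm)
    then show "indicator (ball 0 1) y \<le> (indicator (ball x 2) y :: real)" by (auto simp: indicator_def)
  qed simp
  also have "\<dots> = ennreal (4 * rad2_int)" using nn_integral_inverse_dist_sq[of 2 x] by simp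
  finally show ?thesis .
qed

lemma integrable_kernel_ball:
  assumes "norm (x::real^4) \<le> 1"
  shows "integrable lborel (\<lambda>y. indicator (ball 0 1) y * inverse ((y - x) \<bullet> (y - x)))"
    and "(LINT y|lborel. indicator (ball 0 1) y * inverse ((y - x) \<bullet> (y - x))) \<le> 4 * rad2_int"
proof -
  have fin: "(\<integral>\<^sup>+y. ennreal (indicator (ball 0 1) y * inverse ((y - x) \<bullet> (y - x))) \<partial>lborel) < \<infinity>"
    by (rule le_less_trans[OF nn_integral_kernel_ball[OF assms]]) simp
  show "integrable lborel (\<lambda>y. indicator (ball 0 1) y * inverse ((y - x) \<bullet> (y - x)))"
    by (rule integrableI_nonneg) (use fin in auto)
  have "(LINT y|lborel. indicator (ball 0 1) y * inverse ((y - x) \<bullet> (y - x))) = enn2real (\<integral>\<^sup>+y. ennreal (indicator (ball 0 1) y * inverse ((y - x) \<bullet> (y - x))) \<partial>lborel)"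
    by (rule integral_eq_nn_integral) auto
  also have "\<dots> \<le> enn2real (ennreal (4 * rad2_int))" by (intro enn2real_mono nn_integral_kernel_ball assms) simp
  finally show "(LINT y|lborel. indicator (ball 0 1) y * inverse ((y - x) \<bullet> (y - x))) \<le> 4 * rad2_int"
    using rad2_int_nonneg by simp
qed

text \<open>Jensen's inequality for the probability density N / m, proved with the tangent line of
  exp at the mean. The right side is a nonnegative integral so that it may be infinite.\<close>

lemma exp_integral_le:
  fixes N g :: "'a \<Rightarrow> real"
  assumes N: "integrable M N" "\<And>x. N x \<ge> 0" and m: "(LINT x|M. N x) = m" "m > 0"
    and g[measurable]: "g \<in> borel_measurable M" and Ng: "integrable M (\<lambda>x. N x * g x)"
  shows "ennreal (exp (LINT x|M. N x * g x)) \<le> (\<integral>\<^sup>+x. ennreal (N x / m * exp (m * g x)) \<partial>M)"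
proof (cases "(\<integral>\<^sup>+x. ennreal (N x / m * exp (m * g x)) \<partial>M) = \<infinity>")
  case False
  have [measurable]: "N \<in> borel_measurable M" using N by auto
  have i: "integrable M (\<lambda>x. N x / m * exp (m * g x))"
    by (rule integrableI_nonneg) (use False N m in \<open>auto simp: less_top\<close>)
  let ?c = "LINT x|M. N x * g x"
  have "exp ?c = (LINT x|M. exp ?c / m * N x + exp ?c * (N x * g x) - exp ?c * ?c / m * N x)"
    using N(1) Ng m by simp
  also have "\<dots> \<le> (LINT x|M. N x / m * exp (m * g x))"
  proof (rule integral_mono)
    show "integrable M (\<lambda>x. exp ?c / m * N x + exp ?c * (N x * g x) - exp ?c * ?c / m * N x)"
      using N(1) Ng by simp
    fix x
    have "1 + (m * g x - ?c) \<le> exp (m * g x - ?c)" by (rule exp_ge_add_one_self)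
    then have "exp ?c * (1 + (m * g x - ?c)) \<le> exp ?c * exp (m * g x - ?c)" by simp
    also have "\<dots> = exp (m * g x)" by (simp flip: exp_add)
    finally have "N x / m * (exp ?c * (1 + (m * g x - ?c))) \<le> N x / m * exp (m * g x)"
      using N(2)[of x] m by (intro mult_left_mono) auto
    moreover have "N x / m * (exp ?c * (1 + (m * g x - ?c))) = exp ?c / m * N x + exp ?c * (N x * g x) - exp ?c * ?c / m * N x"
      using m by (simp add: field_simps)
    ultimately show "exp ?c / m * N x + exp ?c * (N x * g x) - exp ?c * ?c / m * N x \<le> N x / m * exp (m * g x)" by simp
  qed (rule i)
  finally have "ennreal (exp ?c) \<le> ennreal (LINT x|M. N x / m * exp (m * g x))" by (rule ennreal_leI)
  also have "\<dots> = (\<integral>\<^sup>+x. ennreal (N x / m * exp (m * g x)) \<partial>M)"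
    by (rule nn_integral_eq_integral[symmetric, OF i]) (use N m in auto)
  finally show ?thesis .
qed simp

text \<open>Jensen moves the exponential inside the potential, Fubini exchanges the integrals, and
  the smallness condition makes the exponent admissible for \<open>exp_green_le\<close>; this is an
  inequality of Brezis-Merle type. The case distinction in the integrand discards points where the
  Bochner integral takes its default value 0.\<close>

lemma exp_potential_integrable:
  assumes N: "integrable lborel N" "\<And>x. N x \<ge> 0" "\<And>x. x \<notin> ball 0 1 \<Longrightarrow> N x = 0"
    and L: "L \<ge> 0" "L * (LINT x|lborel. N x) * \<kappa> \<le> 1"
  shows "(\<integral>\<^sup>+y. indicator (ball 0 1) y * ennreal (if integrable lborel (\<lambda>x. N x * green x y) then exp (L * (LINT x|lborel. N x * green x y)) else 0) \<partial>lborel) < \<infinity>"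
    (is "(\<integral>\<^sup>+y. ?F y \<partial>lborel) < _")
proof -
  define m where "m = (LINT x|lborel. N x)"
  have m0: "m \<ge> 0" unfolding m_def by (intro integral_nonneg_AE AE_I2 N)
  have [measurable]: "N \<in> borel_measurable borel" using N(1) by auto
  have fin: "emeasure lborel (ball (0::real^4) 1) < \<infinity>" by (rule emeasure_bounded_finite) simp
  show ?thesis
  proof (cases "m = 0")
    case True
    then have "AE x in lborel. N x = 0" using integral_nonneg_eq_0_iff_AE[OF N(1)] N(2) by (simp add: m_def)
    then have "(LINT x|lborel. N x * green x y) = 0" for y
      by (intro integral_eq_zero_AE) (auto elim: eventually_mono)
    then have "(\<integral>\<^sup>+y. ?F y \<partial>lborel) \<le> (\<integral>\<^sup>+y. indicator (ball 0 1) y \<partial>(lborel :: (real^4) measure))"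
      by (intro nn_integral_mono) (auto simp: indicator_def)
    also have "\<dots> < \<infinity>" using fin by simp
    finally show ?thesis .
  next
    case False
    then have m: "m > 0" using m0 by simp
    let ?E = "\<lambda>x y. ennreal (N x / m * exp (m * (L * green x y)))"
    have "?F y \<le> indicator (ball 0 1) y * (\<integral>\<^sup>+x. ?E x y \<partial>lborel)" for y
    proof (cases "integrable lborel (\<lambda>x. N x * green x y)")
      case True
      have "integrable lborel (\<lambda>x. N x * (L * green x y))" "(LINT x|lborel. N x * (L * green x y)) = L * (LINT x|lborel. N x * green x y)"
        using integrable_mult_right[OF True, of L] by (simp_all only: mult.left_commute) simp
      with exp_integral_le[OF N(1,2) m_def[symmetric] m, of "\<lambda>x. L * green x y"] True
      show ?thesis by (auto intro!: mult_left_mono)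
    qed simp
    then have "(\<integral>\<^sup>+y. ?F y \<partial>lborel) \<le> (\<integral>\<^sup>+y. indicator (ball 0 1) y * (\<integral>\<^sup>+x. ?E x y \<partial>lborel) \<partial>lborel)"
      by (intro nn_integral_mono)
    also have "\<dots> = (\<integral>\<^sup>+y. (\<integral>\<^sup>+x. indicator (ball 0 1) y * ?E x y \<partial>lborel) \<partial>lborel)"
      by (subst nn_integral_cmult) auto
    also have "\<dots> = (\<integral>\<^sup>+x. (\<integral>\<^sup>+y. indicator (ball 0 1) y * ?E x y \<partial>lborel) \<partial>lborel)"
      by (rule lborel_pair.Fubini') measurable
    also have "\<dots> \<le> (\<integral>\<^sup>+x. ennreal (N x) * (ennreal (inverse m) * ennreal (4 * (4 * rad2_int))) \<partial>lborel)"
    proof (rule nn_integral_mono)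
      fix x
      show "(\<integral>\<^sup>+y. indicator (ball 0 1) y * ?E x y \<partial>lborel) \<le> ennreal (N x) * (ennreal (inverse m) * ennreal (4 * (4 * rad2_int)))"
      proof (cases "norm x < 1")
        case True
        then have x: "norm x \<le> 1" by simp
        have "(\<integral>\<^sup>+y. indicator (ball 0 1) y * ?E x y \<partial>lborel) \<le> (\<integral>\<^sup>+y. ennreal (N x / m) * (ennreal 4 * ennreal (indicator (ball 0 1) y * inverse ((y - x) \<bullet> (y - x)))) \<partial>lborel)"
        proof (rule nn_integral_mono_AE)
          show "AE y in lborel. indicator (ball 0 1) y * ?E x y \<le> ennreal (N x / m) * (ennreal 4 * ennreal (indicator (ball 0 1) y * inverse ((y - x) \<bullet> (y - x))))"
            using AE_lborel_singleton[of x]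
          proof eventually_elim
            case (elim y)
            show ?case
            proof (cases "y \<in> ball 0 1")
              case y: True
              have "exp (m * (L * green x y)) = exp ((L * m) * green x y)" by (simp add: mult_ac)
              also have "\<dots> \<le> 4 * inverse ((x - y) \<bullet> (x - y))"
                by (rule exp_green_le) (use x y elim L m in \<open>auto simp: m_def\<close>)
              also have "(x - y) \<bullet> (x - y) = (y - x) \<bullet> (y - x)" by (simp add: inner_diff_left inner_diff_right inner_commute)
              finally have "?E x y \<le> ennreal (N x / m * (4 * inverse ((y - x) \<bullet> (y - x))))"
                using N(2)[of x] m by (intro ennreal_leI mult_left_mono) auto
              moreover have "0 \<le> N x / m" "0 \<le> (4::real)" using N(2)[of x] m by auto
              then have "ennreal (N x / m * (4 * inverse ((y - x) \<bullet> (y - x)))) = ennreal (N x / m) * (ennreal 4 * ennreal (inverse ((y - x) \<bullet> (y - x))))"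
                by (simp only: ennreal_mult')
              ultimately show ?thesis using y by (simp only: indicator_simps mult_1_left if_True)
            qed simp
          qed
        qed
        also have "\<dots> = ennreal (N x / m) * (ennreal 4 * (\<integral>\<^sup>+y. ennreal (indicator (ball 0 1) y * inverse ((y - x) \<bullet> (y - x))) \<partial>lborel))"
        proof -
          have k: "(\<lambda>y. ennreal (indicator (ball 0 1) y * inverse ((y - x) \<bullet> (y - x)))) \<in> borel_measurable lborel" by measurable
          then have k2: "(\<lambda>y. ennreal 4 * ennreal (indicator (ball 0 1) y * inverse ((y - x) \<bullet> (y - x)))) \<in> borel_measurable lborel" by measurable
          show ?thesis unfolding nn_integral_cmult[OF k2] nn_integral_cmult[OF k] by (rule refl)
        qed
        also have "\<dots> \<le> ennreal (N x / m) * (ennreal 4 * ennreal (4 * rad2_int))"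
          by (intro mult_left_mono nn_integral_kernel_ball x) auto
        also have "\<dots> = ennreal (N x) * (ennreal (inverse m) * ennreal (4 * (4 * rad2_int)))"
        proof -
          have "ennreal (4 * (4 * rad2_int)) = ennreal 4 * ennreal (4 * rad2_int)" by (rule ennreal_mult') simp
          then show ?thesis by (simp only: divide_inverse ennreal_mult'[OF N(2)] mult.assoc)
        qed
        finally show ?thesis .
      next
        case False
        then have "N x = 0" using N(3)[of x] by simp
        then show ?thesis by simp
      qed
    qed
    also have "\<dots> = (\<integral>\<^sup>+x. ennreal (N x) \<partial>lborel) * (ennreal (inverse m) * ennreal (4 * (4 * rad2_int)))"
      by (rule nn_integral_multc) measurable
    also have "(\<integral>\<^sup>+x. ennreal (N x) \<partial>lborel) = ennreal m"
      unfolding m_def by (rule nn_integral_eq_integral[OF N(1)]) (use N in auto)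
    also have "ennreal m * (ennreal (inverse m) * ennreal (4 * (4 * rad2_int))) < \<infinity>"
      by (simp add: ennreal_mult_less_top)
    finally show ?thesis .
  qed
qed

section \<open>Uniform integral bounds\<close>

text \<open>The hypotheses in the form in which the estimates consume them. \<open>H_lower\<close>
  is confined to smaller concentric balls, as the coefficient may tend to 0 at the sphere;
  \<open>f_exp\<close> is the integrated form of f'/f -> l; \<open>H_refl\<close> combines both
  parts of (H3) for planes at height at least \<open>lam0\<close>.\<close>

locale unit_problem =
  fixes H :: "real^4 \<Rightarrow> real \<Rightarrow> real" and f :: "real \<Rightarrow> real" and l M lam0 :: real
  assumes H_nonneg: "\<And>x t. x \<in> ball 0 1 \<Longrightarrow> H x t \<ge> 0"
    and H_bounded: "\<And>\<tau>. \<exists>C. AE x in lborel. x \<in> ball 0 1 \<longrightarrow> (\<forall>t\<in>{0..\<tau>}. H x t \<le> C)"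
    and H_upper: "\<exists>A>0. \<exists>T. \<forall>x\<in>ball 0 1. \<forall>t\<ge>T. H x t \<le> A * f t"
    and H_lower: "\<And>\<rho>. \<rho> < 1 \<Longrightarrow> \<exists>a>0. \<exists>T. \<forall>x\<in>cball 0 \<rho>. \<forall>t\<ge>T. a * f t \<le> H x t"
    and M: "M > 0" and f_pos: "\<And>t. t \<ge> M \<Longrightarrow> f t > 0" and f_mono: "\<And>s t. M \<le> s \<Longrightarrow> s \<le> t \<Longrightarrow> f s \<le> f t"
    and f_super: "filterlim (\<lambda>t. f t / t) at_top at_top"
    and l: "l \<ge> 0" and f_exp: "\<And>\<epsilon>. \<epsilon> > 0 \<Longrightarrow> \<exists>T\<ge>M. \<forall>s t. T \<le> s \<longrightarrow> s \<le> t \<longrightarrow>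
       f s * exp ((l - \<epsilon>) * (t - s)) \<le> f t \<and> f t \<le> f s * exp ((l + \<epsilon>) * (t - s))"
    and lam0: "0 < lam0" "lam0 < 1"
    and H_refl: "\<And>e m y s t. norm e = 1 \<Longrightarrow> lam0 \<le> m \<Longrightarrow> norm y < 1 \<Longrightarrow> m < y \<bullet> e \<Longrightarrow> 0 \<le> s \<Longrightarrow> s \<le> t \<Longrightarrow>
       H y s \<le> H (y - (2 * (y \<bullet> e - m)) *\<^sub>R e) t"
begin

text \<open>A solution in its continuous version: \<open>u\<close> is given at every point of the
  closed ball by the Green potential of a Borel density, and the equation couples the two almost
  everywhere. The bound on \<open>N\<close> is qualitative: it depends on the solution and serves
  only continuity and the exchange of integrals.\<close>

definition sol :: "(real^4 \<Rightarrow> real) \<Rightarrow> (real^4 \<Rightarrow> real) \<Rightarrow> bool" where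
  "sol u N \<longleftrightarrow> N \<in> borel_measurable borel \<and> (\<forall>x. 0 \<le> N x) \<and> (\<forall>x. x \<notin> ball 0 1 \<longrightarrow> N x = 0) \<and> (\<exists>K. \<forall>x. N x \<le> K) \<and>
     (\<forall>x. norm x \<le> 1 \<longrightarrow> u x = (LINT y|lborel. N y * green y x)) \<and> (\<forall>x. norm x > 1 \<longrightarrow> u x = 0) \<and>
     (AE x in lborel. x \<in> ball 0 1 \<longrightarrow> N x = H x (u x)) \<and> weak_pair (\<lambda>x. indicator (ball 0 1) x * u x) N"

lemma H_growth: "\<exists>C\<ge>0. AE x in lborel. x \<in> ball 0 1 \<longrightarrow> (\<forall>t\<ge>0. H x t \<le> C * exp ((l + 1) * t))"
proof -
  obtain A T1 where A: "A > 0" "\<And>x t. x \<in> ball 0 1 \<Longrightarrow> t \<ge> T1 \<Longrightarrow> H x t \<le> A * f t" using H_upper by blast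
  obtain T2 where T2: "T2 \<ge> M" "\<And>s t. T2 \<le> s \<Longrightarrow> s \<le> t \<Longrightarrow> f t \<le> f s * exp ((l + 1) * (t - s))"
    using f_exp[of 1] by auto
  define T where "T = max T1 T2"
  have T0: "T \<ge> 0" using T2 M by (auto simp: T_def)
  obtain C where C: "AE x in lborel. x \<in> ball 0 1 \<longrightarrow> (\<forall>t\<in>{0..T}. H x t \<le> C)" using H_bounded by blast
  have fT: "f T2 > 0" using f_pos T2 by simp
  define D where "D = max (max C 0) (A * f T2)"
  have "AE x in lborel. x \<in> ball 0 1 \<longrightarrow> (\<forall>t\<ge>0. H x t \<le> D * exp ((l + 1) * t))"
    using C
  proof eventually_elim
    case (elim x)
    show ?case
    proof (intro impI allI)
      fix t :: real assume x: "x \<in> ball 0 1" and t: "t \<ge> 0"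
      have e1: "exp ((l + 1) * t) \<ge> 1" using t l by simp
      show "H x t \<le> D * exp ((l + 1) * t)"
      proof (cases "t \<le> T")
        case True
        then have "H x t \<le> C" using elim x t by auto
        also have "C \<le> D * 1" by (simp add: D_def)
        also have "\<dots> \<le> D * exp ((l + 1) * t)" using e1 by (intro mult_left_mono) (auto simp: D_def)
        finally show ?thesis .
      next
        case False
        then have "H x t \<le> A * f t" using A(2)[OF x] by (auto simp: T_def)
        also have "\<dots> \<le> A * (f T2 * exp ((l + 1) * (t - T2)))" using T2(2)[of T2 t] False A(1) by (intro mult_left_mono) (auto simp: T_def)
        also have "\<dots> \<le> (A * f T2) * exp ((l + 1) * t)"
        proof -
          have "(l + 1) * (t - T2) \<le> (l + 1) * t" using T2(1) M l by (intro mult_left_mono) auto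
          then have "f T2 * exp ((l + 1) * (t - T2)) \<le> f T2 * exp ((l + 1) * t)" using fT by simp
          then show ?thesis using A(1) by (simp add: mult.assoc)
        qed
        also have "\<dots> \<le> D * exp ((l + 1) * t)" by (intro mult_right_mono) (auto simp: D_def)
        finally show ?thesis .
      qed
    qed
  qed
  then show ?thesis by (intro exI[of _ D]) (auto simp: D_def)
qed

text \<open>\<open>N\<close> is split into a bounded part, whose potential is bounded, and a tail of
  small mass, whose potential has an integrable exponential at the rate needed. As H grows at most
  like exp((l + 1) t), \<open>N\<close> is square integrable; since the kernel is in L^2 uniformly,
  \<open>U\<close> and then \<open>N\<close> are bounded.\<close>

lemma bounded_density:
  assumes wp: "weak_pair U N" and NH: "AE x in lborel. x \<in> ball 0 1 \<longrightarrow> N x = H x (U x)"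
  shows "\<exists>K. AE x in lborel. N x \<le> K"
proof -
  have [measurable]: "U \<in> borel_measurable borel" "N \<in> borel_measurable borel"
    and out: "\<And>x. x \<notin> ball 0 1 \<Longrightarrow> U x = 0" "\<And>x. x \<notin> ball 0 1 \<Longrightarrow> N x = 0" and N0: "\<And>x. N x \<ge> 0" 
    and Ui: "integrable lborel U" and NU: "integrable lborel (\<lambda>x. N x * U x)"
    using wp by (auto simp: weak_pair_def)
  have rep: "AE y in lborel. y \<in> ball 0 1 \<longrightarrow> integrable lborel (\<lambda>x. N x * green x y) \<and> U y = (LINT x|lborel. N x * green x y) \<and> U y \<ge> 0"
    by (rule green_representation[OF wp])
  have fin: "emeasure lborel (ball (0::real^4) 1) < \<infinity>" by (rule emeasure_bounded_finite) simp
  then have Bi: "integrable lborel (\<lambda>x::real^4. indicator (ball 0 1) x * c)" for c :: real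
    by (simp add: integrable_real_indicator)
  obtain C1 where C1: "AE x in lborel. x \<in> ball 0 1 \<longrightarrow> (\<forall>t\<in>{0..1}. H x t \<le> C1)" using H_bounded by blast
  \<comment> \<open>Where \<open>U\<close> is at most 1 the density is bounded by
    \<open>H_bounded\<close>; where it exceeds 1, the density is at most
    \<open>N x * U x\<close>.\<close>
  have Ni: "integrable lborel N"
  proof (rule Bochner_Integration.integrable_bound)
    show "integrable lborel (\<lambda>x. indicator (ball 0 1) x * \<bar>C1\<bar> + \<bar>N x * U x\<bar>)" using Bi NU by auto
    show "AE x in lborel. norm (N x) \<le> norm (indicator (ball 0 1) x * \<bar>C1\<bar> + \<bar>N x * U x\<bar>)"
      using rep C1 NH
    proof eventually_elim
      case (elim x)
      show ?case
      proof (cases "x \<in> ball 0 1")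
        case True
        then have U0: "U x \<ge> 0" using elim by auto
        show ?thesis
        proof (cases "U x \<le> 1")
          case u: True
          then have "N x \<le> C1" using elim True U0 by auto
          then have "N x \<le> \<bar>C1\<bar> + \<bar>N x * U x\<bar>" by linarith
          then show ?thesis using True N0[of x] by simp
        next
          case False
          then have "N x * 1 \<le> N x * U x" using N0[of x] by (intro mult_left_mono) auto
          then show ?thesis using True N0[of x] U0 by simp
        qed
      qed (use out in auto)
    qed
  qed measurable
  obtain C where C: "C \<ge> 0" "AE x in lborel. x \<in> ball 0 1 \<longrightarrow> (\<forall>t\<ge>0. H x t \<le> C * exp ((l + 1) * t))"
    using H_growth by blast
  \<comment> \<open>The factor 2 comes from squaring the growth bound exp((l + 1) t).\<close>
  define L where "L = 2 * (l + 1)"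
  have L: "L > 0" using l by (simp add: L_def)
  define N2 where "N2 n x = N x - min (N x) (real n)" for n x
  have N2m[measurable]: "N2 n \<in> borel_measurable borel" for n unfolding N2_def by measurable
  have N2b: "0 \<le> N2 n x" "N2 n x \<le> N x" for n x using N0[of x] by (auto simp: N2_def)
  have N2i: "integrable lborel (N2 n)" for n
    by (rule Bochner_Integration.integrable_bound[OF Ni]) (use N2b N0 in auto)
  have "(\<lambda>n. LINT x|lborel. N2 n x) \<longlonglongrightarrow> (LINT x|(lborel :: (real^4) measure). 0)"
  proof (rule integral_dominated_convergence[where w=N])
    show "AE x in lborel. (\<lambda>n. N2 n x) \<longlonglongrightarrow> 0"
    proof (rule AE_I2, rule tendsto_eventually)
      fix x
      obtain n0 :: nat where "N x \<le> real n0" using real_arch_simple by blast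
      then show "\<forall>\<^sub>F n in sequentially. N2 n x = 0"
        by (intro eventually_mono[OF eventually_ge_at_top[of n0]]) (auto simp: N2_def min_def)
    qed
  qed (use Ni N2b N0 in auto)
  then have "(\<lambda>n. LINT x|lborel. N2 n x) \<longlonglongrightarrow> 0" by simp
  moreover have "1 / (L * \<kappa>) > 0" using L kappa_pos by simp
  ultimately have "\<forall>\<^sub>F n in sequentially. (LINT x|lborel. N2 n x) < 1 / (L * \<kappa>)" by (rule order_tendstoD(2))
  then obtain n where n: "(LINT x|lborel. N2 n x) < 1 / (L * \<kappa>)" by (auto dest: eventually_happens)
  have small: "L * (LINT x|lborel. N2 n x) * \<kappa> \<le> 1"
    using n L kappa_pos by (simp add: pos_less_divide_eq mult_ac less_imp_le)
  let ?v = "\<lambda>y. LINT x|lborel. N2 n x * green x y"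
  have ex: "(\<integral>\<^sup>+y. indicator (ball 0 1) y * ennreal (if integrable lborel (\<lambda>x. N2 n x * green x y) then exp (L * ?v y) else 0) \<partial>lborel) < \<infinity>"
    by (rule exp_potential_integrable[OF N2i N2b(1) _ _ small]) (use out N2b L in \<open>auto simp: N2_def\<close>)
  \<comment> \<open>A bound for the potential of the part of \<open>N\<close> truncated at n, from
    the crude kernel bound |x - y|^(-2).\<close>
  define D where "D = real n * (\<kappa> * (4 * rad2_int))"
  have UD: "AE y in lborel. y \<in> ball 0 1 \<longrightarrow> integrable lborel (\<lambda>x. N2 n x * green x y) \<and> U y \<le> D + ?v y"
    using rep
  proof eventually_elim
    case (elim y)
    show ?case
    proof
      assume y: "y \<in> ball 0 1"
      then have y1: "norm y \<le> 1" by simp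
      have i: "integrable lborel (\<lambda>x. N x * green x y)" and Uy: "U y = (LINT x|lborel. N x * green x y)" using elim y by auto
      have g0: "0 \<le> green x y" if "x \<in> ball 0 1" for x using green_nonneg[of x y] that y1 by simp
      have i2: "integrable lborel (\<lambda>x. N2 n x * green x y)"
      proof (rule Bochner_Integration.integrable_bound[OF i])
        show "AE x in lborel. norm (N2 n x * green x y) \<le> norm (N x * green x y)"
          using N2b by (intro AE_I2) (auto simp: abs_mult N0 intro!: mult_right_mono)
      qed measurable
      have ik: "integrable lborel (\<lambda>x. real n * (\<kappa> * (indicator (ball 0 1) x * inverse ((x - y) \<bullet> (x - y)))))"
        using integrable_kernel_ball(1)[OF y1] by simp
      have "(LINT x|lborel. N x * green x y - N2 n x * green x y) \<le> (LINT x|lborel. real n * (\<kappa> * (indicator (ball 0 1) x * inverse ((x - y) \<bullet> (x - y)))))"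
      proof (rule integral_mono[OF _ ik])
        show "integrable lborel (\<lambda>x. N x * green x y - N2 n x * green x y)" using i i2 by simp
        fix x
        show "N x * green x y - N2 n x * green x y \<le> real n * (\<kappa> * (indicator (ball 0 1) x * inverse ((x - y) \<bullet> (x - y))))"
        proof (cases "x \<in> ball 0 1")
          case True
          have "N x * green x y - N2 n x * green x y = min (N x) (real n) * green x y" by (simp add: N2_def algebra_simps)
          also have "\<dots> \<le> real n * (\<kappa> * inverse ((x - y) \<bullet> (x - y)))"
            using True y1 g0[OF True] green_le_inverse[of x y] N0[of x] by (intro mult_mono) auto
          finally show ?thesis using True by simp
        qed (simp add: out N2_def)
      qed
      also have "\<dots> \<le> D" unfolding D_def using integrable_kernel_ball(2)[OF y1] kappa_pos by (simp add: mult_left_mono)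
      finally show "integrable lborel (\<lambda>x. N2 n x * green x y) \<and> U y \<le> D + ?v y" using i i2 Uy by simp
    qed
  qed
  have N2bound: "AE y in lborel. ennreal ((N y)\<^sup>2) \<le> ennreal (C\<^sup>2 * exp (L * D)) * (indicator (ball 0 1) y * ennreal (if integrable lborel (\<lambda>x. N2 n x * green x y) then exp (L * ?v y) else 0))"
    using UD NH C(2) rep
  proof eventually_elim
    case (elim y)
    show ?case
    proof (cases "y \<in> ball 0 1")
      case True
      then have i: "integrable lborel (\<lambda>x. N2 n x * green x y)" and Uv: "U y \<le> D + ?v y" and U0: "U y \<ge> 0"
        and N: "N y \<le> C * exp ((l + 1) * U y)" using elim by auto
      have "(N y)\<^sup>2 \<le> (C * exp ((l + 1) * U y))\<^sup>2" using N N0 by (intro power_mono)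
      also have "\<dots> = C\<^sup>2 * exp (L * U y)" by (simp add: power_mult_distrib L_def algebra_simps flip: exp_of_nat_mult)
      also have "\<dots> \<le> C\<^sup>2 * exp (L * D + L * ?v y)"
        using Uv L by (intro mult_left_mono) (auto simp flip: distrib_left)
      also have "\<dots> = C\<^sup>2 * exp (L * D) * exp (L * ?v y)" by (simp add: exp_add)
      finally have "ennreal ((N y)\<^sup>2) \<le> ennreal (C\<^sup>2 * exp (L * D) * exp (L * ?v y))" by (rule ennreal_leI)
      then show ?thesis using True i by (simp add: ennreal_mult)
    qed (simp add: out)
  qed
  have vm: "(\<lambda>y. indicator (ball 0 1) y * ennreal (if integrable lborel (\<lambda>x. N2 n x * green x y) then exp (L * ?v y) else 0)) \<in> borel_measurable borel"
    by measurable
  have "(\<integral>\<^sup>+y. ennreal ((N y)\<^sup>2) \<partial>lborel) \<le> (\<integral>\<^sup>+y. ennreal (C\<^sup>2 * exp (L * D)) * (indicator (ball 0 1) y * ennreal (if integrable lborel (\<lambda>x. N2 n x * green x y) then exp (L * ?v y) else 0)) \<partial>lborel)"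
    by (rule nn_integral_mono_AE[OF N2bound])
  also have "\<dots> = ennreal (C\<^sup>2 * exp (L * D)) * (\<integral>\<^sup>+y. indicator (ball 0 1) y * ennreal (if integrable lborel (\<lambda>x. N2 n x * green x y) then exp (L * ?v y) else 0) \<partial>lborel)"
    by (rule nn_integral_cmult) (use vm in simp)
  also have "\<dots> < \<infinity>" using ex by (simp add: ennreal_mult_less_top)
  finally have Nsq: "integrable lborel (\<lambda>y. (N y)\<^sup>2)" by (intro integrableI_nonneg) auto
  \<comment> \<open>This comes from 2 N G <= N^2 + G^2 and the uniform square integrability of the
    kernel.\<close>
  define K where "K = ((LINT y|lborel. (N y)\<^sup>2) + 16 * \<kappa>\<^sup>2 * (4 * rad2_int)) / 2"
  have UK: "AE y in lborel. y \<in> ball 0 1 \<longrightarrow> 0 \<le> U y \<and> U y \<le> K"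
    using rep
  proof eventually_elim
    case (elim y)
    show ?case
    proof
      assume y: "y \<in> ball 0 1"
      then have y1: "norm y \<le> 1" by simp
      have i: "integrable lborel (\<lambda>x. N x * green x y)" and Uy: "U y = (LINT x|lborel. N x * green x y)" using elim y by auto
      note k = integrable_kernel_ball[OF y1]
      have "U y \<le> (LINT x|lborel. ((N x)\<^sup>2 + 16 * \<kappa>\<^sup>2 * (indicator (ball 0 1) x * inverse ((x - y) \<bullet> (x - y)))) / 2)"
        unfolding Uy
      proof (rule integral_mono[OF i])
        show "integrable lborel (\<lambda>x. ((N x)\<^sup>2 + 16 * \<kappa>\<^sup>2 * (indicator (ball 0 1) x * inverse ((x - y) \<bullet> (x - y)))) / 2)"
          using Nsq k by simp
        fix x
        show "N x * green x y \<le> ((N x)\<^sup>2 + 16 * \<kappa>\<^sup>2 * (indicator (ball 0 1) x * inverse ((x - y) \<bullet> (x - y)))) / 2"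
        proof (cases "x \<in> ball 0 1")
          case True
          have "2 * (N x * green x y) \<le> (N x)\<^sup>2 + (green x y)\<^sup>2"
            using zero_le_power2[of "N x - green x y"] by (simp add: power2_eq_square algebra_simps)
          then show ?thesis using True green_sq_le[of x y] y1 by simp
        qed (simp add: out)
      qed
      also have "\<dots> = ((LINT y|lborel. (N y)\<^sup>2) + 16 * \<kappa>\<^sup>2 * (LINT x|lborel. indicator (ball 0 1) x * inverse ((x - y) \<bullet> (x - y)))) / 2"
        using Nsq k(1) by simp
      also have "\<dots> \<le> K" unfolding K_def using k(2) by (intro divide_right_mono add_left_mono mult_left_mono) auto
      finally show "0 \<le> U y \<and> U y \<le> K" using elim y by auto
    qed
  qed
  obtain C2 where C2: "AE x in lborel. x \<in> ball 0 1 \<longrightarrow> (\<forall>t\<in>{0..K}. H x t \<le> C2)" using H_bounded by blast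
  have "AE x in lborel. N x \<le> max C2 0"
    using UK C2 NH by eventually_elim (use out in \<open>auto simp: le_max_iff_disj\<close>)
  then show ?thesis by blast
qed

text \<open>Truncating the density at its essential bound and redefining the function as a potential
  changes both only on null sets.\<close>

lemma weak_pair_sol:
  assumes wp: "weak_pair U N" and NH: "AE x in lborel. x \<in> ball 0 1 \<longrightarrow> N x = H x (U x)"
  shows "\<exists>u N'. sol u N' \<and> (AE x in lborel. x \<in> ball 0 1 \<longrightarrow> U x = u x)"
proof -
  have m[measurable]: "U \<in> borel_measurable borel" "N \<in> borel_measurable borel"
    and out: "\<And>x. x \<notin> ball 0 1 \<Longrightarrow> U x = 0" "\<And>x. x \<notin> ball 0 1 \<Longrightarrow> N x = 0" and N0: "\<And>x. N x \<ge> 0" 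
    and Ui: "integrable lborel U" and NU: "integrable lborel (\<lambda>x. N x * U x)"
    using wp by (auto simp: weak_pair_def)
  obtain K where K: "AE x in lborel. N x \<le> K" using bounded_density[OF wp NH] by blast
  define N' where "N' x = min (N x) \<bar>K\<bar>" for x
  have N'E: "AE x in lborel. N' x = N x" using K by eventually_elim (auto simp: N'_def)
  have N'm[measurable]: "N' \<in> borel_measurable borel" unfolding N'_def by measurable
  define u where "u x = (if norm x \<le> 1 then LINT y|lborel. N' y * green y x else 0)" for x
  have um[measurable]: "u \<in> borel_measurable borel" unfolding u_def by measurable
  have NN: "(LINT y|lborel. N' y * v y) = (LINT y|lborel. N y * v y)" "integrable lborel (\<lambda>y. N' y * v y) \<longleftrightarrow> integrable lborel (\<lambda>y. N y * v y)"
    if v[measurable]: "v \<in> borel_measurable borel" for v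
  proof -
    have e: "AE y in lborel. N' y * v y = N y * v y" using N'E by eventually_elim simp
    show "(LINT y|lborel. N' y * v y) = (LINT y|lborel. N y * v y)" by (rule integral_cong_AE[OF _ _ e]) measurable
    show "integrable lborel (\<lambda>y. N' y * v y) \<longleftrightarrow> integrable lborel (\<lambda>y. N y * v y)" by (rule integrable_cong_AE[OF _ _ e]) measurable
  qed
  have uU: "AE x in lborel. x \<in> ball 0 1 \<longrightarrow> U x = u x"
    using green_representation[OF wp] by eventually_elim (auto simp: u_def NN(1))
  have uU2: "AE x in lborel. indicator (ball 0 1) x * u x = U x"
    using uU by eventually_elim (use out in \<open>auto simp: indicator_def\<close>)
  have "weak_pair (\<lambda>x. indicator (ball 0 1) x * u x) N'"
    unfolding weak_pair_def
  proof (intro conjI allI impI)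
    show "indicator (ball 0 1) x * u x = 0" "N' x = 0" if "x \<notin> ball 0 1" for x using that out by (auto simp: N'_def)
    show "0 \<le> N' x" for x using N0 by (simp add: N'_def)
    show "integrable lborel (\<lambda>x. indicator (ball 0 1) x * u x)"
      using Ui by (subst integrable_cong_AE[OF _ _ uU2]) auto
    have e: "AE x in lborel. N' x * (indicator (ball 0 1) x * u x) = N x * U x" using N'E uU2 by eventually_elim simp
    show "integrable lborel (\<lambda>x. N' x * (indicator (ball 0 1) x * u x))"
      using NU by (subst integrable_cong_AE[OF _ _ e]) auto
    fix \<phi> :: "real^4 \<Rightarrow> real" and C :: real
    assume A: "smooth \<phi> \<and> C \<ge> 0 \<and> (\<forall>x\<in>ball 0 1. 0 \<le> \<phi> x \<and> \<phi> x \<le> C * (1 - x \<bullet> x)\<^sup>2 \<and> (\<forall>i. \<bar>pderiv_at i \<phi> x\<bar> \<le> C * (1 - x \<bullet> x)))"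
    have pm[measurable]: "\<phi> \<in> borel_measurable borel" "lap (lap \<phi>) \<in> borel_measurable borel"
      using A by (auto intro!: smooth_borel smooth_lap)
    have B: "integrable lborel (\<lambda>x. N x * \<phi> x)" "(LINT x|lborel. U x * lap (lap \<phi>) x) = (LINT x|lborel. N x * \<phi> x)"
      using wp A unfolding weak_pair_def by blast+
    show "integrable lborel (\<lambda>x. N' x * \<phi> x)" using B(1) NN(2)[OF pm(1)] by simp
    have "(LINT x|lborel. indicator (ball 0 1) x * u x * lap (lap \<phi>) x) = (LINT x|lborel. U x * lap (lap \<phi>) x)"
    proof (rule integral_cong_AE)
      show "AE x in lborel. indicator (ball 0 1) x * u x * lap (lap \<phi>) x = U x * lap (lap \<phi>) x" using uU2 by eventually_elim simp
    qed measurable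
    then show "(LINT x|lborel. indicator (ball 0 1) x * u x * lap (lap \<phi>) x) = (LINT x|lborel. N' x * \<phi> x)"
      using B(2) NN(1)[OF pm(1)] by simp
  qed measurable
  moreover have "AE x in lborel. x \<in> ball 0 1 \<longrightarrow> N' x = H x (u x)"
    using uU N'E NH by eventually_elim auto
  moreover have "N' x \<le> \<bar>K\<bar>" "0 \<le> N' x" "x \<notin> ball 0 1 \<Longrightarrow> N' x = 0" for x using N0[of x] out(2)[of x] by (auto simp: N'_def)
  ultimately have "sol u N'" unfolding sol_def using N'm by (auto simp: u_def)
  then show ?thesis using uU by blast
qed

end

section \<open>Polynomial test functions, continuity of potentials and uniform integral
  bounds\<close>

lemma radial_derivs:
  fixes F F1 F2 :: "real \<Rightarrow> real"
  assumes F: "\<And>t. (F has_real_derivative F1 t) (at t)" and F1: "\<And>t. (F1 has_real_derivative F2 t) (at t)"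
  shows "lap (\<lambda>x::real^4. F (x \<bullet> x)) = (\<lambda>x. 4 * (x \<bullet> x) * F2 (x \<bullet> x) + 8 * F1 (x \<bullet> x))"
    and "pderiv_at i (\<lambda>x::real^4. F (x \<bullet> x)) x = F1 (x \<bullet> x) * (2 * x $ i)"
proof -
  have s: "smooth (\<lambda>x::real^4. x \<bullet> x)" using smooth_dist_sq[of "0::real^4"] by simp
  have g: "grad2 (\<lambda>x::real^4. x \<bullet> x) (\<lambda>x. x \<bullet> x) x = 4 * (x \<bullet> x)" "lap (\<lambda>x::real^4. x \<bullet> x) x = 8" for x
    using grad2_dist_sq[of "0::real^4" x] lap_dist_sq[of "0::real^4" x] by simp_all
  show "lap (\<lambda>x::real^4. F (x \<bullet> x)) = (\<lambda>x. 4 * (x \<bullet> x) * F2 (x \<bullet> x) + 8 * F1 (x \<bullet> x))"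
    unfolding lap_compose[OF F F1 s] g by (simp add: mult_ac)
  show "pderiv_at i (\<lambda>x::real^4. F (x \<bullet> x)) x = F1 (x \<bullet> x) * (2 * x $ i)"
    using pderiv_at_compose(1)[OF F smooth_differentiable[OF s]] pderiv_at_dist_sq[of i "0::real^4"] by simp
qed

lemma smooth_radial_poly: "smooth (\<lambda>x::real^4. (1 - x \<bullet> x) ^ 2)" "smooth (\<lambda>x::real^4. (1 - x \<bullet> x) ^ 2 * (2 - x \<bullet> x))"
proof -
  have s: "smooth (\<lambda>x::real^4. x \<bullet> x)" using smooth_dist_sq[of "0::real^4"] by simp
  show "smooth (\<lambda>x::real^4. (1 - x \<bullet> x) ^ 2)" "smooth (\<lambda>x::real^4. (1 - x \<bullet> x) ^ 2 * (2 - x \<bullet> x))"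
    by (intro smooth_mult smooth_power smooth_diff smooth_const s)+
qed

text \<open>The constant bi-Laplacian converts the weighted mass of the density into the integral of
  the solution.\<close>

lemma test_poly1: "lap (lap (\<lambda>x::real^4. (1 - x \<bullet> x) ^ 2)) x = 192"
  "pderiv_at i (\<lambda>x::real^4. (1 - x \<bullet> x) ^ 2) x = - 2 * (1 - x \<bullet> x) * (2 * x $ i)"
proof -
  have 1: "((\<lambda>t. (1 - t) ^ 2) has_real_derivative - 2 * (1 - t)) (at t)" "((\<lambda>t. - 2 * (1 - t)) has_real_derivative 2) (at t)" for t :: real
    by (auto intro!: derivative_eq_intros)
  have 2: "((\<lambda>t. 24 * t - 16) has_real_derivative 24) (at t)" "((\<lambda>t. 24) has_real_derivative 0) (at t)" for t :: real
    by (auto intro!: derivative_eq_intros)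
  have "lap (\<lambda>x::real^4. (1 - x \<bullet> x) ^ 2) = (\<lambda>x. 24 * (x \<bullet> x) - 16)"
    unfolding radial_derivs(1)[OF 1] by (simp add: algebra_simps)
  then show "lap (lap (\<lambda>x::real^4. (1 - x \<bullet> x) ^ 2)) x = 192"
    using radial_derivs(1)[OF 2] by simp
  show "pderiv_at i (\<lambda>x::real^4. (1 - x \<bullet> x) ^ 2) x = - 2 * (1 - x \<bullet> x) * (2 * x $ i)"
    by (rule radial_derivs(2)[OF 1])
qed

text \<open>The test function is positive in the ball while its bi-Laplacian is negative for |x|^2 >
  2/3. Values of u near the sphere therefore enter with a favourable sign, and the estimate closes
  on a concentric ball, where \<open>H_lower\<close> holds.\<close>

lemma test_poly2: "lap (lap (\<lambda>x::real^4. (1 - x \<bullet> x) ^ 2 * (2 - x \<bullet> x))) x = 768 - 1152 * (x \<bullet> x)"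
  "pderiv_at i (\<lambda>x::real^4. (1 - x \<bullet> x) ^ 2 * (2 - x \<bullet> x)) x = ((1 - x \<bullet> x) * (3 * (x \<bullet> x) - 5)) * (2 * x $ i)"
proof -
  have 1: "((\<lambda>t. (1 - t) ^ 2 * (2 - t)) has_real_derivative (1 - t) * (3 * t - 5)) (at t)"
     "((\<lambda>t. (1 - t) * (3 * t - 5)) has_real_derivative 8 - 6 * t) (at t)" for t :: real
    by (auto intro!: derivative_eq_intros simp: power2_eq_square algebra_simps)
  have 2: "((\<lambda>t. 96 * t - 48 * t ^ 2 - 40) has_real_derivative 96 - 96 * t) (at t)" "((\<lambda>t. 96 - 96 * t) has_real_derivative - 96) (at t)" for t :: real
    by (auto intro!: derivative_eq_intros)
  have "lap (\<lambda>x::real^4. (1 - x \<bullet> x) ^ 2 * (2 - x \<bullet> x)) = (\<lambda>x. 96 * (x \<bullet> x) - 48 * (x \<bullet> x) ^ 2 - 40)"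
    unfolding radial_derivs(1)[OF 1] by (simp add: power2_eq_square algebra_simps)
  then show "lap (lap (\<lambda>x::real^4. (1 - x \<bullet> x) ^ 2 * (2 - x \<bullet> x))) x = 768 - 1152 * (x \<bullet> x)"
    using radial_derivs(1)[OF 2] by (simp add: algebra_simps)
  show "pderiv_at i (\<lambda>x::real^4. (1 - x \<bullet> x) ^ 2 * (2 - x \<bullet> x)) x = ((1 - x \<bullet> x) * (3 * (x \<bullet> x) - 5)) * (2 * x $ i)"
    by (rule radial_derivs(2)[OF 1])
qed

lemma weak_pair_polys:
  assumes wp: "weak_pair U N"
  shows "integrable lborel (\<lambda>x. N x * (1 - x \<bullet> x) ^ 2)" "(LINT x|lborel. U x * 192) = (LINT x|lborel. N x * (1 - x \<bullet> x) ^ 2)"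
   "integrable lborel (\<lambda>x. N x * ((1 - x \<bullet> x) ^ 2 * (2 - x \<bullet> x)))"
   "(LINT x|lborel. U x * (768 - 1152 * (x \<bullet> x))) = (LINT x|lborel. N x * ((1 - x \<bullet> x) ^ 2 * (2 - x \<bullet> x)))"
proof -
  have xi: "0 \<le> x \<bullet> x" "x \<bullet> x < 1" "\<bar>x $ i\<bar> \<le> 1" if "x \<in> ball 0 1" for x :: "real^4" and i
    using that component_le_norm_cart[of x i] inner_self_less_1[of x] by auto
  have *: "integrable lborel (\<lambda>x. N x * \<phi> x)" "(LINT x|lborel. U x * lap (lap \<phi>) x) = (LINT x|lborel. N x * \<phi> x)"
    if "smooth \<phi>" "\<And>x. x \<in> ball 0 1 \<Longrightarrow> 0 \<le> \<phi> x" "\<And>x. x \<in> ball 0 1 \<Longrightarrow> \<phi> x \<le> 10 * (1 - x \<bullet> x)\<^sup>2"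
      "\<And>x i. x \<in> ball 0 1 \<Longrightarrow> \<bar>pderiv_at i \<phi> x\<bar> \<le> 10 * (1 - x \<bullet> x)" for \<phi>
  proof -
    have "smooth \<phi> \<and> (10::real) \<ge> 0 \<and> (\<forall>x\<in>ball 0 1. 0 \<le> \<phi> x \<and> \<phi> x \<le> 10 * (1 - x \<bullet> x)\<^sup>2 \<and> (\<forall>i. \<bar>pderiv_at i \<phi> x\<bar> \<le> 10 * (1 - x \<bullet> x)))"
      using that by auto
    then show "integrable lborel (\<lambda>x. N x * \<phi> x)" "(LINT x|lborel. U x * lap (lap \<phi>) x) = (LINT x|lborel. N x * \<phi> x)"
      using wp unfolding weak_pair_def by blast+
  qed
  have b1: "\<bar>pderiv_at i (\<lambda>x::real^4. (1 - x \<bullet> x) ^ 2) x\<bar> \<le> 10 * (1 - x \<bullet> x)" if x: "x \<in> ball 0 1" for x i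
  proof -
    have "(1 - x \<bullet> x) * (4 * \<bar>x $ i\<bar>) \<le> (1 - x \<bullet> x) * 10" using xi(1,2)[OF x] xi(3)[OF x, of i] by (intro mult_left_mono) auto
    moreover have "\<bar>- 2 * a * (2 * z)\<bar> = a * (4 * \<bar>z\<bar>)" if "a \<ge> 0" for a z :: real using that by (simp add: abs_mult)
    ultimately show ?thesis using xi(1,2)[OF x] unfolding test_poly1(2) by (simp only: mult.commute[of 10] diff_ge_0_iff_ge less_imp_le)
  qed
  have b2: "\<bar>pderiv_at i (\<lambda>x::real^4. (1 - x \<bullet> x) ^ 2 * (2 - x \<bullet> x)) x\<bar> \<le> 10 * (1 - x \<bullet> x)" if x: "x \<in> ball 0 1" for x i
  proof -
    have "\<bar>3 * (x \<bullet> x) - 5\<bar> * (2 * \<bar>x $ i\<bar>) \<le> 5 * (2 * 1)" using xi(1,2)[OF x] xi(3)[OF x, of i] by (intro mult_mono) auto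
    then have "(1 - x \<bullet> x) * (\<bar>3 * (x \<bullet> x) - 5\<bar> * (2 * \<bar>x $ i\<bar>)) \<le> (1 - x \<bullet> x) * 10" using xi(1,2)[OF x] xi(3)[OF x, of i] by (intro mult_left_mono) auto
    moreover have "\<bar>(a * b) * (2 * z)\<bar> = a * (\<bar>b\<bar> * (2 * \<bar>z\<bar>))" if "a \<ge> 0" for a b z :: real using that by (simp add: abs_mult)
    ultimately show ?thesis using xi(1,2)[OF x] unfolding test_poly2(2) by (simp only: mult.commute[of 10] diff_ge_0_iff_ge less_imp_le)
  qed
  have c2: "(1 - x \<bullet> x) ^ 2 * (2 - x \<bullet> x) \<le> 10 * (1 - x \<bullet> x)\<^sup>2" if x: "x \<in> ball 0 1" for x :: "real^4"
  proof -
    have "2 - x \<bullet> x \<le> 10" using xi(1)[OF x] by linarith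
    then have "(1 - x \<bullet> x)\<^sup>2 * (2 - x \<bullet> x) \<le> (1 - x \<bullet> x)\<^sup>2 * 10" by (intro mult_left_mono) auto
    then show ?thesis by (simp only: mult.commute)
  qed
  have n2: "0 \<le> (1 - x \<bullet> x) ^ 2 * (2 - x \<bullet> x)" if x: "x \<in> ball 0 1" for x :: "real^4"
    using xi[OF x] by (intro mult_nonneg_nonneg) auto
  show "integrable lborel (\<lambda>x. N x * (1 - x \<bullet> x) ^ 2)"
    by (rule *(1)) (use smooth_radial_poly(1) b1 in auto)
  have "(LINT x|lborel. U x * lap (lap (\<lambda>x. (1 - x \<bullet> x) ^ 2)) x) = (LINT x|lborel. N x * (1 - x \<bullet> x) ^ 2)"
    by (rule *(2)) (use smooth_radial_poly(1) b1 in auto)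
  then show "(LINT x|lborel. U x * 192) = (LINT x|lborel. N x * (1 - x \<bullet> x) ^ 2)" unfolding test_poly1(1) .
  show "integrable lborel (\<lambda>x. N x * ((1 - x \<bullet> x) ^ 2 * (2 - x \<bullet> x)))"
    by (rule *(1)[OF smooth_radial_poly(2) n2 c2 b2])
  have "(LINT x|lborel. U x * lap (lap (\<lambda>x. (1 - x \<bullet> x) ^ 2 * (2 - x \<bullet> x))) x) = (LINT x|lborel. N x * ((1 - x \<bullet> x) ^ 2 * (2 - x \<bullet> x)))"
    by (rule *(2)[OF smooth_radial_poly(2) n2 c2 b2])
  then show "(LINT x|lborel. U x * (768 - 1152 * (x \<bullet> x))) = (LINT x|lborel. N x * ((1 - x \<bullet> x) ^ 2 * (2 - x \<bullet> x)))" unfolding test_poly2(1) .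
qed

text \<open>The kernel is damped near the diagonal by the factor \<open>cut m\<close>, which makes
  the integrand bounded and the damped potential continuous by dominated convergence. The error is a
  constant times 1/(m + 1), uniformly in x, so the potential is a uniform limit of continuous
  functions.\<close>

lemma continuous_potential:
  fixes k :: "real^4 \<Rightarrow> real^4 \<Rightarrow> real"
  assumes N: "N \<in> borel_measurable borel" "\<And>x. 0 \<le> N x" "\<And>x. N x \<le> K" "\<And>x. x \<notin> ball 0 1 \<Longrightarrow> N x = 0"
    and km: "\<And>x. norm x \<le> 1 \<Longrightarrow> (\<lambda>y. k x y) \<in> borel_measurable borel"
    and kb: "\<And>x y. norm x \<le> 1 \<Longrightarrow> norm y < 1 \<Longrightarrow> \<bar>k x y\<bar> \<le> C * inverse ((y - x) \<bullet> (y - x))"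
    and kc: "\<And>x y. norm x \<le> 1 \<Longrightarrow> norm y < 1 \<Longrightarrow> x \<noteq> y \<Longrightarrow> continuous (at x within cball 0 1) (\<lambda>x. k x y)"
  shows "continuous_on (cball 0 1) (\<lambda>x. LINT y|lborel. N y * k x y)"
    and "\<And>x. norm x \<le> 1 \<Longrightarrow> integrable lborel (\<lambda>y. N y * k x y)"
proof -
  note N(1)[measurable]
  have K0: "K \<ge> 0" using N(2,3) by (meson order_trans)
  have C0: "C \<ge> 0"
  proof -
    \<comment> \<open>The kernel bound at two points at distance 1 shows that the constant cannot be
      negative.\<close>
    have "0 \<le> \<bar>k (axis 1 1) 0\<bar>" by simp
    also have "\<dots> \<le> C * inverse ((0 - axis 1 1) \<bullet> (0 - axis (1::4) (1::real)))" by (rule kb) auto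
    also have "\<dots> = C" by (simp add: inner_axis_axis)
    finally show ?thesis .
  qed
  have kk: "\<bar>N y * k x y\<bar> \<le> K * (C * (indicator (ball 0 1) y * inverse ((y - x) \<bullet> (y - x))))" if "norm x \<le> 1" for x y
  proof (cases "norm y < 1")
    case True
    have "\<bar>N y\<bar> * \<bar>k x y\<bar> \<le> K * (C * inverse ((y - x) \<bullet> (y - x)))"
      using kb[OF that True] N(2,3)[of y] K0 by (intro mult_mono) auto
    then show ?thesis using True by (simp add: abs_mult)
  qed (use N(4) in auto)
  show int: "integrable lborel (\<lambda>y. N y * k x y)" if x: "norm x \<le> 1" for x
  proof (rule Bochner_Integration.integrable_bound)
    show "integrable lborel (\<lambda>y. K * (C * (indicator (ball 0 1) y * inverse ((y - x) \<bullet> (y - x)))))"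
      using integrable_kernel_ball(1)[OF x] by simp
    show "AE y in lborel. norm (N y * k x y) \<le> norm (K * (C * (indicator (ball 0 1) y * inverse ((y - x) \<bullet> (y - x)))))"
      using kk[OF x] by (intro AE_I2) (simp only: real_norm_def, meson abs_ge_self order_trans)
    show "(\<lambda>y. N y * k x y) \<in> borel_measurable lborel" using km[OF x] by measurable
  qed
  define cut where "cut m x y = min 1 (real (Suc m) * ((y - x) \<bullet> (y - x)))" for m and x y :: "real^4"
  have cm[measurable]: "(\<lambda>y. cut m x y) \<in> borel_measurable borel" for m x
    unfolding cut_def by (intro borel_measurable_continuous_onI continuous_intros)
  have c01: "0 \<le> cut m x y" "cut m x y \<le> 1" for m x y by (auto simp: cut_def)
  define v where "v m x = (LINT y|lborel. N y * (k x y * cut m x y))" for m x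
  have vc: "continuous_on (cball 0 1) (v m)" for m
  proof (rule continuous_on_sequentiallyI)
    fix u :: "nat \<Rightarrow> real^4" and a assume u: "\<forall>n. u n \<in> cball 0 1" "a \<in> cball 0 1" "u \<longlonglongrightarrow> a"
    show "(\<lambda>n. v m (u n)) \<longlonglongrightarrow> v m a" unfolding v_def
    proof (rule integral_dominated_convergence[where w="\<lambda>y. K * (C * real (Suc m)) * indicator (ball 0 1) y"])
      have "emeasure lborel (ball (0::real^4) 1) < \<infinity>" by (rule emeasure_bounded_finite) simp
      then show "integrable lborel (\<lambda>y::real^4. K * (C * real (Suc m)) * indicator (ball 0 1) y)"
        by (simp add: integrable_real_indicator)
      have [measurable]: "k a \<in> borel_measurable borel" "k (u n) \<in> borel_measurable borel" for n
        using km[of a] km[of "u n"] u by auto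
      show "(\<lambda>y. N y * (k a y * cut m a y)) \<in> borel_measurable lborel" by measurable
      show "(\<lambda>y. N y * (k (u n) y * cut m (u n) y)) \<in> borel_measurable lborel" for n by measurable
      show "AE y in lborel. norm (N y * (k (u n) y * cut m (u n) y)) \<le> K * (C * real (Suc m)) * indicator (ball 0 1) y" for n
      proof (rule AE_I2)
        fix y
        show "norm (N y * (k (u n) y * cut m (u n) y)) \<le> K * (C * real (Suc m)) * indicator (ball 0 1) y"
        proof (cases "norm y < 1")
          case True
          let ?s = "(y - u n) \<bullet> (y - u n)"
          have "\<bar>k (u n) y\<bar> * \<bar>cut m (u n) y\<bar> \<le> (C * inverse ?s) * (real (Suc m) * ?s)"
            using kb[of "u n" y] u True C0 by (intro mult_mono) (auto simp: cut_def)
          also have "\<dots> \<le> C * real (Suc m)" 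
          proof (cases "?s = 0")
            case True
            have "0 \<le> C * real (Suc m)" using C0 by simp
            then show ?thesis using True by (simp only: mult_zero_right)
          next
            case False
            then have "(C * inverse ?s) * (real (Suc m) * ?s) = C * real (Suc m)"
              by (simp add: field_simps del: of_nat_Suc)
            then show ?thesis by (rule eq_refl)
          qed
          finally have "\<bar>k (u n) y * cut m (u n) y\<bar> \<le> C * real (Suc m)" by (simp add: abs_mult)
          then have "\<bar>N y\<bar> * \<bar>k (u n) y * cut m (u n) y\<bar> \<le> K * (C * real (Suc m))"
            using N(2,3)[of y] K0 by (intro mult_mono) auto
          then show ?thesis using True by (simp add: abs_mult)
        qed (use N(4) in auto)
      qed
      show "AE y in lborel. (\<lambda>n. N y * (k (u n) y * cut m (u n) y)) \<longlonglongrightarrow> N y * (k a y * cut m a y)"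
        using AE_lborel_singleton[of a]
      proof eventually_elim
        case (elim y)
        show ?case
        proof (cases "norm y < 1")
          case True
          have "continuous (at a within cball 0 1) (\<lambda>x. k x y)" using kc[of a y] u elim True by auto
          then have "(\<lambda>n. k (u n) y) \<longlonglongrightarrow> k a y"
            using u unfolding continuous_within_sequentially by (auto simp: o_def)
          moreover have "(\<lambda>n. cut m (u n) y) \<longlonglongrightarrow> cut m a y" unfolding cut_def by (intro tendsto_intros u)
          ultimately show ?thesis by (intro tendsto_intros)
        qed (use N(4) in simp)
      qed
    qed
  qed
  have close: "\<bar>(LINT y|lborel. N y * k x y) - v m x\<bar> \<le> K * C * rad2_int / real (Suc m)" if x: "norm x \<le> 1" for x m
  proof -
    let ?r = "1 / sqrt (real (Suc m))"
    let ?I = "\<lambda>y. indicator (ball x ?r) y * inverse ((y - x) \<bullet> (y - x))"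
    have fin: "(\<integral>\<^sup>+y. ennreal (?I y) \<partial>lborel) = ennreal (?r\<^sup>2 * rad2_int)"
      by (rule nn_integral_inverse_dist_sq) simp
    have Ii: "integrable lborel ?I"
    proof (rule integrableI_nonneg)
      show "(\<integral>\<^sup>+y. ennreal (?I y) \<partial>lborel) < \<infinity>" unfolding fin by simp
    qed auto
    have "(LINT y|lborel. ?I y) = enn2real (\<integral>\<^sup>+y. ennreal (?I y) \<partial>lborel)" by (rule integral_eq_nn_integral) auto
    then have Iv: "(LINT y|lborel. ?I y) = rad2_int / real (Suc m)" unfolding fin using rad2_int_nonneg by (simp add: power_divide)
    have pt: "\<bar>N y * k x y - N y * (k x y * cut m x y)\<bar> \<le> (K * C) * ?I y" for y
    proof (cases "norm y < 1")
      case True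
      have eq: "\<bar>N y * k x y - N y * (k x y * cut m x y)\<bar> = (\<bar>N y\<bar> * \<bar>k x y\<bar>) * (1 - cut m x y)"
      proof -
        have "N y * k x y - N y * (k x y * cut m x y) = N y * k x y * (1 - cut m x y)" by (simp add: algebra_simps)
        then show ?thesis using c01[of m x y] by (simp add: abs_mult)
      qed
      show ?thesis
      proof (cases "y \<in> ball x ?r")
        case y: True
        have "(\<bar>N y\<bar> * \<bar>k x y\<bar>) * (1 - cut m x y) \<le> (K * (C * inverse ((y - x) \<bullet> (y - x)))) * 1"
          using kb[OF x True] N(2,3)[of y] K0 c01[of m x y] C0 by (intro mult_mono) auto
        then show ?thesis using y eq by (simp add: mult_ac)
      next
        case False
        then have "?r \<le> norm (y - x)" by (simp add: dist_norm norm_minus_commute)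
        then have "?r\<^sup>2 \<le> (norm (y - x))\<^sup>2" by (intro power_mono) auto
        then have "1 / real (Suc m) \<le> (y - x) \<bullet> (y - x)" by (simp add: power2_norm_eq_inner power_divide)
        then have "1 \<le> real (Suc m) * ((y - x) \<bullet> (y - x))" by (simp add: pos_divide_le_eq mult.commute)
        then have "cut m x y = 1" by (simp add: cut_def)
        then show ?thesis using False by simp
      qed
    next
      case False
      then have "N y = 0" using N(4)[of y] by simp
      then show ?thesis using K0 C0 by simp
    qed
    have i2: "integrable lborel (\<lambda>y. N y * (k x y * cut m x y))"
    proof (rule Bochner_Integration.integrable_bound[OF int[OF x]])
      show "(\<lambda>y. N y * (k x y * cut m x y)) \<in> borel_measurable lborel" using km[OF x] by measurable
      show "AE y in lborel. norm (N y * (k x y * cut m x y)) \<le> norm (N y * k x y)"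
        using c01 by (intro AE_I2) (auto simp: abs_mult mult.assoc[symmetric] intro!: mult_left_le)
    qed
    have "\<bar>(LINT y|lborel. N y * k x y) - v m x\<bar> = \<bar>LINT y|lborel. N y * k x y - N y * (k x y * cut m x y)\<bar>"
      unfolding v_def using int[OF x] i2 by simp
    also have "\<dots> \<le> (LINT y|lborel. (K * C) * ?I y)"
      by (rule order_trans[OF integral_abs_bound]) (intro integral_mono, use int[OF x] i2 Ii pt in auto)
    also have "\<dots> = K * C * rad2_int / real (Suc m)" unfolding integral_mult_right_zero Iv by simp
    finally show ?thesis .
  qed
  show "continuous_on (cball 0 1) (\<lambda>x. LINT y|lborel. N y * k x y)"
  proof (rule uniform_limit_theorem[where F=sequentially])
    show "uniform_limit (cball 0 1) v (\<lambda>x. LINT y|lborel. N y * k x y) sequentially"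
    proof (rule uniform_limitI)
      fix \<epsilon> :: real assume "\<epsilon> > 0"
      have "(\<lambda>m. K * C * rad2_int * inverse (real (Suc m))) \<longlonglongrightarrow> K * C * rad2_int * 0"
        by (intro tendsto_intros LIMSEQ_inverse_real_of_nat)
      then have "\<forall>\<^sub>F m in sequentially. K * C * rad2_int / real (Suc m) < \<epsilon>"
        using \<open>\<epsilon> > 0\<close> by (intro order_tendstoD(2)[where y=0]) (simp_all add: divide_inverse)
      then show "\<forall>\<^sub>F m in sequentially. \<forall>x\<in>cball 0 1. dist (v m x) (LINT y|lborel. N y * k x y) < \<epsilon>"
      proof eventually_elim
        case (elim m)
        show ?case
        proof
          fix x :: "real^4" assume "x \<in> cball 0 1"
          then have "\<bar>(LINT y|lborel. N y * k x y) - v m x\<bar> \<le> K * C * rad2_int / real (Suc m)" by (intro close) simp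
          then show "dist (v m x) (LINT y|lborel. N y * k x y) < \<epsilon>"
            using elim unfolding dist_real_def by linarith
        qed
      qed
    qed
  qed (use vc in auto)
qed

context unit_problem
begin

lemma solD:
  assumes "sol u N"
  shows "N \<in> borel_measurable borel" "\<And>x. 0 \<le> N x" "\<And>x. x \<notin> ball 0 1 \<Longrightarrow> N x = 0" "\<exists>K. \<forall>x. N x \<le> K"
    "\<And>x. norm x \<le> 1 \<Longrightarrow> u x = (LINT y|lborel. N y * green y x)" "\<And>x. norm x > 1 \<Longrightarrow> u x = 0"
    "AE x in lborel. x \<in> ball 0 1 \<longrightarrow> N x = H x (u x)" "weak_pair (\<lambda>x. indicator (ball 0 1) x * u x) N"
  using assms unfolding sol_def by auto

lemma continuous_green: "norm x \<le> 1 \<Longrightarrow> norm y < 1 \<Longrightarrow> x \<noteq> y \<Longrightarrow> continuous (at x within cball 0 1) (\<lambda>x. green y x)"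
proof -
  assume A: "norm x \<le> 1" "norm y < 1" "x \<noteq> y"
  have s: "(y - x) \<bullet> (y - x) + 0 \<noteq> 0" using A by simp
  have "0 \<le> \<theta> y x / ((y - x) \<bullet> (y - x) + 0)" using theta_nonneg[of y x] A by (intro divide_nonneg_nonneg) auto
  then have "isCont gf (\<theta> y x / ((y - x) \<bullet> (y - x) + 0))" by (intro DERIV_isCont[OF gf_deriv]) linarith
  moreover have "continuous (at x) (\<lambda>x. \<theta> y x / ((y - x) \<bullet> (y - x) + 0))"
    unfolding \<theta>_def using s by (intro continuous_intros) auto
  ultimately have "continuous (at x) (\<lambda>x. gf (\<theta> y x / ((y - x) \<bullet> (y - x) + 0)))"
    by (rule isCont_o2[rotated])
  then have "continuous (at x) (\<lambda>x. green y x)" unfolding green_def green_reg_def by (intro continuous_intros)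
  then show ?thesis by (rule continuous_at_imp_continuous_within)
qed

lemma borel_green_left: "(\<lambda>y. green y x) \<in> borel_measurable borel"
  by (rule borel_green) auto

lemma sol_continuous:
  assumes s: "sol u N" shows "continuous_on (cball 0 1) u" and "\<And>x. norm x \<le> 1 \<Longrightarrow> integrable lborel (\<lambda>y. N y * green y x)"
proof -
  obtain K where K: "\<And>x. N x \<le> K" using solD(4)[OF s] by blast
  have b: "\<bar>green y x\<bar> \<le> \<kappa> * inverse ((y - x) \<bullet> (y - x))" if "norm x \<le> 1" "norm y < 1" for x y
    using green_le_inverse[of y x] green_nonneg[of y x] that by simp
  have "continuous_on (cball 0 1) (\<lambda>x. LINT y|lborel. N y * green y x)"
    by (rule continuous_potential(1)[OF solD(1-2)[OF s] K solD(3)[OF s] borel_green_left b continuous_green])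
  then show "continuous_on (cball 0 1) u"
    by (rule continuous_on_eq) (use solD(5)[OF s] in auto)
  show "integrable lborel (\<lambda>y. N y * green y x)" if "norm x \<le> 1" for x
    by (rule continuous_potential(2)[OF solD(1-2)[OF s] K solD(3)[OF s] borel_green_left b continuous_green that])
qed

lemma sol_nonneg: assumes s: "sol u N" shows "u x \<ge> 0"
proof (cases "norm x \<le> 1")
  case True
  have "0 \<le> N y * green y x" for y
    using solD(2,3)[OF s, of y] green_nonneg[of y x] True by (cases "norm y < 1") auto
  then show ?thesis using solD(5)[OF s True] by (simp add: integral_nonneg_AE)
qed (use solD(6)[OF s] in auto)

text \<open>Testing with the second polynomial bounds the weighted mass I by the integral J of u
  over the ball of radius 9/10. There superlinearity of f bounds J by a small multiple of I plus a
  constant, and the multiple can be absorbed. The first polynomial then bounds the integral of u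
  over the whole ball.\<close>

lemma sol_uniform_bounds:
  "\<exists>C\<ge>0. \<forall>u N. sol u N \<longrightarrow> integrable lborel (\<lambda>x. indicator (ball 0 1) x * u x) \<and> (LINT x|lborel. indicator (ball 0 1) x * u x) \<le> C
     \<and> integrable lborel (\<lambda>x. N x * (1 - x \<bullet> x) ^ 2) \<and> (LINT x|lborel. N x * (1 - x \<bullet> x) ^ 2) \<le> C"
proof -
  \<comment> \<open>The square 81/100 exceeds 2/3, so the bi-Laplacian of the test function is
    negative outside this radius.\<close>
  define r :: real where "r = 9/10"
  obtain a T where a: "a > 0" "\<And>x t. x \<in> cball 0 r \<Longrightarrow> t \<ge> T \<Longrightarrow> a * f t \<le> H x t"
  proof -
    have "r < 1" by (simp add: r_def)
    from H_lower[OF this] show ?thesis using that by blast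
  qed
  have "\<forall>\<^sub>F t in at_top. 76800 / a \<le> f t / t" using f_super by (simp add: filterlim_at_top)
  then obtain T1 where T1: "\<And>t. t \<ge> T1 \<Longrightarrow> 76800 / a \<le> f t / t" by (auto simp: eventually_at_top_linorder)
  define T2 where "T2 = max 1 (max T T1)"
  have T2: "T2 \<ge> 1" by (simp add: T2_def)
  \<comment> \<open>On this ball the test function is at least (19/100)^2 >= 1/50, so the bound
    gives 76800 J <= 50 I + const. As 76800 = 100 * 768 and I <= 768 J, half of I is
    absorbed.\<close>
  have Hlow: "76800 * (t - T2) \<le> H x t" if x: "x \<in> cball 0 r" and t: "t \<ge> 0" for x t
  proof (cases "t \<ge> T2")
    case True
    then have t1: "t \<ge> T" "t \<ge> T1" "t > 0" by (auto simp: T2_def)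
    have "76800 / a * t \<le> f t" using T1[OF t1(2)] t1(3) by (simp add: pos_le_divide_eq)
    then have "76800 * t \<le> a * f t" using a(1) by (simp add: pos_divide_le_eq mult.commute)
    then have "76800 * t \<le> H x t" using a(2)[OF x t1(1)] by linarith
    then show ?thesis using T2 by (simp add: right_diff_distrib) 
  next
    case False
    have "x \<in> ball 0 1" using x by (auto simp: r_def)
    then have "0 \<le> H x t" by (rule H_nonneg)
    then show ?thesis using False by (smt (verit) mult_nonneg_nonpos)
  qed
  define V where "V = measure lborel (ball (0::real^4) 1)"
  have fin: "emeasure lborel (ball (0::real^4) 1) < \<infinity>" by (rule emeasure_bounded_finite) simp
  have V0: "V \<ge> 0" by (simp add: V_def)
  define C where "C = 1536 * T2 * V"
  have C0: "C \<ge> 0" using V0 T2 by (simp add: C_def)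
  have "integrable lborel (\<lambda>x. indicator (ball 0 1) x * u x) \<and> (LINT x|lborel. indicator (ball 0 1) x * u x) \<le> C
     \<and> integrable lborel (\<lambda>x. N x * (1 - x \<bullet> x) ^ 2) \<and> (LINT x|lborel. N x * (1 - x \<bullet> x) ^ 2) \<le> C" if s: "sol u N" for u N
  proof -
    let ?U = "\<lambda>x. indicator (ball 0 1) x * u x"
    let ?p = "\<lambda>x::real^4. (1 - x \<bullet> x) ^ 2 * (2 - x \<bullet> x)"
    note wp = solD(8)[OF s]
    note P = weak_pair_polys[OF wp]
    have Ui: "integrable lborel ?U" and Um[measurable]: "?U \<in> borel_measurable borel" using wp by (auto simp: weak_pair_def)
    note [measurable] = solD(1)[OF s]
    have U0: "0 \<le> ?U x" for x using sol_nonneg[OF s, of x] by simp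
    have cU: "integrable lborel (\<lambda>x. indicator (cball 0 r) x * ?U x)"
      using integrable_mult_indicator[of "cball 0 r" lborel ?U] Ui by simp
    define J where "J = (LINT x|lborel. indicator (cball 0 r) x * ?U x)"
    define I where "I = (LINT x|lborel. N x * ?p x)"
    have xi: "0 \<le> x \<bullet> x" "x \<bullet> x < 1" if "x \<in> ball 0 1" for x :: "real^4"
      using that inner_self_less_1[of x] by auto
    have "I = (LINT x|lborel. ?U x * (768 - 1152 * (x \<bullet> x)))" unfolding I_def using P(4) by simp
    also have "\<dots> \<le> (LINT x|lborel. 768 * (indicator (cball 0 r) x * ?U x))"
    proof (rule integral_mono)
      show "integrable lborel (\<lambda>x. ?U x * (768 - 1152 * (x \<bullet> x)))"
      proof (rule Bochner_Integration.integrable_bound[where f="\<lambda>x. 1920 * ?U x"])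
        show "AE x in lborel. norm (?U x * (768 - 1152 * (x \<bullet> x))) \<le> norm (1920 * ?U x)"
        proof (rule AE_I2)
          fix x :: "real^4"
          show "norm (?U x * (768 - 1152 * (x \<bullet> x))) \<le> norm (1920 * ?U x)"
          proof (cases "x \<in> ball 0 1")
            case True
            then have "\<bar>768 - 1152 * (x \<bullet> x)\<bar> \<le> 1920" using xi[OF True] by (intro abs_leI) linarith+
            then have "\<bar>?U x\<bar> * \<bar>768 - 1152 * (x \<bullet> x)\<bar> \<le> \<bar>?U x\<bar> * 1920" by (intro mult_left_mono) auto
            then show ?thesis by (simp only: real_norm_def abs_mult) (simp add: mult.commute)
          qed simp
        qed
        have "(\<lambda>x::real^4. 768 - 1152 * (x \<bullet> x)) \<in> borel_measurable borel" by (intro borel_measurable_continuous_onI continuous_intros)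
        then show "(\<lambda>x. ?U x * (768 - 1152 * (x \<bullet> x))) \<in> borel_measurable lborel" using borel_measurable_times[OF Um] by simp
      qed (use Ui in simp)
      show "integrable lborel (\<lambda>x. 768 * (indicator (cball 0 r) x * ?U x))" using cU by simp
      fix x :: "real^4"
      show "?U x * (768 - 1152 * (x \<bullet> x)) \<le> 768 * (indicator (cball 0 r) x * ?U x)"
      proof (cases "x \<in> cball 0 r")
        case True
        have "?U x * (768 - 1152 * (x \<bullet> x)) \<le> ?U x * 768" using U0 by (intro mult_left_mono) auto
        moreover have "indicator (cball 0 r) x = (1::real)" using True by simp
        ultimately show ?thesis by (simp only: mult_1_left mult.commute[of 768])
      next
        case False
        then have "r\<^sup>2 \<le> (norm x)\<^sup>2" by (intro power_mono) (auto simp: r_def)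
        moreover have "r\<^sup>2 = 81/100" by (simp add: r_def power2_eq_square)
        ultimately have "768 - 1152 * (x \<bullet> x) \<le> 0" unfolding power2_norm_eq_inner by linarith
        then have "?U x * (768 - 1152 * (x \<bullet> x)) \<le> 0" by (rule mult_nonneg_nonpos[OF U0])
        moreover have "indicator (cball 0 r) x = (0::real)" using False by simp
        ultimately show ?thesis by (simp only: mult_zero_left mult_zero_right)
      qed
    qed
    also have "\<dots> = 768 * J" by (simp add: J_def)
    finally have IJ: "I \<le> 768 * J" .
    have Bi: "integrable lborel (\<lambda>x::real^4. 76800 * T2 * indicator (ball 0 1) x)" using fin by (simp add: integrable_real_indicator)
    have pi: "integrable lborel (\<lambda>x. 50 * (N x * ?p x))" using P(3) by simp
    have "76800 * J = (LINT x|lborel. 76800 * (indicator (cball 0 r) x * ?U x))" by (simp add: J_def)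
    also have "\<dots> \<le> (LINT x|lborel. 50 * (N x * ?p x) + 76800 * T2 * indicator (ball 0 1) x)"
    proof (rule integral_mono_AE)
      show "AE x in lborel. 76800 * (indicator (cball 0 r) x * ?U x) \<le> 50 * (N x * ?p x) + 76800 * T2 * indicator (ball 0 1) x"
        using solD(7)[OF s]
      proof eventually_elim
        case (elim x)
        show ?case
        proof (cases "x \<in> ball 0 1")
          case True
          note xx = xi[OF True]
          have p0: "0 \<le> ?p x" using xx by (intro mult_nonneg_nonneg) auto
          show ?thesis
          proof (cases "x \<in> cball 0 r")
            case c: True
            then have "(norm x)\<^sup>2 \<le> r\<^sup>2" by (intro power_mono) auto
            moreover have "r\<^sup>2 = 81/100" by (simp add: r_def power2_eq_square)
            ultimately have "x \<bullet> x \<le> 81/100" unfolding power2_norm_eq_inner by linarith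
            then have "(19/100)\<^sup>2 \<le> (1 - x \<bullet> x)\<^sup>2" by (intro power_mono) linarith+
            then have "(19/100)\<^sup>2 * 1 \<le> ?p x" using xx by (intro mult_mono) auto
            moreover have "(1/50::real) \<le> (19/100)\<^sup>2 * 1" by (simp add: power2_eq_square)
            ultimately have "1/50 \<le> ?p x" by linarith
            then have "N x * (1/50) \<le> N x * ?p x" using solD(2)[OF s] by (intro mult_left_mono) auto
            then have "76800 * (u x - T2) \<le> 50 * (N x * ?p x)"
              using Hlow[OF c sol_nonneg[OF s, of x]] elim True by simp
            moreover have "indicator (cball 0 r) x = (1::real)" "indicator (ball 0 1) x = (1::real)" using c True by simp_all
            ultimately show ?thesis by (simp only: mult_1_left mult_1_right right_diff_distrib diff_le_eq)
          next
            case False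
            have "0 \<le> N x * ?p x" by (rule mult_nonneg_nonneg[OF solD(2)[OF s] p0])
            then have "0 \<le> 50 * (N x * ?p x) + 76800 * T2" using T2 by linarith
            moreover have "indicator (cball 0 r) x = (0::real)" "indicator (ball 0 1) x = (1::real)" using False True by simp_all
            ultimately show ?thesis by (simp only: mult_zero_left mult_zero_right mult_1_right)
          qed
        next
          case False
          then have "N x = 0" by (rule solD(3)[OF s])
          moreover have "indicator (ball 0 1) x = (0::real)" using False by simp
          ultimately show ?thesis by (simp only: mult_zero_left mult_zero_right add_0_right order_refl)
        qed
      qed
    qed (use cU pi Bi in auto)
    also have "\<dots> = 50 * I + 76800 * T2 * V" using Bi pi fin by (simp add: I_def V_def)
    finally have "76800 * J \<le> 50 * I + 76800 * T2 * V" .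
    then have IC: "I \<le> C" using IJ by (simp add: C_def)
    have NI: "(LINT x|lborel. N x * (1 - x \<bullet> x) ^ 2) \<le> I" unfolding I_def
    proof (rule integral_mono[OF P(1) P(3)])
      fix x :: "real^4"
      show "N x * (1 - x \<bullet> x) ^ 2 \<le> N x * ?p x"
      proof (cases "x \<in> ball 0 1")
        case True
        have "(1 - x \<bullet> x) ^ 2 * 1 \<le> ?p x" using xi[OF True] by (intro mult_left_mono) auto
        then show ?thesis using solD(2)[OF s, of x] by (intro mult_left_mono) auto
      qed (simp add: solD(3)[OF s])
    qed
    have "192 * (LINT x|lborel. ?U x) \<le> C" using P(2) NI IC by simp
    moreover have "0 \<le> (LINT x|lborel. ?U x)" by (intro integral_nonneg_AE AE_I2 U0)
    ultimately have "(LINT x|lborel. ?U x) \<le> C" by linarith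
    then show ?thesis using Ui P(1) NI IC by auto
  qed
  then show ?thesis using C0 by blast
qed

end

section \<open>Moving planes\<close>

lemma sq_dist_commute: "((a::'a::real_inner) - b) \<bullet> (a - b) = (b - a) \<bullet> (b - a)"
  by (simp add: inner_diff_left inner_diff_right inner_commute algebra_simps)

definition refl_at :: "real^4 \<Rightarrow> real \<Rightarrow> real^4 \<Rightarrow> real^4" where
  "refl_at e m y = y - (2 * (y \<bullet> e - m)) *\<^sub>R e"

lemma refl_at_inner: "norm e = 1 \<Longrightarrow> refl_at e m y \<bullet> e = 2 * m - y \<bullet> e"
  by (simp add: refl_at_def inner_diff_left norm_eq_1)

lemma refl_at_refl_at: "norm e = 1 \<Longrightarrow> refl_at e m (refl_at e m y) = y"
  unfolding refl_at_def[of e m "refl_at e m y"] refl_at_inner by (simp add: refl_at_def algebra_simps flip: scaleR_add_left)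

lemma refl_at_self_inner: "norm e = 1 \<Longrightarrow> refl_at e m y \<bullet> refl_at e m y = y \<bullet> y - 4 * m * (y \<bullet> e - m)"
  by (simp add: refl_at_def inner_diff_left inner_diff_right norm_eq_1 inner_commute algebra_simps)

lemma refl_at_dist:
  assumes "norm e = 1"
  shows "(refl_at e m x - z) \<bullet> (refl_at e m x - z) = (x - z) \<bullet> (x - z) - 4 * (x \<bullet> e - m) * (m - z \<bullet> e)"
  using assms by (simp add: refl_at_def inner_diff_left inner_diff_right norm_eq_1 inner_commute algebra_simps)

lemma refl_at_dist_both:
  assumes "norm e = 1"
  shows "(refl_at e m x - refl_at e m y) \<bullet> (refl_at e m x - refl_at e m y) = (x - y) \<bullet> (x - y)"
  using assms unfolding refl_at_dist[OF assms, of m x] refl_at_inner[OF assms]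
  by (simp add: refl_at_def inner_diff_left inner_diff_right norm_eq_1 inner_commute algebra_simps)

text \<open>The linear part is orthogonal, hence of determinant plus or minus 1, and the rest is a
  translation.\<close>

lemma lborel_distr_refl_at:
  assumes e: "norm e = 1"
  shows "distr lborel borel (refl_at e m) = lborel"
proof -
  define g where "g y = y - (2 * (y \<bullet> e)) *\<^sub>R e" for y :: "real^4"
  have lin: "linear g" unfolding g_def by (intro linearI) (simp_all add: inner_add_left algebra_simps)
  have gg: "g (g y) = y" for y using refl_at_refl_at[OF e, of 0 y] by (simp add: g_def refl_at_def)
  have "orthogonal_transformation g"
    unfolding orthogonal_transformation
  proof (intro conjI lin allI)
    fix v show "norm (g v) = norm v"
      using refl_at_self_inner[OF e, of 0 v] by (simp add: g_def refl_at_def norm_eq_sqrt_inner)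
  qed
  then have "orthogonal_matrix (matrix g)" by (simp add: orthogonal_transformation_matrix)
  then have det: "\<bar>det (matrix g)\<bar> = 1" using det_orthogonal_matrix[of "matrix g"] by auto
  have gm[measurable]: "g \<in> borel_measurable borel"
    using linear_continuous_on lin by (intro borel_measurable_continuous_onI) (simp add: linear_continuous_on linear_conv_bounded_linear)
  have dg: "distr lborel borel g = lborel"
  proof (rule lborel_eqI[symmetric])
    fix l u :: "real^4" assume lu: "\<And>b. b \<in> Basis \<Longrightarrow> l \<bullet> b \<le> u \<bullet> b"
    have "g -` box l u = g ` box l u"
    proof (intro set_eqI iffI)
      fix y assume "y \<in> g -` box l u"
      then have "g y \<in> box l u" by simp
      then have "g (g y) \<in> g ` box l u" by (rule imageI)
      then show "y \<in> g ` box l u" by (simp only: gg)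
    next
      fix y assume "y \<in> g ` box l u"
      then obtain z where "z \<in> box l u" "y = g z" by blast
      then show "y \<in> g -` box l u" by (simp add: gg)
    qed
    moreover have sg: "g -` box l u \<in> sets borel" using measurable_sets_borel[OF gm, of "box l u"] by simp
    moreover have "measure lebesgue (g ` box l u) = measure lebesgue (box l u)"
      using measure_linear_image[OF lin, of "box l u"] det by simp
    ultimately have m: "measure lborel (g -` box l u) = measure lborel (box l u)" by simp
    have "bounded (g ` box l u)" by (intro bounded_linear_image bounded_box) (use lin in \<open>simp add: linear_conv_bounded_linear\<close>)
    then have "emeasure lborel (g -` box l u) \<noteq> \<infinity>" using emeasure_bounded_finite[of "g -` box l u"] \<open>g -` box l u = g ` box l u\<close> by auto
    then have "emeasure lborel (g -` box l u) = ennreal (measure lborel (g -` box l u))" by (intro emeasure_eq_ennreal_measure) auto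
    also have "\<dots> = emeasure lborel (box l u)" unfolding m
      by (rule emeasure_eq_ennreal_measure[symmetric]) (use emeasure_bounded_finite[OF bounded_box, of l u] in auto)
    finally have "emeasure lborel (g -` box l u) = emeasure lborel (box l u)" .
    then show "emeasure (distr lborel borel g) (box l u) = (\<Prod>b\<in>Basis. (u - l) \<bullet> b)"
      using lu by (simp add: emeasure_distr emeasure_lborel_box)
  qed simp
  have "refl_at e m = (\<lambda>y. (2 * m) *\<^sub>R e + y) \<circ> g"
    by (auto simp: refl_at_def g_def fun_eq_iff algebra_simps)
  then have "distr lborel borel (refl_at e m) = distr (distr lborel borel g) borel (\<lambda>y. (2 * m) *\<^sub>R e + y)"
    by (simp add: distr_distr)
  then show ?thesis by (simp add: dg lborel_distr_plus)
qed

lemma borel_refl_at[measurable]: "refl_at e m \<in> borel_measurable borel"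
  unfolding refl_at_def[abs_def] by (intro borel_measurable_continuous_onI continuous_intros)

lemma AE_refl_at:
  assumes "norm e = 1" "AE y in lborel. P y" shows "AE y in lborel. P (refl_at e m y)"
proof -
  have "AE y in distr lborel borel (refl_at e m). P y" unfolding lborel_distr_refl_at[OF assms(1)] by (rule assms(2))
  then show ?thesis by (rule AE_distrD[rotated]) simp
qed

lemma integral_refl_at:
  fixes F :: "real^4 \<Rightarrow> real"
  assumes "norm e = 1" and [measurable]: "F \<in> borel_measurable borel"
  shows "(LINT y|lborel. F (refl_at e m y)) = (LINT y|lborel. F y)" "integrable lborel (\<lambda>y. F (refl_at e m y)) \<longleftrightarrow> integrable lborel F"
proof -
  show "(LINT y|lborel. F (refl_at e m y)) = (LINT y|lborel. F y)"
    using integral_distr[of "refl_at e m" lborel borel F] by (simp add: lborel_distr_refl_at[OF assms(1)])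
  show "integrable lborel (\<lambda>y. F (refl_at e m y)) \<longleftrightarrow> integrable lborel F"
    using integrable_distr_eq[of "refl_at e m" lborel borel F] by (simp add: lborel_distr_refl_at[OF assms(1)])
qed

text \<open>Rewriting as N (k + k') + (N' - N) k' exhibits two nonnegative terms even if k is
  negative.\<close>

lemma reflected_pair_pos:
  fixes N k k' :: real
  assumes "0 \<le> N" "N \<le> N'" "k' > 0" "k + k' > 0"
  shows "N * k + N' * k' \<ge> 0" "N * k + N' * k' = 0 \<Longrightarrow> N = 0 \<and> N' = 0"
proof -
  have 1: "N * (k + k') \<ge> 0" using assms by simp
  have 2: "(N' - N) * k' \<ge> 0" using assms by simp
  have eq: "N * k + N' * k' = N * (k + k') + (N' - N) * k'" by (simp add: algebra_simps)
  show "N * k + N' * k' \<ge> 0" using 1 2 eq by linarith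
  assume "N * k + N' * k' = 0"
  then have "N * (k + k') = 0" "(N' - N) * k' = 0" using 1 2 eq by linarith+
  then show "N = 0 \<and> N' = 0" using assms by auto
qed

text \<open>The reflected pairing that drives the method of moving planes: on the small cap the kernel may
  be negative, but there it is outweighed by its value at the reflected point, where the density is larger.\<close>

lemma moving_plane_integral_pos:
  fixes N k :: "real^4 \<Rightarrow> real"
  assumes e: "norm e = 1" and m: "m \<ge> 0"
    and N[measurable]: "N \<in> borel_measurable borel" and N0: "\<And>x. 0 \<le> N x" and out: "\<And>x. x \<notin> ball 0 1 \<Longrightarrow> N x = 0"
    and mono: "AE y in lborel. y \<in> ball 0 1 \<and> m < y \<bullet> e \<longrightarrow> N y \<le> N (refl_at e m y)"
    and k[measurable]: "k \<in> borel_measurable borel" and Nk: "integrable lborel (\<lambda>y. N y * k y)"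
    and k1: "\<And>z. z \<in> ball 0 1 \<Longrightarrow> z \<bullet> e < m \<Longrightarrow> z \<noteq> p \<Longrightarrow> z \<noteq> refl_at e m p \<Longrightarrow> k z > 0"
    and k2: "\<And>y. y \<in> ball 0 1 \<Longrightarrow> m < y \<bullet> e \<Longrightarrow> y \<noteq> p \<Longrightarrow> y \<noteq> refl_at e m p \<Longrightarrow> k y + k (refl_at e m y) > 0"
    and nz: "\<not> (AE y in lborel. N y = 0)"
  shows "(LINT y|lborel. N y * k y) > 0"
proof (rule ccontr)
  let ?R = "refl_at e m"
  let ?S = "\<lambda>y. N y * k y + N (?R y) * k (?R y)"
  assume neg: "\<not> (LINT y|lborel. N y * k y) > 0"
  have Fm: "(\<lambda>y. N y * k y) \<in> borel_measurable borel" by measurable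
  have i2: "integrable lborel (\<lambda>y. N (?R y) * k (?R y))"
    using integral_refl_at(2)[OF e Fm, of m] Nk by simp
  \<comment> \<open>Symmetrising under the reflection pairs every point with its image; the sum is
    invariant, so its sign has to be found only above the plane.\<close>
  have "(LINT y|lborel. ?S y) = 2 * (LINT y|lborel. N y * k y)"
    using integral_refl_at(1)[OF e Fm, of m] Nk i2 by simp
  then have le: "(LINT y|lborel. ?S y) \<le> 0" using neg by simp
  have side: "?S y \<ge> 0 \<and> (?S y = 0 \<longrightarrow> N y = 0 \<and> N (?R y) = 0)"
    if y: "m < y \<bullet> e" and yp: "y \<noteq> p" "y \<noteq> ?R p" "?R y \<noteq> p" "?R y \<noteq> ?R p"
      and mo: "y \<in> ball 0 1 \<longrightarrow> N y \<le> N (?R y)" for y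
  proof -
    have Re: "?R y \<bullet> e < m" using y by (simp add: refl_at_inner[OF e])
    show ?thesis
    proof (cases "y \<in> ball 0 1")
      case True
      have "?R y \<bullet> ?R y \<le> y \<bullet> y" unfolding refl_at_self_inner[OF e] using m y by simp
      then have "norm (?R y) \<le> norm y" by (simp add: norm_eq_sqrt_inner)
      then have "?R y \<in> ball 0 1" using True by simp
      then have "k (?R y) > 0" using k1 Re yp by blast
      then show ?thesis using reflected_pair_pos[OF N0 _ _ k2[OF True y yp(1,2)]] mo True by blast
    next
      case False
      then have Ny: "N y = 0" by (rule out)
      show ?thesis
      proof (cases "?R y \<in> ball 0 1")
        case True
        then have "k (?R y) > 0" using k1 Re yp by blast
        then show ?thesis using Ny N0[of "?R y"] by auto
      qed (use out Ny in auto)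
    qed
  qed
  have plane: "AE y in lborel. y \<bullet> e \<noteq> m"
  proof -
    have "negligible {y. e \<bullet> y = m}" using e by (intro negligible_hyperplane) auto
    then have "{y. e \<bullet> y = m} \<in> null_sets lebesgue" by (simp add: negligible_iff_null_sets)
    moreover have "{y. e \<bullet> y = m} \<in> sets borel" by simp
    ultimately have "{y. e \<bullet> y = m} \<in> null_sets lborel" by (simp add: null_sets_def)
    then have "AE y in lborel. y \<notin> {y. e \<bullet> y = m}" by (rule AE_not_in)
    then show ?thesis by eventually_elim (auto simp: inner_commute)
  qed
  have S: "AE y in lborel. ?S y \<ge> 0 \<and> (?S y = 0 \<longrightarrow> N y = 0)"
    using plane mono AE_refl_at[OF e mono, of m] AE_lborel_singleton[of p] AE_lborel_singleton[of "?R p"]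
  proof eventually_elim
    case (elim y)
    have ne: "?R y \<noteq> p" "?R y \<noteq> ?R p" using elim refl_at_refl_at[OF e] by metis+
    show ?case
    proof (cases "m < y \<bullet> e")
      case True
      then show ?thesis using side[OF True] elim ne by blast
    next
      case False
      then have R: "m < ?R y \<bullet> e" using elim by (simp add: refl_at_inner[OF e])
      have RR: "?R (?R y) = y" by (rule refl_at_refl_at[OF e])
      have "N (?R y) * k (?R y) + N (?R (?R y)) * k (?R (?R y)) \<ge> 0 \<and> (N (?R y) * k (?R y) + N (?R (?R y)) * k (?R (?R y)) = 0 \<longrightarrow> N (?R y) = 0 \<and> N (?R (?R y)) = 0)"
        by (rule side[OF R]) (use elim ne RR R in auto)
      then show ?thesis unfolding RR by (simp add: add.commute)
    qed
  qed
  have Si: "integrable lborel ?S" using Nk i2 by simp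
  have S0: "AE y in lborel. 0 \<le> ?S y" using S by eventually_elim simp
  have "(LINT y|lborel. ?S y) = 0" using le integral_nonneg_AE[OF S0] by linarith
  then have "AE y in lborel. ?S y = 0" using integral_nonneg_eq_0_iff_AE[OF Si S0] by simp
  then have "AE y in lborel. N y = 0" using S by eventually_elim simp
  then show False using nz by simp
qed

section \<open>Reflection inequalities for the Green function and its directional derivative\<close>

lemma gf_strict_mono: "0 \<le> a \<Longrightarrow> a < b \<Longrightarrow> gf a < gf b"
proof (rule DERIV_pos_imp_increasing_open[of a b])
  fix x assume "0 \<le> a" "a < x"
  then show "\<exists>y. (gf has_real_derivative y) (at x) \<and> 0 < y"
    by (intro exI[of _ "x / (1 + x)\<^sup>2"] conjI gf_deriv) auto
next
  assume a: "0 \<le> a"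
  show "continuous_on {a..b} gf"
    by (rule continuous_at_imp_continuous_on) (use a in \<open>auto intro!: DERIV_isCont[OF gf_deriv]\<close>)
qed

text \<open>The derivative of gf(t / s) in s is -(t / (s + t))^2 / s, and t / (s + t) increases with
  t; so the difference of the values for t1 and t4 strictly decreases in s.\<close>

lemma gf_div_decreasing:
  assumes s: "0 < s" "s < S" and t: "0 \<le> t4" "t4 < t1"
  shows "gf (t1 / S) - gf (t4 / S) < gf (t1 / s) - gf (t4 / s)"
proof (rule DERIV_neg_imp_decreasing[OF s(2)])
  fix x assume x: "s \<le> x" "x \<le> S"
  then have x0: "x > 0" using s by simp
  have d: "((\<lambda>x. gf (t / x)) has_real_derivative - ((t / (x + t))\<^sup>2 / x)) (at x)" if "t \<ge> 0" for t
  proof -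
    have "((\<lambda>x. t / x) has_real_derivative - (t / x\<^sup>2)) (at x)"
      using x0 by (auto intro!: derivative_eq_intros simp: power2_eq_square)
    moreover have "t / x > -1" using that x0 by (meson divide_nonneg_pos less_le_trans neg_less_0_iff_less zero_less_one)
    ultimately have "((\<lambda>x. gf (t / x)) has_real_derivative (t / x) / (1 + t / x)\<^sup>2 * - (t / x\<^sup>2)) (at x)"
      by (intro DERIV_chain2[OF gf_deriv]) auto
    moreover have "(t / x) / (1 + t / x)\<^sup>2 * - (t / x\<^sup>2) = - ((t / (x + t))\<^sup>2 / x)"
    proof -
      have "1 + t / x = (x + t) / x" using x0 by (simp add: field_simps)
      then show ?thesis using x0 that by (simp add: power_divide power2_eq_square field_simps)
    qed
    ultimately show ?thesis by simp
  qed
  have "t4 / (x + t4) < t1 / (x + t1)" using t x0 by (simp add: frac_less2 divide_less_eq less_divide_eq field_simps)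
  then have "(t4 / (x + t4))\<^sup>2 < (t1 / (x + t1))\<^sup>2" using t x0 by (intro power_strict_mono) auto
  then have "(t4 / (x + t4))\<^sup>2 / x < (t1 / (x + t1))\<^sup>2 / x" using x0 by (simp add: divide_strict_right_mono)
  then show "\<exists>y. ((\<lambda>x. gf (t1 / x) - gf (t4 / x)) has_real_derivative y) (at x) \<and> y < 0"
    using DERIV_diff[OF d d, of t1 t4] t by (intro exI conjI) auto
qed

definition al :: "real^4 \<Rightarrow> real" where "al x = 1 - x \<bullet> x"

lemma theta_al: "\<theta> x y = al x * al y" by (simp add: \<theta>_def al_def)

lemma al_pos: "norm x < 1 \<Longrightarrow> al x > 0" using inner_self_less_1 by (simp add: al_def)

lemma al_nonneg: "norm x \<le> 1 \<Longrightarrow> al x \<ge> 0" using inner_self_le_1 by (simp add: al_def)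

lemma al_refl_at: "norm e = 1 \<Longrightarrow> al (refl_at e m x) = al x + 4 * m * (x \<bullet> e - m)"
  by (simp add: al_def refl_at_self_inner)

lemma green_al: "green x y = \<kappa> * gf (al x * al y / ((x - y) \<bullet> (x - y)))"
  by (simp add: green_def green_reg_def theta_al)

lemma green_pos: "norm x < 1 \<Longrightarrow> norm y < 1 \<Longrightarrow> x \<noteq> y \<Longrightarrow> green x y > 0"
proof -
  assume A: "norm x < 1" "norm y < 1" "x \<noteq> y"
  have "al x * al y / ((x - y) \<bullet> (x - y)) > 0" using A al_pos by simp
  then have "gf (al x * al y / ((x - y) \<bullet> (x - y))) > gf 0" by (intro gf_strict_mono) auto
  then show ?thesis using kappa_pos by (simp add: green_al)
qed

text \<open>Reflecting a point of the cap moves it away from the sphere and closer to points below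
  the plane, and both effects increase the kernel. For two points of the cap a single difference may
  have the wrong sign, but reflecting both preserves their distance, while the two mixed distances
  are equal and larger. \<open>gf_div_decreasing\<close> compares the unmixed terms, monotonicity in
  the boundary defects handles the mixed ones.\<close>

lemma green_cap_kernel:
  assumes e: "norm e = 1" and m: "m > 0" and x: "norm x < 1" "m < x \<bullet> e"
  shows "norm z < 1 \<Longrightarrow> z \<bullet> e < m \<Longrightarrow> z \<noteq> refl_at e m x \<Longrightarrow> green z (refl_at e m x) - green z x > 0"
    and "norm y < 1 \<Longrightarrow> m < y \<bullet> e \<Longrightarrow> y \<noteq> x \<Longrightarrow>
      (green y (refl_at e m x) - green y x) + (green (refl_at e m y) (refl_at e m x) - green (refl_at e m y) x) > 0"
proof -
  let ?R = "refl_at e m"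
  have ax: "al x > 0" using al_pos x by simp
  have ax': "al (?R x) > al x" using x m by (simp add: al_refl_at[OF e])
  show "green z (?R x) - green z x > 0" if z: "norm z < 1" "z \<bullet> e < m" "z \<noteq> ?R x"
  proof -
    have az: "al z > 0" using al_pos z by simp
    have s1: "(?R x - z) \<bullet> (?R x - z) > 0" using z by simp
    have s2: "(?R x - z) \<bullet> (?R x - z) < (x - z) \<bullet> (x - z)" unfolding refl_at_dist[OF e] using x z by simp
    have "al z * al x / ((x - z) \<bullet> (x - z)) < al z * al (?R x) / ((?R x - z) \<bullet> (?R x - z))"
      using az ax ax' s1 s2 by (intro frac_less) auto
    moreover have "0 \<le> al z * al x / ((x - z) \<bullet> (x - z))" using az ax by simp
    ultimately have "gf (al z * al x / ((x - z) \<bullet> (x - z))) < gf (al z * al (?R x) / ((?R x - z) \<bullet> (?R x - z)))"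
      by (intro gf_strict_mono)
    then show ?thesis using kappa_pos unfolding green_al sq_dist_commute[of z] by simp
  qed
  show "(green y (?R x) - green y x) + (green (?R y) (?R x) - green (?R y) x) > 0" if y: "norm y < 1" "m < y \<bullet> e" "y \<noteq> x"
  proof -
    have ay: "al y > 0" using al_pos y by simp
    have ay': "al (?R y) > al y" using y m by (simp add: al_refl_at[OF e])
    define s where "s = (x - y) \<bullet> (x - y)"
    define S where "S = (?R x - y) \<bullet> (?R x - y)"
    have s: "0 < s" using y by (simp add: s_def)
    have S: "S = s + 4 * (x \<bullet> e - m) * (y \<bullet> e - m)" unfolding S_def s_def refl_at_dist[OF e] by (simp add: algebra_simps)
    then have sS: "s < S" using x y by simp
    have d: "(y - x) \<bullet> (y - x) = s" "(y - ?R x) \<bullet> (y - ?R x) = S" "(?R y - ?R x) \<bullet> (?R y - ?R x) = s" "(?R y - x) \<bullet> (?R y - x) = S"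
    proof -
      show q: "(y - x) \<bullet> (y - x) = s" unfolding s_def by (rule sq_dist_commute)
      show "(y - ?R x) \<bullet> (y - ?R x) = S" unfolding S_def by (rule sq_dist_commute)
      show "(?R y - ?R x) \<bullet> (?R y - ?R x) = s" unfolding refl_at_dist_both[OF e] by (rule q)
      show "(?R y - x) \<bullet> (?R y - x) = S"
        unfolding refl_at_dist[OF e, of m y x] q S by (simp add: algebra_simps)
    qed
    have "al y * al x < al (?R y) * al (?R x)" using ax ax' ay ay' by (intro mult_strict_mono) auto
    then have 1: "gf (al (?R y) * al (?R x) / S) - gf (al y * al x / S) < gf (al (?R y) * al (?R x) / s) - gf (al y * al x / s)"
      using ax ay by (intro gf_div_decreasing s sS) auto
    have 2: "gf (al (?R y) * al x / S) \<le> gf (al (?R y) * al (?R x) / S)"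
      using s sS ax ax' ay ay' by (intro gf_mono divide_right_mono mult_left_mono divide_nonneg_nonneg mult_nonneg_nonneg) auto
    have 3: "gf (al y * al x / S) \<le> gf (al y * al (?R x) / S)"
      using s sS ax ax' ay ay' by (intro gf_mono divide_right_mono mult_left_mono divide_nonneg_nonneg mult_nonneg_nonneg) auto
    have "0 < gf (al y * al (?R x) / S) - gf (al y * al x / s) + (gf (al (?R y) * al (?R x) / s) - gf (al (?R y) * al x / S))"
      using 1 2 3 by linarith
    then have "0 < \<kappa> * (gf (al y * al (?R x) / S) - gf (al y * al x / s) + (gf (al (?R y) * al (?R x) / s) - gf (al (?R y) * al x / S)))"
      using kappa_pos by simp
    then show ?thesis unfolding green_al d by (simp add: algebra_simps)
  qed
qed

text \<open>The derivative of \<open>green y\<close> at x in direction e is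
  \<open>- (al x * kd e x y)\<close>. The factor \<open>al x\<close>, which vanishes on the sphere,
  is split off so that a strict sign survives up to the sphere, where it acts as a substitute for a
  boundary point lemma.\<close>

definition kd :: "real^4 \<Rightarrow> real^4 \<Rightarrow> real^4 \<Rightarrow> real" where
  "kd e x y = 2 * \<kappa> * (al y)\<^sup>2 * ((x \<bullet> e) * ((y - x) \<bullet> (y - x)) + al x * ((x - y) \<bullet> e)) /
     (((y - x) \<bullet> (y - x)) * ((y - x) \<bullet> (y - x) + al x * al y)\<^sup>2)"

lemma green_directional_deriv:
  assumes x: "norm (x + t *\<^sub>R e) \<le> 1" and y: "norm y \<le> 1" and ne: "x + t *\<^sub>R e \<noteq> y" and e: "norm e = 1"
  shows "((\<lambda>t. green y (x + t *\<^sub>R e)) has_real_derivative - (al (x + t *\<^sub>R e) * kd e (x + t *\<^sub>R e) y)) (at t)"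
proof -
  define z where "z t = x + t *\<^sub>R e" for t
  define s where "s = (y - z t) \<bullet> (y - z t)"
  have s: "s > 0" using ne by (simp add: s_def z_def)
  define A where "A = al (z t)"
  define B where "B = al y"
  have AB: "A \<ge> 0" "B \<ge> 0" using al_nonneg x y by (auto simp: A_def B_def z_def)
  have ee: "e \<bullet> e = 1" using e by (simp add: norm_eq_1)
  have ze: "z t \<bullet> e = x \<bullet> e + t" for t by (simp add: z_def inner_add_left ee)
  have "al (z t) = 1 - (x \<bullet> x + 2 * t * (x \<bullet> e) + t * t)" for t
    by (simp add: al_def z_def inner_add_left inner_add_right ee inner_commute)
  then have dz: "((\<lambda>t. al (z t)) has_real_derivative - (2 * (z t \<bullet> e))) (at t)"
    unfolding ze by (auto intro!: derivative_eq_intros)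
  have "(y - z t) \<bullet> (y - z t) = (y - x) \<bullet> (y - x) - 2 * t * ((y - x) \<bullet> e) + t * t" for t
  proof -
    have "y - z t = (y - x) - t *\<^sub>R e" by (simp add: z_def)
    moreover have "(p - t *\<^sub>R e) \<bullet> (p - t *\<^sub>R e) = p \<bullet> p - 2 * t * (p \<bullet> e) + t * t" for p
      by (simp add: inner_diff_left inner_diff_right ee inner_commute)
    ultimately show ?thesis by (simp only:)
  qed
  moreover have "(y - z t) \<bullet> e = (y - x) \<bullet> e - t" by (simp add: inner_diff_left ze)
  ultimately have ds: "((\<lambda>t. (y - z t) \<bullet> (y - z t)) has_real_derivative - (2 * ((y - z t) \<bullet> e))) (at t)"
    by (auto intro!: derivative_eq_intros)
  have st: "(y - z t) \<bullet> (y - z t) = s" and At: "al (z t) = A" and Bt: "al y = B" by (simp_all only: s_def A_def B_def)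
  have dn: "((\<lambda>t. al y * al (z t)) has_real_derivative B * - (2 * (z t \<bullet> e))) (at t)"
    unfolding Bt by (rule DERIV_cmult[OF dz])
  have s0: "(y - z t) \<bullet> (y - z t) \<noteq> 0" unfolding st using s by simp
  from DERIV_divide[OF dn ds s0]
  have db: "((\<lambda>t. al y * al (z t) / ((y - z t) \<bullet> (y - z t))) has_real_derivative ((B * - (2 * (z t \<bullet> e))) * s - (B * A) * - (2 * ((y - z t) \<bullet> e))) / (s * s)) (at t)"
    by (simp only: st At Bt)
  have gt: "B * A / s > -1"
    using AB s by (simp add: less_le_trans[of "-1" 0])
  define g where "g t = al y * al (z t) / ((y - z t) \<bullet> (y - z t))" for t
  have gt': "g t = B * A / s" by (simp only: g_def A_def B_def s_def)
  have dg: "(g has_real_derivative ((B * - (2 * (z t \<bullet> e))) * s - (B * A) * - (2 * ((y - z t) \<bullet> e))) / (s * s)) (at t)"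
    using db by (simp only: g_def[abs_def])
  have "(gf has_real_derivative (B * A / s) / (1 + B * A / s)\<^sup>2) (at (g t))"
    unfolding gt' by (rule gf_deriv[OF gt])
  from DERIV_cmult[OF DERIV_chain2[OF this dg], of \<kappa>]
  have "((\<lambda>t. green y (z t)) has_real_derivative \<kappa> * ((B * A / s) / (1 + B * A / s)\<^sup>2 * (((B * - (2 * (z t \<bullet> e))) * s - (B * A) * - (2 * ((y - z t) \<bullet> e))) / (s * s)))) (at t)"
    by (simp only: green_al g_def)
  moreover have "\<kappa> * ((B * A / s) / (1 + B * A / s)\<^sup>2 * (((B * - (2 * (z t \<bullet> e))) * s - (B * A) * - (2 * ((y - z t) \<bullet> e))) / (s * s))) = - (A * kd e (z t) y)"
  proof -
    define w where "w = s + A * B"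
    have w: "w > 0" using s AB by (simp add: w_def add_pos_nonneg)
    have 1: "1 + B * A / s = w / s" using s by (simp add: w_def field_simps)
    have "(z t - y) \<bullet> e = - ((y - z t) \<bullet> e)" by (simp add: inner_diff_left)
    then have k: "kd e (z t) y = 2 * \<kappa> * B\<^sup>2 * ((z t \<bullet> e) * s - A * ((y - z t) \<bullet> e)) / (s * w\<^sup>2)"
      by (simp add: kd_def A_def B_def s_def w_def)
    have "\<kappa> * ((B * A / s) / (w / s)\<^sup>2 * (((B * - (2 * p)) * s - (B * A) * - (2 * q)) / (s * s))) =
        - (A * (2 * \<kappa> * B\<^sup>2 * (p * s - A * q) / (s * w\<^sup>2)))" for p q
    proof -
      have 2: "(B * A / s) / (w / s)\<^sup>2 = B * A * s / w\<^sup>2" using s w by (simp add: power2_eq_square)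
      have 3: "((B * - (2 * p)) * s - (B * A) * - (2 * q)) / (s * s) = - (2 * B * (p * s - A * q)) / s / s" by (simp add: algebra_simps)
      show ?thesis unfolding 2 3 using s w by (simp add: power2_eq_square mult_ac)
    qed
    then show ?thesis unfolding k 1 .
  qed
  ultimately show ?thesis by (simp only: A_def z_def)
qed

text \<open>With A, B the boundary defects and r the distance, everything reduces to B r <= 4 (r^2 +
  A B). Since B <= A + 2 r, either B <= 4 r, or B <= 2 A and then B^2 is controlled by A B. The
  constant arises as 40 = 2 (4 * 4 + 4).\<close>

lemma kd_bound:
  assumes x: "norm x \<le> 1" and y: "norm y < 1" and e: "norm e = 1"
  shows "\<bar>kd e x y\<bar> \<le> 40 * \<kappa> * inverse ((y - x) \<bullet> (y - x))"
proof (cases "x = y")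
  case True
  then show ?thesis by (simp add: kd_def)
next
  case False
  define r where "r = norm (y - x)"
  have r: "r > 0" using False by (simp add: r_def)
  define A where "A = al x"
  define B where "B = al y"
  have A: "0 \<le> A" "A \<le> 1" and B: "0 \<le> B" using al_nonneg x y by (auto simp: A_def B_def) (simp add: al_def)
  define w where "w = r\<^sup>2 + A * B"
  have w: "w > 0" using r A B by (simp add: w_def add_pos_nonneg)
  have s: "(y - x) \<bullet> (y - x) = r\<^sup>2" by (simp add: r_def power2_norm_eq_inner)
  have BA: "B \<le> A + 2 * r"
  proof -
    have "B - A = (norm x)\<^sup>2 - (norm y)\<^sup>2" by (simp add: A_def B_def al_def power2_norm_eq_inner)
    also have "\<dots> = (norm x - norm y) * (norm x + norm y)" by (simp add: power2_eq_square algebra_simps)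
    also have "\<dots> \<le> r * 2"
    proof (cases "norm x \<ge> norm y")
      case True
      have "norm x - norm y \<le> r" using norm_triangle_ineq2[of x y] by (simp add: r_def norm_minus_commute)
      then show ?thesis using True x y by (intro mult_mono) auto
    next
      case False
      then have "(norm x - norm y) * (norm x + norm y) \<le> 0" by (intro mult_nonpos_nonneg) auto
      then show ?thesis using r by linarith
    qed
    finally show ?thesis by simp
  qed
  have key: "B * r \<le> 4 * w"
  proof (cases "B \<le> 4 * r")
    case True
    then have "B * r \<le> 4 * r * r" using r by (intro mult_right_mono) auto
    also have "\<dots> \<le> 4 * w" using A B by (simp add: w_def power2_eq_square)
    finally show ?thesis .
  next
    case False
    then have "B \<le> 2 * A" using BA by simp
    then have "B * B \<le> (2 * A) * B" using B by (intro mult_right_mono) auto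
    then have "B * B \<le> 2 * (A * B)" by (simp only: mult.assoc)
    moreover have "2 * (B * r) \<le> B * B + r * r" using zero_le_power2[of "B - r"] by (simp add: power2_eq_square algebra_simps)
    moreover have "0 \<le> r * r" "0 \<le> A * B" using A B by auto
    moreover have "p \<le> 4 * (q + s)" if "2 * p \<le> b + q" "b \<le> 2 * s" "0 \<le> q" "0 \<le> s" for p q s b :: real
    proof -
      have "2 * p \<le> 2 * s + q" using that(1,2) by (rule order_trans[OF _ add_right_mono])
      then show ?thesis using that(3,4) by simp
    qed
    ultimately show ?thesis unfolding w_def power2_eq_square by blast
  qed
  have xe: "\<bar>x \<bullet> e\<bar> \<le> 1" using Cauchy_Schwarz_ineq2[of x e] x e by simp
  have xy: "\<bar>(x - y) \<bullet> e\<bar> \<le> r" using Cauchy_Schwarz_ineq2[of "x - y" e] e by (simp add: r_def norm_minus_commute)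
  have "\<bar>(x \<bullet> e) * r\<^sup>2 + A * ((x - y) \<bullet> e)\<bar> \<le> 1 * r\<^sup>2 + A * r"
    by (rule order_trans[OF abs_triangle_ineq], unfold abs_mult, intro add_mono mult_mono) (use xe xy A r in auto)
  then have "B\<^sup>2 * \<bar>(x \<bullet> e) * r\<^sup>2 + A * ((x - y) \<bullet> e)\<bar> \<le> B\<^sup>2 * (r\<^sup>2 + A * r)" by (intro mult_left_mono) auto
  also have "\<dots> = (B * r) * (B * r) + (A * B) * (B * r)" by (simp add: power2_eq_square algebra_simps)
  also have "\<dots> \<le> (4 * w) * (4 * w) + w * (4 * w)"
  proof (rule add_mono)
    show "(B * r) * (B * r) \<le> (4 * w) * (4 * w)" using B r w by (intro mult_mono[OF key key]) auto
    have "A * B \<le> w" by (simp add: w_def)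
    then show "(A * B) * (B * r) \<le> w * (4 * w)" using A B r w by (intro mult_mono[OF _ key]) auto
  qed
  also have "\<dots> = 20 * w\<^sup>2" by (simp add: power2_eq_square)
  finally have "2 * \<kappa> * (B\<^sup>2 * \<bar>(x \<bullet> e) * r\<^sup>2 + A * ((x - y) \<bullet> e)\<bar>) \<le> 2 * \<kappa> * (20 * w\<^sup>2)" using kappa_pos by (intro mult_left_mono) auto
  then have "2 * \<kappa> * (B\<^sup>2 * \<bar>(x \<bullet> e) * r\<^sup>2 + A * ((x - y) \<bullet> e)\<bar>) / (r\<^sup>2 * w\<^sup>2) \<le> 2 * \<kappa> * (20 * w\<^sup>2) / (r\<^sup>2 * w\<^sup>2)"
    using r w by (intro divide_right_mono) auto
  moreover have "\<bar>kd e x y\<bar> = 2 * \<kappa> * (B\<^sup>2 * \<bar>(x \<bullet> e) * r\<^sup>2 + A * ((x - y) \<bullet> e)\<bar>) / (r\<^sup>2 * w\<^sup>2)"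
    unfolding kd_def s A_def[symmetric] B_def[symmetric] w_def[symmetric] using kappa_pos by (simp add: abs_mult abs_divide mult.assoc)
  moreover have "2 * \<kappa> * (20 * w\<^sup>2) / (r\<^sup>2 * w\<^sup>2) = 40 * \<kappa> * inverse (r\<^sup>2)" using w r by (simp add: field_simps)
  ultimately show ?thesis unfolding s by simp
qed

lemma kd_continuous:
  assumes x: "norm x \<le> 1" and y: "norm y < 1" and ne: "x \<noteq> y"
  shows "continuous (at x within cball 0 1) (\<lambda>x. kd e x y)"
proof -
  have s: "(y - x) \<bullet> (y - x) > 0" using ne by simp
  have "al x * al y \<ge> 0" using al_nonneg x y by simp
  then have w: "(y - x) \<bullet> (y - x) + al x * al y > 0" using s by linarith
  have "continuous (at x within cball 0 1) (\<lambda>x. al x)" unfolding al_def by (intro continuous_intros)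
  then show ?thesis unfolding kd_def using s w by (intro continuous_intros) auto
qed

text \<open>For x on the plane, y and its image are equally far from x and contribute m s minus or
  plus \<open>al x\<close> t, with weights c <= c' because (B / (s + \<open>al x\<close> B))^2
  increases with the defect B. The sum (c + c') m s + (c' - c) \<open>al x\<close> t is positive
  since m > 0, also for x on the sphere.\<close>

lemma kd_plane:
  assumes e: "norm e = 1" and m: "m > 0" and x: "norm x \<le> 1" "x \<bullet> e = m"
  shows "norm z < 1 \<Longrightarrow> z \<bullet> e < m \<Longrightarrow> kd e x z > 0"
    and "norm y < 1 \<Longrightarrow> m < y \<bullet> e \<Longrightarrow> kd e x y + kd e x (refl_at e m y) > 0"
proof -
  have A: "al x \<ge> 0" by (rule al_nonneg[OF x(1)])
  show "kd e x z > 0" if z: "norm z < 1" "z \<bullet> e < m"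
  proof -
    have s: "(z - x) \<bullet> (z - x) > 0" using z x by auto
    have B: "al z > 0" by (rule al_pos[OF z(1)])
    have "(x \<bullet> e) * ((z - x) \<bullet> (z - x)) + al x * ((x - z) \<bullet> e) > 0"
      using s m A z x by (intro add_pos_nonneg mult_pos_pos mult_nonneg_nonneg) (auto simp: inner_diff_left)
    moreover have "(z - x) \<bullet> (z - x) + al x * al z > 0" using s B A by (simp add: add_pos_nonneg)
    ultimately show ?thesis unfolding kd_def using s B kappa_pos
      by (intro divide_pos_pos mult_pos_pos zero_less_power) simp_all
  qed
  show "kd e x y + kd e x (refl_at e m y) > 0" if y: "norm y < 1" "m < y \<bullet> e"
  proof -
    let ?y = "refl_at e m y"
    define s where "s = (y - x) \<bullet> (y - x)"
    have s: "s > 0" using y x by (auto simp: s_def)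
    have s': "(?y - x) \<bullet> (?y - x) = s" unfolding refl_at_dist[OF e] using x by (simp add: s_def)
    define B where "B = al y"
    define B' where "B' = al ?y"
    have B: "B > 0" using al_pos y by (simp add: B_def)
    have BB: "B' \<ge> B" using y m by (simp add: B_def B'_def al_refl_at[OF e])
    define t where "t = y \<bullet> e - m"
    have t: "t > 0" using y by (simp add: t_def)
    have d1: "(x - y) \<bullet> e = - t" using x by (simp add: inner_diff_left t_def)
    have d2: "(x - ?y) \<bullet> e = t" using x by (simp add: inner_diff_left t_def refl_at_inner[OF e])
    define c where "c = (B / (s + al x * B))\<^sup>2"
    define c' where "c' = (B' / (s + al x * B'))\<^sup>2"
    have c0: "c > 0" using B s A by (simp add: c_def add_pos_nonneg less_imp_neq[symmetric])
    have "B / (s + al x * B) \<le> B' / (s + al x * B')"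
      using B BB s A by (simp add: divide_le_eq le_divide_eq add_pos_nonneg field_simps)
    then have cc: "c \<le> c'" unfolding c_def c'_def using B s A by (intro power_mono) auto
    have k1: "kd e x y = 2 * \<kappa> / s * (c * (m * s - al x * t))"
      unfolding kd_def s_def[symmetric] B_def[symmetric] x(2) d1 c_def using s by (simp add: power_divide)
    have k2: "kd e x ?y = 2 * \<kappa> / s * (c' * (m * s + al x * t))"
      unfolding kd_def s' B'_def[symmetric] x(2) d2 c'_def using s by (simp add: power_divide)
    have "c * (m * s - al x * t) + c' * (m * s + al x * t) = (c + c') * (m * s) + (c' - c) * (al x * t)" by (simp add: algebra_simps)
    moreover have "(c + c') * (m * s) > 0" "(c' - c) * (al x * t) \<ge> 0" using c0 cc m s A t by auto
    ultimately have "c * (m * s - al x * t) + c' * (m * s + al x * t) > 0" by linarith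
    then have "2 * \<kappa> / s * (c * (m * s - al x * t) + c' * (m * s + al x * t)) > 0" using kappa_pos s by simp
    then show ?thesis unfolding k1 k2 by (simp add: distrib_left)
  qed
qed

lemma refl_at_norm_less: "norm e = 1 \<Longrightarrow> 0 \<le> m \<Longrightarrow> m \<le> x \<bullet> e \<Longrightarrow> norm x < 1 \<Longrightarrow> norm (refl_at e m x) < 1"
proof -
  assume A: "norm e = 1" "0 \<le> m" "m \<le> x \<bullet> e" "norm x < 1"
  have "0 \<le> 4 * m * (x \<bullet> e - m)" using A by simp
  then have "refl_at e m x \<bullet> refl_at e m x < 1" using inner_self_less_1[OF A(4)] by (simp add: refl_at_self_inner[OF A(1)])
  then show ?thesis by (simp add: norm_eq_sqrt_inner)
qed

lemma borel_kd[measurable]: "(\<lambda>y. kd e x y) \<in> borel_measurable borel"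
  unfolding kd_def al_def by measurable

text \<open>The line lies in a hyperplane whose normal is orthogonal to its direction.\<close>

lemma AE_not_on_line:
  fixes x e :: "real^4"
  shows "AE y in lborel. \<forall>t. y \<noteq> x + t *\<^sub>R e"
proof -
  obtain w :: "real^4" where w: "w \<noteq> 0" "orthogonal e w" using orthogonal_to_vector_exists[of e] by auto
  have "negligible {y. w \<bullet> y = w \<bullet> x}" by (rule negligible_hyperplane) (use w in simp)
  moreover have sb: "{y. w \<bullet> y = w \<bullet> x} \<in> sets lborel" by simp
  ultimately have "{y. w \<bullet> y = w \<bullet> x} \<in> null_sets lborel"
    using null_sets_completion_iff[OF sb] negligible_iff_null_sets by auto
  then show ?thesis
    by (rule AE_I') (use w in \<open>auto simp: orthogonal_def inner_add_right inner_commute\<close>)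
qed

lemma green_segment:
  assumes e: "norm e = 1" and y: "norm y < 1" and T: "0 \<le> T" and seg: "\<And>t. 0 \<le> t \<Longrightarrow> t \<le> T \<Longrightarrow> norm (x + t *\<^sub>R e) \<le> 1"
    and ne: "\<And>t. y \<noteq> x + t *\<^sub>R e"
  shows "(LINT t|lborel. indicator {0..T} t * (al (x + t *\<^sub>R e) * kd e (x + t *\<^sub>R e) y)) = green y x - green y (x + T *\<^sub>R e)"
proof -
  have "(LINT t|lborel. (al (x + t *\<^sub>R e) * kd e (x + t *\<^sub>R e) y) * indicator {0..T} t) = - green y (x + T *\<^sub>R e) - - green y (x + 0 *\<^sub>R e)"
  proof (rule integral_FTC_Icc_real[OF T])
    fix t :: real assume t: "0 \<le> t" "t \<le> T"
    have nt: "norm (x + t *\<^sub>R e) \<le> 1" using seg t by blast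
    have net: "x + t *\<^sub>R e \<noteq> y" using ne[of t] by simp
    show "((\<lambda>t. - green y (x + t *\<^sub>R e)) has_real_derivative al (x + t *\<^sub>R e) * kd e (x + t *\<^sub>R e) y) (at t)"
      using DERIV_minus[OF green_directional_deriv[OF nt less_imp_le[OF y] net e]] by simp
    have s: "(y - (x + t *\<^sub>R e)) \<bullet> (y - (x + t *\<^sub>R e)) > 0" using net by (simp only: inner_gt_zero_iff) simp
    have "al (x + t *\<^sub>R e) * al y \<ge> 0" using al_nonneg[OF nt] al_nonneg[of y] y by simp
    then have w: "(y - (x + t *\<^sub>R e)) \<bullet> (y - (x + t *\<^sub>R e)) + al (x + t *\<^sub>R e) * al y \<noteq> 0" using s by linarith
    have c: "isCont (\<lambda>t. al (x + t *\<^sub>R e)) t" unfolding al_def by (intro continuous_intros)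
    show "isCont (\<lambda>t. al (x + t *\<^sub>R e) * kd e (x + t *\<^sub>R e) y) t"
      unfolding kd_def using s w c by (intro continuous_intros) (simp_all only: mult_eq_0_iff power_eq_0_iff simp_thms less_irrefl, (metis less_irrefl)?)
  qed
  then show ?thesis by (simp add: mult.commute)
qed

section \<open>The moving plane argument, the boundary layer and the mass bound\<close>

context unit_problem
begin

lemma sol_kd:
  assumes s: "sol u N" and e: "norm e = 1"
  shows "continuous_on (cball 0 1) (\<lambda>x. LINT y|lborel. N y * kd e x y)"
    and "\<And>x. norm x \<le> 1 \<Longrightarrow> integrable lborel (\<lambda>y. N y * kd e x y)"
proof -
  obtain K where K: "\<And>x. N x \<le> K" using solD(4)[OF s] by blast
  have b: "\<bar>kd e x y\<bar> \<le> (40 * \<kappa>) * inverse ((y - x) \<bullet> (y - x))" if "norm x \<le> 1" "norm y < 1" for x y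
    by (rule kd_bound[OF that e])
  show "continuous_on (cball 0 1) (\<lambda>x. LINT y|lborel. N y * kd e x y)"
    by (rule continuous_potential(1)[OF solD(1-2)[OF s] K solD(3)[OF s] borel_kd b kd_continuous])
  show "integrable lborel (\<lambda>y. N y * kd e x y)" if "norm x \<le> 1" for x
    by (rule continuous_potential(2)[OF solD(1-2)[OF s] K solD(3)[OF s] borel_kd b kd_continuous that])
qed

text \<open>In place of differentiating \<open>u\<close>, the fundamental theorem of calculus is
  applied to the kernel along the segment, for each y off the line, and the integrals in t and y are
  exchanged. The double integral converges because \<open>kd\<close> is bounded by a multiple of the
  inverse squared distance.\<close>

lemma segment_decrease:
  assumes s: "sol u N" and e: "norm e = 1" and T: "0 \<le> T" and seg: "\<And>t. 0 \<le> t \<Longrightarrow> t \<le> T \<Longrightarrow> norm (x + t *\<^sub>R e) \<le> 1"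
    and v: "\<And>t. 0 \<le> t \<Longrightarrow> t \<le> T \<Longrightarrow> 0 \<le> (LINT y|lborel. N y * kd e (x + t *\<^sub>R e) y)"
  shows "u (x + T *\<^sub>R e) \<le> u x"
proof -
  obtain K where K: "\<And>x. N x \<le> K" using solD(4)[OF s] by blast
  note N = solD(1)[OF s] solD(2)[OF s] solD(3)[OF s]
  note N(1)[measurable]
  have K0: "K \<ge> 0" using N(2) K by (meson order_trans)
  define p where "p t = x + t *\<^sub>R e" for t
  have pm[measurable]: "p \<in> borel_measurable borel" unfolding p_def[abs_def] by (intro borel_measurable_continuous_onI continuous_intros)
  define F where "F t y = indicator {0..T} t * (N y * (al (p t) * kd e (p t) y))" for t y
  have Fm[measurable]: "(\<lambda>(t, y). F t y) \<in> borel_measurable (lborel \<Otimes>\<^sub>M lborel)"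
    unfolding F_def kd_def al_def by measurable
  define B where "B = K * (40 * \<kappa>)"
  have B0: "B \<ge> 0" using K0 kappa_pos by (simp add: B_def)
  have Fb: "\<bar>F t y\<bar> \<le> indicator {0..T} t * (B * (indicator (ball 0 1) y * inverse ((y - p t) \<bullet> (y - p t))))" for t y
  proof (cases "t \<in> {0..T} \<and> norm y < 1")
    case True
    have nt: "norm (p t) \<le> 1" using seg True by (simp add: p_def)
    have a: "0 \<le> al (p t)" "al (p t) \<le> 1" using al_nonneg[OF nt] by (auto simp: al_def)
    have "\<bar>al (p t) * kd e (p t) y\<bar> \<le> 1 * (40 * \<kappa> * inverse ((y - p t) \<bullet> (y - p t)))"
      unfolding abs_mult using kd_bound[OF nt _ e, of y] True a by (intro mult_mono) auto
    then have "\<bar>N y\<bar> * \<bar>al (p t) * kd e (p t) y\<bar> \<le> K * (1 * (40 * \<kappa> * inverse ((y - p t) \<bullet> (y - p t))))"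
      using K[of y] N(2)[of y] K0 by (intro mult_mono) auto
    then show ?thesis using True by (simp add: F_def B_def abs_mult mult.assoc)
  next
    case False
    then have "F t y = 0" using N(3)[of y] by (auto simp: F_def indicator_def)
    then show ?thesis using B0 by simp
  qed
  have kb: "integrable lborel (\<lambda>y. indicator {0..T} t * (B * (indicator (ball 0 1) y * inverse ((y - p t) \<bullet> (y - p t)))))" for t
  proof (cases "t \<in> {0..T}")
    case True
    then show ?thesis using integrable_kernel_ball(1)[of "p t"] seg by (simp add: p_def)
  qed simp
  have Fi: "integrable lborel (F t)" for t
  proof (rule Bochner_Integration.integrable_bound[OF kb[of t]])
    show "F t \<in> borel_measurable lborel" unfolding F_def by measurable
    show "AE y in lborel. norm (F t y) \<le> norm (indicator {0..T} t * (B * (indicator (ball 0 1) y * inverse ((y - p t) \<bullet> (y - p t)))))"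
      using Fb[of t] by (intro AE_I2) (simp only: real_norm_def, meson abs_ge_self order_trans)
  qed
  have int: "integrable (lborel \<Otimes>\<^sub>M lborel) (\<lambda>(t, y). F t y)"
  proof (rule lborel_pair.Fubini_integrable[OF Fm])
    show "AE t in lborel. integrable lborel (\<lambda>y. case (t, y) of (t, y) \<Rightarrow> F t y)" using Fi by simp
    show "integrable lborel (\<lambda>t. LINT y|lborel. norm (case (t, y) of (t, y) \<Rightarrow> F t y))"
    proof (rule Bochner_Integration.integrable_bound[where f = "\<lambda>t. (B * (4 * rad2_int)) * indicator {0..T} t"])
      show "integrable lborel (\<lambda>t. (B * (4 * rad2_int)) * indicator {0..T} t)"
        by (intro integrable_mult_right integrable_real_indicator) (simp_all add: emeasure_lborel_Icc[OF T])
      show "(\<lambda>t. LINT y|lborel. norm (case (t, y) of (t, y) \<Rightarrow> F t y)) \<in> borel_measurable lborel" by measurable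
      show "AE t in lborel. norm (LINT y|lborel. norm (case (t, y) of (t, y) \<Rightarrow> F t y)) \<le> norm ((B * (4 * rad2_int)) * indicator {0..T} t)"
      proof (rule AE_I2)
        fix t
        have "(LINT y|lborel. \<bar>F t y\<bar>) \<le> (LINT y|lborel. indicator {0..T} t * (B * (indicator (ball 0 1) y * inverse ((y - p t) \<bullet> (y - p t)))))"
          by (intro integral_mono integrable_abs Fi kb Fb)
        also have "\<dots> \<le> (B * (4 * rad2_int)) * indicator {0..T} t"
        proof (cases "t \<in> {0..T}")
          case True
          then have "(LINT y|lborel. indicator (ball 0 1) y * inverse ((y - p t) \<bullet> (y - p t))) \<le> 4 * rad2_int"
            using integrable_kernel_ball(2)[of "p t"] seg by (simp add: p_def)
          then have "B * (LINT y|lborel. indicator (ball 0 1) y * inverse ((y - p t) \<bullet> (y - p t))) \<le> B * (4 * rad2_int)"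
            by (rule mult_left_mono[OF _ B0])
          then show ?thesis using True by simp
        qed simp
        finally have 1: "(LINT y|lborel. \<bar>F t y\<bar>) \<le> (B * (4 * rad2_int)) * indicator {0..T} t" .
        have "0 \<le> (LINT y|lborel. \<bar>F t y\<bar>)" by (simp add: integral_nonneg_AE)
        then show "norm (LINT y|lborel. norm (case (t, y) of (t, y) \<Rightarrow> F t y)) \<le> norm ((B * (4 * rad2_int)) * indicator {0..T} t)"
          using 1 by simp
      qed
    qed
  qed
  have "(LINT t|lborel. LINT y|lborel. F t y) = (LINT y|lborel. LINT t|lborel. F t y)"
    by (rule lborel_pair.Fubini_integral[OF int, symmetric])
  moreover have "0 \<le> (LINT t|lborel. LINT y|lborel. F t y)"
  proof (rule integral_nonneg_AE, rule AE_I2)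
    fix t
    show "0 \<le> (LINT y|lborel. F t y)"
    proof (cases "t \<in> {0..T}")
      case True
      have "(LINT y|lborel. F t y) = al (p t) * (LINT y|lborel. N y * kd e (p t) y)"
        using True by (simp add: F_def mult.left_commute[of "N _"])
      then show ?thesis using v[of t] al_nonneg[of "p t"] seg[of t] True by (simp add: p_def)
    qed (simp add: F_def)
  qed
  moreover have "(LINT y|lborel. LINT t|lborel. F t y) = (LINT y|lborel. N y * green y x - N y * green y (x + T *\<^sub>R e))"
  proof (rule integral_cong_AE)
    show "(\<lambda>y. LINT t|lborel. F t y) \<in> borel_measurable lborel" by measurable
    show "(\<lambda>y. N y * green y x - N y * green y (x + T *\<^sub>R e)) \<in> borel_measurable lborel"
      using borel_green_left[of x] borel_green_left[of "x + T *\<^sub>R e"] by measurable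
    show "AE y in lborel. (LINT t|lborel. F t y) = N y * green y x - N y * green y (x + T *\<^sub>R e)"
      using AE_not_on_line[of x e]
    proof eventually_elim
      case (elim y)
      show ?case
      proof (cases "norm y < 1")
        case True
        have "(LINT t|lborel. F t y) = N y * (LINT t|lborel. indicator {0..T} t * (al (x + t *\<^sub>R e) * kd e (x + t *\<^sub>R e) y))"
          unfolding F_def p_def by (simp add: mult.left_commute[of "indicator _ _" "N y"])
        also have "\<dots> = N y * (green y x - green y (x + T *\<^sub>R e))"
          using green_segment[OF e True T seg] elim by simp
        finally show ?thesis by (simp add: right_diff_distrib)
      qed (use N(3)[of y] in \<open>simp add: F_def\<close>)
    qed
  qed
  moreover have "(LINT y|lborel. N y * green y x - N y * green y (x + T *\<^sub>R e)) = u x - u (x + T *\<^sub>R e)"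
  proof -
    have n: "norm x \<le> 1" "norm (x + T *\<^sub>R e) \<le> 1" using seg[of 0] seg[of T] T by auto
    show ?thesis unfolding solD(5)[OF s n(1)] solD(5)[OF s n(2)]
      by (rule Bochner_Integration.integral_diff[OF sol_continuous(2)[OF s n(1)] sol_continuous(2)[OF s n(2)]])
  qed
  ultimately show ?thesis by linarith
qed

definition below :: "(real^4 \<Rightarrow> real) \<Rightarrow> real^4 \<Rightarrow> real \<Rightarrow> bool" where
  "below u e m \<longleftrightarrow> (\<forall>x. norm x < 1 \<longrightarrow> m < x \<bullet> e \<longrightarrow> u x \<le> u (refl_at e m x))"

text \<open>\<open>H_refl\<close> compares the nonlinearity at the two points and at the two values
  of u at once, so an ordering of u becomes an ordering of the densities.\<close>

lemma below_density:
  assumes s: "sol u N" and e: "norm e = 1" and m: "lam0 \<le> m" and b: "below u e m"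
  shows "AE y in lborel. y \<in> ball 0 1 \<and> m < y \<bullet> e \<longrightarrow> N y \<le> N (refl_at e m y)"
  using solD(7)[OF s] AE_refl_at[OF e solD(7)[OF s], of m]
proof eventually_elim
  case (elim y)
  show ?case
  proof (intro impI, elim conjE)
    assume y: "y \<in> ball 0 1" "m < y \<bullet> e"
    have ny: "norm y < 1" using y by simp
    have "norm (refl_at e m y) < 1" using refl_at_norm_less[OF e _ _ ny, of m] m lam0 y by simp
    then have 1: "N (refl_at e m y) = H (refl_at e m y) (u (refl_at e m y))" using elim by simp
    have "H y (u y) \<le> H (refl_at e m y) (u (refl_at e m y))"
      unfolding refl_at_def[of e m y]
      by (rule H_refl[OF e m ny y(2) sol_nonneg[OF s]]) (use b ny y in \<open>auto simp: below_def refl_at_def\<close>)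
    then show "N y \<le> N (refl_at e m y)" using 1 elim y by simp
  qed
qed

text \<open>Once the densities are ordered, both conclusions are the same reflected pairing with two
  kernels: the difference of the Green functions of a cap point and its image, and \<open>kd\<close>
  at a point of the plane.\<close>

lemma below_strict:
  assumes s: "sol u N" and nz: "\<not> (AE y in lborel. N y = 0)" and e: "norm e = 1" and m: "lam0 \<le> m" and b: "below u e m"
  shows "norm x < 1 \<Longrightarrow> m < x \<bullet> e \<Longrightarrow> u x < u (refl_at e m x)"
    and "norm x \<le> 1 \<Longrightarrow> x \<bullet> e = m \<Longrightarrow> 0 < (LINT y|lborel. N y * kd e x y)"
proof -
  have m0: "m > 0" using m lam0 by simp
  note mp = moving_plane_integral_pos[OF e less_imp_le[OF m0] solD(1-2)[OF s] _ below_density[OF s e m b], where p = x]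
  show "u x < u (refl_at e m x)" if x: "norm x < 1" "m < x \<bullet> e"
  proof -
    have n: "norm x \<le> 1" "norm (refl_at e m x) \<le> 1" using x refl_at_norm_less[OF e _ _ x(1), of m] m0 by auto
    have i: "integrable lborel (\<lambda>y. N y * green y x)" "integrable lborel (\<lambda>y. N y * green y (refl_at e m x))"
      using sol_continuous(2)[OF s] n by auto
    have "0 < (LINT y|lborel. N y * (green y (refl_at e m x) - green y x))"
    proof (rule mp)
      show "N x = 0" if "x \<notin> ball 0 1" for x by (rule solD(3)[OF s that])
      show "\<not> (AE y in lborel. N y = 0)" by (rule nz)
      show "(\<lambda>y. green y (refl_at e m x) - green y x) \<in> borel_measurable borel"
        by (intro borel_measurable_diff borel_green_left)
      show "integrable lborel (\<lambda>y. N y * (green y (refl_at e m x) - green y x))"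
        unfolding right_diff_distrib by (intro Bochner_Integration.integrable_diff i)
      show "0 < green z (refl_at e m x) - green z x" if "z \<in> ball 0 1" "z \<bullet> e < m" "z \<noteq> x" "z \<noteq> refl_at e m x" for z
        using green_cap_kernel(1)[OF e m0 x, of z] that by simp
      show "0 < green y (refl_at e m x) - green y x + (green (refl_at e m y) (refl_at e m x) - green (refl_at e m y) x)"
        if "y \<in> ball 0 1" "m < y \<bullet> e" "y \<noteq> x" "y \<noteq> refl_at e m x" for y
        using green_cap_kernel(2)[OF e m0 x, of y] that by simp
    qed
    also have "\<dots> = u (refl_at e m x) - u x"
      unfolding right_diff_distrib solD(5)[OF s n(1)] solD(5)[OF s n(2)]
      by (rule Bochner_Integration.integral_diff[OF i(2) i(1)])
    finally show ?thesis by simp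
  qed
  show "0 < (LINT y|lborel. N y * kd e x y)" if x: "norm x \<le> 1" "x \<bullet> e = m"
  proof (rule mp)
      show "N x = 0" if "x \<notin> ball 0 1" for x by (rule solD(3)[OF s that])
      show "\<not> (AE y in lborel. N y = 0)" by (rule nz)
    show "kd e x \<in> borel_measurable borel" by (rule borel_kd)
    show "integrable lborel (\<lambda>y. N y * kd e x y)" by (rule sol_kd(2)[OF s e x(1)])
    show "0 < kd e x z" if "z \<in> ball 0 1" "z \<bullet> e < m" "z \<noteq> x" "z \<noteq> refl_at e m x" for z
      using kd_plane(1)[OF e m0 x, of z] that by simp
    show "0 < kd e x y + kd e x (refl_at e m y)" if "y \<in> ball 0 1" "m < y \<bullet> e" "y \<noteq> x" "y \<noteq> refl_at e m x" for y
      using kd_plane(2)[OF e m0 x, of y] that by simp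
  qed
qed

lemma sol_sphere: assumes s: "sol u N" and x: "norm x \<ge> 1" shows "u x = 0"
proof (cases "norm x = 1")
  case True
  then have "al x = 0" by (simp add: al_def norm_eq_1)
  then have "green y x = 0" for y by (simp add: green_al)
  then show ?thesis using solD(5)[OF s, of x] True by simp
qed (use x solD(6)[OF s] in auto)

text \<open>A zero of the potential would force the density to vanish wherever the kernel is
  positive, hence almost everywhere.\<close>

lemma sol_pos: assumes s: "sol u N" and nz: "\<not> (AE y in lborel. N y = 0)" and x: "norm x < 1" shows "u x > 0"
proof (rule ccontr)
  assume "\<not> u x > 0"
  then have u0: "(LINT y|lborel. N y * green y x) = 0" using sol_nonneg[OF s, of x] solD(5)[OF s, of x] x by simp
  have nn: "0 \<le> N y * green y x" for y
    using solD(2,3)[OF s, of y] green_nonneg[of y x] x by (cases "norm y < 1") auto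
  have "AE y in lborel. N y * green y x = 0"
    using u0 integral_nonneg_eq_0_iff_AE[OF sol_continuous(2)[OF s]] nn x by simp
  moreover have "AE y in lborel. y \<noteq> x" by (rule AE_lborel_singleton)
  ultimately have "AE y in lborel. N y = 0"
  proof eventually_elim
    case (elim y)
    then show ?case using green_pos[of y x] x solD(3)[OF s, of y] by (cases "norm y < 1") auto
  qed
  then show False using nz by simp
qed

lemma below_all:
  assumes s: "sol u N" and nz: "\<not> (AE y in lborel. N y = 0)" and e: "norm e = 1" and m: "lam0 \<le> m" "m \<le> 1"
  shows "below u e m"
proof (rule ccontr)
  assume nb: "\<not> below u e m"
  define S where "S = {m. lam0 \<le> m \<and> m \<le> 1 \<and> \<not> below u e m}"
  have mS: "m \<in> S" using nb m by (simp add: S_def)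
  have bdd: "bdd_above S" by (rule bdd_aboveI[of _ 1]) (simp add: S_def)
  define m0 where "m0 = Sup S"
  have m0: "lam0 \<le> m0" "m0 \<le> 1"
  proof -
    have "m \<le> m0" unfolding m0_def by (rule cSup_upper[OF mS bdd])
    then show "lam0 \<le> m0" using m by simp
    show "m0 \<le> 1" unfolding m0_def by (rule cSup_least) (use mS in \<open>auto simp: S_def\<close>)
  qed
  have m0p: "m0 > 0" using m0 lam0 by simp
  have above: "below u e k" if "m0 < k" "k \<le> 1" for k
  proof (rule ccontr)
    assume "\<not> below u e k"
    then have "k \<in> S" using that m0 by (simp add: S_def)
    then have "k \<le> m0" unfolding m0_def by (rule cSup_upper[OF _ bdd])
    then show False using that by simp
  qed
  have uc: "continuous_on (cball 0 1) u" by (rule sol_continuous(1)[OF s])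
  have xe: "x \<bullet> e \<le> norm x" for x using norm_cauchy_schwarz[of x e] e by simp
  have b0: "below u e m0" unfolding below_def
  proof (intro allI impI)
    fix x assume x: "norm x < 1" "m0 < x \<bullet> e"
    \<comment> \<open>\<open>Suc (Suc n)\<close> keeps the factor below 1, so the height stays
      strictly below the level of x already for n = 0.\<close>
    define k where "k n = m0 + (x \<bullet> e - m0) * inverse (real (Suc (Suc n)))" for n
    have k0: "k \<longlonglongrightarrow> m0 + (x \<bullet> e - m0) * 0" unfolding k_def
      by (intro tendsto_intros LIMSEQ_Suc[OF LIMSEQ_inverse_real_of_nat])
    have kn: "m0 < k n" "k n < x \<bullet> e" for n
    proof -
      have "inverse (real (Suc (Suc n))) < 1" by (simp add: inverse_less_1_iff)
      then have "(x \<bullet> e - m0) * inverse (real (Suc (Suc n))) < (x \<bullet> e - m0) * 1" using x by (intro mult_strict_left_mono) auto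
      then show "k n < x \<bullet> e" by (simp add: k_def)
      show "m0 < k n" using x by (simp add: k_def)
    qed
    have le: "u x \<le> u (refl_at e (k n) x)" for n
      using above[OF kn(1)[of n]] kn(2)[of n] xe[of x] x by (auto simp: below_def)
    have "(\<lambda>n. refl_at e (k n) x) \<longlonglongrightarrow> refl_at e m0 x" unfolding refl_at_def using k0 by (intro tendsto_intros) simp
    then have "(\<lambda>n. u (refl_at e (k n) x)) \<longlonglongrightarrow> u (refl_at e m0 x)"
    proof (rule continuous_on_tendsto_compose[OF uc])
      show "refl_at e m0 x \<in> cball 0 1" using refl_at_norm_less[OF e _ _ x(1), of m0] m0p x by simp
      have "norm (refl_at e (k n) x) < 1" for n by (rule refl_at_norm_less[OF e _ _ x(1)]) (use kn[of n] m0p in auto)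
      then show "\<forall>\<^sub>F n in sequentially. refl_at e (k n) x \<in> cball 0 1" by (simp add: less_imp_le)
    qed
    then show "u x \<le> u (refl_at e m0 x)" by (rule LIMSEQ_le_const) (use le in auto)
  qed
  \<comment> \<open>Failing heights within 1/(n+1) of the supremum, each with a point that violates
    the comparison.\<close>
  have "\<exists>k x. k \<in> S \<and> m0 - inverse (real (Suc n)) < k \<and> norm x < 1 \<and> k < x \<bullet> e \<and> u (refl_at e k x) < u x" for n
  proof -
    have "m0 - inverse (real (Suc n)) < Sup S" by (simp add: m0_def)
    then obtain k where k: "k \<in> S" "m0 - inverse (real (Suc n)) < k" using less_cSup_iff[OF _ bdd] mS by auto
    then show ?thesis by (auto simp: S_def below_def not_le)
  qed
  then obtain k X where kX: "\<And>n. k n \<in> S" "\<And>n. m0 - inverse (real (Suc n)) < k n" "\<And>n. norm (X n) < 1" "\<And>n. k n < X n \<bullet> e"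
      "\<And>n. u (refl_at e (k n) (X n)) < u (X n)" by metis
  have kle: "k n \<le> m0" for n unfolding m0_def by (rule cSup_upper[OF kX(1) bdd])
  have k0: "k \<longlonglongrightarrow> m0"
  proof (rule tendsto_sandwich)
    show "(\<lambda>n. m0 - inverse (real (Suc n))) \<longlonglongrightarrow> m0" using tendsto_diff[OF tendsto_const LIMSEQ_inverse_real_of_nat, of m0] by simp
    show "\<forall>\<^sub>F n in sequentially. m0 - inverse (real (Suc n)) \<le> k n" by (intro always_eventually allI less_imp_le[OF kX(2)])
    show "\<forall>\<^sub>F n in sequentially. k n \<le> m0" using kle by (intro always_eventually allI)
  qed simp
  have "compact (cball (0::real^4) 1)" by simp
  moreover have "\<forall>n. X n \<in> cball 0 1" using kX(3) by (simp add: less_imp_le)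
  ultimately obtain x r where x: "x \<in> cball 0 1" "strict_mono r" "(X \<circ> r) \<longlonglongrightarrow> x" unfolding compact_def by blast
  have kr: "(\<lambda>n. k (r n)) \<longlonglongrightarrow> m0" using LIMSEQ_subseq_LIMSEQ[OF k0 x(2)] by (simp add: o_def)
  have Xr: "(\<lambda>n. X (r n)) \<longlonglongrightarrow> x" using x(3) by (simp add: o_def)
  have Rr: "(\<lambda>n. refl_at e (k (r n)) (X (r n))) \<longlonglongrightarrow> refl_at e m0 x"
    unfolding refl_at_def by (intro tendsto_intros kr Xr)
  have Rn: "norm (refl_at e (k n) (X n)) < 1" for n
    by (rule refl_at_norm_less[OF e _ _ kX(3)]) (use kX(1,4)[of n] lam0 in \<open>auto simp: S_def\<close>)
  have Rx: "norm (refl_at e m0 x) \<le> 1"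
    by (rule LIMSEQ_le_const2[OF tendsto_norm[OF Rr]]) (use Rn less_imp_le in blast)
  have xm: "m0 \<le> x \<bullet> e"
    by (rule LIMSEQ_le[OF kr tendsto_inner[OF Xr tendsto_const]]) (use kX(4) less_imp_le in blast)
  have ur: "(\<lambda>n. u (refl_at e (k (r n)) (X (r n)))) \<longlonglongrightarrow> u (refl_at e m0 x)"
    by (rule continuous_on_tendsto_compose[OF uc Rr]) (use Rx Rn in \<open>auto simp: less_imp_le\<close>)
  have ux: "(\<lambda>n. u (X (r n))) \<longlonglongrightarrow> u x"
    by (rule continuous_on_tendsto_compose[OF uc Xr]) (use x(1) kX(3) in \<open>auto simp: less_imp_le\<close>)
  have ule: "u (refl_at e m0 x) \<le> u x" by (rule LIMSEQ_le[OF ur ux]) (use kX(5) less_imp_le in blast)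
  have nx: "norm x \<le> 1" using x(1) by simp
  show False
  proof (cases "m0 < x \<bullet> e")
    case True
    show False
    proof (cases "norm x < 1")
      case inside: True
      show False using below_strict(1)[OF s nz e m0(1) b0 inside True] ule by simp
    next
      case False
      \<comment> \<open>On the sphere u vanishes, whereas the reflected point is interior, where u
        is positive.\<close>
      then have x1: "norm x = 1" using nx by simp
      have "0 < 4 * m0 * (x \<bullet> e - m0)" using True m0p by simp
      then have "refl_at e m0 x \<bullet> refl_at e m0 x < 1" using x1 by (simp add: refl_at_self_inner[OF e] norm_eq_1)
      then have "norm (refl_at e m0 x) < 1" by (simp add: norm_eq_sqrt_inner)
      then show False using sol_pos[OF s nz] sol_sphere[OF s, of x] x1 ule by fastforce
    qed
  next
    case False
    then have xe0: "x \<bullet> e = m0" using xm by simp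
    define v where "v z = (LINT y|lborel. N y * kd e z y)" for z
    \<comment> \<open>The witnesses and their images collapse to one point of the plane, where the
      strict comparison degenerates. The sign of the integrated directional kernel persists near
      that point and makes u nonincreasing along the short segment from image to witness.\<close>
    have vx: "v x > 0" unfolding v_def by (rule below_strict(2)[OF s nz e m0(1) b0 nx xe0])
    have "continuous_on (cball 0 1) v" unfolding v_def by (rule sol_kd(1)[OF s e])
    then obtain \<delta> where \<delta>: "\<delta> > 0" "\<And>z. z \<in> cball 0 1 \<Longrightarrow> dist z x < \<delta> \<Longrightarrow> dist (v z) (v x) < v x"
      using x(1) vx unfolding continuous_on_iff by metis
    have vpos: "v z > 0" if "z \<in> cball 0 1" "dist z x < \<delta>" for z
      using \<delta>(2)[OF that] by (simp add: dist_real_def abs_if split: if_splits)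
    have Rxx: "refl_at e m0 x = x" using xe0 by (simp add: refl_at_def)
    have "\<forall>\<^sub>F n in sequentially. dist (X (r n)) x < \<delta>" using Xr \<delta>(1) by (rule tendstoD)
    moreover have "\<forall>\<^sub>F n in sequentially. dist (refl_at e (k (r n)) (X (r n))) x < \<delta>"
      using tendstoD[OF Rr \<delta>(1)] by (simp add: Rxx)
    ultimately have "\<forall>\<^sub>F n in sequentially. False"
    proof eventually_elim
      case (elim n)
      define z where "z = refl_at e (k (r n)) (X (r n))"
      define T where "T = 2 * (X (r n) \<bullet> e - k (r n))"
      have T: "T > 0" using kX(4)[of "r n"] by (simp add: T_def)
      have zT: "z + T *\<^sub>R e = X (r n)" by (simp add: z_def T_def refl_at_def)
      have C: "z + t *\<^sub>R e \<in> cball 0 1 \<inter> ball x \<delta>" if t: "0 \<le> t" "t \<le> T" for t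
      proof -
        have cv: "convex (cball 0 1 \<inter> ball x \<delta>)" by (intro convex_Int convex_cball convex_ball)
        have zz: "z \<in> cball 0 1 \<inter> ball x \<delta>" "X (r n) \<in> cball 0 1 \<inter> ball x \<delta>"
          using elim Rn[of "r n"] kX(3)[of "r n"] by (auto simp: z_def dist_commute less_imp_le)
        have tT: "0 \<le> t / T" "t / T \<le> 1" using t T by auto
        have "(1 - t / T) *\<^sub>R z + (t / T) *\<^sub>R X (r n) \<in> cball 0 1 \<inter> ball x \<delta>"
          by (rule convexD_alt[OF cv zz tT])
        moreover have "(1 - t / T) *\<^sub>R z + (t / T) *\<^sub>R X (r n) = z + t *\<^sub>R e"
          unfolding zT[symmetric] using T by (simp add: algebra_simps)
        ultimately show ?thesis by simp
      qed
      have "u (z + T *\<^sub>R e) \<le> u z"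
      proof (rule segment_decrease[OF s e less_imp_le[OF T]])
        fix t assume t: "0 \<le> t" "t \<le> T"
        show "norm (z + t *\<^sub>R e) \<le> 1" using C[OF t] by simp
        show "0 \<le> (LINT y|lborel. N y * kd e (z + t *\<^sub>R e) y)"
          using vpos[of "z + t *\<^sub>R e"] C[OF t] by (simp add: v_def dist_commute)
      qed
      then show False using kX(5)[of "r n", folded z_def] by (simp add: zT)
    qed
    then show False by simp
  qed
qed

text \<open>Two distinct points are mirror images in their bisecting hyperplane, which has unit
  normal (x - z) / |x - z| and height (|x|^2 - |z|^2) / (2 |x - z|); the hypothesis says that this
  height is at least \<open>lam0\<close>.\<close>

lemma sol_reflect_le:
  assumes s: "sol u N" and ne: "x \<noteq> z" and m: "lam0 * (2 * norm (x - z)) \<le> x \<bullet> x - z \<bullet> z"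
  shows "u x \<le> u z"
proof (cases "norm x < 1 \<and> \<not> (AE y in lborel. N y = 0)")
  case True
  define w where "w = norm (x - z)"
  have w: "w > 0" using ne by (simp add: w_def)
  define e where "e = (1 / w) *\<^sub>R (x - z)"
  define k where "k = (x \<bullet> x - z \<bullet> z) / (2 * w)"
  have e: "norm e = 1" using w by (simp add: e_def w_def)
  have ww: "(x - z) \<bullet> (x - z) = w * w" by (simp add: w_def power2_norm_eq_inner[symmetric] power2_eq_square)
  have xz: "2 * (x \<bullet> (x - z)) = (x \<bullet> x - z \<bullet> z) + (x - z) \<bullet> (x - z)" by (simp add: inner_diff_left inner_diff_right inner_commute)
  have "x \<bullet> e = (x \<bullet> (x - z)) / w" by (simp add: e_def)
  also have "\<dots> = k + w / 2" using xz w unfolding ww k_def by (simp add: field_simps)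
  finally have xe: "x \<bullet> e = k + w / 2" .
  have lk: "lam0 \<le> k" using m w unfolding k_def w_def[symmetric] by (simp add: le_divide_eq)
  have "x \<bullet> e \<le> norm x" using norm_cauchy_schwarz[of x e] e by simp
  then have k1: "k \<le> 1" using xe w True by simp
  have "refl_at e k x = x - w *\<^sub>R e" by (simp add: refl_at_def xe)
  also have "\<dots> = z" using w by (simp add: e_def)
  finally have Rz: "refl_at e k x = z" .
  have "below u e k" using below_all[OF s _ e lk k1] True by simp
  then show ?thesis using True xe w Rz by (auto simp: below_def)
next
  case False
  have "u x = 0"
  proof (cases "norm x < 1")
    case True
    then have "AE y in lborel. N y * green y x = 0" using False by (auto elim!: eventually_mono)
    then have "(LINT y|lborel. N y * green y x) = 0" by (rule integral_eq_zero_AE)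
    then show ?thesis using solD(5)[OF s, of x] True by simp
  qed (use sol_sphere[OF s] in auto)
  then show ?thesis using sol_nonneg[OF s] by simp
qed

text \<open>For x in the layer, u x is at most u z for all z in a small ball further inside, so the
  uniform bound on the integral of u, divided by the volume of that ball, bounds u x.\<close>

lemma boundary_bound:
  "\<exists>d>0. d < 1 / 4 \<and> (\<exists>C\<ge>0. \<forall>u N x. sol u N \<longrightarrow> 1 - d \<le> norm x \<longrightarrow> u x \<le> C)"
proof -
  obtain C where C: "C \<ge> 0" "\<And>u N. sol u N \<Longrightarrow> integrable lborel (\<lambda>x. indicator (ball 0 1) x * u x)"
      "\<And>u N. sol u N \<Longrightarrow> (LINT x|lborel. indicator (ball 0 1) x * u x) \<le> C"
    using sol_uniform_bounds by blast
  \<comment> \<open>Thus \<open>lam0\<close> = 1 - 8 d. The comparison ball is centred at depth 3 d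
    on the ray through x and has radius d^2, which is at most d / 8.\<close>
  define d where "d = (1 - lam0) / 8"
  have d: "0 < d" "d \<le> 1 / 8" "lam0 = 1 - 8 * d" using lam0 by (auto simp: d_def field_simps)
  define V where "V = unit_ball_vol 4 * (d * d) ^ 4"
  have V: "V > 0" using d by (simp add: V_def)
  have "u x \<le> C / V" if s: "sol u N" and x: "1 - d \<le> norm x" for u N x
  proof (cases "norm x < 1")
    case True
    define p where "p = (1 - 3 * d) *\<^sub>R sgn x"
    have x0: "x \<noteq> 0" using x d by auto
    have np: "norm p = 1 - 3 * d" using x0 d by (simp add: p_def norm_sgn)
    have xs: "x = norm x *\<^sub>R sgn x" using x0 by (simp add: sgn_div_norm)
    have nxp: "norm (x - p) = norm x - (1 - 3 * d)"
    proof -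
      have "x - p = (norm x - (1 - 3 * d)) *\<^sub>R sgn x" using xs by (metis p_def scaleR_left.diff)
      then have "norm (x - p) = \<bar>norm x - (1 - 3 * d)\<bar> * norm (sgn x)" by simp
      then show ?thesis using x0 x d by (simp add: norm_sgn)
    qed
    have le: "u x \<le> u z" and nz: "norm z < 1" if z: "z \<in> cball p (d * d)" for z
    proof -
      have pz: "norm (z - p) \<le> d * d" using z by (simp add: dist_norm norm_minus_commute)
      have dd: "d * d \<le> d / 8" using d by (simp add: mult_left_mono[of d "1/8" d, simplified])
      have z1: "norm z \<le> 1 - 3 * d + d * d" using norm_triangle_sub[of z p] np pz by simp
      have z2: "1 - 3 * d - d * d \<le> norm z" using norm_triangle_sub[of p z] np pz by (simp add: norm_minus_commute)
      show "norm z < 1" using z1 dd d by linarith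
      define s where "s = norm x - (1 - 3 * d)"
      have sd: "2 * d \<le> s" "s \<le> 3 * d" using x True by (auto simp: s_def)
      have xz: "norm (x - z) \<le> s + d * d"
        using norm_triangle_ineq[of "x - p" "p - z"] nxp pz by (simp add: s_def norm_minus_commute)
      have "lam0 * (2 * norm (x - z)) \<le> lam0 * (2 * (s + d * d))" using xz lam0 by (intro mult_left_mono) auto
      \<comment> \<open>The right side minus the left side is 11 s d - 4 d^2 up to terms of third
        and fourth order, and s >= 2 d.\<close>
      also have "\<dots> \<le> (s - d * d) * (2 - 5 * d - d * d)"
      proof -
        have 1: "s * d \<ge> 2 * d * d" using sd d by (intro mult_right_mono) auto
        have "(s * d) * d \<le> (s * d) * (1 / 8)" using d sd by (intro mult_left_mono) auto
        then have 2: "s * d * d \<le> s * d / 8" by simp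
        have 3: "0 \<le> d * d * d" "0 \<le> d * d * d * d" "0 \<le> d * d" using d by auto
        have "(s - d * d) * (2 - 5 * d - d * d) - lam0 * (2 * (s + d * d)) = 11 * (s * d) - s * d * d - 4 * (d * d) + 21 * (d * d * d) + d * d * d * d"
          unfolding d(3) by (simp add: algebra_simps)
        moreover have "11 * (s * d) - s * d * d - 4 * (d * d) \<ge> 0" using 1 2 3 by linarith
        ultimately show ?thesis using 3 by linarith
      qed
      also have "\<dots> \<le> (norm x - norm z) * (norm x + norm z)"
        proof (rule mult_mono)
          have "0 \<le> d * d" by simp
          then show "s - d * d \<le> norm x - norm z" "2 - 5 * d - d * d \<le> norm x + norm z" "0 \<le> norm x - norm z" "0 \<le> 2 - 5 * d - d * d"
            using z1 z2 sd x True d(1,2) dd unfolding s_def by linarith+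
        qed
      also have "\<dots> = x \<bullet> x - z \<bullet> z" by (simp add: power2_norm_eq_inner[symmetric] power2_eq_square algebra_simps)
      finally have k: "lam0 * (2 * norm (x - z)) \<le> x \<bullet> x - z \<bullet> z" .
      have "norm z < norm x" using z1 dd x d by linarith
      then have "x \<noteq> z" by auto
      from sol_reflect_le[OF s this k] show "u x \<le> u z" .
    qed
    have ecb: "emeasure lborel (cball p (d * d)) = ennreal V" unfolding V_def by (rule emeasure_cball4) (use d in simp)
    then have "measure lborel (cball p (d * d)) = V" using V by (simp add: measure_def)
    moreover have i1: "integrable lborel (\<lambda>z. indicator (cball p (d * d)) z * u x)"
      using ecb by (intro integrable_mult_left integrable_real_indicator) auto
    ultimately have "V * u x = (LINT z|lborel. indicator (cball p (d * d)) z * u x)" by simp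
    also have "\<dots> \<le> (LINT z|lborel. indicator (ball 0 1) z * u z)"
    proof (rule integral_mono[OF i1 C(2)[OF s]])
      fix z show "indicator (cball p (d * d)) z * u x \<le> indicator (ball 0 1) z * u z"
        using le[of z] nz[of z] sol_nonneg[OF s, of z] by (cases "z \<in> cball p (d * d)") auto
    qed
    also have "\<dots> \<le> C" by (rule C(3)[OF s])
    finally show ?thesis using V by (simp add: pos_le_divide_eq mult.commute)
  next
    case False
    then show ?thesis using sol_sphere[OF s, of x] C V by simp
  qed
  then show ?thesis using d C V by (intro exI[of _ d] conjI exI[of _ "C / V"]) auto
qed

text \<open>In the layer the density is bounded because u is; further inside the weight (1 -
  |x|^2)^2 is at least d^2, so the weighted bound applies.\<close>

lemma mass_bound: "\<exists>\<Lambda>\<ge>0. \<forall>u N. sol u N \<longrightarrow> integrable lborel N \<and> (LINT x|lborel. N x) \<le> \<Lambda>"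
proof -
  obtain d C where d: "0 < d" "d < 1 / 4" and C: "C \<ge> 0" "\<And>u N x. sol u N \<Longrightarrow> 1 - d \<le> norm x \<Longrightarrow> u x \<le> C"
    using boundary_bound by blast
  obtain C2 where C2: "\<And>u N. sol u N \<Longrightarrow> integrable lborel (\<lambda>x. N x * (1 - x \<bullet> x) ^ 2)"
      "\<And>u N. sol u N \<Longrightarrow> (LINT x|lborel. N x * (1 - x \<bullet> x) ^ 2) \<le> C2"
    using sol_uniform_bounds by blast
  obtain C3' where C3': "AE x in lborel. x \<in> ball 0 1 \<longrightarrow> (\<forall>t\<in>{0..C}. H x t \<le> C3')" using H_bounded by blast
  define C3 where "C3 = max C3' 0"
  have bb: "emeasure lborel (ball (0::real^4) 1) < \<infinity>" by (rule emeasure_bounded_finite) simp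
  define \<Lambda> where "\<Lambda> = C3 * measure lborel (ball (0::real^4) 1) + C2 / d\<^sup>2"
  have "integrable lborel N \<and> (LINT x|lborel. N x) \<le> \<Lambda>" if s: "sol u N" for u N
  proof -
    let ?g = "\<lambda>x. C3 * indicator (ball 0 1) x + N x * (1 - x \<bullet> x) ^ 2 / d\<^sup>2"
    have gi: "integrable lborel ?g" using C2(1)[OF s] bb
      by (intro Bochner_Integration.integrable_add integrable_mult_right integrable_real_indicator integrable_divide) auto
    have AE: "AE x in lborel. N x \<le> ?g x"
      using C3' solD(7)[OF s]
    proof eventually_elim
      case (elim x)
      have N0: "0 \<le> N x" by (rule solD(2)[OF s])
      have q: "0 \<le> N x * (1 - x \<bullet> x) ^ 2 / d\<^sup>2" using N0 by simp
      show ?case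
      proof (cases "norm x < 1")
        case False
        then show ?thesis using solD(3)[OF s, of x] by simp
      next
        case True
        show ?thesis
        proof (cases "1 - d \<le> norm x")
          case near: True
          then have "u x \<in> {0..C}" using C(2)[OF s] sol_nonneg[OF s] by simp
          then have "N x \<le> C3'" using elim True by simp
          then have "N x \<le> C3" by (simp add: C3_def le_max_iff_disj)
          then show ?thesis using q True by simp
        next
          case far: False
          have "x \<bullet> x = norm x * norm x" by (simp add: power2_norm_eq_inner[symmetric] power2_eq_square)
          also have "\<dots> \<le> (1 - d) * 1" using far d True by (intro mult_mono) auto
          finally have "d \<le> 1 - x \<bullet> x" by simp
          then have "d\<^sup>2 \<le> (1 - x \<bullet> x)\<^sup>2" using d by (intro power_mono) auto
          then have "N x * d\<^sup>2 \<le> N x * (1 - x \<bullet> x)\<^sup>2" using N0 by (intro mult_left_mono) auto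
          then have "N x \<le> N x * (1 - x \<bullet> x) ^ 2 / d\<^sup>2" using d by (simp add: pos_le_divide_eq)
          then show ?thesis using True by (simp add: C3_def)
        qed
      qed
    qed
    have iN: "integrable lborel N"
    proof (rule Bochner_Integration.integrable_bound[OF gi])
      show "N \<in> borel_measurable lborel" using solD(1)[OF s] by simp
      show "AE x in lborel. norm (N x) \<le> norm (?g x)" using AE
        by eventually_elim (use solD(2)[OF s] in \<open>simp only: real_norm_def, metis abs_ge_self abs_of_nonneg order_trans\<close>)
    qed
    have "(LINT x|lborel. N x) \<le> (LINT x|lborel. ?g x)" by (rule integral_mono_AE[OF iN gi AE])
    also have "\<dots> = C3 * measure lborel (ball (0::real^4) 1) + (LINT x|lborel. N x * (1 - x \<bullet> x) ^ 2) / d\<^sup>2"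
      using C2(1)[OF s] bb by (subst Bochner_Integration.integral_add) (auto intro!: integrable_mult_right integrable_real_indicator integrable_divide)
    also have "\<dots> \<le> \<Lambda>" unfolding \<Lambda>_def using C2(2)[OF s] by (intro add_left_mono divide_right_mono) auto
    finally show ?thesis using iN by simp
  qed
  then show ?thesis by (intro exI[of _ "max \<Lambda> 0"]) fastforce
qed

end

section \<open>Exclusion of interior blow-up\<close>

lemma gf_div: "s > 0 \<Longrightarrow> th \<ge> 0 \<Longrightarrow> gf (th / s) = ln (s + th) - ln s - th / (s + th)"
proof -
  assume a: "s > 0" "th \<ge> 0"
  have 1: "1 + th / s = (s + th) / s" using a by (simp add: field_simps)
  have 2: "(th / s) / ((s + th) / s) = th / (s + th)" using a by simp
  show ?thesis unfolding gf_def 1 2 using a by (simp add: ln_div)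
qed

text \<open>The admissible gap between \<open>green\<close> and its pure logarithm when one argument
  keeps distance d from the sphere, wherever in the ball the other one is.\<close>

definition log_gap :: "real \<Rightarrow> real" where "log_gap d = \<kappa> * (ln 4 + 2 * \<bar>ln d\<bar> + 1)"

lemma log_gap_nonneg: "log_gap d \<ge> 0" using kappa_pos by (simp add: log_gap_def)

text \<open>After \<open>gf_div\<close> the pole -ln s separates; what remains is ln(s + th) with s
  + th between d^2 and 4, and a quotient between 0 and 1.\<close>

lemma green_log:
  assumes d: "d > 0" and x: "norm x \<le> 1 - d" and y: "norm y < 1" and ne: "y \<noteq> x"
  shows "\<bar>green y x + \<kappa> * ln ((y - x) \<bullet> (y - x))\<bar> \<le> log_gap d"
proof -
  define s where "s = (y - x) \<bullet> (y - x)"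
  define th where "th = al y * al x"
  have s: "s > 0" using ne by (simp add: s_def)
  have th: "th \<ge> 0" using al_nonneg x y d by (simp add: th_def)
  have Q: "s + th = 1 - 2 * (x \<bullet> y) + (x \<bullet> x) * (y \<bullet> y)"
    by (simp add: s_def th_def al_def inner_diff_left inner_diff_right inner_commute[of y x] algebra_simps)
  have xy: "norm x * norm y \<le> (1 - d) * 1" using x y order_trans[OF norm_ge_zero x] by (intro mult_mono) auto
  have "d\<^sup>2 \<le> (1 - norm x * norm y)\<^sup>2" using xy d by (intro power_mono) auto
  also have "\<dots> = 1 - 2 * (norm x * norm y) + (x \<bullet> x) * (y \<bullet> y)"
    by (simp add: power2_norm_eq_inner[symmetric] power2_eq_square algebra_simps)
  also have "\<dots> \<le> s + th" unfolding Q using norm_cauchy_schwarz[of x y] by simp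
  finally have Ql: "d\<^sup>2 \<le> s + th" .
  have Qu: "s + th \<le> 4"
  proof -
    have "norm x * norm y \<le> 1" using xy d by simp
    then have "- (x \<bullet> y) \<le> 1" using Cauchy_Schwarz_ineq2[of x y] by linarith
    moreover have "(x \<bullet> x) * (y \<bullet> y) \<le> 1 * 1" using inner_self_le_1[of x] inner_self_le_1[of y] x y d by (intro mult_mono) auto
    ultimately show ?thesis unfolding Q by simp
  qed
  have "ln (d\<^sup>2) \<le> ln (s + th)" using Ql d by (subst ln_le_cancel_iff) (auto intro: less_le_trans[of 0 "d\<^sup>2"])
  then have l1: "2 * ln d \<le> ln (s + th)" using d by (simp add: ln_realpow)
  have l2: "ln (s + th) \<le> ln 4" using Qu s th by (subst ln_le_cancel_iff) auto
  have f: "0 \<le> th / (s + th)" "th / (s + th) \<le> 1" using s th by auto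
  have "green y x + \<kappa> * ln s = \<kappa> * (ln (s + th) - th / (s + th))"
    unfolding green_al s_def[symmetric] th_def[symmetric] gf_div[OF s th] by (simp add: algebra_simps)
  moreover have "\<bar>ln (s + th) - th / (s + th)\<bar> \<le> ln 4 + 2 * \<bar>ln d\<bar> + 1"
  proof -
    have "(0::real) \<le> ln 4" by simp
    then show ?thesis using l1 l2 f by linarith
  qed
  ultimately show ?thesis unfolding s_def[symmetric] log_gap_def using kappa_pos by (simp add: abs_mult)
qed

text \<open>Discrete form of the logarithmic divergence: the annulus from r to 2 r has 15 r^4 times
  the volume of the unit ball and carries density at least c / (2 r)^4, so each of the n annuli
  contributes the same amount.\<close>

lemma dyadic_annuli_mass:
  fixes N :: "real^4 \<Rightarrow> real"
  assumes N: "integrable lborel N" "\<And>x. 0 \<le> N x" and s: "\<sigma> > 0" and c: "c \<ge> 0"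
    and low: "AE y in lborel. \<sigma> \<le> norm (y - p) \<longrightarrow> norm (y - p) < 2 ^ n * \<sigma> \<longrightarrow> c / norm (y - p) ^ 4 \<le> N y"
  shows "real n * (15 * c * unit_ball_vol 4 / 16) \<le> (LINT y|lborel. N y)"
proof -
  have i: "integrable lborel (\<lambda>y. indicator (ball p r) y * N y)" for r
    by (rule integrable_real_mult_indicator[of "ball p r" lborel N, simplified mult.commute[of "N _"]]) (use N in auto)
  have em: "emeasure lborel (ball p r) = ennreal (unit_ball_vol 4 * r ^ 4)" if "r \<ge> 0" for r
    using emeasure_ball[of r p] that by simp
  have mb: "measure lborel (ball p r) = unit_ball_vol 4 * r ^ 4" if "r \<ge> 0" for r
    unfolding measure_def em[OF that] using that by simp
  have ib: "integrable lborel (\<lambda>y. indicator (ball p r) y :: real)" if "r \<ge> 0" for r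
    using em[OF that] by (intro integrable_real_indicator) auto
  have "real k * (15 * c * unit_ball_vol 4 / 16) \<le> (LINT y|lborel. indicator (ball p (2 ^ k * \<sigma>)) y * N y)" if "k \<le> n" for k
    using that
  proof (induction k)
    case 0
    show ?case using N(2) by (simp add: integral_nonneg_AE)
  next
    case (Suc k)
    define r where "r = 2 ^ k * \<sigma>"
    have r: "r > 0" using s by (simp add: r_def)
    have r2: "2 ^ Suc k * \<sigma> = 2 * r" by (simp add: r_def)
    define b where "b = c / (2 * r) ^ 4"
    have rn: "2 * r \<le> 2 ^ n * \<sigma>"
    proof -
      have "(2::real) ^ Suc k \<le> 2 ^ n" using Suc.prems by (intro power_increasing) auto
      then show ?thesis unfolding r2[symmetric] using s by (intro mult_right_mono) auto
    qed
    have rs: "\<sigma> \<le> r" using s by (simp add: r_def)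
    have "(LINT y|lborel. indicator (ball p r) y * N y + b * (indicator (ball p (2 * r)) y - indicator (ball p r) y))
        \<le> (LINT y|lborel. indicator (ball p (2 * r)) y * N y)"
    proof (rule integral_mono_AE)
      show "integrable lborel (\<lambda>y. indicator (ball p r) y * N y + b * (indicator (ball p (2 * r)) y - indicator (ball p r) y))"
        using r by (intro Bochner_Integration.integrable_add integrable_mult_right Bochner_Integration.integrable_diff i ib) auto
      show "integrable lborel (\<lambda>y. indicator (ball p (2 * r)) y * N y)" by (rule i)
      show "AE y in lborel. indicator (ball p r) y * N y + b * (indicator (ball p (2 * r)) y - indicator (ball p r) y)
        \<le> indicator (ball p (2 * r)) y * N y"
        using low
      proof eventually_elim
        case (elim y)
        have dy: "dist p y = norm (y - p)" by (simp add: dist_norm norm_minus_commute)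
        show ?case
        proof (cases "norm (y - p) < r")
          case True
          then show ?thesis using r by (simp add: dy)
        next
          case False
          show ?thesis
          proof (cases "norm (y - p) < 2 * r")
            case True
            have "c / (2 * r) ^ 4 \<le> c / norm (y - p) ^ 4"
              using True False r c by (intro divide_left_mono power_mono mult_pos_pos zero_less_power) auto
            also have "\<dots> \<le> N y" using elim True False rs rn by simp
            finally show ?thesis using True False by (simp add: dy b_def)
          next
            case 2: False
            then show ?thesis using False by (simp add: dy)
          qed
        qed
      qed
    qed
    moreover have "(LINT y|lborel. indicator (ball p r) y * N y + b * (indicator (ball p (2 * r)) y - indicator (ball p r) y))
        = (LINT y|lborel. indicator (ball p r) y * N y) + b * (unit_ball_vol 4 * (2 * r) ^ 4 - unit_ball_vol 4 * r ^ 4)"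
    proof -
      have id: "integrable lborel (\<lambda>y. indicator (ball p (2 * r)) y - indicator (ball p r) y :: real)"
        using r by (intro Bochner_Integration.integrable_diff ib) auto
      have "(LINT y|lborel. indicator (ball p (2 * r)) y - indicator (ball p r) y :: real) = unit_ball_vol 4 * (2 * r) ^ 4 - unit_ball_vol 4 * r ^ 4"
        using Bochner_Integration.integral_diff[OF ib[of "2 * r"] ib[of r]] mb[of r] mb[of "2 * r"] r by simp
      then show ?thesis using Bochner_Integration.integral_add[OF i[of r] integrable_mult_right[OF id, of b]] by simp
    qed
    moreover have "b * (unit_ball_vol 4 * (2 * r) ^ 4 - unit_ball_vol 4 * r ^ 4) = 15 * c * unit_ball_vol 4 / 16"
      using r by (simp add: b_def power_mult_distrib field_simps)
    moreover have "real k * (15 * c * unit_ball_vol 4 / 16) \<le> (LINT y|lborel. indicator (ball p r) y * N y)"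
      unfolding r_def using Suc by simp
    moreover have "real (Suc k) * (15 * c * unit_ball_vol 4 / 16) = real k * (15 * c * unit_ball_vol 4 / 16) + 15 * c * unit_ball_vol 4 / 16"
      by (simp only: of_nat_Suc distrib_right mult_1)
    ultimately show ?case unfolding r2 by linarith
  qed
  from this[of n] have "real n * (15 * c * unit_ball_vol 4 / 16) \<le> (LINT y|lborel. indicator (ball p (2 ^ n * \<sigma>)) y * N y)" by simp
  also have "\<dots> \<le> (LINT y|lborel. N y)"
    using N(2) by (intro integral_mono i N(1)) (auto simp: indicator_def)
  finally show ?thesis .
qed

section \<open>Profile of a solution around an interior maximum\<close>

context unit_problem
begin

text \<open>Above a threshold \<open>H_upper\<close> and the monotonicity of f apply; below it H is
  bounded, and f t >= f M > 0 turns that bound into a multiple of f t.\<close>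

lemma density_upper:
  "\<exists>C>0. \<forall>u N t. sol u N \<longrightarrow> M \<le> t \<longrightarrow> (\<forall>x. u x \<le> t) \<longrightarrow> (AE y in lborel. N y \<le> C * f t)"
proof -
  obtain A T where A: "A > 0" "\<And>x t. x \<in> ball 0 1 \<Longrightarrow> t \<ge> T \<Longrightarrow> H x t \<le> A * f t" using H_upper by blast
  define T' where "T' = max M T"
  obtain D where D: "AE x in lborel. x \<in> ball 0 1 \<longrightarrow> (\<forall>t\<in>{0..T'}. H x t \<le> D)" using H_bounded by blast
  have fM: "f M > 0" by (rule f_pos) simp
  define C where "C = max A (D / f M)"
  have C: "C > 0" "A \<le> C" "D / f M \<le> C" using A by (auto simp: C_def)
  have "AE y in lborel. N y \<le> C * f t" if s: "sol u N" and t: "M \<le> t" "\<forall>x. u x \<le> t" for u N t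
    using D solD(7)[OF s]
  proof eventually_elim
    case (elim y)
    have ft: "f M \<le> f t" using f_mono t by simp
    show ?case
    proof (cases "y \<in> ball 0 1")
      case True
      show ?thesis
      proof (cases "u y \<le> T'")
        case le: True
        then have "N y \<le> D" using elim True sol_nonneg[OF s] by simp
        also have "D = D / f M * f M" using fM by simp
        also have "\<dots> \<le> C * f M" using C fM by (intro mult_right_mono) auto
        also have "\<dots> \<le> C * f t" using C ft by (intro mult_left_mono) auto
        finally show ?thesis .
      next
        case False
        then have "N y \<le> A * f (u y)" using elim True A(2)[OF True, of "u y"] by (simp add: T'_def)
        also have "\<dots> \<le> A * f t" using A t False by (intro mult_left_mono f_mono) (auto simp: T'_def)
        also have "\<dots> \<le> C * f t" using C ft fM by (intro mult_right_mono) auto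
        finally show ?thesis .
      qed
    qed (use solD(3)[OF s, of y] C ft fM in simp)
  qed
  then show ?thesis using C by blast
qed

lemma integrable_indicator_mult:
  assumes "integrable lborel N" shows "integrable lborel (\<lambda>y::real^4. indicator (ball p r) y * N y :: real)"
  by (rule integrable_real_mult_indicator[of "ball p r" lborel N, simplified mult.commute[of "N _"]]) (use assms in auto)

text \<open>Up to \<open>log_gap\<close>, the drop u p - u x is 2 \<open>\<kappa>\<close> times the
  integral of ln(|y - x| / |y - p|) against the density. Only the mass within S of p sees the full
  logarithm; farther out the ratio is at most 2. Within r of p the pole is controlled by the
  pointwise bound C / r^4, at a cost independent of r.\<close>

lemma peak_decay:
  assumes s: "sol u N" and iN: "integrable lborel N" and L: "(LINT y|lborel. N y) \<le> \<Lambda>" and d: "d > 0" and r: "r > 0"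
    and C: "C \<ge> 0" and up: "AE y in lborel. N y \<le> C / r ^ 4" and p: "norm p \<le> 1 - d" and x: "norm x \<le> 1 - d" "norm (x - p) \<le> S"
  shows "u p - u x \<le> 2 * \<kappa> * (LINT y|lborel. indicator (ball p S) y * N y) * ln (1 + norm (x - p) / r)
    + (2 * \<kappa> * (C * rad2_int + ln 2 * \<Lambda>) + 2 * log_gap d * \<Lambda>)"
proof -
  define \<rho> where "\<rho> = norm (x - p)"
  have \<rho>: "0 \<le> \<rho>" "\<rho> \<le> S" using x by (auto simp: \<rho>_def)
  define X where "X = ln (1 + \<rho> / r)"
  have X: "X \<ge> 0" using \<rho> r by (simp add: X_def)
  define K where "K y = indicator (ball p r) y * inverse ((y - p) \<bullet> (y - p))" for y
  have K0: "K y \<ge> 0" for y by (simp add: K_def)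
  have Km: "K \<in> borel_measurable lborel" unfolding K_def by measurable
  have Kn: "(\<integral>\<^sup>+ y. ennreal (K y) \<partial>lborel) = ennreal (r\<^sup>2 * rad2_int)"
    unfolding K_def using nn_integral_inverse_dist_sq[OF r, of p] by (simp add: ennreal_mult' ennreal_indicator)
  have rad: "rad2_int \<ge> 0" by (simp add: rad2_int_def)
  have Ki: "integrable lborel K" by (rule integrableI_nonneg) (use Km K0 Kn in auto)
  have KI: "(LINT y|lborel. K y) = r\<^sup>2 * rad2_int"
    using integral_eq_nn_integral[OF Km] K0 Kn rad r by simp
  let ?B = "\<lambda>y. indicator (ball p S) y * N y"
  let ?g = "\<lambda>y. (2 * \<kappa> * X) * ?B y + (2 * \<kappa> * ln 2 + 2 * log_gap d) * N y + (2 * \<kappa> * (C / r ^ 4) * r\<^sup>2) * K y"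
  have n: "norm p \<le> 1" "norm x \<le> 1" using p x d by auto
  have ig: "integrable lborel (\<lambda>y. N y * green y p)" "integrable lborel (\<lambda>y. N y * green y x)"
    using sol_continuous(2)[OF s] n by auto
  have gi: "integrable lborel ?g"
    by (intro Bochner_Integration.integrable_add integrable_mult_right integrable_indicator_mult iN Ki)
  have "u p - u x = (LINT y|lborel. N y * green y p - N y * green y x)"
    unfolding solD(5)[OF s n(1)] solD(5)[OF s n(2)] by (rule Bochner_Integration.integral_diff[OF ig, symmetric])
  also have "\<dots> \<le> (LINT y|lborel. ?g y)"
  proof (rule integral_mono_AE[OF Bochner_Integration.integrable_diff[OF ig] gi])
    show "AE y in lborel. N y * green y p - N y * green y x \<le> ?g y"
      using up AE_lborel_singleton[of p] AE_lborel_singleton[of x]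
    proof eventually_elim
      case (elim y)
      have N0: "0 \<le> N y" by (rule solD(2)[OF s])
      show ?case
      proof (cases "norm y < 1")
        case False
        then have "N y = 0" using solD(3)[OF s, of y] by simp
        then show ?thesis using K0[of y] kappa_pos C r by simp
      next
        case True
        define w where "w = norm (y - p)"
        have w: "w > 0" using elim by (simp add: w_def)
        have g1: "green y p \<le> - (\<kappa> * ln ((y - p) \<bullet> (y - p))) + log_gap d"
          using green_log[OF d p True] elim by (simp add: abs_le_iff)
        have g2: "green y x \<ge> - (\<kappa> * ln ((y - x) \<bullet> (y - x))) - log_gap d"
          using green_log[OF d x(1) True] elim by (simp add: abs_le_iff)
        have sq: "ln (z \<bullet> z) = 2 * ln (norm z)" if "z \<noteq> 0" for z :: "real^4"
          using that by (simp add: power2_norm_eq_inner[symmetric] ln_realpow)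
        have "norm (y - x) \<le> w + \<rho>" using norm_triangle_ineq[of "y - p" "p - x"] by (simp add: w_def \<rho>_def norm_minus_commute)
        then have "ln (norm (y - x)) \<le> ln (w + \<rho>)" using elim by (subst ln_le_cancel_iff) (use w \<rho> in auto)
        moreover have lnw: "ln (w + \<rho>) = ln w + ln (1 + \<rho> / w)"
        proof -
          have "w + \<rho> = w * (1 + \<rho> / w)" using w by (simp add: field_simps)
          then show ?thesis using w \<rho> by (simp add: ln_mult_pos add_pos_nonneg)
        qed
        ultimately have yx: "ln (norm (y - x)) - ln w \<le> ln (1 + \<rho> / w)" by simp
        have "green y p - green y x \<le> 2 * \<kappa> * (ln (norm (y - x)) - ln w) + 2 * log_gap d"
          using g1 g2 sq[of "y - p"] sq[of "y - x"] elim by (simp add: w_def algebra_simps)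
        also have "\<dots> \<le> 2 * \<kappa> * ln (1 + \<rho> / w) + 2 * log_gap d"
          using yx kappa_pos by (intro add_right_mono mult_left_mono) auto
        finally have gg: "green y p - green y x \<le> 2 * \<kappa> * ln (1 + \<rho> / w) + 2 * log_gap d" .
        define i where "i = (indicator (ball p S) y :: real)"
        have i: "0 \<le> i" by (simp add: i_def)
        have dy: "dist p y = w" by (simp add: dist_norm norm_minus_commute w_def)
        \<comment> \<open>Three ranges of w = |y - p|: beyond S the ratio \<rho> / w is at most 1;
          between r and S the value is at most X; below r there is an extra ln(r / w) <= (r / w)^2,
          which is \<open>r\<^sup>2 * K y\<close>.\<close>
        have ln: "ln (1 + \<rho> / w) \<le> i * X + ln 2 + r\<^sup>2 * K y"
        proof (cases "w < S")
          case False
          then have "\<rho> / w \<le> 1" using \<rho> w by simp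
          then have "ln (1 + \<rho> / w) \<le> ln 2" using \<rho> w by (subst ln_le_cancel_iff) (auto simp: add_pos_nonneg)
          moreover have "0 \<le> r\<^sup>2 * K y" "0 \<le> i * X" using K0 i X by auto
          ultimately show ?thesis by linarith
        next
          case S: True
          then have i1: "i = 1" by (simp add: i_def dy)
          show ?thesis
          proof (cases "w < r")
            case False
            then have "\<rho> / w \<le> \<rho> / r" using \<rho> w r by (intro divide_left_mono) auto
            then have "ln (1 + \<rho> / w) \<le> X" unfolding X_def using \<rho> w r by (subst ln_le_cancel_iff) (auto simp: add_pos_nonneg)
            moreover have "0 \<le> r\<^sup>2 * K y" using K0 by simp
            moreover have "(0::real) \<le> ln 2" by simp
            ultimately show ?thesis unfolding i1 by linarith
          next
            case True
            have rw: "1 \<le> r / w" using True w by simp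
            have "\<rho> \<le> (r / w) * \<rho>" using mult_right_mono[OF rw \<rho>(1)] by simp
            have "1 + \<rho> / w \<le> (r / w) * (1 + \<rho> / r)" using rw r w by (simp add: field_simps)
            then have "ln (1 + \<rho> / w) \<le> ln ((r / w) * (1 + \<rho> / r))" using \<rho> w r by (subst ln_le_cancel_iff) (auto simp: add_pos_nonneg)
            also have "\<dots> = ln (r / w) + X" unfolding X_def by (rule ln_mult_pos) (use \<rho> w r in \<open>auto simp: add_pos_nonneg\<close>)
            also have "ln (r / w) \<le> r / w" using ln_le_minus_one[of "r / w"] r w by simp
            also have "r / w \<le> (r / w)\<^sup>2" using rw mult_left_mono[OF rw, of "r / w"] by (simp add: power2_eq_square)
            also have "(r / w)\<^sup>2 = r\<^sup>2 * K y" using True by (simp add: K_def dy w_def power2_norm_eq_inner[symmetric] power_mult_distrib power_inverse divide_inverse)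
            finally have "ln (1 + \<rho> / w) \<le> r\<^sup>2 * K y + X" by simp
            moreover have "(0::real) \<le> ln 2" by simp
            ultimately show ?thesis unfolding i1 by linarith
          qed
        qed
        have "green y p - green y x \<le> 2 * \<kappa> * (i * X + ln 2 + r\<^sup>2 * K y) + 2 * log_gap d"
          by (rule order_trans[OF gg]) (use ln kappa_pos in \<open>intro add_right_mono mult_left_mono, auto\<close>)
        then have "N y * (green y p - green y x) \<le> N y * (2 * \<kappa> * (i * X + ln 2 + r\<^sup>2 * K y) + 2 * log_gap d)"
          by (rule mult_left_mono[OF _ N0])
        also have "\<dots> = (2 * \<kappa> * X) * (i * N y) + (2 * \<kappa> * ln 2 + 2 * log_gap d) * N y + N y * (2 * \<kappa> * r\<^sup>2 * K y)"
          by (simp add: algebra_simps)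
        also have "N y * (2 * \<kappa> * r\<^sup>2 * K y) \<le> (C / r ^ 4) * (2 * \<kappa> * r\<^sup>2 * K y)"
          using elim K0[of y] kappa_pos by (intro mult_right_mono) auto
        finally show ?thesis unfolding i_def by (simp add: right_diff_distrib mult_ac)
      qed
    qed
  qed
  also have "\<dots> = (2 * \<kappa> * X) * (LINT y|lborel. ?B y) + (2 * \<kappa> * ln 2 + 2 * log_gap d) * (LINT y|lborel. N y) + (2 * \<kappa> * (C / r ^ 4) * r\<^sup>2) * (r\<^sup>2 * rad2_int)"
  proof -
    note i1 = integrable_mult_right[OF integrable_indicator_mult[OF iN], of "2 * \<kappa> * X" p S]
      and i2 = integrable_mult_right[OF iN, of "2 * \<kappa> * ln 2 + 2 * log_gap d"]
      and i3 = integrable_mult_right[OF Ki, of "2 * \<kappa> * (C / r ^ 4) * r\<^sup>2"]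
    show ?thesis
      unfolding Bochner_Integration.integral_add[OF Bochner_Integration.integrable_add[OF i1 i2] i3] Bochner_Integration.integral_add[OF i1 i2]
      by (simp only: integral_mult_right_zero KI)
  qed
  also have "(2 * \<kappa> * (C / r ^ 4) * r\<^sup>2) * (r\<^sup>2 * rad2_int) = 2 * \<kappa> * (C * rad2_int)"
  proof -
    show ?thesis using r by (simp add: power2_eq_square power4_eq_xxxx field_simps)
  qed
  also have "(2 * \<kappa> * ln 2 + 2 * log_gap d) * (LINT y|lborel. N y) \<le> (2 * \<kappa> * ln 2 + 2 * log_gap d) * \<Lambda>"
    using L kappa_pos log_gap_nonneg[of d] by (intro mult_left_mono) auto
  finally show ?thesis unfolding X_def \<rho>_def by (simp add: algebra_simps)
qed

text \<open>Mass outside the ball around p is dropped, the kernel being nonnegative; for y inside it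
  |y - x| <= 2 |x - p|, since x is no closer to p than S.\<close>

lemma far_lower:
  assumes s: "sol u N" and iN: "integrable lborel N" and L: "(LINT y|lborel. N y) \<le> \<Lambda>" and d: "d > 0"
    and x: "norm x \<le> 1 - d" "S \<le> norm (x - p)" and S: "S > 0"
  shows "- (2 * \<kappa> * (LINT y|lborel. indicator (ball p S) y * N y) * ln (2 * norm (x - p))) - log_gap d * \<Lambda> \<le> u x"
proof -
  define w where "w = norm (x - p)"
  have w: "w > 0" using order_less_le_trans[OF S x(2)] by (simp add: w_def)
  define m where "m = (LINT y|lborel. indicator (ball p S) y * N y)"
  have mL: "m \<le> \<Lambda>" unfolding m_def
    by (rule order_trans[OF integral_mono[OF integrable_indicator_mult[OF iN] iN] L]) (use solD(2)[OF s] in \<open>auto simp: indicator_def\<close>)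
  have n: "norm x \<le> 1" using x d by simp
  have "(LINT y|lborel. (- (2 * \<kappa> * ln (2 * w)) - log_gap d) * (indicator (ball p S) y * N y)) \<le> (LINT y|lborel. N y * green y x)"
  proof (rule integral_mono_AE)
    show "integrable lborel (\<lambda>y. (- (2 * \<kappa> * ln (2 * w)) - log_gap d) * (indicator (ball p S) y * N y))"
      by (intro integrable_mult_right integrable_indicator_mult iN)
    show "integrable lborel (\<lambda>y. N y * green y x)" by (rule sol_continuous(2)[OF s n])
    show "AE y in lborel. (- (2 * \<kappa> * ln (2 * w)) - log_gap d) * (indicator (ball p S) y * N y) \<le> N y * green y x"
      using AE_lborel_singleton[of x]
    proof eventually_elim
      case (elim y)
      have N0: "0 \<le> N y" by (rule solD(2)[OF s])
      show ?case
      proof (cases "norm y < 1")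
        case False
        then show ?thesis using solD(3)[OF s, of y] by simp
      next
        case True
        have g0: "0 \<le> green y x" using green_nonneg[of y x] True n by simp
        show ?thesis
        proof (cases "y \<in> ball p S")
          case False
          then show ?thesis using g0 N0 by simp
        next
          case yS: True
          have "norm (y - x) \<le> norm (y - p) + norm (p - x)" using norm_triangle_ineq[of "y - p" "p - x"] by simp
          also have "\<dots> \<le> 2 * w" using yS x by (simp add: w_def dist_norm norm_minus_commute)
          finally have "ln (norm (y - x)) \<le> ln (2 * w)" using elim w by (subst ln_le_cancel_iff) auto
          moreover have "ln ((y - x) \<bullet> (y - x)) = 2 * ln (norm (y - x))"
            using elim by (simp add: power2_norm_eq_inner[symmetric] ln_realpow)
          ultimately have "\<kappa> * ln ((y - x) \<bullet> (y - x)) \<le> \<kappa> * (2 * ln (2 * w))" using kappa_pos by (intro mult_left_mono) auto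
          moreover have "green y x \<ge> - (\<kappa> * ln ((y - x) \<bullet> (y - x))) - log_gap d"
            using green_log[OF d x(1) True] elim by (simp add: abs_le_iff)
          ultimately have "- (2 * \<kappa> * ln (2 * w)) - log_gap d \<le> green y x" by simp
          from mult_left_mono[OF this N0] show ?thesis using yS by (simp add: mult.commute)
        qed
      qed
    qed
  qed
  also have "\<dots> = u x" using solD(5)[OF s n] by simp
  finally have "(- (2 * \<kappa> * ln (2 * w)) - log_gap d) * m \<le> u x" by (simp add: m_def)
  moreover have "log_gap d * m \<le> log_gap d * \<Lambda>" using mL log_gap_nonneg by (intro mult_left_mono) auto
  ultimately show ?thesis unfolding w_def[symmetric] m_def[symmetric] by (simp add: algebra_simps)
qed

text \<open>All constants are fixed before the solution. The number n1 of inner annuli sets the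
  width factor L, which determines the tolerance \<eta> and the exponential error \<epsilon>; n2
  counts outer annuli; t0 is so large that a higher maximum leaves room for both ranges. The two
  ranges are linked by \<beta> = 2 \<kappa> m: the inner one yields a lower bound for (l +
  \<epsilon>) \<beta>, the outer one exploits it.\<close>

lemma sol_bounded: "\<exists>C. \<forall>u N x. sol u N \<longrightarrow> u x \<le> C"
proof -
  obtain d Cb where d: "0 < d" "d < 1 / 4" and Cb: "Cb \<ge> 0" "\<And>u N x. sol u N \<Longrightarrow> 1 - d \<le> norm x \<Longrightarrow> u x \<le> Cb"
    using boundary_bound by blast
  obtain \<Lambda> where L0: "\<Lambda> \<ge> 0" and iN: "\<And>u N. sol u N \<Longrightarrow> integrable lborel N" and LL: "\<And>u N. sol u N \<Longrightarrow> (LINT x|lborel. N x) \<le> \<Lambda>"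
    using mass_bound by blast
  \<comment> \<open>The maximum lies deeper than d, so points within d / 2 of it are still at
    distance \<delta> from the sphere, where \<open>H_lower\<close> and the logarithmic estimates
    apply.\<close>
  define \<delta> where "\<delta> = d / 2"
  have \<delta>: "\<delta> > 0" "\<delta> \<le> d" "1 - \<delta> < 1" using d by (auto simp: \<delta>_def)
  obtain a TL where a: "a > 0" "\<And>x t. x \<in> cball 0 (1 - \<delta>) \<Longrightarrow> TL \<le> t \<Longrightarrow> a * f t \<le> H x t" using H_lower[OF \<delta>(3)] by blast
  obtain C1 where C1: "C1 > 0" "\<And>u N t. sol u N \<Longrightarrow> M \<le> t \<Longrightarrow> (\<forall>x. u x \<le> t) \<Longrightarrow> AE y in lborel. N y \<le> C1 * f t"
    using density_upper by blast
  define G where "G = log_gap \<delta> * \<Lambda>"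
  have G: "G \<ge> 0" using log_gap_nonneg L0 by (simp add: G_def)
  define C3 where "C3 = 2 * \<kappa> * (C1 * rad2_int + ln 2 * \<Lambda>) + 2 * log_gap \<delta> * \<Lambda>"
  have rad: "rad2_int \<ge> 0" by (simp add: rad2_int_def)
  have C3: "C3 \<ge> 0" using kappa_pos C1 rad L0 log_gap_nonneg by (simp add: C3_def)
  define c4 where "c4 = a * exp (- ((l + 1) * C3))"
  have c4: "c4 > 0" using a by (simp add: c4_def)
  have V: "unit_ball_vol 4 > (0::real)" by simp
  \<comment> \<open>The inner estimate will be (c4 / 32) |y - p|^(-4), where 32 is 2^4 from doubling
    the radius times the factor 2 allowed by \<eta>; n1 annuli of it exceed the total mass.\<close>
  obtain n1 :: nat where n1: "\<Lambda> < real n1 * (15 * (c4 / 32) * unit_ball_vol 4 / 16)"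
    using reals_Archimedean3[of "15 * (c4 / 32) * unit_ball_vol 4 / 16"] c4 V by (auto simp del: times_divide_eq_left times_divide_eq_right)
  define L where "L = (2::real) ^ n1"
  have L: "L \<ge> 1" by (simp add: L_def)
  have lnL: "ln (1 + L) > 0" using L by simp
  \<comment> \<open>Chosen so that (1 + L)^\<eta> = 2: for |y - p| <= L r an excess \<eta> in the
    exponent costs at most a factor 2.\<close>
  define \<eta> where "\<eta> = ln 2 / ln (1 + L)"
  have \<eta>: "\<eta> > 0" using lnL by (simp add: \<eta>_def)
  define \<beta>b where "\<beta>b = 2 * \<kappa> * \<Lambda>"
  have \<beta>b: "\<beta>b \<ge> 0" using kappa_pos L0 by (simp add: \<beta>b_def)
  \<comment> \<open>This makes 2 \<epsilon> \<beta> <= \<eta>, so that (l + \<epsilon>) \<beta> > 4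
    + \<eta> implies (l - \<epsilon>) \<beta> >= 4.\<close>
  define \<epsilon> where "\<epsilon> = min 1 (\<eta> / (2 * \<beta>b + 1))"
  have \<epsilon>: "0 < \<epsilon>" "\<epsilon> \<le> 1" using \<eta> \<beta>b by (auto simp: \<epsilon>_def)
  have \<epsilon>2: "2 * \<epsilon> * \<beta>b \<le> \<eta>"
  proof -
    have "\<epsilon> \<le> \<eta> / (2 * \<beta>b + 1)" by (simp add: \<epsilon>_def)
    then have "\<epsilon> * (2 * \<beta>b + 1) \<le> \<eta>" using \<beta>b by (simp add: pos_le_divide_eq)
    then show ?thesis using \<epsilon> by (simp add: algebra_simps)
  qed
  obtain Tf where Tf: "Tf \<ge> M" "\<And>s t. Tf \<le> s \<Longrightarrow> s \<le> t \<Longrightarrow> f s * exp ((l - \<epsilon>) * (t - s)) \<le> f t"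
      "\<And>s t. Tf \<le> s \<Longrightarrow> s \<le> t \<Longrightarrow> f t \<le> f s * exp ((l + \<epsilon>) * (t - s))" using f_exp[OF \<epsilon>(1)] by blast
  define T where "T = max Tf TL"
  have T: "T \<ge> Tf" "T \<ge> TL" "T \<ge> M" "T > 0" using Tf M by (auto simp: T_def)
  have fT: "f T > 0" using f_pos T by simp
  define c6 where "c6 = a * f T * exp (- ((l + 1) * (T + G))) / 16"
  have c6: "c6 > 0" using a fT by (simp add: c6_def)
  \<comment> \<open>Below this radius the lower bound from \<open>far_lower\<close> reaches T, so
    the growth estimates for f apply to the values of u; the bound d / 2 keeps the points
    interior.\<close>
  define \<rho>1 where "\<rho>1 = min (d / 2) (exp (- ((l + 1) * (T + G) / 4)) / 2)"
  have \<rho>1: "\<rho>1 > 0" "\<rho>1 \<le> d / 2" "2 * \<rho>1 \<le> exp (- ((l + 1) * (T + G) / 4))" using d by (auto simp: \<rho>1_def)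
  obtain n2 :: nat where n2: "\<Lambda> < real n2 * (15 * c6 * unit_ball_vol 4 / 16)"
    using reals_Archimedean3[of "15 * c6 * unit_ball_vol 4 / 16"] c6 V by (auto simp del: times_divide_eq_left times_divide_eq_right)
  \<comment> \<open>Room for both ranges: the inner radius L r stays below d / 2, and n2 further
    doublings stay below \<rho>1.\<close>
  define r0 where "r0 = min (\<rho>1 / (2 ^ n2 * L)) (d / (2 * L))"
  have r0: "r0 > 0" using \<rho>1 d L by (simp add: r0_def)
  have "\<forall>\<^sub>F t in at_top. 1 \<le> f t / t" using f_super by (simp add: filterlim_at_top)
  then obtain T1 where T1: "\<And>t. t \<ge> T1 \<Longrightarrow> 1 \<le> f t / t" by (auto simp: eventually_at_top_linorder)
  \<comment> \<open>Cb places the maximum inside, T1 and 1 / r0^4 force r <= r0, and the last entry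
    keeps u above T throughout the inner range.\<close>
  define t0 where "t0 = max (max (max Cb 1) (max T1 (1 / r0 ^ 4))) (T + \<beta>b * ln (1 + L) + C3)"
  have "u x1 \<le> t0" if s: "sol u N" for u N x1
  proof (rule ccontr)
    assume neg: "\<not> u x1 \<le> t0"
    have t01: "t0 \<ge> Cb" "t0 \<ge> 1" "t0 \<ge> T1" "t0 \<ge> 1 / r0 ^ 4" "t0 \<ge> T + \<beta>b * ln (1 + L) + C3" by (auto simp: t0_def)
    have x1: "x1 \<in> cball 0 1"
    proof (rule ccontr)
      assume "x1 \<notin> cball 0 1"
      then show False using sol_sphere[OF s, of x1] neg t01 by simp
    qed
    have ne: "cball (0::real^4) 1 \<noteq> {}" by simp
    obtain p where p: "p \<in> cball 0 1" "\<And>x. x \<in> cball 0 1 \<Longrightarrow> u x \<le> u p"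
      using continuous_attains_sup[OF compact_cball ne sol_continuous(1)[OF s]] by blast
    define t where "t = u p"
    have t: "t > t0" using p(2)[OF x1] neg by (simp add: t_def)
    have ut: "u x \<le> t" for x
      using p(2)[of x] sol_sphere[OF s, of x] t t01 by (cases "norm x \<le> 1") (auto simp: t_def)
    have np: "norm p < 1 - d"
    proof (rule ccontr)
      assume "\<not> norm p < 1 - d"
      then have "u p \<le> Cb" using Cb(2)[OF s] by simp
      then show False using t t01 by (simp add: t_def)
    qed
    have tT: "t \<ge> T + \<beta>b * ln (1 + L) + C3" using t t01 by simp
    have "0 \<le> \<beta>b * ln (1 + L)" using \<beta>b lnL by simp
    then have tM: "t \<ge> M" using tT T C3 by simp
    have ft: "f t > 0" by (rule f_pos[OF tM])
    have "1 \<le> f t / t" by (rule T1) (use t t01 in simp)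
    moreover have "t > 0" using t t01 by simp
    ultimately have "t \<le> f t" using pos_le_divide_eq[of t 1 "f t"] by simp
    then have fr: "1 / r0 ^ 4 \<le> f t" using t t01 by simp
    \<comment> \<open>The scale on which the density bound C1 f t reads C1 / r^4.\<close>
    define r where "r = root 4 (1 / f t)"
    have r: "r > 0" using ft by (simp add: r_def)
    have r4: "r ^ 4 = 1 / f t" unfolding r_def using ft by (intro real_root_pow_pos2) auto
    have rr0: "r \<le> r0"
    proof -
      have "1 \<le> f t * r0 ^ 4" using fr r0 by (simp add: divide_le_eq)
      then have "r ^ 4 \<le> r0 ^ 4" unfolding r4 using ft by (simp add: divide_le_eq mult.commute)
      then show ?thesis using power_le_imp_le_base[of r 3 r0] r0 by simp
    qed
    have Lr: "L * r \<le> d / 2" "2 ^ n2 * (L * r) \<le> \<rho>1"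
    proof -
      have "r \<le> d / (2 * L)" "r \<le> \<rho>1 / (2 ^ n2 * L)" using rr0 by (auto simp: r0_def)
      then show "L * r \<le> d / 2" "2 ^ n2 * (L * r) \<le> \<rho>1" using L by (simp_all add: pos_le_divide_eq mult_ac)
    qed
    have up: "AE y in lborel. N y \<le> C1 / r ^ 4" using C1(2)[OF s tM] ut by (simp add: r4)
    define m where "m = (LINT y|lborel. indicator (ball p (L * r)) y * N y)"
    have m0: "0 \<le> m" unfolding m_def using solD(2)[OF s] by (simp add: integral_nonneg_AE)
    have mL: "m \<le> \<Lambda>" unfolding m_def
      by (rule order_trans[OF integral_mono[OF integrable_indicator_mult[OF iN[OF s]] iN[OF s]] LL[OF s]]) (use solD(2)[OF s] in \<open>auto simp: indicator_def\<close>)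
    define \<beta> where "\<beta> = 2 * \<kappa> * m"
    have \<beta>: "0 \<le> \<beta>" "\<beta> \<le> \<beta>b" using m0 mL kappa_pos by (auto simp: \<beta>_def \<beta>b_def)
    have npd: "norm p \<le> 1 - \<delta>" using np \<delta> by simp
    have near: "norm y \<le> 1 - \<delta>" if "norm (y - p) \<le> d / 2" for y
      using norm_triangle_sub[of y p] that np by (simp add: \<delta>_def)
    have dec: "t - u y \<le> \<beta> * ln (1 + norm (y - p) / r) + C3" if "norm (y - p) \<le> L * r" for y
      unfolding \<beta>_def C3_def t_def m_def
      by (rule peak_decay[OF s iN[OF s] LL[OF s] \<delta>(1) r less_imp_le[OF C1(1)] up npd near that]) (use that Lr in simp)
    define q where "q = (l + \<epsilon>) * \<beta>"
    \<comment> \<open>Otherwise the decay estimate keeps f(u) above a multiple of |y - p|^(-4) on n1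
      annuli starting at radius r, which exceeds the available mass.\<close>
    have q: "q > 4 + \<eta>"
    proof (rule ccontr)
      assume "\<not> q > 4 + \<eta>"
      then have q: "q \<le> 4 + \<eta>" by simp
      have "real n1 * (15 * (c4 / 32) * unit_ball_vol 4 / 16) \<le> (LINT y|lborel. N y)"
      proof (rule dyadic_annuli_mass[OF iN[OF s] solD(2)[OF s] r, where p = p])
        show "0 \<le> c4 / 32" using c4 by simp
        show "AE y in lborel. r \<le> norm (y - p) \<longrightarrow> norm (y - p) < 2 ^ n1 * r \<longrightarrow> c4 / 32 / norm (y - p) ^ 4 \<le> N y"
          using solD(7)[OF s]
        proof (eventually_elim, intro impI)
          fix y assume Ny: "y \<in> ball 0 1 \<longrightarrow> N y = H y (u y)" and y: "r \<le> norm (y - p)" "norm (y - p) < 2 ^ n1 * r"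
          define \<rho> where "\<rho> = norm (y - p)"
          have \<rho>: "r \<le> \<rho>" "\<rho> \<le> L * r" using y by (auto simp: \<rho>_def L_def)
          have ny: "norm y \<le> 1 - \<delta>" using near[of y] \<rho> Lr by (simp add: \<rho>_def)
          define X where "X = ln (1 + \<rho> / r)"
          have "\<rho> / r \<le> L" using \<rho> r by (simp add: pos_divide_le_eq)
          then have XL: "X \<le> ln (1 + L)" unfolding X_def using \<rho> r L by (subst ln_le_cancel_iff) (auto simp: add_pos_nonneg)
          have X0: "X \<ge> 0" using \<rho> r by (simp add: X_def)
          have dy: "t - u y \<le> \<beta> * X + C3" using dec[of y] \<rho> by (simp add: X_def \<rho>_def)
          have "\<beta> * X \<le> \<beta>b * ln (1 + L)" using \<beta> XL X0 \<beta>b by (intro mult_mono) auto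
          then have uT: "T \<le> u y" using dy tT by simp
          have "f t \<le> f (u y) * exp ((l + \<epsilon>) * (t - u y))" using Tf(3)[of "u y" t] uT T ut by simp
          also have "(l + \<epsilon>) * (t - u y) \<le> (4 + \<eta>) * X + (l + 1) * C3"
          proof -
            have "(l + \<epsilon>) * (t - u y) \<le> (l + \<epsilon>) * (\<beta> * X + C3)" using dy l \<epsilon> by (intro mult_left_mono) auto
            also have "\<dots> = q * X + (l + \<epsilon>) * C3" by (simp add: q_def algebra_simps)
            also have "\<dots> \<le> (4 + \<eta>) * X + (l + 1) * C3" using q X0 \<epsilon> C3 by (intro add_mono mult_right_mono) auto
            finally show ?thesis .
          qed
          also have "(4 + \<eta>) * X \<le> 4 * ln (2 * \<rho> / r) + ln 2"
          proof -
            have "\<eta> * X \<le> \<eta> * ln (1 + L)" using XL \<eta> by (intro mult_left_mono) auto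
            also have "\<dots> = ln 2" using lnL by (simp add: \<eta>_def)
            finally have "\<eta> * X \<le> ln 2" .
            moreover have "1 + \<rho> / r \<le> 2 * \<rho> / r" using \<rho> r by (simp add: field_simps)
            then have "X \<le> ln (2 * \<rho> / r)" unfolding X_def using \<rho> r by (subst ln_le_cancel_iff) (auto simp: add_pos_nonneg)
            ultimately show ?thesis by (simp add: distrib_right)
          qed
          also have "exp (4 * ln (2 * \<rho> / r) + ln 2 + (l + 1) * C3) = (2 * \<rho> / r) ^ 4 * 2 * exp ((l + 1) * C3)"
          proof -
            have "exp (4 * ln (2 * \<rho> / r)) = exp (ln (2 * \<rho> / r)) ^ 4" using exp_of_nat_mult[of 4 "ln (2 * \<rho> / r)"] by simp
            also have "exp (ln (2 * \<rho> / r)) = 2 * \<rho> / r" using \<rho> r by simp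
            finally show ?thesis by (simp add: exp_add)
          qed
          finally have f1: "f t \<le> f (u y) * ((2 * \<rho> / r) ^ 4 * 2 * exp ((l + 1) * C3))"
            using f_pos[of "u y"] uT T by (simp add: mult_left_mono)
          \<comment> \<open>Here the choice r^4 = 1 / f t pays off: f t cancels and leaves a bound
            independent of the height of the maximum.\<close>
          have "(2 * \<rho> / r) ^ 4 = 16 * \<rho> ^ 4 * f t" using r4 by (simp add: power_divide power_mult_distrib)
          then have "f t \<le> f t * (32 * \<rho> ^ 4 * f (u y) * exp ((l + 1) * C3))" using f1 by (simp add: mult_ac)
          then have f2: "1 \<le> 32 * \<rho> ^ 4 * f (u y) * exp ((l + 1) * C3)" using ft by simp
          have \<rho>0: "\<rho> > 0" using \<rho> r by simp
          have "c4 / 32 / \<rho> ^ 4 \<le> c4 / 32 / \<rho> ^ 4 * (32 * \<rho> ^ 4 * f (u y) * exp ((l + 1) * C3))"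
            using mult_left_mono[OF f2, of "c4 / 32 / \<rho> ^ 4"] c4 \<rho>0 by simp
          also have "\<dots> = c4 * exp ((l + 1) * C3) * f (u y)" using \<rho>0 by simp
          also have "\<dots> = a * f (u y)" by (simp add: c4_def exp_minus)
          also have "\<dots> \<le> H y (u y)" using a(2)[of y "u y"] ny uT T by simp
          also have "\<dots> = N y" using Ny ny \<delta> by simp
          finally show "c4 / 32 / norm (y - p) ^ 4 \<le> N y" by (simp add: \<rho>_def)
        qed
      qed
      then show False using n1 LL[OF s] by linarith
    qed
    have \<beta>4: "4 \<le> (l - \<epsilon>) * \<beta>"
    proof -
      have "2 * \<epsilon> * \<beta> \<le> 2 * \<epsilon> * \<beta>b" using \<beta> \<epsilon> by (intro mult_left_mono) auto
      moreover have "(l - \<epsilon>) * \<beta> = q - 2 * \<epsilon> * \<beta>" by (simp add: q_def algebra_simps)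
      ultimately show ?thesis using q \<epsilon>2 by linarith
    qed
    have le: "l - \<epsilon> > 0"
    proof (rule ccontr)
      assume "\<not> l - \<epsilon> > 0"
      then have "(l - \<epsilon>) * \<beta> \<le> 0" using \<beta> by (intro mult_nonpos_nonneg) auto
      then show False using \<beta>4 by simp
    qed
    have \<beta>l: "4 \<le> (l + 1) * \<beta>"
    proof -
      have "(l - \<epsilon>) * \<beta> \<le> (l + 1) * \<beta>" using \<beta> \<epsilon> by (intro mult_right_mono) auto
      then show ?thesis using \<beta>4 by simp
    qed
    have Lr0: "L * r > 0" using L r by simp
    \<comment> \<open>Beyond L r the mass m alone gives u >= -\<beta> ln(2 |y - p|) - G, and (l -
      \<epsilon>) \<beta> >= 4 turns this into a lower bound c6 |y - p|^(-4) with c6 independent of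
      r.\<close>
    have "real n2 * (15 * c6 * unit_ball_vol 4 / 16) \<le> (LINT y|lborel. N y)"
    proof (rule dyadic_annuli_mass[OF iN[OF s] solD(2)[OF s] Lr0, where p = p])
      show "0 \<le> c6" using c6 by simp
      show "AE y in lborel. L * r \<le> norm (y - p) \<longrightarrow> norm (y - p) < 2 ^ n2 * (L * r) \<longrightarrow> c6 / norm (y - p) ^ 4 \<le> N y"
        using solD(7)[OF s]
      proof (eventually_elim, intro impI)
        fix y assume Ny: "y \<in> ball 0 1 \<longrightarrow> N y = H y (u y)" and y: "L * r \<le> norm (y - p)" "norm (y - p) < 2 ^ n2 * (L * r)"
        define \<rho> where "\<rho> = norm (y - p)"
        have \<rho>: "0 < \<rho>" "\<rho> \<le> \<rho>1" using y Lr0 Lr by (auto simp: \<rho>_def)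
        have ny: "norm y \<le> 1 - \<delta>" using near[of y] \<rho> \<rho>1 by (simp add: \<rho>_def)
        define Z where "Z = - ln (2 * \<rho>)"
        have "2 * \<rho> \<le> exp (- ((l + 1) * (T + G) / 4))" using \<rho> \<rho>1 by simp
        then have "ln (2 * \<rho>) \<le> - ((l + 1) * (T + G) / 4)" using \<rho> ln_le_cancel_iff[of "2 * \<rho>" "exp (- ((l + 1) * (T + G) / 4))"] by simp
        then have Z: "(l + 1) * (T + G) / 4 \<le> Z" by (simp add: Z_def)
        have lTG: "0 \<le> (l + 1) * (T + G)" using l T G by simp
        then have Z0: "Z \<ge> 0" using Z by simp
        have uy: "\<beta> * Z - G \<le> u y"
          using far_lower[OF s iN[OF s] LL[OF s] \<delta>(1) ny y(1) Lr0] by (simp add: \<beta>_def m_def Z_def \<rho>_def G_def)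
        have "T + G \<le> \<beta> * Z"
        proof -
          have "(T + G) * 4 \<le> (T + G) * ((l + 1) * \<beta>)" using \<beta>l T G by (intro mult_left_mono) auto
          then have "T + G \<le> \<beta> * ((l + 1) * (T + G) / 4)" by (simp add: algebra_simps)
          also have "\<dots> \<le> \<beta> * Z" using Z \<beta> by (intro mult_left_mono) auto
          finally show ?thesis .
        qed
        then have uT: "T \<le> u y" using uy by simp
        have "4 * Z - (l + 1) * (T + G) \<le> (l - \<epsilon>) * (\<beta> * Z - G - T)"
        proof -
          have "4 * Z \<le> ((l - \<epsilon>) * \<beta>) * Z" using \<beta>4 Z0 by (intro mult_right_mono) auto
          moreover have "(l - \<epsilon>) * (T + G) \<le> (l + 1) * (T + G)" using \<epsilon> T G by (intro mult_right_mono) auto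
          ultimately show ?thesis by (simp add: algebra_simps)
        qed
        also have "\<dots> \<le> (l - \<epsilon>) * (u y - T)" using uy le by (intro mult_left_mono) auto
        finally have e1: "exp (4 * Z - (l + 1) * (T + G)) \<le> exp ((l - \<epsilon>) * (u y - T))" by simp
        have "exp (4 * Z) = exp Z ^ 4" using exp_of_nat_mult[of 4 Z] by simp
        also have "exp Z = 1 / (2 * \<rho>)" using \<rho> by (simp add: Z_def exp_minus inverse_eq_divide)
        finally have e2: "exp (4 * Z) = 1 / (16 * \<rho> ^ 4)" by (simp add: power_divide power_mult_distrib)
        have e3: "exp (4 * Z - (l + 1) * (T + G)) = 1 / (16 * \<rho> ^ 4) * exp (- ((l + 1) * (T + G)))"
          by (simp only: diff_conv_add_uminus exp_add e2)
        have "c6 / \<rho> ^ 4 = a * (f T * exp (4 * Z - (l + 1) * (T + G)))"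
          unfolding c6_def e3 by simp
        also have "\<dots> \<le> a * (f T * exp ((l - \<epsilon>) * (u y - T)))" using a fT e1 by (intro mult_left_mono) auto
        also have "\<dots> \<le> a * f (u y)" using Tf(2)[OF T(1) uT] a by (intro mult_left_mono) auto
        also have "\<dots> \<le> H y (u y)" using a(2)[of y "u y"] ny uT T by simp
        also have "\<dots> = N y" using Ny ny \<delta> by simp
        finally show "c6 / norm (y - p) ^ 4 \<le> N y" by (simp add: \<rho>_def)
      qed
    qed
    then show False using n2 LL[OF s] by linarith
  qed
  then show ?thesis by blast
qed

end

section \<open>From the ball to the unit problem\<close>

lemma has_derivative_gradient:
  fixes g :: "real^'n::finite \<Rightarrow> real"
  assumes "g differentiable (at x)" shows "(g has_derivative (\<lambda>v. gradient g x \<bullet> v)) (at x)"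
proof -
  let ?F = "frechet_derivative g (at x)"
  have d: "(g has_derivative ?F) (at x)" using assms by (simp add: frechet_derivative_works)
  then have lin: "linear ?F" by (rule has_derivative_linear)
  have "?F v = gradient g x \<bullet> v" for v
  proof -
    have "?F v = ?F (\<Sum>i\<in>UNIV. (v $ i) *\<^sub>R axis i 1)"
      using basis_expansion[of v] by (simp add: scalar_mult_eq_scaleR)
    also have "\<dots> = (\<Sum>i\<in>UNIV. v $ i * ?F (axis i 1))"
      using lin by (simp add: linear_sum linear_scale)
    also have "\<dots> = gradient g x \<bullet> v" by (simp add: gradient_def pderiv_at_def inner_vec_def mult.commute)
    finally show ?thesis .
  qed
  then have "?F = (\<lambda>v. gradient g x \<bullet> v)" by (rule ext)
  then show ?thesis using d by simp
qed

lemma AE_interval_witness: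
  fixes s t :: real
  assumes "AE x in lborel. P x" "s < t" shows "\<exists>x. s < x \<and> x < t \<and> P x"
proof (rule ccontr)
  assume "\<not> ?thesis"
  then have "AE x in lborel. x \<notin> {s<..<t}" using assms(1) by (auto elim!: eventually_mono)
  then have "{s<..<t} \<in> null_sets lborel" by (subst AE_iff_null_sets) auto
  then show False using assms(2) by (simp add: null_sets_def)
qed

text \<open>A strict excess would persist on a small ball, which is not null. This turns the
  essential bound on the coefficient into one at every point, as \<open>H_upper\<close>
  asks.\<close>

lemma continuous_bound_of_AE:
  fixes a :: "'a::euclidean_space \<Rightarrow> real"
  assumes c: "continuous_on S a" and S: "open S" and ae: "AE x in lborel. x \<in> S \<longrightarrow> a x \<le> C" and x: "x \<in> S"
  shows "a x \<le> C"
proof (rule ccontr)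
  assume n: "\<not> a x \<le> C"
  have "open (S \<inter> a -` {C<..})" using continuous_open_preimage[OF c S, of "{C<..}"] by simp
  moreover have "x \<in> S \<inter> a -` {C<..}" using n x by simp
  ultimately obtain e where e: "e > 0" "ball x e \<subseteq> S \<inter> a -` {C<..}" by (rule openE)
  have "AE z in lborel. z \<notin> ball x e" using ae
  proof eventually_elim
    case (elim z)
    show ?case
    proof
      assume "z \<in> ball x e"
      then have "z \<in> S \<inter> a -` {C<..}" using e(2) by (rule subsetD[rotated])
      then show False using elim by simp
    qed
  qed
  then have "ball x e \<in> null_sets lborel" by (subst AE_iff_null_sets) auto
  then show False using e(1) unit_ball_vol_pos[of "real DIM('a)"] by (simp add: null_sets_def emeasure_ball)
qed

lemma Linf_AE_bound:
  assumes "g \<in> Linf \<Omega>" "\<Omega> \<in> sets borel"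
  shows "\<exists>C. AE z in lborel. z \<in> \<Omega> \<longrightarrow> \<bar>g z\<bar> \<le> C"
proof -
  have e: "Linf_norm \<Omega> g < \<infinity>" using assms(1) by (simp add: Linf_def)
  have "AE z in lebesgue_on \<Omega>. ereal \<bar>g z\<bar> \<le> Linf_norm \<Omega> g" unfolding Linf_norm_def by (rule esssup_AE)
  moreover obtain C :: real where "Linf_norm \<Omega> g \<le> ereal C"
    using e by (cases "Linf_norm \<Omega> g") auto
  ultimately have "AE z in lebesgue_on \<Omega>. \<bar>g z\<bar> \<le> C"
    by (elim eventually_mono) (metis ereal_less_eq(3) order_trans)
  then show ?thesis using AE_lebesgue_on_iff[OF assms(2)] by auto
qed

text \<open>(H1) bounds h almost everywhere jointly in (x, t); by Fubini the bound holds for almost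
  every x at almost every t, and continuity in t extends it to every t.\<close>

lemma caratheodory_AE_bound:
  fixes h :: "real^4 \<Rightarrow> real \<Rightarrow> real"
  assumes car: "caratheodory (ball c R) h" and H1: "hyp_H1 (ball c R) h"
  shows "\<exists>C. AE x in lborel. x \<in> ball c R \<longrightarrow> (\<forall>t\<in>{0..\<tau>}. h x t \<le> C)"
proof (cases "\<tau> \<ge> 0")
  case True
  \<comment> \<open>The interval reaches to \<tau> + 1 so that witnesses just to the right of t =
    \<tau> are available.\<close>
  let ?S = "ball c R \<times> {0..\<tau> + 1}"
  have S: "?S \<in> sets borel" by (rule borel_Times) auto
  have "(\<lambda>(x, t). h x t) \<in> Linf ?S" using H1 True by (simp add: hyp_H1_def)
  from Linf_AE_bound[OF this S] obtain C where
    "AE z in lborel. z \<in> ?S \<longrightarrow> \<bar>case z of (x, t) \<Rightarrow> h x t\<bar> \<le> C" by blast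
  then have "AE z in lborel \<Otimes>\<^sub>M lborel. z \<in> ?S \<longrightarrow> \<bar>case z of (x, t) \<Rightarrow> h x t\<bar> \<le> C" by (subst lborel_prod)
  from lborel_pair.AE_pair[OF this]
  have 1: "AE x in lborel. AE t in lborel. (x, t) \<in> ?S \<longrightarrow> \<bar>h x t\<bar> \<le> C" by simp
  have "AE x in lborel. x \<in> ball c R \<longrightarrow> continuous_on UNIV (h x)"
    using car AE_lebesgue_on_iff[of "ball c R"] by (simp add: caratheodory_def)
  with 1 have "AE x in lborel. x \<in> ball c R \<longrightarrow> (\<forall>t\<in>{0..\<tau>}. h x t \<le> C)"
  proof eventually_elim
    case (elim x)
    show ?case
    proof (intro impI ballI, rule ccontr)
      fix t assume x: "x \<in> ball c R" and t: "t \<in> {0..\<tau>}" and n: "\<not> h x t \<le> C"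
      have "continuous_on UNIV (h x)" using elim x by blast
      then obtain e where e: "e > 0" "\<And>s. dist s t < e \<Longrightarrow> dist (h x s) (h x t) < h x t - C"
        using n unfolding continuous_on_iff by (metis UNIV_I diff_gt_0_iff_gt not_le)
      obtain s where s: "t < s" "s < t + min e 1" "(x, s) \<in> ?S \<longrightarrow> \<bar>h x s\<bar> \<le> C"
        using AE_interval_witness[OF elim(1), of t "t + min e 1"] e by auto
      have "dist s t < e" using s(1,2) by (simp add: dist_real_def)
      then have "\<bar>h x s - h x t\<bar> < h x t - C" using e(2)[of s] by (simp add: dist_real_def)
      then have "h x s > C" by linarith
      then show False using s x t by auto
    qed
  qed
  then show ?thesis by blast
qed auto

text \<open>For large t the derivative of ln f is within \<epsilon> of l, so ln f(t) - (l -
  \<epsilon>) t is nondecreasing and ln f(t) - (l + \<epsilon>) t is nonincreasing.\<close>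

lemma assumption_A_growth:
  assumes "assumption_A f"
  shows "\<exists>M l. M > 0 \<and> l \<ge> 0 \<and> (\<forall>t\<ge>M. f t > 0) \<and> (\<forall>s t. M \<le> s \<longrightarrow> s \<le> t \<longrightarrow> f s \<le> f t) \<and> filterlim (\<lambda>t. f t / t) at_top at_top \<and>
    (\<forall>\<epsilon>>0. \<exists>T\<ge>M. \<forall>s t. T \<le> s \<longrightarrow> s \<le> t \<longrightarrow> f s * exp ((l - \<epsilon>) * (t - s)) \<le> f t \<and> f t \<le> f s * exp ((l + \<epsilon>) * (t - s)))"
proof -
  from assms obtain f' M l where f': "\<And>t. t \<ge> 0 \<Longrightarrow> (f has_real_derivative f' t) (at t within {0..})"
    and M: "M > 0" "\<And>t. t \<ge> M \<Longrightarrow> f t > 0" "\<And>t. t \<ge> M \<Longrightarrow> f' t \<ge> 0" and sup: "filterlim (\<lambda>t. f t / t) at_top at_top"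
    and l: "l \<ge> 0" "((\<lambda>t. f' t / f t) \<longlongrightarrow> l) at_top"
    unfolding assumption_A_def by blast
  have df: "(f has_real_derivative f' t) (at t)" if "t \<ge> M" for t
  proof -
    have "at t within {0..} = at t" by (rule at_within_interior) (use that M in simp)
    then show ?thesis using f'[of t] that M by simp
  qed
  have mono: "f s \<le> f t" if "M \<le> s" "s \<le> t" for s t
    by (rule DERIV_nonneg_imp_nondecreasing[OF that(2)]) (use df M(3) that in \<open>meson order_trans\<close>)
  have "\<exists>T\<ge>M. \<forall>s t. T \<le> s \<longrightarrow> s \<le> t \<longrightarrow> f s * exp ((l - \<epsilon>) * (t - s)) \<le> f t \<and> f t \<le> f s * exp ((l + \<epsilon>) * (t - s))"
    if e: "\<epsilon> > 0" for \<epsilon>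
  proof -
    have "\<forall>\<^sub>F t in at_top. dist (f' t / f t) l < \<epsilon>" by (rule tendstoD[OF l(2) e])
    then obtain T0 where T0: "\<And>t. t \<ge> T0 \<Longrightarrow> dist (f' t / f t) l < \<epsilon>" by (auto simp: eventually_at_top_linorder)
    define T where "T = max T0 M"
    have T: "T \<ge> M" "T \<ge> T0" by (auto simp: T_def)
    have q: "l - \<epsilon> \<le> f' t / f t" "f' t / f t \<le> l + \<epsilon>" if "t \<ge> T" for t
      using T0[of t] that T by (auto simp: dist_real_def abs_less_iff)
    have dl: "((\<lambda>x. ln (f x) - k * x) has_real_derivative f' x / f x - k) (at x)" if "x \<ge> T" for x k
      using df[of x] M(2)[of x] that T by (auto intro!: derivative_eq_intros)
    have "f s * exp ((l - \<epsilon>) * (t - s)) \<le> f t \<and> f t \<le> f s * exp ((l + \<epsilon>) * (t - s))" if st: "T \<le> s" "s \<le> t" for s t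
    proof -
      have fp: "f s > 0" "f t > 0" using M(2) st T by auto
      have "ln (f s) - (l - \<epsilon>) * s \<le> ln (f t) - (l - \<epsilon>) * t"
      proof (rule DERIV_nonneg_imp_nondecreasing[OF st(2)])
        fix x assume "s \<le> x" "x \<le> t"
        then have "x \<ge> T" using st by simp
        then show "\<exists>y. ((\<lambda>x. ln (f x) - (l - \<epsilon>) * x) has_real_derivative y) (at x) \<and> 0 \<le> y"
          using dl q(1) by (intro exI[of _ "f' x / f x - (l - \<epsilon>)"]) simp
      qed
      then have "ln (f s) + (l - \<epsilon>) * (t - s) \<le> ln (f t)" by (simp add: right_diff_distrib)
      then have "exp (ln (f s) + (l - \<epsilon>) * (t - s)) \<le> exp (ln (f t))" by simp
      moreover have "ln (f t) - (l + \<epsilon>) * t \<le> ln (f s) - (l + \<epsilon>) * s"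
      proof (rule DERIV_nonpos_imp_nonincreasing[OF st(2)])
        fix x assume "s \<le> x" "x \<le> t"
        then have "x \<ge> T" using st by simp
        then show "\<exists>y. ((\<lambda>x. ln (f x) - (l + \<epsilon>) * x) has_real_derivative y) (at x) \<and> y \<le> 0"
          using dl q(2) by (intro exI[of _ "f' x / f x - (l + \<epsilon>)"]) simp
      qed
      then have "ln (f t) \<le> ln (f s) + (l + \<epsilon>) * (t - s)" by (simp add: right_diff_distrib)
      then have "exp (ln (f t)) \<le> exp (ln (f s) + (l + \<epsilon>) * (t - s))" by simp
      ultimately show ?thesis using fp by (simp add: exp_add)
    qed
    then show ?thesis using T by blast
  qed
  then show ?thesis using M l(1) mono sup by blast
qed

text \<open>The segment from y to its image runs in direction -e inside the boundary strip, at
  points where e is within \<delta> of the outer normal, so (H3b) makes h nondecreasing along it;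
  (H3a) then raises s to t at the image.\<close>

lemma strip_reflection_mono:
  fixes h :: "real^4 \<Rightarrow> real \<Rightarrow> real"
  assumes R: "R > 0" and H3: "hyp_H3 c R h"
  shows "\<exists>lam0. 0 < lam0 \<and> lam0 < 1 \<and> (\<forall>e m y s t. norm e = 1 \<longrightarrow> lam0 \<le> m \<longrightarrow> norm y < 1 \<longrightarrow> m < y \<bullet> e \<longrightarrow> 0 \<le> s \<longrightarrow> s \<le> t \<longrightarrow>
    h (c + R *\<^sub>R y) s \<le> h (c + R *\<^sub>R (y - (2 * (y \<bullet> e - m)) *\<^sub>R e)) t)"
proof -
  let ?S = "boundary_strip (ball c R)"
  from H3 obtain r \<delta> where H: "0 < r \<and> r < R \<and> 0 < \<delta> \<and> (\<forall>x\<in>?S r. mono_on {0..} (h x)) \<and> (\<forall>t\<ge>0. C1_on (?S r) (\<lambda>x. h x t)) \<and>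
     (\<forall>x\<in>?S r. \<forall>t\<ge>0. \<forall>\<theta>. norm \<theta> = 1 \<and> norm (\<theta> - sgn (x - c)) \<le> \<delta> \<longrightarrow> gradient (\<lambda>y. h y t) x \<bullet> \<theta> \<le> 0)"
    unfolding hyp_H3_def by (elim exE)
  note r = H[THEN conjunct1] H[THEN conjunct2, THEN conjunct1]
    and \<delta> = H[THEN conjunct2, THEN conjunct2, THEN conjunct1]
    and mono = H[THEN conjunct2, THEN conjunct2, THEN conjunct2, THEN conjunct1]
    and C1 = H[THEN conjunct2, THEN conjunct2, THEN conjunct2, THEN conjunct2, THEN conjunct1]
    and G = H[THEN conjunct2, THEN conjunct2, THEN conjunct2, THEN conjunct2, THEN conjunct2]
  \<comment> \<open>Points z of the segment satisfy z . e > 2 \<open>lam0\<close> - 1. The three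
    entries make this positive, keep the rescaled point within r of the boundary, and keep the
    squared distance from e to the normal at most 4 - 4 \<open>lam0\<close> <= \<delta>^2.\<close>
  define lam0 where "lam0 = max (max (3 / 4) (1 - r / (2 * R))) (1 - \<delta>\<^sup>2 / 4)"
  have "r / (2 * R) > 0" "\<delta>\<^sup>2 / 4 > 0" using r R \<delta> by simp_all
  then have lam: "0 < lam0" "lam0 < 1" "3 / 4 \<le> lam0" "1 - r / (2 * R) \<le> lam0" "1 - \<delta>\<^sup>2 / 4 \<le> lam0"
    unfolding lam0_def by linarith+
  have "h (c + R *\<^sub>R y) s \<le> h (c + R *\<^sub>R (y - (2 * (y \<bullet> e - m)) *\<^sub>R e)) t"
    if e: "norm e = 1" and m: "lam0 \<le> m" and y: "norm y < 1" "m < y \<bullet> e" and st: "0 \<le> s" "s \<le> t" for e m y s t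
  proof -
    define T where "T = 2 * (y \<bullet> e - m)"
    have T: "T > 0" using y by (simp add: T_def)
    define z where "z \<tau> = y - \<tau> *\<^sub>R e" for \<tau>
    have ee: "e \<bullet> e = 1" using e by (simp add: norm_eq_1)
    have ye1: "y \<bullet> e < 1" using norm_cauchy_schwarz[of y e] e y by simp
    have pt: "c + R *\<^sub>R z \<tau> \<in> boundary_strip (ball c R) r \<and> norm (e - sgn (z \<tau>)) \<le> \<delta>" if t: "0 \<le> \<tau>" "\<tau> \<le> T" for \<tau>
    proof -
      have ze: "z \<tau> \<bullet> e = y \<bullet> e - \<tau>" by (simp add: z_def inner_diff_left ee)
      have zl: "2 * lam0 - 1 < z \<tau> \<bullet> e" using ze t m ye1 by (simp add: T_def)
      have "z \<tau> \<bullet> z \<tau> = y \<bullet> y - \<tau> * (2 * (y \<bullet> e) - \<tau>)"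
        by (simp add: z_def inner_diff_left inner_diff_right ee inner_commute algebra_simps)
      moreover have "0 \<le> \<tau> * (2 * (y \<bullet> e) - \<tau>)" using t m lam by (intro mult_nonneg_nonneg) (auto simp: T_def)
      ultimately have "z \<tau> \<bullet> z \<tau> < 1" using inner_self_less_1[OF y(1)] by simp
      then have nz: "norm (z \<tau>) < 1" by (simp add: norm_eq_sqrt_inner)
      have zn: "z \<tau> \<bullet> e \<le> norm (z \<tau>)" using norm_cauchy_schwarz[of "z \<tau>" e] e by simp
      then have nl: "2 * lam0 - 1 < norm (z \<tau>)" using zl by simp
      then have n0: "norm (z \<tau>) > 0" using lam by linarith
      have "(e - sgn (z \<tau>)) \<bullet> (e - sgn (z \<tau>)) = 2 - 2 * ((z \<tau> \<bullet> e) / norm (z \<tau>))"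
      proof -
        have "sgn (z \<tau>) \<bullet> sgn (z \<tau>) = 1" using n0 by (intro norm_eq_1[THEN iffD1]) (simp add: norm_sgn)
        moreover have "sgn (z \<tau>) \<bullet> e = (z \<tau> \<bullet> e) / norm (z \<tau>)" by (simp add: sgn_div_norm divide_inverse mult.commute)
        ultimately show ?thesis by (simp add: inner_diff_left inner_diff_right ee inner_commute[of e "sgn (z \<tau>)"])
      qed
      also have "\<dots> \<le> 2 - 2 * (z \<tau> \<bullet> e)"
      proof -
        have "0 \<le> z \<tau> \<bullet> e" using zl lam by simp
        then have "(z \<tau> \<bullet> e) / 1 \<le> (z \<tau> \<bullet> e) / norm (z \<tau>)" using nz n0 by (intro divide_left_mono) auto
        then show ?thesis by simp
      qed
      also have "\<dots> \<le> \<delta>\<^sup>2" using zl lam by simp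
      finally have "norm (e - sgn (z \<tau>)) \<le> \<delta>" using \<delta> by (simp add: norm_eq_sqrt_inner real_le_lsqrt)
      moreover have "c + R *\<^sub>R z \<tau> \<in> boundary_strip (ball c R) r"
      proof -
        have inB: "c + R *\<^sub>R z \<tau> \<in> ball c R" using nz R by (simp add: dist_norm)
        have fr: "frontier (ball c R) = sphere c R" using R by simp
        have q: "c + R *\<^sub>R sgn (z \<tau>) \<in> sphere c R" using n0 R by (simp add: dist_norm norm_sgn)
        have zs: "norm (z \<tau>) *\<^sub>R sgn (z \<tau>) = z \<tau>" using n0 by (simp add: sgn_div_norm)
        have "dist (c + R *\<^sub>R z \<tau>) (c + R *\<^sub>R sgn (z \<tau>)) = norm (R *\<^sub>R (z \<tau> - sgn (z \<tau>)))"
          by (simp add: dist_norm scaleR_diff_right)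
        also have "z \<tau> - sgn (z \<tau>) = (norm (z \<tau>) - 1) *\<^sub>R sgn (z \<tau>)" by (simp add: scaleR_diff_left zs)
        also have "norm (R *\<^sub>R (norm (z \<tau>) - 1) *\<^sub>R sgn (z \<tau>)) = R * (1 - norm (z \<tau>))" using n0 nz R by (simp add: norm_sgn abs_mult abs_of_nonpos)
        also have "\<dots> < R * (2 - 2 * lam0)" using nl R by (intro mult_strict_left_mono) auto
        also have "\<dots> \<le> R * (r / R)" using lam(4) R by (intro mult_left_mono) (auto simp: field_simps)
        finally have "dist (c + R *\<^sub>R z \<tau>) (c + R *\<^sub>R sgn (z \<tau>)) < r" using R by simp
        then have "infdist (c + R *\<^sub>R z \<tau>) (sphere c R) < r" using infdist_le[OF q] by (rule le_less_trans[rotated])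
        then show ?thesis unfolding boundary_strip_def fr using inB by simp
      qed
      ultimately show ?thesis by blast
    qed
    have "h (c + R *\<^sub>R z 0) s \<le> h (c + R *\<^sub>R z T) s"
    proof (rule DERIV_nonneg_imp_nondecreasing[OF less_imp_le[OF T]])
      fix \<tau> assume \<tau>: "0 \<le> \<tau>" "\<tau> \<le> T"
      let ?X = "c + R *\<^sub>R z \<tau>"
      have X: "?X \<in> boundary_strip (ball c R) r" "norm (e - sgn (z \<tau>)) \<le> \<delta>" using pt[OF \<tau>] by auto
      have sg: "sgn (?X - c) = sgn (z \<tau>)" using R by (simp add: sgn_scaleR)
      have g: "gradient (\<lambda>y. h y s) ?X \<bullet> e \<le> 0" by (rule G[rule_format, OF X(1) st(1)]) (use X(2) sg e in simp)
      have "(\<lambda>x. h x s) differentiable (at ?X)" using C1[rule_format, OF st(1)] X(1) by (simp add: C1_on_def)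
      from has_derivative_gradient[OF this]
      have D: "((\<lambda>x. h x s) has_derivative (\<lambda>v. gradient (\<lambda>y. h y s) ?X \<bullet> v)) (at ?X)" .
      have "((\<lambda>\<tau>. c + R *\<^sub>R z \<tau>) has_derivative (\<lambda>d. - (d * R) *\<^sub>R e)) (at \<tau>)"
        unfolding z_def by (auto intro!: derivative_eq_intros simp: mult.commute)
      from has_derivative_compose[OF this D]
      have "((\<lambda>\<tau>. h (c + R *\<^sub>R z \<tau>) s) has_derivative (\<lambda>d. gradient (\<lambda>y. h y s) ?X \<bullet> (- (d * R) *\<^sub>R e))) (at \<tau>)" .
      then have "((\<lambda>\<tau>. h (c + R *\<^sub>R z \<tau>) s) has_real_derivative - R * (gradient (\<lambda>y. h y s) ?X \<bullet> e)) (at \<tau>)"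
        by (rule has_derivative_imp_has_field_derivative) (simp add: mult_ac)
      moreover have "0 \<le> - R * (gradient (\<lambda>y. h y s) ?X \<bullet> e)" using g R by (simp add: mult_nonneg_nonpos)
      ultimately show "\<exists>d. ((\<lambda>\<tau>. h (c + R *\<^sub>R z \<tau>) s) has_real_derivative d) (at \<tau>) \<and> 0 \<le> d" by blast
    qed
    also have "h (c + R *\<^sub>R z T) s \<le> h (c + R *\<^sub>R z T) t"
    proof -
      have "mono_on {0..} (h (c + R *\<^sub>R z T))" using mono pt[of T] T by simp
      then show ?thesis using st by (auto intro: mono_onD)
    qed
    finally show ?thesis by (simp add: z_def T_def)
  qed
  then show ?thesis using lam(1,2) by blast
qed

theorem theorem1p2:
  fixes c :: "real^4" and R :: real
    and h :: "real^4 \<Rightarrow> real \<Rightarrow> real"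
    and f :: "real \<Rightarrow> real" and a :: "real^4 \<Rightarrow> real"
  assumes "R > 0"
    and "\<forall>x\<in>ball c R. \<forall>t. h x t \<ge> 0"
    and "caratheodory (ball c R) h"
    and "hyp_H1 (ball c R) h"
    and "hyp_H2 (ball c R) h f a"
    and "hyp_H3 c R h"
    and "(\<exists>a\<^sub>0>0. \<forall>x\<in>ball c R. a x \<ge> a\<^sub>0) \<or>
         (\<exists>\<alpha>>1. filterlim (\<lambda>t. f t / t powr \<alpha>) at_top at_top)"
  shows "\<exists>C>0. \<forall>u. weak_solution (ball c R) h u \<longrightarrow> Linf_norm (ball c R) u \<le> ereal C"
proof -
  note R = assms(1) and h0 = assms(2)
  from assms(5) have fA: "assumption_A f" and aL: "a \<in> Linf (ball c R)" and ac: "continuous_on (ball c R) a"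
    and apos: "\<And>x. x \<in> ball c R \<Longrightarrow> a x > 0" and ul: "uniform_limit (ball c R) (\<lambda>t x. h x t / (a x * f t)) (\<lambda>_. 1) at_top"
    by (auto simp: hyp_H2_def)
  obtain M l where M: "M > 0" and l: "l \<ge> 0" and fp: "\<And>t. t \<ge> M \<Longrightarrow> f t > 0" and fm: "\<And>s t. M \<le> s \<Longrightarrow> s \<le> t \<Longrightarrow> f s \<le> f t"
    and fs: "filterlim (\<lambda>t. f t / t) at_top at_top"
    and fe: "\<And>\<epsilon>. \<epsilon> > 0 \<Longrightarrow> \<exists>T\<ge>M. \<forall>s t. T \<le> s \<longrightarrow> s \<le> t \<longrightarrow> f s * exp ((l - \<epsilon>) * (t - s)) \<le> f t \<and> f t \<le> f s * exp ((l + \<epsilon>) * (t - s))"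
    using assumption_A_growth[OF fA] by blast
  obtain lam0 where lam: "0 < lam0" "lam0 < 1"
    and refl: "\<And>e m y s t. norm e = 1 \<Longrightarrow> lam0 \<le> m \<Longrightarrow> norm y < 1 \<Longrightarrow> m < y \<bullet> e \<Longrightarrow> 0 \<le> s \<Longrightarrow> s \<le> t \<Longrightarrow>
      h (c + R *\<^sub>R y) s \<le> h (c + R *\<^sub>R (y - (2 * (y \<bullet> e - m)) *\<^sub>R e)) t"
    using strip_reflection_mono[OF R assms(6)] by blast
  have "\<forall>\<^sub>F t in at_top. \<forall>x\<in>ball c R. dist (h x t / (a x * f t)) 1 < 1 / 2"
    by (rule uniform_limitD[OF ul]) simp
  then obtain T0 where T0: "\<And>t x. t \<ge> T0 \<Longrightarrow> x \<in> ball c R \<Longrightarrow> dist (h x t / (a x * f t)) 1 < 1 / 2"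
    unfolding eventually_at_top_linorder by blast
  define T where "T = max T0 M"
  have hl: "a x * f t / 2 \<le> h x t" and hu: "h x t \<le> 2 * (a x * f t)" if "x \<in> ball c R" "t \<ge> T" for x t
  proof -
    define b where "b = a x * f t"
    have b: "b > 0" using apos[OF that(1)] fp[of t] that by (simp add: b_def T_def)
    have "\<bar>h x t / b - 1\<bar> < 1 / 2" using T0[of t x] that by (simp add: T_def b_def dist_real_def)
    then have "1 / 2 \<le> h x t / b" "h x t / b \<le> 2" by linarith+
    then show "a x * f t / 2 \<le> h x t" "h x t \<le> 2 * (a x * f t)"
      using b unfolding b_def[symmetric] by (simp_all add: pos_le_divide_eq pos_divide_le_eq)
  qed
  obtain Ca where Ca: "AE x in lborel. x \<in> ball c R \<longrightarrow> \<bar>a x\<bar> \<le> Ca" using Linf_AE_bound[OF aL] by auto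
  have "AE x in lborel. x \<in> ball c R \<longrightarrow> a x \<le> Ca" using Ca by eventually_elim auto
  then have aC: "a x \<le> Ca" if "x \<in> ball c R" for x using continuous_bound_of_AE[OF ac open_ball _ that] by blast
  have Ca0: "Ca > 0" using aC[of c] apos[of c] R by simp
  have sc: "c + R *\<^sub>R x \<in> ball c R" if "x \<in> ball 0 1" for x using that R by (simp add: dist_norm)
  have R4: "R ^ 4 > 0" using R by simp
  interpret unit_problem "\<lambda>x t. R ^ 4 * h (c + R *\<^sub>R x) t" f l M lam0
  proof
    show "0 \<le> R ^ 4 * h (c + R *\<^sub>R x) t" if "x \<in> ball 0 1" for x t using h0 sc[OF that] R4 by simp
    show "\<exists>C. AE x in lborel. x \<in> ball 0 1 \<longrightarrow> (\<forall>t\<in>{0..\<tau>}. R ^ 4 * h (c + R *\<^sub>R x) t \<le> C)" for \<tau>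
    proof -
      obtain C where "AE x in lborel. x \<in> ball c R \<longrightarrow> (\<forall>t\<in>{0..\<tau>}. h x t \<le> C)"
        using caratheodory_AE_bound[OF assms(3,4)] by blast
      from lborel_scale_AE[OF R this, of c]
      have "AE x in lborel. x \<in> ball 0 1 \<longrightarrow> (\<forall>t\<in>{0..\<tau>}. R ^ 4 * h (c + R *\<^sub>R x) t \<le> R ^ 4 * C)"
        by eventually_elim (use sc R4 in \<open>auto intro!: mult_left_mono\<close>)
      then show ?thesis by blast
    qed
    show "\<exists>A>0. \<exists>T. \<forall>x\<in>ball 0 1. \<forall>t\<ge>T. R ^ 4 * h (c + R *\<^sub>R x) t \<le> A * f t"
    proof (rule exI[of _ "R ^ 4 * (2 * Ca)"], rule conjI)
      show "0 < R ^ 4 * (2 * Ca)" using R4 Ca0 by simp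
      show "\<exists>T. \<forall>x\<in>ball 0 1. \<forall>t\<ge>T. R ^ 4 * h (c + R *\<^sub>R x) t \<le> R ^ 4 * (2 * Ca) * f t"
      proof (rule exI[of _ T], intro ballI allI impI)
      fix x :: "real^4" and t assume x: "x \<in> ball 0 1" and t: "T \<le> t"
      have "h (c + R *\<^sub>R x) t \<le> 2 * (a (c + R *\<^sub>R x) * f t)" by (rule hu[OF sc[OF x] t])
      also have "\<dots> \<le> 2 * (Ca * f t)" using aC[OF sc[OF x]] fp[of t] t by (simp add: T_def mult_right_mono)
      finally have "R ^ 4 * h (c + R *\<^sub>R x) t \<le> R ^ 4 * (2 * (Ca * f t))" using R4 by (intro mult_left_mono) auto
      then show "R ^ 4 * h (c + R *\<^sub>R x) t \<le> R ^ 4 * (2 * Ca) * f t" by (simp add: mult_ac)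
      qed
    qed
    show "\<exists>b>0. \<exists>T. \<forall>x\<in>cball 0 \<rho>. \<forall>t\<ge>T. b * f t \<le> R ^ 4 * h (c + R *\<^sub>R x) t" if \<rho>: "\<rho> < 1" for \<rho>
    proof (cases "\<rho> < 0")
      case True
      then show ?thesis by (intro exI[of _ 1]) auto
    next
      case False
      have sub: "cball c (R * \<rho>) \<subseteq> ball c R" using \<rho> R by (intro cball_subset_ball_iff[THEN iffD2]) auto
      have "0 \<le> R * \<rho>" using False R by (intro mult_nonneg_nonneg) auto
      then have ne: "cball c (R * \<rho>) \<noteq> {}" by simp
      \<comment> \<open>On a compact concentric ball the continuous positive coefficient attains a
        positive minimum.\<close>
      obtain x0 where x0: "x0 \<in> cball c (R * \<rho>)" "\<And>x. x \<in> cball c (R * \<rho>) \<Longrightarrow> a x0 \<le> a x"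
        using continuous_attains_inf[OF compact_cball ne continuous_on_subset[OF ac sub]] by blast
      have a0: "a x0 > 0" using apos x0 sub by blast
      show ?thesis
      proof (rule exI[of _ "R ^ 4 * (a x0 / 2)"], rule conjI)
        show "0 < R ^ 4 * (a x0 / 2)" using R4 a0 by simp
        show "\<exists>T. \<forall>x\<in>cball 0 \<rho>. \<forall>t\<ge>T. R ^ 4 * (a x0 / 2) * f t \<le> R ^ 4 * h (c + R *\<^sub>R x) t"
        proof (rule exI[of _ T], intro ballI allI impI)
        fix x :: "real^4" and t assume x: "x \<in> cball 0 \<rho>" and t: "T \<le> t"
        have xc: "c + R *\<^sub>R x \<in> cball c (R * \<rho>)" using x R by (simp add: dist_norm)
        have "a x0 * f t / 2 \<le> a (c + R *\<^sub>R x) * f t / 2"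
          using x0(2)[OF xc] fp[of t] t by (simp add: T_def mult_right_mono)
        also have "\<dots> \<le> h (c + R *\<^sub>R x) t" by (rule hl) (use xc sub t in auto)
        finally have "R ^ 4 * (a x0 * f t / 2) \<le> R ^ 4 * h (c + R *\<^sub>R x) t" using R4 by (intro mult_left_mono) auto
        then show "R ^ 4 * (a x0 / 2) * f t \<le> R ^ 4 * h (c + R *\<^sub>R x) t" by (simp add: mult_ac)
        qed
      qed
    qed
    show "R ^ 4 * h (c + R *\<^sub>R y) s \<le> R ^ 4 * h (c + R *\<^sub>R (y - (2 * (y \<bullet> e - m)) *\<^sub>R e)) t"
      if "norm e = 1" "lam0 \<le> m" "norm y < 1" "m < y \<bullet> e" "0 \<le> s" "s \<le> t" for e m y s t
      using refl[OF that] R4 by simp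
  qed (fact M fp fm fs l fe lam)+
  obtain C0 where C0: "\<And>u N x. sol u N \<Longrightarrow> u x \<le> C0" using sol_bounded by blast
  define C where "C = max C0 1"
  have "Linf_norm (ball c R) u \<le> ereal C" if ws: "weak_solution (ball c R) h u" for u
  proof -
    obtain U N where UN: "weak_pair U N"
      "AE x in lborel. x \<in> ball 0 1 \<longrightarrow> U x = u (c + R *\<^sub>R x) \<and> N x = R ^ 4 * h (c + R *\<^sub>R x) (u (c + R *\<^sub>R x))"
      using weak_solution_rescale[OF R ws] h0 by blast
    have "AE x in lborel. x \<in> ball 0 1 \<longrightarrow> N x = R ^ 4 * h (c + R *\<^sub>R x) (U x)" using UN(2) by eventually_elim auto
    from weak_pair_sol[OF UN(1) this] obtain v N' where v: "sol v N'" "AE x in lborel. x \<in> ball 0 1 \<longrightarrow> U x = v x" by blast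
    have "AE x in lborel. x \<in> ball 0 1 \<longrightarrow> \<bar>u (c + R *\<^sub>R x)\<bar> \<le> C"
      using UN(2) v(2)
    proof eventually_elim
      case (elim x)
      then show ?case using C0[OF v(1), of x] sol_nonneg[OF v(1), of x] by (auto simp: C_def)
    qed
    \<comment> \<open>Back to the original ball through the inverse map x -> (x - c) / R, which
      respects null sets.\<close>
    from lborel_scale_AE[OF _ this, of "1 / R" "- ((1 / R) *\<^sub>R c)"]
    have 1: "AE x in lborel. - ((1 / R) *\<^sub>R c) + (1 / R) *\<^sub>R x \<in> ball 0 1 \<longrightarrow> \<bar>u (c + R *\<^sub>R (- ((1 / R) *\<^sub>R c) + (1 / R) *\<^sub>R x))\<bar> \<le> C"
      using R by simp
    have "AE x in lborel. x \<in> ball c R \<longrightarrow> \<bar>u x\<bar> \<le> C"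
      using 1
    proof eventually_elim
      case (elim x)
      have e: "- ((1 / R) *\<^sub>R c) + (1 / R) *\<^sub>R x = (1 / R) *\<^sub>R (x - c)" by (simp add: scaleR_diff_right)
      have "c + R *\<^sub>R ((1 / R) *\<^sub>R (x - c)) = x" using R by simp
      moreover have "x \<in> ball c R \<Longrightarrow> (1 / R) *\<^sub>R (x - c) \<in> ball 0 1" using R by (simp add: dist_norm norm_minus_commute)
      ultimately show ?case using elim unfolding e by auto
    qed
    then have "AE x in lebesgue_on (ball c R). \<bar>u x\<bar> \<le> C" using AE_lebesgue_on_iff[of "ball c R"] by simp
    then have ae: "AE x in lebesgue_on (ball c R). ereal \<bar>u x\<bar> \<le> ereal C" by simp
    have [measurable]: "u \<in> borel_measurable (lebesgue_on (ball c R))"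
      using ws by (auto simp: weak_solution_def H20_def H2_def L2_def)
    show ?thesis unfolding Linf_norm_def by (rule esssup_I[OF _ ae]) measurable
  qed
  then show ?thesis by (intro exI[of _ C]) (simp add: C_def)
qed

end
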